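(* Let $P\to X$ be a principal $H_\sigma$-bundle over a diffeological space $X$, classified by $f_P:X\to B^{\mathrm{sph}}_\sigma(G)$. Then $$\tau(P)=f_P^*(\tau_{\mathrm{univ}}),$$ i.e. $\alpha(P)=f_P^*\alpha_{\mathrm{univ}}$ and $\operatorname{DD}_{\alpha(P)}(P)=f_P^*\operatorname{DD}_{\mathrm{univ}}$.
   Context: Let $\widetilde E^{\mathrm{sph}}(G)$ be the set of families $(x_i,g_i)_{i\in\mathbb N}$ with $x_i\in\mathbb R$, $g_i\in G$ ($G$ a diffeological group), only finitely many $x_i$ nonzero, and $\sum_i x_i^2=1$. Define $(x_i,g_i)\sim(x_i,g_i')$ iff $g_i=g_i'$ whenever $x_i\neq 0$, and $E^{\mathrm{sph}}(G)=\widetilde E^{\mathrm{sph}}(G)/\sim$, with the final diffeology of the maps $\psi_I:S_I\times G^I\to E^{\mathrm{sph}}(G)$, $I\subset\mathbb N$ finite, where $S_I\subset\mathbb R^I$ is the unit sphere with the subset diffeology and $\psi_I$ extends families by $x_i=0$ outside $I$. Let $\sigma:\mathbb Z_2\to\operatorname{Aut}(G)$ be a smooth action, $H_\sigma=G\rtimes_\sigma\mathbb Z_2$ acting on $E^{\mathrm{sph}}(G)$ by $(h,\varepsilon)\cdot[(x_i,g_i)]=[(\varepsilon x_i,h\,\sigma^\varepsilon(g_i))]$, and $B^{\mathrm{sph}}_\sigma(G)=E^{\mathrm{sph}}(G)/H_\sigma$ with the quotient diffeology; $E^{\mathrm{sph}}(G)\to B^{\mathrm{sph}}_\sigma(G)$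 is the universal principal $H_\sigma$-bundle. "Classified by $f_P$" means $f_P$ is smooth and $P\cong f_P^*E^{\mathrm{sph}}(G)$ as principal $H_\sigma$-bundles. Fix a central extension $1\to U(1)\to\widehat G\xrightarrow{q}G\to1$ of diffeological groups and an action $\widehat\sigma:\mathbb Z_2\to\operatorname{Aut}(\widehat G)$ with $q\circ\widehat\sigma^\varepsilon=\sigma^\varepsilon\circ q$. For a principal $H_\sigma$-bundle $P$ over a base $X$ with transition functions $(g_{ij},\varepsilon_{ij})$ over an open cover, $\alpha(P)=[\varepsilon_{ij}]\in H^1(X;\mathbb Z_2)$, and $\beta(P)\in H^2(X;U(1)_{\alpha(P)})$ is the class of the twisted Čech cocycle $a_{ijk}=\widehat g_{ij}\,\widehat\sigma^{\varepsilon_{ij}}(\widehat g_{jk})\,\widehat g_{ik}^{-1}$, with $\widehat g_{ij}$ smooth lifts of $g_{ij}$ to $\widehat G$; here $U(1)_{\alpha(P)}$, $\mathbb R_{\alpha(P)}$, $\mathbb Z_{\alpha(P)}$ are the local systems twisted by $(\varepsilon_{ij})$ via the $\mathbb Z_2$-action induced by $\widehat\sigma$. $\operatorname{DD}_{\alpha(P)}(P)\in H^3(X;\mathbb Z_{\alpha(P)})$ is the image of $\beta(P)$ under the connecting morphism of $0\to\mathbb Z_{\alpha(P)}\to\mathbb R_{\alpha(P)}\to U(1)_{\alpha(P)}\to0$. The spherical twisting datum is $\tau(P)=(\alpha(P),\operatorname{DD}_{\alpha(P)}(P))$. The universal classes $\alpha_{\mathrm{univ}}$, $\operatorname{DD}_{\mathrm{univ}}\in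 H^3(B^{\mathrm{sph}}_\sigma(G);\mathbb Z_{\alpha_{\mathrm{univ}}})$ and $\tau_{\mathrm{univ}}=(\alpha_{\mathrm{univ}},\operatorname{DD}_{\mathrm{univ}})$ are those of the universal bundle $E^{\mathrm{sph}}(G)\to B^{\mathrm{sph}}_\sigma(G)$. The local system $f_P^*\mathbb Z_{\alpha_{\mathrm{univ}}}$ is identified with $\mathbb Z_{\alpha(P)}$. *)

theory Defs
  imports "HOL-Analysis.Analysis" "HOL-Algebra.FiniteProduct" "HOL-Algebra.Coset"
begin

section \<open>Diffeological spaces\<close>

text \<open>
  The \<open>n\<close>-dimensional Cartesian space is the library's \<^const>\<open>Euclidean_space\<close> \<open>n\<close>, whose points
  are the sequences vanishing from index \<open>n\<close> on.  A function is \<open>C\<^sup>\<infinity>\<close> on an open set if all its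
  iterated partial derivatives exist and are continuous there.
\<close>

primrec Ck_on :: "nat \<Rightarrow> nat \<Rightarrow> (nat \<Rightarrow> real) set \<Rightarrow> ((nat \<Rightarrow> real) \<Rightarrow> real) \<Rightarrow> bool" where
  "Ck_on 0 n U \<phi> \<longleftrightarrow>
     continuous_map (subtopology (Euclidean_space n) U) euclideanreal \<phi>"
| "Ck_on (Suc k) n U \<phi> \<longleftrightarrow>
     continuous_map (subtopology (Euclidean_space n) U) euclideanreal \<phi> \<and>
     (\<forall>i<n. \<exists>\<psi>. (\<forall>v\<in>U. ((\<lambda>t. \<phi> (v(i := t))) has_real_derivative \<psi> v) (at (v i))) \<and>
               Ck_on k n U \<psi>)"

definition smooth_fun :: "nat \<Rightarrow> (nat \<Rightarrow> real) set \<Rightarrow> ((nat \<Rightarrow> real) \<Rightarrow> real) \<Rightarrow> bool" where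
  "smooth_fun n U \<phi> \<longleftrightarrow> (\<forall>k. Ck_on k n U \<phi>)"

text \<open>\<open>plots X n U p\<close>: the restriction of \<open>p\<close> to the open set \<open>U\<close> of \<open>n\<close>-space is a plot of \<open>X\<close>.\<close>

record 'a diff_space =
  points :: "'a set"
  plots :: "nat \<Rightarrow> (nat \<Rightarrow> real) set \<Rightarrow> ((nat \<Rightarrow> real) \<Rightarrow> 'a) \<Rightarrow> bool"

definition diffeological_space :: "'a diff_space \<Rightarrow> bool" where
  "diffeological_space X \<longleftrightarrow>
     (\<forall>n U p. plots X n U p \<longrightarrow> openin (Euclidean_space n) U \<and> p ` U \<subseteq> points X) \<and>
     (\<forall>n U p p'. plots X n U p \<and> (\<forall>v\<in>U. p v = p' v) \<longrightarrow> plots X n U p') \<and>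
     (\<forall>n U x. openin (Euclidean_space n) U \<and> x \<in> points X \<longrightarrow> plots X n U (\<lambda>_. x)) \<and>
     (\<forall>n U p. openin (Euclidean_space n) U \<and>
        (\<forall>v\<in>U. \<exists>V. openin (Euclidean_space n) V \<and> v \<in> V \<and> V \<subseteq> U \<and> plots X n V p) \<longrightarrow>
        plots X n U p) \<and>
     (\<forall>n U p m V F. plots X n U p \<and> openin (Euclidean_space m) V \<and> F ` V \<subseteq> U \<and>
        (\<forall>i<n. smooth_fun m V (\<lambda>v. F v i)) \<longrightarrow> plots X m V (p \<circ> F))"

definition smooth_map :: "'a diff_space \<Rightarrow> 'b diff_space \<Rightarrow> ('a \<Rightarrow> 'b) \<Rightarrow> bool" where
  "smooth_map X Y f \<longleftrightarrow>
     f ` points X \<subseteq> points Y \<and> (\<forall>n U p. plots X n U p \<longrightarrow> plots Y n U (f \<circ> p))"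

definition diffeomorphism :: "'a diff_space \<Rightarrow> 'b diff_space \<Rightarrow> ('a \<Rightarrow> 'b) \<Rightarrow> bool" where
  "diffeomorphism X Y f \<longleftrightarrow>
     bij_betw f (points X) (points Y) \<and> smooth_map X Y f \<and>
     smooth_map Y X (inv_into (points X) f)"

definition D_topology :: "'a diff_space \<Rightarrow> 'a topology" where
  "D_topology X = topology (\<lambda>W. W \<subseteq> points X \<and>
     (\<forall>n U p. plots X n U p \<longrightarrow> openin (Euclidean_space n) {v\<in>U. p v \<in> W}))"

lemma openin_D_topology:
  "openin (D_topology X) W \<longleftrightarrow> W \<subseteq> points X \<and>
     (\<forall>n U p. plots X n U p \<longrightarrow> openin (Euclidean_space n) {v\<in>U. p v \<in> W})"
proof -
  let ?L = "\<lambda>W. W \<subseteq> points X \<and>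
     (\<forall>n U p. plots X n U p \<longrightarrow> openin (Euclidean_space n) {v\<in>U. p v \<in> W})"
  have "istopology ?L"
    unfolding istopology_def
  proof (intro conjI allI impI; (elim conjE)?)
    fix A B n U p
    assume "\<forall>n U p. plots X n U p \<longrightarrow> openin (Euclidean_space n) {v\<in>U. p v \<in> A}"
      "\<forall>n U p. plots X n U p \<longrightarrow> openin (Euclidean_space n) {v\<in>U. p v \<in> B}" "plots X n U p"
    then have "openin (Euclidean_space n) ({v\<in>U. p v \<in> A} \<inter> {v\<in>U. p v \<in> B})"
      by blast
    moreover have "{v\<in>U. p v \<in> A} \<inter> {v\<in>U. p v \<in> B} = {v\<in>U. p v \<in> A \<inter> B}" by blast
    ultimately show "openin (Euclidean_space n) {v\<in>U. p v \<in> A \<inter> B}" by simp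
  next
    fix \<K> n U p
    assume K: "\<forall>K\<in>\<K>. ?L K" and p: "plots X n U p"
    have "openin (Euclidean_space n) (\<Union>K\<in>\<K>. {v\<in>U. p v \<in> K})"
      using K p by blast
    moreover have "(\<Union>K\<in>\<K>. {v\<in>U. p v \<in> K}) = {v\<in>U. p v \<in> \<Union>\<K>}" by blast
    ultimately show "openin (Euclidean_space n) {v\<in>U. p v \<in> \<Union>\<K>}" by simp
  qed blast+
  then show ?thesis
    unfolding D_topology_def by (simp add: topology_inverse')
qed

definition subspace_diff :: "'a diff_space \<Rightarrow> 'a set \<Rightarrow> 'a diff_space" where
  "subspace_diff X A =
     \<lparr>points = points X \<inter> A, plots = (\<lambda>n U p. plots X n U p \<and> p ` U \<subseteq> A)\<rparr>"

definition prod_diff :: "'a diff_space \<Rightarrow> 'b diff_space \<Rightarrow> ('a \<times> 'b) diff_space" where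
  "prod_diff X Y = \<lparr>points = points X \<times> points Y,
     plots = (\<lambda>n U p. plots X n U (fst \<circ> p) \<and> plots Y n U (snd \<circ> p))\<rparr>"

definition power_diff :: "'i set \<Rightarrow> 'a diff_space \<Rightarrow> ('i \<Rightarrow> 'a) diff_space" where
  "power_diff I X = \<lparr>points = I \<rightarrow>\<^sub>E points X,
     plots = (\<lambda>n U p. openin (Euclidean_space n) U \<and> p ` U \<subseteq> (I \<rightarrow>\<^sub>E points X) \<and>
       (\<forall>i\<in>I. plots X n U (\<lambda>v. p v i)))\<rparr>"

text \<open>
  The final diffeology on \<open>Y\<close> of a family of maps \<open>\<psi> : S \<rightarrow> Y\<close>: plots are locally either constant or
  of the form \<open>\<psi> \<circ> r\<close> for a plot \<open>r\<close> of one of the sources.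
\<close>

definition final_diff :: "'b set \<Rightarrow> ('a diff_space \<times> ('a \<Rightarrow> 'b)) set \<Rightarrow> 'b diff_space" where
  "final_diff Y \<F> = \<lparr>points = Y,
     plots = (\<lambda>n U p. openin (Euclidean_space n) U \<and> p ` U \<subseteq> Y \<and>
       (\<forall>v\<in>U. \<exists>V. openin (Euclidean_space n) V \<and> v \<in> V \<and> V \<subseteq> U \<and>
          ((\<exists>y. \<forall>w\<in>V. p w = y) \<or>
           (\<exists>(S, \<psi>)\<in>\<F>. \<exists>r. plots S n V r \<and> (\<forall>w\<in>V. p w = \<psi> (r w))))))\<rparr>"

definition discrete_diff :: "'a set \<Rightarrow> 'a diff_space" where
  "discrete_diff Y = \<lparr>points = Y,
     plots = (\<lambda>n U p. openin (Euclidean_space n) U \<and> p ` U \<subseteq> Y \<and>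
       (\<forall>v\<in>U. \<exists>V. openin (Euclidean_space n) V \<and> v \<in> V \<and> V \<subseteq> U \<and> (\<forall>w\<in>V. p w = p v)))\<rparr>"

definition real_diff :: "real diff_space" where
  "real_diff = \<lparr>points = UNIV,
     plots = (\<lambda>n U p. openin (Euclidean_space n) U \<and> smooth_fun n U p)\<rparr>"

definition complex_diff :: "complex diff_space" where
  "complex_diff = \<lparr>points = UNIV,
     plots = (\<lambda>n U p. openin (Euclidean_space n) U \<and>
       smooth_fun n U (Re \<circ> p) \<and> smooth_fun n U (Im \<circ> p))\<rparr>"


section \<open>Diffeological groups\<close>

record 'a diff_group = "'a monoid" +
  gplots :: "nat \<Rightarrow> (nat \<Rightarrow> real) set \<Rightarrow> ((nat \<Rightarrow> real) \<Rightarrow> 'a) \<Rightarrow> bool"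

definition dspace :: "'a diff_group \<Rightarrow> 'a diff_space" where
  "dspace G = \<lparr>points = carrier G, plots = gplots G\<rparr>"

definition diffeological_group :: "'a diff_group \<Rightarrow> bool" where
  "diffeological_group G \<longleftrightarrow> group G \<and> diffeological_space (dspace G) \<and>
     smooth_map (prod_diff (dspace G) (dspace G)) (dspace G) (\<lambda>(x, y). x \<otimes>\<^bsub>G\<^esub> y) \<and>
     smooth_map (dspace G) (dspace G) (\<lambda>x. inv\<^bsub>G\<^esub> x)"

definition Z2_group :: "int diff_group" where
  "Z2_group = \<lparr>carrier = {1, -1}, mult = (*), one = 1, gplots = plots (discrete_diff {1, -1})\<rparr>"

definition R_group :: "real diff_group" where
  "R_group = \<lparr>carrier = UNIV, mult = (+), one = 0, gplots = plots real_diff\<rparr>"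

definition Z_group :: "real diff_group" where
  "Z_group = \<lparr>carrier = \<int>, mult = (+), one = 0, gplots = plots (subspace_diff real_diff \<int>)\<rparr>"

definition U1_group :: "complex diff_group" where
  "U1_group = \<lparr>carrier = sphere 0 1, mult = (*), one = 1,
     gplots = plots (subspace_diff complex_diff (sphere 0 1))\<rparr>"

definition exp_U1 :: "real \<Rightarrow> complex" where
  "exp_U1 t = cis (2 * pi * t)"

text \<open>A smooth action of \<open>\<int>\<^sub>2 = {1, -1}\<close> on \<open>G\<close> by automorphisms.\<close>

definition smooth_Z2_action :: "'g diff_group \<Rightarrow> (int \<Rightarrow> 'g \<Rightarrow> 'g) \<Rightarrow> bool" where
  "smooth_Z2_action G \<sigma> \<longleftrightarrow>
     (\<forall>\<epsilon>\<in>carrier Z2_group. \<sigma> \<epsilon> \<in> iso G G) \<and>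
     (\<forall>g\<in>carrier G. \<sigma> 1 g = g) \<and>
     (\<forall>\<epsilon>\<in>carrier Z2_group. \<forall>\<delta>\<in>carrier Z2_group. \<forall>g\<in>carrier G. \<sigma> (\<epsilon> * \<delta>) g = \<sigma> \<epsilon> (\<sigma> \<delta> g)) \<and>
     smooth_map (prod_diff (dspace Z2_group) (dspace G)) (dspace G) (\<lambda>(\<epsilon>, g). \<sigma> \<epsilon> g)"

definition H_group :: "'g diff_group \<Rightarrow> (int \<Rightarrow> 'g \<Rightarrow> 'g) \<Rightarrow> ('g \<times> int) diff_group" where
  "H_group G \<sigma> = \<lparr>carrier = carrier G \<times> carrier Z2_group,
     mult = (\<lambda>(h, \<epsilon>) (h', \<epsilon>'). (h \<otimes>\<^bsub>G\<^esub> \<sigma> \<epsilon> h', \<epsilon> * \<epsilon>')),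
     one = (\<one>\<^bsub>G\<^esub>, 1),
     gplots = plots (prod_diff (dspace G) (dspace Z2_group))\<rparr>"


section \<open>Principal bundles\<close>

record ('p, 'x, 'h) gbundle =
  total :: "'p diff_space"
  base :: "'x diff_space"
  proj :: "'p \<Rightarrow> 'x"
  act :: "'h \<Rightarrow> 'p \<Rightarrow> 'p"

text \<open>
  A local trivialization over a D-open set \<open>U\<close> is an equivariant diffeomorphism
  \<open>p \<mapsto> (proj p, \<eta> p)\<close> from the part of the total space over \<open>U\<close> to \<open>U \<times> H\<close>.  It corresponds to the
  local section \<open>s\<close> with \<open>p = \<eta> p \<cdot> s (proj p)\<close>.
\<close>

definition local_trivialization ::
  "'h diff_group \<Rightarrow> ('p, 'x, 'h) gbundle \<Rightarrow> 'x set \<Rightarrow> ('p \<Rightarrow> 'h) \<Rightarrow> bool" where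
  "local_trivialization H P U \<eta> \<longleftrightarrow>
     openin (D_topology (base P)) U \<and>
     diffeomorphism (subspace_diff (total P) {p. proj P p \<in> U})
       (prod_diff (subspace_diff (base P) U) (dspace H)) (\<lambda>p. (proj P p, \<eta> p)) \<and>
     (\<forall>h\<in>carrier H. \<forall>p\<in>points (total P). proj P p \<in> U \<longrightarrow> \<eta> (act P h p) = h \<otimes>\<^bsub>H\<^esub> \<eta> p)"

definition principal_bundle :: "'h diff_group \<Rightarrow> ('p, 'x, 'h) gbundle \<Rightarrow> bool" where
  "principal_bundle H P \<longleftrightarrow>
     diffeological_group H \<and> diffeological_space (total P) \<and> diffeological_space (base P) \<and>
     smooth_map (total P) (base P) (proj P) \<and>
     smooth_map (prod_diff (dspace H) (total P)) (total P) (\<lambda>(h, p). act P h p) \<and>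
     (\<forall>p\<in>points (total P). act P \<one>\<^bsub>H\<^esub> p = p) \<and>
     (\<forall>h\<in>carrier H. \<forall>k\<in>carrier H. \<forall>p\<in>points (total P).
        act P (h \<otimes>\<^bsub>H\<^esub> k) p = act P h (act P k p)) \<and>
     (\<forall>h\<in>carrier H. \<forall>p\<in>points (total P). proj P (act P h p) = proj P p) \<and>
     (\<forall>x\<in>points (base P). \<exists>U \<eta>. x \<in> U \<and> local_trivialization H P U \<eta>)"

definition pullback_bundle ::
  "'x diff_space \<Rightarrow> ('x \<Rightarrow> 'y) \<Rightarrow> ('p, 'y, 'h) gbundle \<Rightarrow> ('x \<times> 'p, 'x, 'h) gbundle" where
  "pullback_bundle X f E = \<lparr>
     total = subspace_diff (prod_diff X (total E)) {(x, e). f x = proj E e},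
     base = X, proj = fst, act = (\<lambda>h (x, e). (x, act E h e))\<rparr>"

definition bundle_iso ::
  "'h diff_group \<Rightarrow> ('p, 'x, 'h) gbundle \<Rightarrow> ('q, 'x, 'h) gbundle \<Rightarrow> ('p \<Rightarrow> 'q) \<Rightarrow> bool" where
  "bundle_iso H P Q \<Psi> \<longleftrightarrow>
     diffeomorphism (total P) (total Q) \<Psi> \<and>
     (\<forall>p\<in>points (total P). proj Q (\<Psi> p) = proj P p) \<and>
     (\<forall>h\<in>carrier H. \<forall>p\<in>points (total P). \<Psi> (act P h p) = act Q h (\<Psi> p))"

text \<open>
  Trivializations over an open cover, with transition functions \<open>h\<^sub>i\<^sub>j = \<eta>\<^sub>i\<^sup>-\<^sup>1 \<eta>\<^sub>j\<close>, i.e.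
  \<open>s\<^sub>i = h\<^sub>i\<^sub>j \<cdot> s\<^sub>j\<close> for the local sections, so that \<open>h\<^sub>i\<^sub>j h\<^sub>j\<^sub>k = h\<^sub>i\<^sub>k\<close>.  For left principal bundles this
  is the convention under which the \<open>a\<^sub>i\<^sub>j\<^sub>k\<close> below take values in the kernel of \<open>q\<close>.
\<close>

record ('i, 'x, 'p, 'h) trivs =
  idx :: "'i set"
  cov :: "'i \<Rightarrow> 'x set"
  chart :: "'i \<Rightarrow> 'p \<Rightarrow> 'h"

definition trivialization ::
  "'h diff_group \<Rightarrow> ('p, 'x, 'h) gbundle \<Rightarrow> ('i, 'x, 'p, 'h) trivs \<Rightarrow> bool" where
  "trivialization H P T \<longleftrightarrow>
     (\<Union>i\<in>idx T. cov T i) = points (base P) \<and>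
     (\<forall>i\<in>idx T. local_trivialization H P (cov T i) (chart T i))"

definition fibre_point :: "('p, 'x, 'h) gbundle \<Rightarrow> 'x \<Rightarrow> 'p" where
  "fibre_point P x = (SOME p. p \<in> points (total P) \<and> proj P p = x)"

definition transition ::
  "'h diff_group \<Rightarrow> ('p, 'x, 'h) gbundle \<Rightarrow> ('i, 'x, 'p, 'h) trivs \<Rightarrow> 'i \<Rightarrow> 'i \<Rightarrow> 'x \<Rightarrow> 'h" where
  "transition H P T i j x =
     inv\<^bsub>H\<^esub> (chart T i (fibre_point P x)) \<otimes>\<^bsub>H\<^esub> chart T j (fibre_point P x)"


section \<open>The spherical universal bundle\<close>

type_synonym 'g sph_family = "(nat \<Rightarrow> real) \<times> (nat \<Rightarrow> 'g)"

definition sph_families :: "'g diff_group \<Rightarrow> 'g sph_family set" where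
  "sph_families G = {(x, g). finite {i. x i \<noteq> 0} \<and> (\<Sum>i | x i \<noteq> 0. (x i)\<^sup>2) = 1 \<and>
     (\<forall>i. g i \<in> carrier G)}"

definition sph_rel :: "'g diff_group \<Rightarrow> ('g sph_family \<times> 'g sph_family) set" where
  "sph_rel G = {((x, g), (x', g')). (x, g) \<in> sph_families G \<and> (x', g') \<in> sph_families G \<and>
     x = x' \<and> (\<forall>i. x i \<noteq> 0 \<longrightarrow> g i = g' i)}"

definition sphere_diff :: "nat set \<Rightarrow> (nat \<Rightarrow> real) diff_space" where
  "sphere_diff I = subspace_diff (power_diff I real_diff) {x. (\<Sum>i\<in>I. (x i)\<^sup>2) = 1}"

text \<open>The value \<open>\<one>\<close> outside \<open>I\<close> is irrelevant by \<^const>\<open>sph_rel\<close>.\<close>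

definition psi_sph :: "'g diff_group \<Rightarrow> nat set \<Rightarrow> 'g sph_family \<Rightarrow> 'g sph_family set" where
  "psi_sph G I = (\<lambda>(x, g). sph_rel G ``
     {(\<lambda>i. if i \<in> I then x i else 0, \<lambda>i. if i \<in> I then g i else \<one>\<^bsub>G\<^esub>)})"

definition E_sph :: "'g diff_group \<Rightarrow> 'g sph_family set diff_space" where
  "E_sph G = final_diff (sph_families G // sph_rel G)
     {(prod_diff (sphere_diff I) (power_diff I (dspace G)), psi_sph G I) | I. finite I}"

definition act_sph ::
  "'g diff_group \<Rightarrow> (int \<Rightarrow> 'g \<Rightarrow> 'g) \<Rightarrow> 'g \<times> int \<Rightarrow> 'g sph_family set \<Rightarrow> 'g sph_family set" where
  "act_sph G \<sigma> = (\<lambda>(h, \<epsilon>) \<xi>.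
     (\<lambda>(x, g). (\<lambda>i. of_int \<epsilon> * x i, \<lambda>i. h \<otimes>\<^bsub>G\<^esub> \<sigma> \<epsilon> (g i))) ` \<xi>)"

definition orbit_sph ::
  "'g diff_group \<Rightarrow> (int \<Rightarrow> 'g \<Rightarrow> 'g) \<Rightarrow> 'g sph_family set \<Rightarrow> 'g sph_family set set" where
  "orbit_sph G \<sigma> \<xi> = (\<lambda>h. act_sph G \<sigma> h \<xi>) ` carrier (H_group G \<sigma>)"

definition B_sph ::
  "'g diff_group \<Rightarrow> (int \<Rightarrow> 'g \<Rightarrow> 'g) \<Rightarrow> 'g sph_family set set diff_space" where
  "B_sph G \<sigma> = final_diff (orbit_sph G \<sigma> ` points (E_sph G)) {(E_sph G, orbit_sph G \<sigma>)}"

definition univ_bundle :: "'g diff_group \<Rightarrow> (int \<Rightarrow> 'g \<Rightarrow> 'g) \<Rightarrow>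
    ('g sph_family set, 'g sph_family set set, 'g \<times> int) gbundle" where
  "univ_bundle G \<sigma> = \<lparr>total = E_sph G, base = B_sph G \<sigma>, proj = orbit_sph G \<sigma>, act = act_sph G \<sigma>\<rparr>"


section \<open>Sheaf cohomology\<close>

text \<open>
  The cohomology of a sheaf \<open>F\<close> of abelian groups (written multiplicatively) on an arbitrary
  topological space, computed by Godement's canonical cosimplicial flasque resolution with terms
  \<open>G(F)\<close>, \<open>G(G(F))\<close>, \dots, where \<open>G(F)(U)\<close> is the product of the stalks of \<open>F\<close> at the points of \<open>U\<close>.
  Unfolding stalks of products of stalks, a global section of the \<open>n\<close>-th term (\<open>n = 0, 1, \<dots>\<close>) is a
  family of germs \<open>c [x\<^sub>0, \<dots>, x\<^sub>n]\<close> of \<open>F\<close> at \<open>x\<^sub>n\<close>, defined for all \<open>x\<^sub>0\<close>, all \<open>x\<^sub>1\<close> near \<open>x\<^sub>0\<close>, all \<open>x\<^sub>2\<close>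
  near \<open>x\<^sub>1\<close> and so on (how near may depend on the preceding points), and two such families are
  identified when they agree in the same iterated sense.  The \<open>k\<close>-th coface map omits \<open>x\<^sub>k\<close>; for the
  last one the germ at \<open>x\<^sub>n\<close> is thereby regarded as a germ at the nearby point following it.

  Sheaf cohomology rather than the colimit over open covers is used because the D-topology need not
  be paracompact, and then only the former has a connecting morphism for every short exact sequence
  of sheaves; \v{C}ech cocycles represent classes through the canonical map defined below.
\<close>

record ('x, 's) presheaf =
  sections :: "'x set \<Rightarrow> 's monoid"
  res :: "'x set \<Rightarrow> 'x set \<Rightarrow> 's \<Rightarrow> 's"

text \<open>A germ is represented by an open set and a section over it.\<close>

type_synonym ('x, 's) cochain = "'x list \<Rightarrow> 'x set \<times> 's"

primrec near :: "'x topology \<Rightarrow> nat \<Rightarrow> ('x list \<Rightarrow> bool) \<Rightarrow> 'x list \<Rightarrow> bool" where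
  "near T 0 Q xs \<longleftrightarrow> Q xs"
| "near T (Suc n) Q xs \<longleftrightarrow> (\<forall>\<^sub>F y in nhdsin T (last xs). near T n Q (xs @ [y]))"

definition all_near :: "'x topology \<Rightarrow> nat \<Rightarrow> ('x list \<Rightarrow> bool) \<Rightarrow> bool" where
  "all_near T n Q \<longleftrightarrow> (\<forall>x\<in>topspace T. near T n Q [x])"

definition is_germ :: "'x topology \<Rightarrow> ('x, 's) presheaf \<Rightarrow> 'x \<Rightarrow> 'x set \<times> 's \<Rightarrow> bool" where
  "is_germ T F x = (\<lambda>(V, s). openin T V \<and> x \<in> V \<and> s \<in> carrier (sections F V))"

definition germ_eq ::
  "'x topology \<Rightarrow> ('x, 's) presheaf \<Rightarrow> 'x \<Rightarrow> 'x set \<times> 's \<Rightarrow> 'x set \<times> 's \<Rightarrow> bool" where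
  "germ_eq T F x = (\<lambda>(V, s) (V', s'). \<exists>W. openin T W \<and> x \<in> W \<and> W \<subseteq> V \<inter> V' \<and>
     res F V W s = res F V' W s')"

definition cochains :: "'x topology \<Rightarrow> ('x, 's) presheaf \<Rightarrow> nat \<Rightarrow> ('x, 's) cochain set" where
  "cochains T F n = {c. all_near T n (\<lambda>xs. is_germ T F (last xs) (c xs))}"

definition cochain_eq ::
  "'x topology \<Rightarrow> ('x, 's) presheaf \<Rightarrow> nat \<Rightarrow> ('x, 's) cochain \<Rightarrow> ('x, 's) cochain \<Rightarrow> bool" where
  "cochain_eq T F n c c' \<longleftrightarrow> all_near T n (\<lambda>xs. germ_eq T F (last xs) (c xs) (c' xs))"

definition cochain_one :: "'x topology \<Rightarrow> ('x, 's) presheaf \<Rightarrow> ('x, 's) cochain" where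
  "cochain_one T F = (\<lambda>xs. (topspace T, \<one>\<^bsub>sections F (topspace T)\<^esub>))"

definition cochain_mult ::
  "('x, 's) presheaf \<Rightarrow> ('x, 's) cochain \<Rightarrow> ('x, 's) cochain \<Rightarrow> ('x, 's) cochain" where
  "cochain_mult F c c' = (\<lambda>xs. let (V, s) = c xs; (V', s') = c' xs; W = V \<inter> V' in
     (W, res F V W s \<otimes>\<^bsub>sections F W\<^esub> res F V' W s'))"

definition omit :: "nat \<Rightarrow> 'x list \<Rightarrow> 'x list" where
  "omit k xs = take k xs @ drop (Suc k) xs"

definition coboundary :: "('x, 's) presheaf \<Rightarrow> ('x, 's) cochain \<Rightarrow> ('x, 's) cochain" where
  "coboundary F c = (\<lambda>xs. let W = (\<Inter>k<length xs. fst (c (omit k xs))) in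
     (W, \<Otimes>\<^bsub>sections F W\<^esub>k\<in>{..<length xs}. (case c (omit k xs) of (V, s) \<Rightarrow>
        if even k then res F V W s else inv\<^bsub>sections F W\<^esub> (res F V W s))))"

definition cocycles :: "'x topology \<Rightarrow> ('x, 's) presheaf \<Rightarrow> nat \<Rightarrow> ('x, 's) cochain set" where
  "cocycles T F n =
     {c \<in> cochains T F n. cochain_eq T F (Suc n) (coboundary F c) (cochain_one T F)}"

definition coboundaries :: "'x topology \<Rightarrow> ('x, 's) presheaf \<Rightarrow> nat \<Rightarrow> ('x, 's) cochain set" where
  "coboundaries T F n = (case n of
     0 \<Rightarrow> {b \<in> cochains T F 0. cochain_eq T F 0 b (cochain_one T F)}
   | Suc m \<Rightarrow> {b \<in> cochains T F n. \<exists>a\<in>cochains T F m. cochain_eq T F n b (coboundary F a)})"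

text \<open>The class of \<open>c\<close> in \<open>H\<^sup>n\<close>, as the set of all cocycles representing it.\<close>

definition coho_class ::
  "'x topology \<Rightarrow> ('x, 's) presheaf \<Rightarrow> nat \<Rightarrow> ('x, 's) cochain \<Rightarrow> ('x, 's) cochain set" where
  "coho_class T F n c = {c' \<in> cocycles T F n.
     \<exists>b\<in>coboundaries T F n. cochain_eq T F n c' (cochain_mult F c b)}"

text \<open>
  The class of a \v{C}ech cochain \<open>a\<close>, \<open>a [i\<^sub>0, \<dots>, i\<^sub>n] \<in> F(U i\<^sub>0 \<inter> \<dots> \<inter> U i\<^sub>n)\<close>, of an open cover under the
  canonical map from \v{C}ech to sheaf cohomology: one chooses for every point \<open>x\<close> an index \<open>i\<close> with
  \<open>x \<in> U\<^sub>i\<close>.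
\<close>

definition cech_class :: "'x topology \<Rightarrow> ('x, 's) presheaf \<Rightarrow> 'i set \<Rightarrow> ('i \<Rightarrow> 'x set) \<Rightarrow> nat \<Rightarrow>
    ('i list \<Rightarrow> 's) \<Rightarrow> ('x, 's) cochain set" where
  "cech_class T F I U n a = (let l = (\<lambda>x. SOME i. i \<in> I \<and> x \<in> U i) in
     coho_class T F n (\<lambda>xs. (\<Inter>x\<in>set xs. U (l x), a (map l xs))))"

text \<open>
  A morphism of sheaves is given by its components \<open>\<phi> V : F(V) \<rightarrow> F'(V)\<close>; more generally a map
  \<open>\<theta> V : F(V) \<rightarrow> F'(f\<^sup>-\<^sup>1(V))\<close> over \<open>f : X \<rightarrow> Y\<close> is used to pull back cohomology classes.
\<close>

definition cochain_map :: "('x set \<Rightarrow> 's \<Rightarrow> 't) \<Rightarrow> ('x, 's) cochain \<Rightarrow> ('x, 't) cochain" where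
  "cochain_map \<phi> c = (\<lambda>xs. case c xs of (V, s) \<Rightarrow> (V, \<phi> V s))"

definition map_class :: "'x topology \<Rightarrow> ('x, 't) presheaf \<Rightarrow> nat \<Rightarrow> ('x set \<Rightarrow> 's \<Rightarrow> 't) \<Rightarrow>
    ('x, 's) cochain set \<Rightarrow> ('x, 't) cochain set" where
  "map_class T F' n \<phi> \<xi> = (\<Union>c\<in>\<xi>. coho_class T F' n (cochain_map \<phi> c))"

definition pull_cochain :: "'x topology \<Rightarrow> ('x \<Rightarrow> 'y) \<Rightarrow> ('y set \<Rightarrow> 's \<Rightarrow> 't) \<Rightarrow>
    ('y, 's) cochain \<Rightarrow> ('x, 't) cochain" where
  "pull_cochain T f \<theta> c = (\<lambda>xs. case c (map f xs) of (V, s) \<Rightarrow> ({x\<in>topspace T. f x \<in> V}, \<theta> V s))"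

definition pull_class :: "'x topology \<Rightarrow> ('x, 't) presheaf \<Rightarrow> nat \<Rightarrow> ('x \<Rightarrow> 'y) \<Rightarrow>
    ('y set \<Rightarrow> 's \<Rightarrow> 't) \<Rightarrow> ('y, 's) cochain set \<Rightarrow> ('x, 't) cochain set" where
  "pull_class T F' n f \<theta> \<xi> = (\<Union>c\<in>\<xi>. coho_class T F' n (pull_cochain T f \<theta> c))"

text \<open>
  The connecting morphism \<open>H\<^sup>n(C) \<rightarrow> H\<^sup>n\<^sup>+\<^sup>1(A)\<close> of \<open>0 \<rightarrow> A \<rightarrow> B \<rightarrow> C \<rightarrow> 0\<close>, with maps \<open>\<phi>\<close> and \<open>\<psi>\<close>:  lift a
  representative to \<open>B\<close>, take its coboundary and pull that back to \<open>A\<close>.  The set of all results is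
  a full cohomology class.
\<close>

definition connecting :: "'x topology \<Rightarrow> ('x, 'a) presheaf \<Rightarrow> ('x, 'b) presheaf \<Rightarrow>
    ('x, 'c) presheaf \<Rightarrow> ('x set \<Rightarrow> 'a \<Rightarrow> 'b) \<Rightarrow> ('x set \<Rightarrow> 'b \<Rightarrow> 'c) \<Rightarrow> nat \<Rightarrow>
    ('x, 'c) cochain set \<Rightarrow> ('x, 'a) cochain set" where
  "connecting T A B C \<phi> \<psi> n \<xi> = {a \<in> cocycles T A (Suc n).
     \<exists>c\<in>\<xi>. \<exists>b\<in>cochains T B n. cochain_eq T C n (cochain_map \<psi> b) c \<and>
       cochain_eq T B (Suc n) (cochain_map \<phi> a) (coboundary B b)}"


section \<open>Sheaves of smooth functions and twisted coefficients\<close>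

definition smooth_sheaf :: "'x diff_space \<Rightarrow> 'a diff_group \<Rightarrow> ('x, 'x \<Rightarrow> 'a) presheaf" where
  "smooth_sheaf X A = \<lparr>
     sections = (\<lambda>W. \<lparr>
       carrier = {s \<in> extensional W. smooth_map (subspace_diff X W) (dspace A) s},
       mult = (\<lambda>s t. \<lambda>x\<in>W. s x \<otimes>\<^bsub>A\<^esub> t x), one = (\<lambda>x\<in>W. \<one>\<^bsub>A\<^esub>)\<rparr>),
     res = (\<lambda>V W s. restrict s W)\<rparr>"

text \<open>
  The sheaf \<open>A\<^sub>\<alpha>\<close> twisted by a \<open>\<int>\<^sub>2\<close>-valued cocycle \<open>\<epsilon>\<^sub>i\<^sub>j\<close> on a cover \<open>U\<^sub>i\<close>, where \<open>\<int>\<^sub>2\<close> acts on the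
  abelian group \<open>A\<close> by \<open>\<rho>\<close>: a section over \<open>W\<close> is a family of smooth maps \<open>m\<^sub>i : W \<inter> U\<^sub>i \<rightarrow> A\<close> with
  \<open>m\<^sub>i = \<rho>(\<epsilon>\<^sub>i\<^sub>j) m\<^sub>j\<close> on \<open>W \<inter> U\<^sub>i \<inter> U\<^sub>j\<close>.  For discrete \<open>A\<close> this is a local system with fibre \<open>A\<close>.
\<close>

definition family_on :: "'i set \<Rightarrow> ('i \<Rightarrow> 'x set) \<Rightarrow> 'x set \<Rightarrow> ('i \<Rightarrow> 'x \<Rightarrow> 'a) \<Rightarrow> 'i \<Rightarrow> 'x \<Rightarrow> 'a" where
  "family_on I U W m = (\<lambda>i x. if i \<in> I \<and> x \<in> W \<inter> U i then m i x else undefined)"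

definition twisted_sheaf :: "'x diff_space \<Rightarrow> 'a diff_group \<Rightarrow> (int \<Rightarrow> 'a \<Rightarrow> 'a) \<Rightarrow> 'i set \<Rightarrow>
    ('i \<Rightarrow> 'x set) \<Rightarrow> ('i \<Rightarrow> 'i \<Rightarrow> 'x \<Rightarrow> int) \<Rightarrow> ('x, 'i \<Rightarrow> 'x \<Rightarrow> 'a) presheaf" where
  "twisted_sheaf X A \<rho> I U \<epsilon> = \<lparr>
     sections = (\<lambda>W. \<lparr>
       carrier = {m. family_on I U W m = m \<and>
         (\<forall>i\<in>I. smooth_map (subspace_diff X (W \<inter> U i)) (dspace A) (m i)) \<and>
         (\<forall>i\<in>I. \<forall>j\<in>I. \<forall>x\<in>W \<inter> U i \<inter> U j. m i x = \<rho> (\<epsilon> i j x) (m j x))},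
       mult = (\<lambda>m m'. family_on I U W (\<lambda>i x. m i x \<otimes>\<^bsub>A\<^esub> m' i x)),
       one = family_on I U W (\<lambda>i x. \<one>\<^bsub>A\<^esub>)\<rparr>),
     res = (\<lambda>V W m. family_on I U W m)\<rparr>"


section \<open>Central extensions and characteristic classes\<close>

text \<open>The data \<open>1 \<rightarrow> U(1) \<rightarrow> ext_grp \<rightarrow> G \<rightarrow> 1\<close> together with a \<open>\<int>\<^sub>2\<close>-action on the middle group.\<close>

record ('g, 'e) ext =
  ext_grp :: "'e diff_group"
  ext_incl :: "complex \<Rightarrow> 'e"
  ext_q :: "'e \<Rightarrow> 'g"
  ext_sigma :: "int \<Rightarrow> 'e \<Rightarrow> 'e"

text \<open>
  The inclusion is an induction (a diffeomorphism onto its image), and \<open>q\<close> is a locally trivial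
  \<open>U(1)\<close>-bundle over the D-topology of \<open>G\<close>, i.e. it has local smooth sections (so in particular it
  is a subduction).  Local sections provide the local smooth lifts which make the class of \<open>a\<^sub>i\<^sub>j\<^sub>k\<close>
  below independent of the trivializations.
\<close>

definition central_extension :: "'g diff_group \<Rightarrow> ('g, 'e) ext \<Rightarrow> bool" where
  "central_extension G X \<longleftrightarrow>
     diffeological_group (ext_grp X) \<and>
     ext_incl X \<in> hom U1_group (ext_grp X) \<and>
     diffeomorphism (dspace U1_group)
       (subspace_diff (dspace (ext_grp X)) (ext_incl X ` carrier U1_group)) (ext_incl X) \<and>
     ext_q X \<in> hom (ext_grp X) G \<and>
     smooth_map (dspace (ext_grp X)) (dspace G) (ext_q X) \<and>
     ext_q X ` carrier (ext_grp X) = carrier G \<and>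
     kernel (ext_grp X) G (ext_q X) = ext_incl X ` carrier U1_group \<and>
     (\<forall>z\<in>carrier U1_group. \<forall>g\<in>carrier (ext_grp X).
        ext_incl X z \<otimes>\<^bsub>ext_grp X\<^esub> g = g \<otimes>\<^bsub>ext_grp X\<^esub> ext_incl X z) \<and>
     (\<forall>g\<in>carrier G. \<exists>W s. openin (D_topology (dspace G)) W \<and> g \<in> W \<and>
        smooth_map (subspace_diff (dspace G) W) (dspace (ext_grp X)) s \<and>
        (\<forall>w\<in>W. ext_q X (s w) = w))"

definition equivariant_extension ::
  "'g diff_group \<Rightarrow> (int \<Rightarrow> 'g \<Rightarrow> 'g) \<Rightarrow> ('g, 'e) ext \<Rightarrow> bool" where
  "equivariant_extension G \<sigma> X \<longleftrightarrow>
     central_extension G X \<and> smooth_Z2_action (ext_grp X) (ext_sigma X) \<and>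
     (\<forall>\<epsilon>\<in>carrier Z2_group. \<forall>g\<in>carrier (ext_grp X). ext_q X (ext_sigma X \<epsilon> g) = \<sigma> \<epsilon> (ext_q X g))"

text \<open>
  The induced action on \<open>U(1)\<close>, and its lift to the universal cover \<open>\<real>\<close> (the induced action on the
  Lie algebra), which restricts to the action on \<open>\<int>\<close>.
\<close>

definition U1_act :: "('g, 'e) ext \<Rightarrow> int \<Rightarrow> complex \<Rightarrow> complex" where
  "U1_act X \<epsilon> z = inv_into (carrier U1_group) (ext_incl X) (ext_sigma X \<epsilon> (ext_incl X z))"

definition R_act :: "('g, 'e) ext \<Rightarrow> int \<Rightarrow> real \<Rightarrow> real" where
  "R_act X \<epsilon> = (THE r. linear r \<and> (\<forall>t. exp_U1 (r t) = U1_act X \<epsilon> (exp_U1 t)))"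

definition eps_coc :: "'g diff_group \<Rightarrow> (int \<Rightarrow> 'g \<Rightarrow> 'g) \<Rightarrow> ('p, 'x, 'g \<times> int) gbundle \<Rightarrow>
    ('i, 'x, 'p, 'g \<times> int) trivs \<Rightarrow> 'i \<Rightarrow> 'i \<Rightarrow> 'x \<Rightarrow> int" where
  "eps_coc G \<sigma> P T i j x = snd (transition (H_group G \<sigma>) P T i j x)"

definition alpha_class :: "'g diff_group \<Rightarrow> (int \<Rightarrow> 'g \<Rightarrow> 'g) \<Rightarrow> ('p, 'x, 'g \<times> int) gbundle \<Rightarrow>
    ('i, 'x, 'p, 'g \<times> int) trivs \<Rightarrow> ('x, 'x \<Rightarrow> int) cochain set" where
  "alpha_class G \<sigma> P T =
     cech_class (D_topology (base P)) (smooth_sheaf (base P) Z2_group) (idx T) (cov T) 1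
       (\<lambda>is. \<lambda>x\<in>cov T (is ! 0) \<inter> cov T (is ! 1). eps_coc G \<sigma> P T (is ! 0) (is ! 1) x)"

text \<open>The sheaf \<open>A\<^sub>\<alpha>\<^sub>(\<^sub>P\<^sub>)\<close>.\<close>

definition twisted_coeff :: "'g diff_group \<Rightarrow> (int \<Rightarrow> 'g \<Rightarrow> 'g) \<Rightarrow> ('p, 'x, 'g \<times> int) gbundle \<Rightarrow>
    ('i, 'x, 'p, 'g \<times> int) trivs \<Rightarrow> 'a diff_group \<Rightarrow> (int \<Rightarrow> 'a \<Rightarrow> 'a) \<Rightarrow>
    ('x, 'i \<Rightarrow> 'x \<Rightarrow> 'a) presheaf" where
  "twisted_coeff G \<sigma> P T A \<rho> =
     twisted_sheaf (base P) A \<rho> (idx T) (cov T) (eps_coc G \<sigma> P T)"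

definition smooth_lifts :: "'g diff_group \<Rightarrow> (int \<Rightarrow> 'g \<Rightarrow> 'g) \<Rightarrow> ('g, 'e) ext \<Rightarrow>
    ('p, 'x, 'g \<times> int) gbundle \<Rightarrow> ('i, 'x, 'p, 'g \<times> int) trivs \<Rightarrow> ('i \<Rightarrow> 'i \<Rightarrow> 'x \<Rightarrow> 'e) \<Rightarrow> bool" where
  "smooth_lifts G \<sigma> X P T gh \<longleftrightarrow> (\<forall>i\<in>idx T. \<forall>j\<in>idx T.
     smooth_map (subspace_diff (base P) (cov T i \<inter> cov T j)) (dspace (ext_grp X)) (gh i j) \<and>
     (\<forall>x\<in>cov T i \<inter> cov T j. ext_q X (gh i j x) = fst (transition (H_group G \<sigma>) P T i j x)))"

definition lift_coc :: "('g, 'e) ext \<Rightarrow> ('i \<Rightarrow> 'i \<Rightarrow> 'x \<Rightarrow> int) \<Rightarrow> ('i \<Rightarrow> 'i \<Rightarrow> 'x \<Rightarrow> 'e) \<Rightarrow>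
    'i \<Rightarrow> 'i \<Rightarrow> 'i \<Rightarrow> 'x \<Rightarrow> complex" where
  "lift_coc X \<epsilon> gh i j k x = inv_into (carrier U1_group) (ext_incl X)
     (gh i j x \<otimes>\<^bsub>ext_grp X\<^esub> ext_sigma X (\<epsilon> i j x) (gh j k x) \<otimes>\<^bsub>ext_grp X\<^esub> inv\<^bsub>ext_grp X\<^esub> gh i k x)"

text \<open>
  The value \<open>a\<^sub>i\<^sub>j\<^sub>k\<close> is expressed in the frame \<open>i\<close> (this is what the twisted cocycle identity
  \<open>\<epsilon>\<^sub>i\<^sub>j a\<^sub>j\<^sub>k\<^sub>l \<cdot> a\<^sub>i\<^sub>j\<^sub>l = a\<^sub>i\<^sub>j\<^sub>k \<cdot> a\<^sub>i\<^sub>k\<^sub>l\<close> says), so as a section of \<open>U(1)\<^sub>\<alpha>\<close> its component in the frame \<open>l\<close> is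
  \<open>\<epsilon>\<^sub>l\<^sub>i a\<^sub>i\<^sub>j\<^sub>k\<close>.
\<close>

definition beta_class :: "'g diff_group \<Rightarrow> (int \<Rightarrow> 'g \<Rightarrow> 'g) \<Rightarrow> ('g, 'e) ext \<Rightarrow>
    ('p, 'x, 'g \<times> int) gbundle \<Rightarrow> ('i, 'x, 'p, 'g \<times> int) trivs \<Rightarrow> ('i \<Rightarrow> 'i \<Rightarrow> 'x \<Rightarrow> 'e) \<Rightarrow>
    ('x, 'i \<Rightarrow> 'x \<Rightarrow> complex) cochain set" where
  "beta_class G \<sigma> X P T gh =
     cech_class (D_topology (base P)) (twisted_coeff G \<sigma> P T U1_group (U1_act X)) (idx T) (cov T) 2
       (\<lambda>is. let i = is ! 0; j = is ! 1; k = is ! 2 in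
          family_on (idx T) (cov T) (cov T i \<inter> cov T j \<inter> cov T k)
            (\<lambda>l x. U1_act X (eps_coc G \<sigma> P T l i x) (lift_coc X (eps_coc G \<sigma> P T) gh i j k x)))"

definition DD_class :: "'g diff_group \<Rightarrow> (int \<Rightarrow> 'g \<Rightarrow> 'g) \<Rightarrow> ('g, 'e) ext \<Rightarrow>
    ('p, 'x, 'g \<times> int) gbundle \<Rightarrow> ('i, 'x, 'p, 'g \<times> int) trivs \<Rightarrow> ('i \<Rightarrow> 'i \<Rightarrow> 'x \<Rightarrow> 'e) \<Rightarrow>
    ('x, 'i \<Rightarrow> 'x \<Rightarrow> real) cochain set" where
  "DD_class G \<sigma> X P T gh =
     connecting (D_topology (base P))
       (twisted_coeff G \<sigma> P T Z_group (R_act X))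
       (twisted_coeff G \<sigma> P T R_group (R_act X))
       (twisted_coeff G \<sigma> P T U1_group (U1_act X))
       (\<lambda>W m. m)
       (\<lambda>W m. family_on (idx T) (cov T) W (\<lambda>i x. exp_U1 (m i x)))
       2 (beta_class G \<sigma> X P T gh)"

definition tau :: "'g diff_group \<Rightarrow> (int \<Rightarrow> 'g \<Rightarrow> 'g) \<Rightarrow> ('g, 'e) ext \<Rightarrow>
    ('p, 'x, 'g \<times> int) gbundle \<Rightarrow> ('i, 'x, 'p, 'g \<times> int) trivs \<Rightarrow> ('i \<Rightarrow> 'i \<Rightarrow> 'x \<Rightarrow> 'e) \<Rightarrow>
    ('x, 'x \<Rightarrow> int) cochain set \<times> ('x, 'i \<Rightarrow> 'x \<Rightarrow> real) cochain set" where
  "tau G \<sigma> X P T gh = (alpha_class G \<sigma> P T, DD_class G \<sigma> X P T gh)"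


section \<open>Pullback of the characteristic classes\<close>

text \<open>
  Below, \<open>P\<close> is a bundle with trivializations \<open>T\<close>, \<open>E\<close> a bundle with trivializations \<open>T'\<close>,
  \<open>f : base P \<rightarrow> base E\<close>, and \<open>\<Psi> : P \<rightarrow> f\<^sup>*E\<close> an isomorphism.
\<close>

definition preim :: "'x diff_space \<Rightarrow> ('x \<Rightarrow> 'y) \<Rightarrow> 'y set \<Rightarrow> 'x set" where
  "preim X f V = {x \<in> points X. f x \<in> V}"

definition pull_alpha :: "'x diff_space \<Rightarrow> ('x \<Rightarrow> 'y) \<Rightarrow> ('y, 'y \<Rightarrow> int) cochain set \<Rightarrow>
    ('x, 'x \<Rightarrow> int) cochain set" where
  "pull_alpha X f = pull_class (D_topology X) (smooth_sheaf X Z2_group) 1 f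
     (\<lambda>V s. \<lambda>x\<in>preim X f V. s (f x))"

text \<open>The local system \<open>f\<^sup>*\<int>\<^sub>\<alpha>\<^sub>(\<^sub>E\<^sub>)\<close>, and the pullback \<open>H\<^sup>3(base E; \<int>\<^sub>\<alpha>\<^sub>(\<^sub>E\<^sub>)) \<rightarrow> H\<^sup>3(X; f\<^sup>*\<int>\<^sub>\<alpha>\<^sub>(\<^sub>E\<^sub>))\<close>.\<close>

definition pull_Z_coeff :: "'g diff_group \<Rightarrow> (int \<Rightarrow> 'g \<Rightarrow> 'g) \<Rightarrow> ('g, 'e) ext \<Rightarrow>
    'x diff_space \<Rightarrow> ('x \<Rightarrow> 'y) \<Rightarrow> ('q, 'y, 'g \<times> int) gbundle \<Rightarrow> ('j, 'y, 'q, 'g \<times> int) trivs \<Rightarrow>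
    ('x, 'j \<Rightarrow> 'x \<Rightarrow> real) presheaf" where
  "pull_Z_coeff G \<sigma> Ext X f E T' =
     twisted_sheaf X Z_group (R_act Ext) (idx T') (\<lambda>j. preim X f (cov T' j))
       (\<lambda>j k x. eps_coc G \<sigma> E T' j k (f x))"

definition pull_DD :: "'g diff_group \<Rightarrow> (int \<Rightarrow> 'g \<Rightarrow> 'g) \<Rightarrow> ('g, 'e) ext \<Rightarrow>
    'x diff_space \<Rightarrow> ('x \<Rightarrow> 'y) \<Rightarrow> ('q, 'y, 'g \<times> int) gbundle \<Rightarrow> ('j, 'y, 'q, 'g \<times> int) trivs \<Rightarrow>
    ('y, 'j \<Rightarrow> 'y \<Rightarrow> real) cochain set \<Rightarrow> ('x, 'j \<Rightarrow> 'x \<Rightarrow> real) cochain set" where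
  "pull_DD G \<sigma> Ext X f E T' = pull_class (D_topology X) (pull_Z_coeff G \<sigma> Ext X f E T') 3 f
     (\<lambda>V m. family_on (idx T') (\<lambda>j. preim X f (cov T' j)) (preim X f V) (\<lambda>j x. m j (f x)))"

text \<open>
  The identification \<open>f\<^sup>*\<int>\<^sub>\<alpha>\<^sub>(\<^sub>E\<^sub>) \<cong> \<int>\<^sub>\<alpha>\<^sub>(\<^sub>P\<^sub>)\<close> induced by \<open>\<Psi>\<close>: under \<open>\<Psi>\<close> the local sections are related by
  \<open>s\<^sub>i = k\<^sub>i\<^sub>j \<cdot> t\<^sub>j\<close> with \<open>k\<^sub>i\<^sub>j = \<eta>\<^sub>i(p)\<^sup>-\<^sup>1 \<eta>'\<^sub>j(\<Psi> p)\<close>, so the \<open>j\<close>-component \<open>m\<^sub>j\<close> of a section becomes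
  \<open>m\<^sub>i = \<delta>\<^sub>i\<^sub>j m\<^sub>j\<close> with \<open>\<delta>\<^sub>i\<^sub>j\<close> the \<open>\<int>\<^sub>2\<close>-part of \<open>k\<^sub>i\<^sub>j\<close>; this depends neither on \<open>j\<close> nor on the point \<open>p\<close> of
  the fibre.
\<close>

definition ident_Z :: "'g diff_group \<Rightarrow> (int \<Rightarrow> 'g \<Rightarrow> 'g) \<Rightarrow> ('g, 'e) ext \<Rightarrow>
    ('p, 'x, 'g \<times> int) gbundle \<Rightarrow> ('i, 'x, 'p, 'g \<times> int) trivs \<Rightarrow>
    ('x \<Rightarrow> 'y) \<Rightarrow> ('j, 'y, 'q, 'g \<times> int) trivs \<Rightarrow> ('p \<Rightarrow> 'x \<times> 'q) \<Rightarrow>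
    'x set \<Rightarrow> ('j \<Rightarrow> 'x \<Rightarrow> real) \<Rightarrow> 'i \<Rightarrow> 'x \<Rightarrow> real" where
  "ident_Z G \<sigma> Ext P T f T' \<Psi> W m = family_on (idx T) (cov T) W (\<lambda>i x.
     let p = fibre_point P x;
         j = (SOME j. j \<in> idx T' \<and> f x \<in> cov T' j);
         k = inv\<^bsub>H_group G \<sigma>\<^esub> (chart T i p) \<otimes>\<^bsub>H_group G \<sigma>\<^esub> chart T' j (snd (\<Psi> p))
     in R_act Ext (snd k) (m j x))"

definition pull_tau :: "'g diff_group \<Rightarrow> (int \<Rightarrow> 'g \<Rightarrow> 'g) \<Rightarrow> ('g, 'e) ext \<Rightarrow>
    ('p, 'x, 'g \<times> int) gbundle \<Rightarrow> ('i, 'x, 'p, 'g \<times> int) trivs \<Rightarrow> ('x \<Rightarrow> 'y) \<Rightarrow>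
    ('q, 'y, 'g \<times> int) gbundle \<Rightarrow> ('j, 'y, 'q, 'g \<times> int) trivs \<Rightarrow> ('p \<Rightarrow> 'x \<times> 'q) \<Rightarrow>
    ('y, 'y \<Rightarrow> int) cochain set \<times> ('y, 'j \<Rightarrow> 'y \<Rightarrow> real) cochain set \<Rightarrow>
    ('x, 'x \<Rightarrow> int) cochain set \<times> ('x, 'i \<Rightarrow> 'x \<Rightarrow> real) cochain set" where
  "pull_tau G \<sigma> Ext P T f E T' \<Psi> = (\<lambda>(\<xi>, \<zeta>).
     (pull_alpha (base P) f \<xi>,
      map_class (D_topology (base P)) (twisted_coeff G \<sigma> P T Z_group (R_act Ext)) 3
        (ident_Z G \<sigma> Ext P T f T' \<Psi>) (pull_DD G \<sigma> Ext (base P) f E T' \<zeta>)))"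

end

theory Submission
  imports Defs
begin

text \<open>
  Comparing each local trivialization \<open>\<eta>\<^sub>i\<close> of \<open>P\<close> with each local trivialization \<open>\<eta>'\<^sub>j\<close> of the
  universal bundle by means of the isomorphism of \<open>P\<close> with \<open>f\<^sup>*E\<close> yields smooth functions
  \<open>k\<^sub>i\<^sub>j = \<eta>\<^sub>i\<^sup>-\<^sup>1 \<eta>'\<^sub>j\<close> with values in \<open>H\<^sub>\<sigma>\<close>, for which \<open>h\<^sub>i\<^sub>i\<^sub>' k\<^sub>i\<^sub>'\<^sub>j = k\<^sub>i\<^sub>j\<close> and \<open>k\<^sub>i\<^sub>j f\<^sup>*h'\<^sub>j\<^sub>j\<^sub>' = k\<^sub>i\<^sub>j\<^sub>'\<close>
  (locale \<open>comparison\<close>, \<open>comparison_bundles\<close>). They make the transition functions of the two bundles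
  cohomologous, and all three invariants are compared through them.

  For \<open>\<alpha>\<close>, the \<open>\<int>\<^sub>2\<close>-components \<open>\<delta>\<^sub>i\<^sub>j\<close> of the \<open>k\<^sub>i\<^sub>j\<close> are a cochain whose coboundary is the quotient of
  the two cocycles (\<open>alpha_natural\<close>). Acting by \<open>\<delta>\<close> also identifies the pulled back local systems
  with those of \<open>P\<close>.

  For \<open>\<beta>\<close>, the \<open>G\<close>-components of the \<open>k\<^sub>i\<^sub>j\<close> lift to the central extension, not over a whole set of the
  cover but near every point, which is enough because a cochain assigns germs to points. With
  lifts \<open>\<kappa>\<close> the two sides of \<open>k\<^sub>0 h'\<^sub>0\<^sub>1 = h\<^sub>0\<^sub>1 k\<^sub>1\<close> differ by a function \<open>b\<^sub>0\<^sub>1\<close> with values in \<open>U(1)\<close>;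
  evaluating \<open>k\<^sub>0 h'\<^sub>0\<^sub>1 h'\<^sub>1\<^sub>2\<close> in two ways shows that the coboundary of \<open>b\<close> is the quotient of the two
  cocycles (\<open>defect_comparison\<close>, \<open>beta_comparison\<close>).

  For the Dixmier-Douady class it remains that the connecting morphism is natural. A smooth
  involutive automorphism of \<open>U(1)\<close> acts on its Lie algebra \<open>\<real>\<close> by a sign, so it lifts to \<open>\<real>\<close> and
  preserves \<open>\<int>\<close> (\<open>exp_R_act\<close>, \<open>R_act_Ints\<close>), and smooth functions to \<open>U(1)\<close> have local logarithms (\<open>smooth_on_log\<close>). Hence the
  exponential sequences are short exact on germs, the connecting morphism yields one full cohomology
  class (\<open>connecting_eq_coho_class\<close>), and a common representative of both sides decides the equality
  (\<open>DD_natural\<close>).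

  The cohomological part is reduced to pointwise algebra. Choosing for each point an index of the
  cover, its frame, turns a section of a twisted sheaf into a function with values in the coefficient
  group, and a cochain of degree \<open>n\<close> into a function of \<open>x\<^sub>0, \<dots>, x\<^sub>n, y\<close>, where \<open>y\<close> ranges over the
  domain of the germ at \<open>x\<^sub>n\<close> (\<open>hat\<close>). Quantifying over all \<open>x\<^sub>0\<close>, all \<open>x\<^sub>1\<close> near \<open>x\<^sub>0\<close> and so on is a
  filter on lists of points (\<open>near_filter\<close>); equality of cochains becomes eventual equality of
  functions, and the coboundary an alternating product in an abelian group (\<open>cochain_eq_iff\<close>,
  \<open>hat_coboundary\<close>, \<open>coho_class_iff\<close>).
\<close>


section \<open>Points near each other\<close>

text \<open>
  The iterated quantifier over nearby points as a filter, so that several statements about nearby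
  points can be combined.
\<close>

definition near_filter :: "'x topology \<Rightarrow> nat \<Rightarrow> 'x list filter" where
  "near_filter T n = Abs_filter (all_near T n)"

lemma near_mono: "near T n P xs \<Longrightarrow> (\<And>ys. P ys \<Longrightarrow> Q ys) \<Longrightarrow> near T n Q xs"
  by (induction n arbitrary: xs) (auto elim!: eventually_mono)

lemma near_conj: "near T n P xs \<Longrightarrow> near T n Q xs \<Longrightarrow> near T n (\<lambda>ys. P ys \<and> Q ys) xs"
  by (induction n arbitrary: xs) (auto elim: eventually_elim2)

lemma near_True: "near T n (\<lambda>_. True) xs"
  by (induction n arbitrary: xs) auto

lemma eventually_near_filter: "eventually Q (near_filter T n) \<longleftrightarrow> all_near T n Q"
  unfolding near_filter_def
proof (rule eventually_Abs_filter)
  show "is_filter (all_near T n)"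
  proof
    show "all_near T n (\<lambda>_. True)"
      by (simp add: all_near_def near_True)
    show "all_near T n (\<lambda>xs. P xs \<and> Q xs)" if "all_near T n P" "all_near T n Q" for P Q
      using that by (simp add: all_near_def near_conj)
    show "all_near T n Q" if "\<forall>xs. P xs \<longrightarrow> Q xs" "all_near T n P" for P Q
      using that unfolding all_near_def by (metis near_mono)
  qed
qed

lemma eventually_near_filter_0:
  "eventually Q (near_filter T 0) \<longleftrightarrow> (\<forall>x\<in>topspace T. Q [x])"
  by (simp add: eventually_near_filter all_near_def)

text \<open>
  By definition the quantifier peels off the first point. The germs of a cochain live at the last
  point, so inductions on the degree have to peel off the last one.
\<close>

lemma near_Suc_append:
  "near T (Suc n) R xs \<longleftrightarrow> near T n (\<lambda>xs. \<forall>\<^sub>F y in nhdsin T (last xs). R (xs @ [y])) xs"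
proof (induction n arbitrary: xs)
  case (Suc n)
  have "near T (Suc (Suc n)) R xs \<longleftrightarrow> (\<forall>\<^sub>F y in nhdsin T (last xs). near T (Suc n) R (xs @ [y]))"
    by simp
  then show ?case
    unfolding Suc.IH by simp
qed simp

lemma eventually_near_filter_Suc:
  "eventually R (near_filter T (Suc n)) \<longleftrightarrow>
     (\<forall>\<^sub>F xs in near_filter T n. \<forall>\<^sub>F y in nhdsin T (last xs). R (xs @ [y]))"
  unfolding eventually_near_filter all_near_def near_Suc_append ..

lemma near_filter_length: "\<forall>\<^sub>F xs in near_filter T n. length xs = Suc n"
  by (induction n) (auto simp: eventually_near_filter_0 eventually_near_filter_Suc
      intro: eventually_mono)

lemma eventually_nhdsin_topspace: "\<forall>\<^sub>F y in nhdsin T x. y \<in> topspace T"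
  by (metis eventually_nhdsin openin_topspace)

lemma near_filter_topspace: "\<forall>\<^sub>F xs in near_filter T n. set xs \<subseteq> topspace T"
proof (induction n)
  case (Suc n)
  then show ?case
    unfolding eventually_near_filter_Suc
    by (auto elim!: eventually_mono intro: eventually_mono[OF eventually_nhdsin_topspace])
qed (simp add: eventually_near_filter_0)

lemma near_filter_nonempty: "\<forall>\<^sub>F xs in near_filter T n. xs \<noteq> []"
  by (rule eventually_mono[OF near_filter_length]) auto

lemma near_filter_last: "\<forall>\<^sub>F xs in near_filter T n. last xs \<in> topspace T"
  using near_filter_topspace near_filter_nonempty
  by eventually_elim auto

lemma eventually_nhdsin_nhdsin:
  assumes "eventually P (nhdsin T x)"
  shows "\<forall>\<^sub>F y in nhdsin T x. eventually P (nhdsin T y)"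
  using assms unfolding eventually_nhdsin by meson

lemma near_filter_butlast:
  assumes "eventually Q (near_filter T n)"
  shows "\<forall>\<^sub>F zs in near_filter T (Suc n). Q (butlast zs)"
  unfolding eventually_near_filter_Suc using assms by eventually_elim simp

lemma last_omit: "k < length xs - 1 \<Longrightarrow> last (omit k xs) = last xs"
  unfolding omit_def by (cases xs rule: rev_cases) auto

lemma omit_append: "k < length xs \<Longrightarrow> omit k (xs @ [y]) = omit k xs @ [y]"
  unfolding omit_def by auto

lemma length_omit: "k < length xs \<Longrightarrow> length (omit k xs) = length xs - 1"
  unfolding omit_def by auto

lemma map_omit: "map f (omit k xs) = omit k (map f xs)"
  unfolding omit_def by (simp add: take_map drop_map)

text \<open>
  Leaving out \<open>x\<^sub>k\<close> is harmless because a neighbourhood of \<open>x\<^sub>k\<^sub>-\<^sub>1\<close> is also a neighbourhood of all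
  \<open>x\<^sub>k\<close> that are near \<open>x\<^sub>k\<^sub>-\<^sub>1\<close>.
\<close>

lemma near_filter_omit:
  assumes "eventually Q (near_filter T n)" "k \<le> Suc n"
  shows "\<forall>\<^sub>F xs in near_filter T (Suc n). Q (omit k xs)"
  using assms
proof (induction n arbitrary: Q k)
  case 0
  have Q: "\<forall>x\<in>topspace T. Q [x]"
    using "0.prems"(1) by (simp add: eventually_near_filter_0)
  have "k = 0 \<or> k = 1"
    using "0.prems"(2) by auto
  then show ?case
    using Q by (auto simp: eventually_near_filter_Suc eventually_near_filter_0 omit_def
        intro: eventually_mono[OF eventually_nhdsin_topspace])
next
  case (Suc n)
  consider "k = Suc (Suc n)" | "k = Suc n" | "k \<le> n"
    using Suc.prems(2) by linarith
  then show ?case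
  proof cases
    case 1
    have "\<forall>\<^sub>F xs in near_filter T (Suc (Suc n)). Q (butlast xs)"
      by (rule near_filter_butlast[OF Suc.prems(1)])
    with near_filter_length show ?thesis
      by eventually_elim (simp add: omit_def 1 butlast_conv_take)
  next
    case 2
    let ?R = "\<lambda>xs. \<forall>\<^sub>F y in nhdsin T (last xs). Q (xs @ [y])"
    \<comment> \<open>Of \<open>x\<^sub>n, y, z\<close> the middle point is left out: \<open>z\<close>, being near \<open>y\<close>, is near \<open>x\<^sub>n\<close>.\<close>
    have "\<forall>\<^sub>F xs in near_filter T n. ?R xs"
      using Suc.prems(1) unfolding eventually_near_filter_Suc .
    with near_filter_length
    have "\<forall>\<^sub>F xs in near_filter T n. length xs = Suc n \<and>
       (\<forall>\<^sub>F y in nhdsin T (last xs). \<forall>\<^sub>F z in nhdsin T y. Q (xs @ [z]))"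
      by eventually_elim (auto intro: eventually_nhdsin_nhdsin)
    then show ?thesis
      unfolding eventually_near_filter_Suc
      by eventually_elim (auto elim!: eventually_mono simp: 2 omit_def)
  next
    case 3
    let ?R = "\<lambda>xs. \<forall>\<^sub>F y in nhdsin T (last xs). Q (xs @ [y])"
    have "\<forall>\<^sub>F xs in near_filter T (Suc n). ?R (omit k xs)"
      by (rule Suc.IH) (use Suc.prems(1) 3 in \<open>auto simp: eventually_near_filter_Suc\<close>)
    with near_filter_length
    show ?thesis
      unfolding eventually_near_filter_Suc[of _ _ "Suc n"]
      by eventually_elim (use 3 in \<open>simp add: last_omit omit_append\<close>)
  qed
qed

lemma eventually_nhdsin_continuous:
  assumes "continuous_map T T' f" "x \<in> topspace T" "eventually P (nhdsin T' (f x))"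
  shows "\<forall>\<^sub>F y in nhdsin T x. P (f y)"
proof -
  have "f x \<in> topspace T'"
    using assms(1,2) by (meson continuous_map_image_subset_topspace image_subset_iff)
  then obtain S where "openin T' S" "f x \<in> S" "\<forall>y\<in>S. P y"
    using assms(3) unfolding eventually_nhdsin by auto
  then have "openin T {y\<in>topspace T. f y \<in> S} \<and> x \<in> {y\<in>topspace T. f y \<in> S} \<and>
      (\<forall>y\<in>{y\<in>topspace T. f y \<in> S}. P (f y))"
    using assms(1,2) by (auto simp: continuous_map_def)
  then show ?thesis
    unfolding eventually_nhdsin by blast
qed

lemma near_filter_map:
  assumes f: "continuous_map T T' f" and Q: "eventually Q (near_filter T' n)"
  shows "\<forall>\<^sub>F xs in near_filter T n. Q (map f xs)"
  using Q
proof (induction n arbitrary: Q)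
  case 0
  then show ?case
    using f by (auto simp: eventually_near_filter_0 dest: continuous_map_image_subset_topspace)
next
  case (Suc n)
  have "\<forall>\<^sub>F xs in near_filter T n. \<forall>\<^sub>F y in nhdsin T' (last (map f xs)). Q (map f xs @ [y])"
    by (rule Suc.IH) (use Suc.prems in \<open>simp add: eventually_near_filter_Suc\<close>)
  with near_filter_last near_filter_nonempty
  show ?case
    unfolding eventually_near_filter_Suc
    by eventually_elim (auto simp: last_map intro: eventually_nhdsin_continuous[OF f])
qed

text \<open>
  If a choice made at \<open>x\<close>, such as an index of a cover or a local lift, is valid on \<open>N x\<close>, then the
  choices made at all points of a list are valid at its last point.
\<close>

lemma near_filter_neighbourhoods:
  assumes "\<And>x. x \<in> topspace T \<Longrightarrow> openin T (N x) \<and> x \<in> N x"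
  shows "\<forall>\<^sub>F xs in near_filter T n. \<forall>x\<in>set xs. last xs \<in> N x"
proof (induction n)
  case 0
  then show ?case
    using assms by (simp add: eventually_near_filter_0)
next
  case (Suc n)
  from Suc near_filter_topspace
  show ?case
    unfolding eventually_near_filter_Suc
  proof eventually_elim
    case (elim xs)
    have "\<forall>x\<in>set xs. \<forall>\<^sub>F y in nhdsin T (last xs). y \<in> N x"
      using elim assms by (auto simp: eventually_nhdsin)
    then have "\<forall>\<^sub>F y in nhdsin T (last xs). \<forall>x\<in>set xs. y \<in> N x"
      by (simp add: eventually_ball_finite)
    with eventually_nhdsin_topspace show ?case
      by eventually_elim (use assms in auto)
  qed
qed


section \<open>Sheaves of group-valued functions\<close>

text \<open>
  The coboundary on functions of points. The last entry of \<open>zs\<close> is the point of evaluation \<open>y\<close>, which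
  is never left out; hence the bound \<open>length zs - 1\<close>.
\<close>

definition vdiff :: "('a, 'm) monoid_scheme \<Rightarrow> ('x list \<Rightarrow> 'a) \<Rightarrow> 'x list \<Rightarrow> 'a" where
  "vdiff A u zs = (\<Otimes>\<^bsub>A\<^esub>k\<in>{..<length zs - 1}.
     if even k then u (omit k zs) else inv\<^bsub>A\<^esub> (u (omit k zs)))"

text \<open>The germ \<open>c [x\<^sub>0, \<dots>, x\<^sub>n]\<close> is evaluated at \<open>y\<close>, for the list \<open>[x\<^sub>0, \<dots>, x\<^sub>n, y]\<close>.\<close>

definition hat :: "('s \<Rightarrow> 'x \<Rightarrow> 'a) \<Rightarrow> ('x, 's) cochain \<Rightarrow> 'x list \<Rightarrow> 'a" where
  "hat val c zs = val (snd (c (butlast zs))) (last zs)"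

lemma hat_append [simp]: "hat val c (xs @ [y]) = val (snd (c xs)) y"
  by (simp add: hat_def)

text \<open>
  Those functions of points that are of the form \<open>hat val c\<close> for a cochain \<open>c\<close>, up to eventual equality
  (\<open>good_hat\<close> and \<open>realize_cochain\<close>).
\<close>

definition good :: "'x topology \<Rightarrow> ('x set \<Rightarrow> ('x \<Rightarrow> 'a) \<Rightarrow> bool) \<Rightarrow> nat \<Rightarrow> ('x list \<Rightarrow> 'a) \<Rightarrow> bool" where
  "good T S n u \<longleftrightarrow> (\<forall>\<^sub>F xs in near_filter T n.
     \<exists>W. openin T W \<and> last xs \<in> W \<and> S W (\<lambda>y. u (xs @ [y])))"

lemma is_germ_iff:
  "is_germ T F x c \<longleftrightarrow> openin T (fst c) \<and> x \<in> fst c \<and> snd c \<in> carrier (sections F (fst c))"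
  by (cases c) (simp add: is_germ_def)

text \<open>
  A sheaf whose sections are determined by their values in a fixed group \<open>A\<close>; the predicate \<open>S V\<close>
  singles out the functions of values of sections over \<open>V\<close>. For twisted coefficients the values
  depend on a choice of frames, so \<open>S\<close> is not just smoothness.
\<close>

locale fpresheaf = comm_group A for A :: "('a, 'm) monoid_scheme" (structure) +
  fixes T :: "'x topology" and F :: "('x, 's) presheaf"
    and val :: "'s \<Rightarrow> 'x \<Rightarrow> 'a" and S :: "'x set \<Rightarrow> ('x \<Rightarrow> 'a) \<Rightarrow> bool"
  assumes val_S: "\<And>V s. openin T V \<Longrightarrow> s \<in> carrier (sections F V) \<Longrightarrow> S V (val s)"
    and realize: "\<And>V g. openin T V \<Longrightarrow> S V g \<Longrightarrow>
      \<exists>s\<in>carrier (sections F V). \<forall>y\<in>V. val s y = g y"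
    and val_inject: "\<And>V s t. openin T V \<Longrightarrow> s \<in> carrier (sections F V) \<Longrightarrow>
      t \<in> carrier (sections F V) \<Longrightarrow> (\<And>y. y \<in> V \<Longrightarrow> val s y = val t y) \<Longrightarrow> s = t"
    and res_closed: "\<And>V W s. openin T V \<Longrightarrow> openin T W \<Longrightarrow> W \<subseteq> V \<Longrightarrow>
      s \<in> carrier (sections F V) \<Longrightarrow> res F V W s \<in> carrier (sections F W)"
    and val_res: "\<And>V W s y. openin T V \<Longrightarrow> openin T W \<Longrightarrow> W \<subseteq> V \<Longrightarrow>
      s \<in> carrier (sections F V) \<Longrightarrow> y \<in> W \<Longrightarrow> val (res F V W s) y = val s y"
    and S_carrier: "\<And>V g y. openin T V \<Longrightarrow> S V g \<Longrightarrow> y \<in> V \<Longrightarrow> g y \<in> carrier A"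
    and S_cong: "\<And>V g g'. openin T V \<Longrightarrow> S V g \<Longrightarrow> (\<And>y. y \<in> V \<Longrightarrow> g y = g' y) \<Longrightarrow> S V g'"
    and S_inv: "\<And>V g. openin T V \<Longrightarrow> S V g \<Longrightarrow> S V (\<lambda>y. inv g y)"
    and mult_closed: "\<And>V s t. openin T V \<Longrightarrow> s \<in> carrier (sections F V) \<Longrightarrow>
      t \<in> carrier (sections F V) \<Longrightarrow> s \<otimes>\<^bsub>sections F V\<^esub> t \<in> carrier (sections F V)"
    and val_mult: "\<And>V s t y. openin T V \<Longrightarrow> s \<in> carrier (sections F V) \<Longrightarrow>
      t \<in> carrier (sections F V) \<Longrightarrow> y \<in> V \<Longrightarrow> val (s \<otimes>\<^bsub>sections F V\<^esub> t) y = val s y \<otimes> val t y"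
    and one_section: "\<And>V. openin T V \<Longrightarrow> \<one>\<^bsub>sections F V\<^esub> \<in> carrier (sections F V)"
    and val_one: "\<And>V y. openin T V \<Longrightarrow> y \<in> V \<Longrightarrow> val \<one>\<^bsub>sections F V\<^esub> y = \<one>"
begin

lemma val_carrier: "openin T V \<Longrightarrow> s \<in> carrier (sections F V) \<Longrightarrow> y \<in> V \<Longrightarrow> val s y \<in> carrier A"
  using S_carrier val_S by blast

lemma S_restrict:
  assumes "openin T V" "openin T W" "W \<subseteq> V" "S V g"
  shows "S W g"
proof -
  obtain s where "s \<in> carrier (sections F V)" "\<forall>y\<in>V. val s y = g y"
    using realize assms by blast
  then show ?thesis
    using val_S[OF assms(2) res_closed[OF assms(1-3)]] val_res[OF assms(1-3)] S_cong assms(2,3)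
    by (metis subsetD)
qed

lemma sections_comm_group:
  assumes V: "openin T V"
  shows "comm_group (sections F V)"
proof (rule comm_groupI)
  fix s assume s: "s \<in> carrier (sections F V)"
  then obtain t where t: "t \<in> carrier (sections F V)" "\<forall>y\<in>V. val t y = inv (val s y)"
    using realize[OF V S_inv[OF V val_S[OF V s]]] by blast
  have "t \<otimes>\<^bsub>sections F V\<^esub> s = \<one>\<^bsub>sections F V\<^esub>"
    by (rule val_inject[OF V])
      (use s t V in \<open>auto simp: mult_closed one_section val_mult val_one val_carrier\<close>)
  then show "\<exists>t\<in>carrier (sections F V). t \<otimes>\<^bsub>sections F V\<^esub> s = \<one>\<^bsub>sections F V\<^esub>"
    using t by blast
next
  fix s t u assume "s \<in> carrier (sections F V)" "t \<in> carrier (sections F V)" "u \<in> carrier (sections F V)"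
  then show "s \<otimes>\<^bsub>sections F V\<^esub> t \<otimes>\<^bsub>sections F V\<^esub> u = s \<otimes>\<^bsub>sections F V\<^esub> (t \<otimes>\<^bsub>sections F V\<^esub> u)"
    using V by (intro val_inject[OF V]) (auto simp: mult_closed val_mult val_carrier m_assoc)
next
  fix s t assume "s \<in> carrier (sections F V)" "t \<in> carrier (sections F V)"
  then show "s \<otimes>\<^bsub>sections F V\<^esub> t = t \<otimes>\<^bsub>sections F V\<^esub> s"
    using V by (intro val_inject[OF V]) (auto simp: mult_closed val_mult val_carrier m_comm)
next
  fix s assume "s \<in> carrier (sections F V)"
  then show "\<one>\<^bsub>sections F V\<^esub> \<otimes>\<^bsub>sections F V\<^esub> s = s"
    using V by (intro val_inject[OF V]) (auto simp: mult_closed one_section val_mult val_one val_carrier)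
qed (use V in \<open>auto simp: mult_closed one_section\<close>)

lemma val_inv:
  assumes V: "openin T V" and s: "s \<in> carrier (sections F V)" and y: "y \<in> V"
  shows "val (inv\<^bsub>sections F V\<^esub> s) y = inv (val s y)"
proof -
  interpret V: comm_group "sections F V" by (rule sections_comm_group[OF V])
  have "val (inv\<^bsub>sections F V\<^esub> s) y \<otimes> val s y = \<one>"
    using V s y by (simp flip: val_mult add: val_one)
  then show ?thesis
    using inv_equality V s y val_carrier by (metis V.inv_closed)
qed

lemma val_finprod:
  assumes V: "openin T V" and s: "\<And>k. k \<in> K \<Longrightarrow> s k \<in> carrier (sections F V)" and y: "y \<in> V"
  shows "val (finprod (sections F V) s K) y = (\<Otimes>k\<in>K. val (s k) y)"
proof -
  interpret V: comm_group "sections F V" by (rule sections_comm_group[OF V])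
  show ?thesis
    using s
  proof (induction K rule: infinite_finite_induct)
    case (insert k K)
    then have "s \<in> K \<rightarrow> carrier (sections F V)" by auto
    with insert V y show ?case
      by (auto simp: val_mult val_carrier finprod_insert Pi_iff V.finprod_closed)
  qed (use V y in \<open>auto simp: val_one\<close>)
qed

lemma germ_eq_iff:
  assumes "is_germ T F x (V, s)" "is_germ T F x (V', s')"
  shows "germ_eq T F x (V, s) (V', s') \<longleftrightarrow> (\<forall>\<^sub>F y in nhdsin T x. val s y = val s' y)"
proof
  assume "germ_eq T F x (V, s) (V', s')"
  then obtain W where W: "openin T W" "x \<in> W" "W \<subseteq> V \<inter> V'" "res F V W s = res F V' W s'"
    unfolding germ_eq_def by auto
  have "val s y = val s' y" if "y \<in> W" for y
    using assms W that val_res[of V W s y] val_res[of V' W s' y] by (simp add: is_germ_iff)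
  with W(1,2) show "\<forall>\<^sub>F y in nhdsin T x. val s y = val s' y"
    unfolding eventually_nhdsin by blast
next
  assume ev: "\<forall>\<^sub>F y in nhdsin T x. val s y = val s' y"
  have V: "openin T V" "x \<in> V" "s \<in> carrier (sections F V)"
    and V': "openin T V'" "x \<in> V'" "s' \<in> carrier (sections F V')"
    using assms by (auto simp: is_germ_def)
  then have "x \<in> topspace T"
    using openin_subset by blast
  then obtain W where W: "openin T W" "x \<in> W" "\<forall>y\<in>W. val s y = val s' y"
    using ev unfolding eventually_nhdsin by blast
  let ?W = "W \<inter> (V \<inter> V')"
  have o: "openin T ?W"
    using V V' W by auto
  have "res F V ?W s = res F V' ?W s'"
  proof (rule val_inject[OF o])
    fix y assume y: "y \<in> ?W"
    then have "val (res F V ?W s) y = val s y" "val (res F V' ?W s') y = val s' y"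
      using V V' o by (auto intro!: val_res)
    then show "val (res F V ?W s) y = val (res F V' ?W s') y"
      using W y by simp
  qed (use V V' o in \<open>auto intro!: res_closed\<close>)
  then show "germ_eq T F x (V, s) (V', s')"
    unfolding germ_eq_def using o V V' W by auto
qed

lemma cochains_germ: "c \<in> cochains T F n \<Longrightarrow> \<forall>\<^sub>F xs in near_filter T n. is_germ T F (last xs) (c xs)"
  by (simp add: cochains_def eventually_near_filter)

lemma cochainsI: "\<forall>\<^sub>F xs in near_filter T n. is_germ T F (last xs) (c xs) \<Longrightarrow> c \<in> cochains T F n"
  by (simp add: cochains_def eventually_near_filter)

lemma germ_nhd:
  assumes "is_germ T F x (c xs)"
  shows "\<forall>\<^sub>F y in nhdsin T x. is_germ T F y (c xs)"
  using assms unfolding is_germ_iff eventually_nhdsin by blast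

lemma cochain_eq_iff:
  assumes "c \<in> cochains T F n" "c' \<in> cochains T F n"
  shows "cochain_eq T F n c c' \<longleftrightarrow> (\<forall>\<^sub>F zs in near_filter T (Suc n). hat val c zs = hat val c' zs)"
  unfolding cochain_eq_def eventually_near_filter[symmetric] eventually_near_filter_Suc
proof (rule eventually_subst)
  show "\<forall>\<^sub>F xs in near_filter T n. germ_eq T F (last xs) (c xs) (c' xs) =
     (\<forall>\<^sub>F y in nhdsin T (last xs). hat val c (xs @ [y]) = hat val c' (xs @ [y]))"
    using cochains_germ[OF assms(1)] cochains_germ[OF assms(2)]
  proof eventually_elim
    case (elim xs)
    then show ?case
      using germ_eq_iff[of "last xs" "fst (c xs)" "snd (c xs)" "fst (c' xs)" "snd (c' xs)"] by simp
  qed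
qed

lemma good_hat:
  assumes "c \<in> cochains T F n"
  shows "good T S n (hat val c)"
  unfolding good_def using cochains_germ[OF assms]
  by eventually_elim (auto simp: is_germ_iff intro: val_S)

lemma realize_cochain:
  assumes "good T S n u"
  shows "\<exists>c\<in>cochains T F n. \<forall>\<^sub>F zs in near_filter T (Suc n). hat val c zs = u zs"
proof -
  let ?P = "\<lambda>xs Vs. is_germ T F (last xs) Vs \<and> (\<forall>y\<in>fst Vs. val (snd Vs) y = u (xs @ [y]))"
  define c where "c = (\<lambda>xs. SOME Vs. ?P xs Vs)"
  have ev: "\<forall>\<^sub>F xs in near_filter T n. ?P xs (c xs)"
    using assms unfolding good_def
  proof eventually_elim
    case (elim xs)
    then obtain W where W: "openin T W" "last xs \<in> W" "S W (\<lambda>y. u (xs @ [y]))" by blast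
    obtain s where "s \<in> carrier (sections F W)" "\<forall>y\<in>W. val s y = u (xs @ [y])"
      using realize[OF W(1,3)] by blast
    with W have "?P xs (W, s)"
      by (simp add: is_germ_def)
    then show ?case
      unfolding c_def by (rule someI)
  qed
  then have "c \<in> cochains T F n"
    by (intro cochainsI) (auto elim: eventually_mono)
  moreover have "\<forall>\<^sub>F zs in near_filter T (Suc n). hat val c zs = u zs"
    unfolding eventually_near_filter_Suc using ev
    by eventually_elim (auto simp: is_germ_iff eventually_nhdsin)
  ultimately show ?thesis by blast
qed

lemma good_cong:
  assumes "good T S n u" "\<forall>\<^sub>F zs in near_filter T (Suc n). u zs = v zs"
  shows "good T S n v"
  using assms near_filter_last unfolding good_def eventually_near_filter_Suc
proof eventually_elim
  case (elim xs)
  then obtain W where W: "openin T W" "last xs \<in> W" "S W (\<lambda>y. u (xs @ [y]))" by blast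
  obtain W' where W': "openin T W'" "last xs \<in> W'" "\<forall>y\<in>W'. u (xs @ [y]) = v (xs @ [y])"
    using elim unfolding eventually_nhdsin by blast
  have o: "openin T (W \<inter> W')"
    using W W' by blast
  have "S (W \<inter> W') (\<lambda>y. v (xs @ [y]))"
    by (rule S_cong[OF o S_restrict[OF W(1) o _ W(3)]]) (use W' in auto)
  with o W W' show ?case by blast
qed

lemma good_carrier:
  assumes "good T S n u"
  shows "\<forall>\<^sub>F zs in near_filter T (Suc n). u zs \<in> carrier A"
  unfolding eventually_near_filter_Suc using assms[unfolded good_def]
  by eventually_elim (auto simp: eventually_nhdsin intro: S_carrier)

text \<open>For the last coface the germ at the point before \<open>last xs\<close> is used as a germ at \<open>last xs\<close>.\<close>

lemma germs_omit:
  assumes "c \<in> cochains T F n"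
  shows "\<forall>\<^sub>F xs in near_filter T (Suc n). length xs = Suc (Suc n) \<and>
    (\<forall>k<Suc (Suc n). is_germ T F (last xs) (c (omit k xs)))"
proof -
  have "\<forall>\<^sub>F xs in near_filter T (Suc n). \<forall>k\<in>{..Suc n}.
      is_germ T F (last (omit k xs)) (c (omit k xs))"
    by (rule eventually_ball_finite) (auto intro: near_filter_omit[OF cochains_germ[OF assms]])
  moreover have "\<forall>\<^sub>F xs in near_filter T (Suc n). is_germ T F (last xs) (c (butlast xs))"
    unfolding eventually_near_filter_Suc using cochains_germ[OF assms]
    by eventually_elim (use germ_nhd in force)
  ultimately show ?thesis
    using near_filter_length
  proof eventually_elim
    case (elim xs)
    have "is_germ T F (last xs) (c (omit k xs))" if "k < Suc (Suc n)" for k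
    proof (cases "k = Suc n")
      case True
      then have "omit k xs = butlast xs"
        using elim by (simp add: omit_def butlast_conv_take)
      then show ?thesis
        using elim by simp
    next
      case False
      then have "last (omit k xs) = last xs"
        using that elim by (intro last_omit) auto
      then show ?thesis
        using elim that by (metis atMost_iff less_Suc_eq_le)
    qed
    with elim show ?case by simp
  qed
qed

lemma coboundary_hat_aux:
  assumes len: "length xs = Suc (Suc n)"
    and germ: "\<forall>k<Suc (Suc n). is_germ T F (last xs) (c (omit k xs))"
  shows "is_germ T F (last xs) (coboundary F c xs)" (is ?g)
    and "\<forall>y\<in>fst (coboundary F c xs). val (snd (coboundary F c xs)) y = vdiff A (hat val c) (xs @ [y])"
      (is ?v)
proof -
  define W where "W = (\<Inter>k<length xs. fst (c (omit k xs)))"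
  have c: "openin T (fst (c (omit k xs)))" "snd (c (omit k xs)) \<in> carrier (sections F (fst (c (omit k xs))))"
      "W \<subseteq> fst (c (omit k xs))" "last xs \<in> fst (c (omit k xs))" if "k < length xs" for k
    using germ that len by (auto simp: is_germ_iff W_def)
  have "finite {..<length xs}" "{..<length xs} \<noteq> {}"
    using len by auto
  then have o: "openin T W"
    unfolding W_def using c(1) by (intro openin_INT2) auto
  have l: "last xs \<in> W"
    unfolding W_def using c(4) by blast
  interpret W: comm_group "sections F W" by (rule sections_comm_group[OF o])
  define r where "r = (\<lambda>k. res F (fst (c (omit k xs))) W (snd (c (omit k xs))))"
  define t where "t = (\<lambda>k. if even k then r k else inv\<^bsub>sections F W\<^esub> (r k))"
  have r: "r k \<in> carrier (sections F W)" if "k < length xs" for k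
    unfolding r_def using c[OF that] o by (intro res_closed) auto
  then have t: "t k \<in> carrier (sections F W)" if "k < length xs" for k
    using that by (auto simp: t_def)
  have eq: "coboundary F c xs = (W, finprod (sections F W) t {..<length xs})"
    unfolding coboundary_def Let_def W_def[symmetric] t_def r_def
    by (simp add: case_prod_unfold)
  show ?g
    unfolding eq is_germ_def using o l t by (auto intro!: W.finprod_closed)
  show ?v
  proof
    fix y assume "y \<in> fst (coboundary F c xs)"
    then have y: "y \<in> W" by (simp add: eq)
    have vr: "val (r k) y = hat val c (omit k (xs @ [y]))" if "k < length xs" for k
      unfolding r_def using c[OF that] o y that by (simp add: val_res omit_append)
    have vt: "val (t k) y = (if even k then hat val c (omit k (xs @ [y]))
        else inv (hat val c (omit k (xs @ [y]))))" if "k < length xs" for k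
      using that o y by (simp add: t_def vr[symmetric] r val_inv)
    have "val (snd (coboundary F c xs)) y = (\<Otimes>k\<in>{..<length xs}. val (t k) y)"
      unfolding eq snd_conv by (rule val_finprod[OF o _ y]) (use t in auto)
    also have "\<dots> = vdiff A (hat val c) (xs @ [y])"
      unfolding vdiff_def
      by (rule finprod_cong') (use o y t in \<open>auto simp: vt[symmetric] val_carrier\<close>)
    finally show "val (snd (coboundary F c xs)) y = vdiff A (hat val c) (xs @ [y])" .
  qed
qed

lemma coboundary_cochain: "c \<in> cochains T F n \<Longrightarrow> coboundary F c \<in> cochains T F (Suc n)"
  by (rule cochainsI, rule eventually_mono[OF germs_omit]) (auto intro: coboundary_hat_aux(1))

lemma eventually_fst:
  assumes "c \<in> cochains T F n"
    and "\<forall>\<^sub>F xs in near_filter T n. \<forall>y\<in>fst (c xs). P (xs @ [y])"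
  shows "\<forall>\<^sub>F zs in near_filter T (Suc n). P zs"
  unfolding eventually_near_filter_Suc using assms(2) cochains_germ[OF assms(1)]
  by eventually_elim (auto simp: is_germ_iff eventually_nhdsin)

lemma hat_coboundary:
  assumes "c \<in> cochains T F n"
  shows "\<forall>\<^sub>F zs in near_filter T (Suc (Suc n)). hat val (coboundary F c) zs = vdiff A (hat val c) zs"
proof (rule eventually_fst[OF coboundary_cochain[OF assms]])
  show "\<forall>\<^sub>F xs in near_filter T (Suc n). \<forall>y\<in>fst (coboundary F c xs).
      hat val (coboundary F c) (xs @ [y]) = vdiff A (hat val c) (xs @ [y])"
    using germs_omit[OF assms] by eventually_elim (use coboundary_hat_aux(2) in auto)
qed

lemma cochain_mult_aux:
  assumes "c \<in> cochains T F n" "c' \<in> cochains T F n"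
  shows "\<forall>\<^sub>F xs in near_filter T n. is_germ T F (last xs) (cochain_mult F c c' xs) \<and>
    (\<forall>y\<in>fst (cochain_mult F c c' xs).
       val (snd (cochain_mult F c c' xs)) y = val (snd (c xs)) y \<otimes> val (snd (c' xs)) y)"
  using cochains_germ[OF assms(1)] cochains_germ[OF assms(2)]
proof eventually_elim
  case (elim xs)
  obtain V s V' s' where c: "c xs = (V, s)" "c' xs = (V', s')"
    by (meson surj_pair)
  then have V: "openin T V" "last xs \<in> V" "s \<in> carrier (sections F V)"
      "openin T V'" "last xs \<in> V'" "s' \<in> carrier (sections F V')"
    using elim by (auto simp: is_germ_def)
  let ?W = "V \<inter> V'"
  have o: "openin T ?W"
    using V by auto
  have r: "res F V ?W s \<in> carrier (sections F ?W)" "res F V' ?W s' \<in> carrier (sections F ?W)"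
    using V o by (auto intro!: res_closed)
  have "val (res F V ?W s) y = val s y" "val (res F V' ?W s') y = val s' y" if "y \<in> ?W" for y
    using V o that by (auto intro!: val_res)
  then show ?case
    using V o r by (auto simp: c is_germ_def cochain_mult_def Let_def val_mult mult_closed)
qed

lemma cochain_mult_cochain:
  assumes "c \<in> cochains T F n" "c' \<in> cochains T F n"
  shows "cochain_mult F c c' \<in> cochains T F n"
  by (rule cochainsI, rule eventually_mono[OF cochain_mult_aux[OF assms]]) simp

lemma hat_mult:
  assumes "c \<in> cochains T F n" "c' \<in> cochains T F n"
  shows "\<forall>\<^sub>F zs in near_filter T (Suc n).
    hat val (cochain_mult F c c') zs = hat val c zs \<otimes> hat val c' zs"
proof (rule eventually_fst[OF cochain_mult_cochain[OF assms]])
  show "\<forall>\<^sub>F xs in near_filter T n. \<forall>y\<in>fst (cochain_mult F c c' xs).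
      hat val (cochain_mult F c c') (xs @ [y]) = hat val c (xs @ [y]) \<otimes> hat val c' (xs @ [y])"
    using cochain_mult_aux[OF assms] by eventually_elim simp
qed

lemma cochain_one_cochain: "cochain_one T F \<in> cochains T F n"
  by (rule cochainsI, rule eventually_mono[OF near_filter_last])
    (simp add: is_germ_def cochain_one_def one_section)

lemma hat_one: "\<forall>\<^sub>F zs in near_filter T (Suc n). hat val (cochain_one T F) zs = \<one>"
  by (rule eventually_mono[OF near_filter_last]) (simp add: hat_def cochain_one_def val_one)

lemma cocycles_iff:
  "c \<in> cocycles T F n \<longleftrightarrow> c \<in> cochains T F n \<and>
     (\<forall>\<^sub>F zs in near_filter T (Suc (Suc n)). vdiff A (hat val c) zs = \<one>)"
proof (cases "c \<in> cochains T F n")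
  case True
  have "(\<forall>\<^sub>F zs in near_filter T (Suc (Suc n)). hat val (coboundary F c) zs = hat val (cochain_one T F) zs)
    \<longleftrightarrow> (\<forall>\<^sub>F zs in near_filter T (Suc (Suc n)). vdiff A (hat val c) zs = \<one>)"
    by (rule eventually_subst) (use hat_coboundary[OF True] hat_one[of "Suc n"] in eventually_elim, simp)
  then show ?thesis
    using True by (simp add: cocycles_def cochain_eq_iff coboundary_cochain cochain_one_cochain)
qed (simp add: cocycles_def)

text \<open>Products of values outside the carrier are unspecified, hence the condition on \<open>v\<close>.\<close>

lemma vdiff_cong:
  assumes "\<forall>\<^sub>F zs in near_filter T n. u zs = v zs \<and> v zs \<in> carrier A"
  shows "\<forall>\<^sub>F zs in near_filter T (Suc n). vdiff A u zs = vdiff A v zs"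
proof -
  have "\<forall>\<^sub>F zs in near_filter T (Suc n). \<forall>k\<in>{..Suc n}. u (omit k zs) = v (omit k zs) \<and> v (omit k zs) \<in> carrier A"
    by (rule eventually_ball_finite) (auto intro: near_filter_omit[OF assms])
  with near_filter_length show ?thesis
    by eventually_elim (auto simp: vdiff_def intro!: finprod_cong')
qed

lemma vdiff_mult:
  assumes "\<forall>\<^sub>F zs in near_filter T n. u zs \<in> carrier A \<and> v zs \<in> carrier A"
  shows "\<forall>\<^sub>F zs in near_filter T (Suc n). vdiff A (\<lambda>zs. u zs \<otimes> v zs) zs = vdiff A u zs \<otimes> vdiff A v zs"
proof -
  have "\<forall>\<^sub>F zs in near_filter T (Suc n). \<forall>k\<in>{..Suc n}. u (omit k zs) \<in> carrier A \<and> v (omit k zs) \<in> carrier A"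
    by (rule eventually_ball_finite) (auto intro: near_filter_omit[OF assms])
  with near_filter_length show ?thesis
  proof eventually_elim
    case (elim zs)
    let ?e = "\<lambda>u k. if even k then u (omit k zs) else inv (u (omit k zs))"
    have "vdiff A u zs \<otimes> vdiff A v zs = (\<Otimes>k\<in>{..<length zs - 1}. ?e u k \<otimes> ?e v k)"
      unfolding vdiff_def by (rule finprod_multf[symmetric]) (use elim in auto)
    also have "\<dots> = vdiff A (\<lambda>zs. u zs \<otimes> v zs) zs"
      unfolding vdiff_def by (rule finprod_cong') (use elim in \<open>auto simp: inv_mult\<close>)
    finally show ?case ..
  qed
qed

lemma good_vdiff:
  assumes "good T S n u"
  shows "good T S (Suc n) (vdiff A u)"
proof -
  obtain c where c: "c \<in> cochains T F n" "\<forall>\<^sub>F zs in near_filter T (Suc n). hat val c zs = u zs"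
    using realize_cochain[OF assms] by blast
  from c(2) good_carrier[OF assms]
  have "\<forall>\<^sub>F zs in near_filter T (Suc n). hat val c zs = u zs \<and> u zs \<in> carrier A"
    by eventually_elim simp
  from vdiff_cong[OF this] hat_coboundary[OF c(1)]
  have "\<forall>\<^sub>F zs in near_filter T (Suc (Suc n)). hat val (coboundary F c) zs = vdiff A u zs"
    by eventually_elim simp
  with good_hat[OF coboundary_cochain[OF c(1)]] show ?thesis
    by (rule good_cong)
qed

lemma good_one: "good T S n (\<lambda>_. \<one>)"
  using good_hat[OF cochain_one_cochain] hat_one by (rule good_cong)

lemma good_mult:
  assumes "good T S n u" "good T S n v"
  shows "good T S n (\<lambda>zs. u zs \<otimes> v zs)"
proof -
  obtain c where c: "c \<in> cochains T F n" "\<forall>\<^sub>F zs in near_filter T (Suc n). hat val c zs = u zs"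
    using realize_cochain[OF assms(1)] by blast
  obtain d where d: "d \<in> cochains T F n" "\<forall>\<^sub>F zs in near_filter T (Suc n). hat val d zs = v zs"
    using realize_cochain[OF assms(2)] by blast
  show ?thesis
  proof (rule good_cong[OF good_hat[OF cochain_mult_cochain[OF c(1) d(1)]]])
    show "\<forall>\<^sub>F zs in near_filter T (Suc n). hat val (cochain_mult F c d) zs = u zs \<otimes> v zs"
      using hat_mult[OF c(1) d(1)] c(2) d(2) by eventually_elim simp
  qed
qed

lemma good_inv: "good T S n u \<Longrightarrow> good T S n (\<lambda>zs. inv (u zs))"
  unfolding good_def by (erule eventually_mono) (use S_inv in blast)

text \<open>
  The number \<open>n\<close> is the degree of the cochain \<open>w\<close>; the degree of \<open>u\<close> and \<open>v\<close> is \<open>Suc n\<close>. Only classes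
  of positive degree occur.
\<close>

definition cohomologous :: "nat \<Rightarrow> ('x list \<Rightarrow> 'a) \<Rightarrow> ('x list \<Rightarrow> 'a) \<Rightarrow> bool" where
  "cohomologous n u v \<longleftrightarrow>
     (\<exists>w. good T S n w \<and> (\<forall>\<^sub>F zs in near_filter T (Suc (Suc n)). u zs = v zs \<otimes> vdiff A w zs))"

lemma vdiff_one: "vdiff A (\<lambda>_. \<one>) zs = \<one>"
  unfolding vdiff_def by (rule finprod_one_eqI) auto

lemma cohomologous_refl:
  assumes "\<forall>\<^sub>F zs in near_filter T (Suc (Suc n)). u zs = v zs \<and> v zs \<in> carrier A"
  shows "cohomologous n u v"
  unfolding cohomologous_def
  by (rule exI[of _ "\<lambda>_. \<one>"], intro conjI good_one, use assms in eventually_elim) (simp add: vdiff_one)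

lemma cohomologous_trans:
  assumes "cohomologous n u v" "cohomologous n v w" "good T S (Suc n) w"
  shows "cohomologous n u w"
proof -
  obtain a where a: "good T S n a" "\<forall>\<^sub>F zs in near_filter T (Suc (Suc n)). u zs = v zs \<otimes> vdiff A a zs"
    using assms(1) unfolding cohomologous_def by blast
  obtain b where b: "good T S n b" "\<forall>\<^sub>F zs in near_filter T (Suc (Suc n)). v zs = w zs \<otimes> vdiff A b zs"
    using assms(2) unfolding cohomologous_def by blast
  have "\<forall>\<^sub>F zs in near_filter T (Suc n). b zs \<in> carrier A \<and> a zs \<in> carrier A"
    using good_carrier[OF a(1)] good_carrier[OF b(1)] by eventually_elim simp
  from vdiff_mult[OF this] a(2) b(2) good_carrier[OF assms(3)]
    good_carrier[OF good_vdiff[OF a(1)]] good_carrier[OF good_vdiff[OF b(1)]]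
  have "\<forall>\<^sub>F zs in near_filter T (Suc (Suc n)). u zs = w zs \<otimes> vdiff A (\<lambda>zs. b zs \<otimes> a zs) zs"
    by eventually_elim (simp add: m_assoc)
  then show ?thesis
    unfolding cohomologous_def using good_mult[OF b(1) a(1)] by blast
qed

lemma cohomologous_sym:
  assumes "cohomologous n u v" "good T S (Suc n) v"
  shows "cohomologous n v u"
proof -
  obtain a where a: "good T S n a" "\<forall>\<^sub>F zs in near_filter T (Suc (Suc n)). u zs = v zs \<otimes> vdiff A a zs"
    using assms(1) unfolding cohomologous_def by blast
  have "\<forall>\<^sub>F zs in near_filter T (Suc n). a zs \<in> carrier A \<and> inv (a zs) \<in> carrier A"
    using good_carrier[OF a(1)] by eventually_elim simp
  note 1 = vdiff_mult[OF this]
  have "\<forall>\<^sub>F zs in near_filter T (Suc n). a zs \<otimes> inv (a zs) = \<one> \<and> \<one> \<in> carrier A"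
    using good_carrier[OF a(1)] by eventually_elim simp
  note 2 = vdiff_cong[OF this]
  from 1 2 a(2) good_carrier[OF assms(2)]
    good_carrier[OF good_vdiff[OF a(1)]] good_carrier[OF good_vdiff[OF good_inv[OF a(1)]]]
  have "\<forall>\<^sub>F zs in near_filter T (Suc (Suc n)). v zs = u zs \<otimes> vdiff A (\<lambda>zs. inv (a zs)) zs"
    by eventually_elim (simp add: vdiff_one m_assoc)
  then show ?thesis
    unfolding cohomologous_def using good_inv[OF a(1)] by blast
qed

text \<open>Since every good function comes from a cochain, classes can be compared on the level of functions.\<close>

lemma coho_class_iff:
  assumes c: "c \<in> cochains T F (Suc n)"
  shows "c' \<in> coho_class T F (Suc n) c \<longleftrightarrow>
    c' \<in> cocycles T F (Suc n) \<and> cohomologous n (hat val c') (hat val c)"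
proof (cases "c' \<in> cocycles T F (Suc n)")
  case True
  then have c': "c' \<in> cochains T F (Suc n)"
    by (simp add: cocycles_iff)
  have "(\<exists>b\<in>coboundaries T F (Suc n). cochain_eq T F (Suc n) c' (cochain_mult F c b))
      \<longleftrightarrow> cohomologous n (hat val c') (hat val c)"
  proof
    assume "\<exists>b\<in>coboundaries T F (Suc n). cochain_eq T F (Suc n) c' (cochain_mult F c b)"
    then obtain b a where b: "b \<in> cochains T F (Suc n)" "a \<in> cochains T F n"
        "cochain_eq T F (Suc n) b (coboundary F a)" "cochain_eq T F (Suc n) c' (cochain_mult F c b)"
      unfolding coboundaries_def by auto
    have "\<forall>\<^sub>F zs in near_filter T (Suc (Suc n)). hat val c' zs = hat val c zs \<otimes> vdiff A (hat val a) zs"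
      using b(4)[unfolded cochain_eq_iff[OF c' cochain_mult_cochain[OF c b(1)]]]
        b(3)[unfolded cochain_eq_iff[OF b(1) coboundary_cochain[OF b(2)]]]
        hat_mult[OF c b(1)] hat_coboundary[OF b(2)]
      by eventually_elim simp
    then show "cohomologous n (hat val c') (hat val c)"
      unfolding cohomologous_def using good_hat[OF b(2)] by blast
  next
    assume "cohomologous n (hat val c') (hat val c)"
    then obtain w where w: "good T S n w"
        "\<forall>\<^sub>F zs in near_filter T (Suc (Suc n)). hat val c' zs = hat val c zs \<otimes> vdiff A w zs"
      unfolding cohomologous_def by blast
    obtain a where a: "a \<in> cochains T F n" "\<forall>\<^sub>F zs in near_filter T (Suc n). hat val a zs = w zs"
      using realize_cochain[OF w(1)] by blast
    have "\<forall>\<^sub>F zs in near_filter T (Suc n). hat val a zs = w zs \<and> w zs \<in> carrier A"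
      using a(2) good_carrier[OF w(1)] by eventually_elim simp
    note va = vdiff_cong[OF this]
    have d: "coboundary F a \<in> cochains T F (Suc n)"
      by (rule coboundary_cochain[OF a(1)])
    have "coboundary F a \<in> coboundaries T F (Suc n)"
      unfolding coboundaries_def using d a(1) cochain_eq_iff[OF d d] by auto
    moreover have "cochain_eq T F (Suc n) c' (cochain_mult F c (coboundary F a))"
      unfolding cochain_eq_iff[OF c' cochain_mult_cochain[OF c d]]
      using w(2) va hat_mult[OF c d] hat_coboundary[OF a(1)]
      by eventually_elim simp
    ultimately show "\<exists>b\<in>coboundaries T F (Suc n). cochain_eq T F (Suc n) c' (cochain_mult F c b)"
      by blast
  qed
  with True show ?thesis
    by (simp add: coho_class_def)
qed (simp add: coho_class_def)

lemma coho_class_eqI: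
  assumes "c \<in> cochains T F (Suc n)" "d \<in> cochains T F (Suc n)" "cohomologous n (hat val c) (hat val d)"
  shows "coho_class T F (Suc n) c = coho_class T F (Suc n) d"
proof -
  have "cohomologous n u (hat val c) \<longleftrightarrow> cohomologous n u (hat val d)" for u
    using assms(3) cohomologous_sym[OF assms(3) good_hat[OF assms(2)]]
      cohomologous_trans[OF _ _ good_hat[OF assms(1)]] cohomologous_trans[OF _ _ good_hat[OF assms(2)]]
    by blast
  then show ?thesis
    using assms(1,2) by (auto simp: coho_class_iff)
qed

lemma coho_class_self: "c \<in> cocycles T F (Suc n) \<Longrightarrow> c \<in> coho_class T F (Suc n) c"
proof -
  assume c: "c \<in> cocycles T F (Suc n)"
  then have c': "c \<in> cochains T F (Suc n)"
    by (simp add: cocycles_iff)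
  show ?thesis
    unfolding coho_class_iff[OF c'] using c good_carrier[OF good_hat[OF c']]
    by (simp add: cohomologous_refl)
qed

end

section \<open>Maps of sheaves of functions\<close>

lemma finprod_hom:
  assumes "comm_group A" "comm_group B" "h \<in> hom A B" "\<And>k. k \<in> K \<Longrightarrow> s k \<in> carrier A"
  shows "h (finprod A s K) = finprod B (\<lambda>k. h (s k)) K"
proof -
  interpret A: comm_group A by fact
  interpret B: comm_group B by fact
  have one: "h \<one>\<^bsub>A\<^esub> = \<one>\<^bsub>B\<^esub>"
    using assms(3) A.group_axioms B.group_axioms by (rule hom_one)
  show ?thesis
    using assms(4)
  proof (induction K rule: infinite_finite_induct)
    case (insert k K)
    then show ?case
      using assms(3) by (simp add: A.finprod_insert B.finprod_insert Pi_iff hom_mult hom_in_carrier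
          A.finprod_closed)
  qed (simp_all add: one)
qed

lemma vdiff_hom:
  assumes "comm_group A" "comm_group B" "h \<in> hom A B"
    and "\<And>k. k < length zs - 1 \<Longrightarrow> u (omit k zs) \<in> carrier A"
    and "\<And>k. k < length zs - 1 \<Longrightarrow> v (omit k zs) = h (u (omit k zs))"
  shows "vdiff B v zs = h (vdiff A u zs)"
proof -
  interpret A: comm_group A by fact
  interpret B: comm_group B by fact
  interpret h: group_hom A B h
    using assms(3) by unfold_locales
  show ?thesis
    unfolding vdiff_def
    by (subst finprod_hom[OF assms(1-3)])
      (use assms(4,5) in \<open>auto intro!: B.finprod_cong' simp: hom_in_carrier[OF assms(3)]\<close>)
qed

text \<open>
  A map of sheaves over \<open>f\<close> that is given on values: a section \<open>g\<close> over \<open>V\<close> is sent to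
  \<open>y \<mapsto> \<omega> y (g (f y))\<close>. The homomorphism \<open>\<omega> y\<close> depends on the point because it contains the change
  between the frames chosen at \<open>f y\<close> and at \<open>y\<close>.
\<close>

locale sheaf_map =
  src: fpresheaf A' T' F' val' S' + tgt: fpresheaf A T F val S
  for A' :: "('b, 'l) monoid_scheme" and T' :: "'y topology" and F' :: "('y, 't) presheaf"
    and val' :: "'t \<Rightarrow> 'y \<Rightarrow> 'b" and S'
    and A :: "('a, 'm) monoid_scheme" and T :: "'x topology" and F :: "('x, 's) presheaf"
    and val :: "'s \<Rightarrow> 'x \<Rightarrow> 'a" and S +
  fixes f :: "'x \<Rightarrow> 'y" and \<omega> :: "'x \<Rightarrow> 'b \<Rightarrow> 'a"
  assumes f: "continuous_map T T' f"
    and \<omega>: "\<And>y. y \<in> topspace T \<Longrightarrow> \<omega> y \<in> hom A' A"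
    and S_pull: "\<And>V g. openin T' V \<Longrightarrow> S' V g \<Longrightarrow>
      S {x\<in>topspace T. f x \<in> V} (\<lambda>y. \<omega> y (g (f y)))"
begin

definition push :: "('y list \<Rightarrow> 'b) \<Rightarrow> 'x list \<Rightarrow> 'a" where
  "push u zs = \<omega> (last zs) (u (map f zs))"

lemma open_preimage: "openin T' V \<Longrightarrow> openin T {x\<in>topspace T. f x \<in> V}"
  using f by (simp add: continuous_map_def)

lemma push_cong:
  "\<forall>\<^sub>F zs in near_filter T' n. u zs = v zs \<Longrightarrow> \<forall>\<^sub>F zs in near_filter T n. push u zs = push v zs"
  unfolding push_def by (drule near_filter_map[OF f]) (auto elim: eventually_mono)

lemma push_one: "last zs \<in> topspace T \<Longrightarrow> push (\<lambda>_. \<one>\<^bsub>A'\<^esub>) zs = \<one>\<^bsub>A\<^esub>"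
  by (simp add: push_def hom_one[OF \<omega> src.group_axioms tgt.group_axioms])

lemma push_good:
  assumes "good T' S' n u"
  shows "good T S n (push u)"
  using near_filter_map[OF f assms[unfolded good_def]] near_filter_last near_filter_nonempty
  unfolding good_def
proof eventually_elim
  case (elim xs)
  then obtain W where W: "openin T' W" "f (last xs) \<in> W" "S' W (\<lambda>y. u (map f xs @ [y]))"
    by (auto simp: last_map)
  show ?case
    using S_pull[OF W(1,3)] open_preimage[OF W(1)] W(2) elim
    by (intro exI[of _ "{x\<in>topspace T. f x \<in> W}"]) (simp add: push_def)
qed

text \<open>
  All terms of the coboundary share the last point, so a single homomorphism \<open>\<omega> (last zs)\<close> is applied
  to all of them.
\<close>

lemma push_vdiff:
  assumes "\<forall>\<^sub>F zs in near_filter T' n. u zs \<in> carrier A'"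
  shows "\<forall>\<^sub>F zs in near_filter T (Suc n). vdiff A (push u) zs = push (vdiff A' u) zs"
proof -
  have "\<forall>\<^sub>F zs in near_filter T (Suc n). \<forall>k\<in>{..Suc n}. u (map f (omit k zs)) \<in> carrier A'"
    by (rule eventually_ball_finite)
      (auto intro: near_filter_omit[OF near_filter_map[OF f assms]])
  with near_filter_length near_filter_last show ?thesis
  proof eventually_elim
    case (elim zs)
    have "vdiff A (push u) zs = \<omega> (last zs) (vdiff A' (\<lambda>ys. u (map f ys)) zs)"
      by (rule vdiff_hom[OF src.comm_group_axioms tgt.comm_group_axioms \<omega>[OF elim(2)]])
        (use elim in \<open>auto simp: last_omit push_def\<close>)
    also have "vdiff A' (\<lambda>ys. u (map f ys)) zs = vdiff A' u (map f zs)"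
      unfolding vdiff_def map_omit by simp
    finally show ?case
      by (simp add: push_def[of "vdiff A' u"])
  qed
qed

lemma push_mult:
  assumes "\<forall>\<^sub>F zs in near_filter T' n. u zs \<in> carrier A' \<and> v zs \<in> carrier A'"
  shows "\<forall>\<^sub>F zs in near_filter T n. push (\<lambda>zs. u zs \<otimes>\<^bsub>A'\<^esub> v zs) zs = push u zs \<otimes>\<^bsub>A\<^esub> push v zs"
  using near_filter_map[OF f assms] near_filter_last
  by eventually_elim (simp add: push_def hom_mult[OF \<omega>])

lemma push_cohomologous:
  assumes "src.cohomologous n u v" "good T' S' (Suc n) v"
  shows "tgt.cohomologous n (push u) (push v)"
proof -
  obtain w where w: "good T' S' n w"
      "\<forall>\<^sub>F zs in near_filter T' (Suc (Suc n)). u zs = v zs \<otimes>\<^bsub>A'\<^esub> vdiff A' w zs"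
    using assms unfolding src.cohomologous_def by blast
  have "\<forall>\<^sub>F zs in near_filter T' (Suc (Suc n)). v zs \<in> carrier A' \<and> vdiff A' w zs \<in> carrier A'"
    using src.good_carrier[OF assms(2)] src.good_carrier[OF src.good_vdiff[OF w(1)]]
    by eventually_elim simp
  from push_mult[OF this] push_cong[OF w(2)] push_vdiff[OF src.good_carrier[OF w(1)]]
  have "\<forall>\<^sub>F zs in near_filter T (Suc (Suc n)). push u zs = push v zs \<otimes>\<^bsub>A\<^esub> vdiff A (push w) zs"
    by eventually_elim simp
  then show ?thesis
    unfolding tgt.cohomologous_def using push_good[OF w(1)] by blast
qed

text \<open>On sections the map of sheaves is \<open>\<theta>\<close>.\<close>

context
  fixes \<theta>
  assumes \<theta>_closed: "\<And>V s. openin T' V \<Longrightarrow> s \<in> carrier (sections F' V) \<Longrightarrow>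
      \<theta> V s \<in> carrier (sections F {x\<in>topspace T. f x \<in> V})"
    and val_\<theta>: "\<And>V s y. openin T' V \<Longrightarrow> s \<in> carrier (sections F' V) \<Longrightarrow> y \<in> topspace T \<Longrightarrow>
      f y \<in> V \<Longrightarrow> val (\<theta> V s) y = \<omega> y (val' s (f y))"
begin

lemma pull_cochain_aux:
  assumes "c \<in> cochains T' F' n"
  shows "\<forall>\<^sub>F xs in near_filter T n. is_germ T F (last xs) (pull_cochain T f \<theta> c xs) \<and>
    (\<forall>y\<in>fst (pull_cochain T f \<theta> c xs).
       val (snd (pull_cochain T f \<theta> c xs)) y = push (hat val' c) (xs @ [y]))"
  using near_filter_map[OF f src.cochains_germ[OF assms]] near_filter_last near_filter_nonempty
proof eventually_elim
  case (elim xs)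
  then show ?case
    by (auto simp: is_germ_iff pull_cochain_def case_prod_unfold last_map push_def
        intro!: open_preimage \<theta>_closed val_\<theta>)
qed

lemma pull_cochain_cochain: "c \<in> cochains T' F' n \<Longrightarrow> pull_cochain T f \<theta> c \<in> cochains T F n"
  by (rule tgt.cochainsI, rule eventually_mono[OF pull_cochain_aux]) auto

lemma hat_pull:
  assumes "c \<in> cochains T' F' n"
  shows "\<forall>\<^sub>F zs in near_filter T (Suc n). hat val (pull_cochain T f \<theta> c) zs = push (hat val' c) zs"
proof (rule tgt.eventually_fst[OF pull_cochain_cochain[OF assms]])
  show "\<forall>\<^sub>F xs in near_filter T n. \<forall>y\<in>fst (pull_cochain T f \<theta> c xs).
      hat val (pull_cochain T f \<theta> c) (xs @ [y]) = push (hat val' c) (xs @ [y])"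
    using pull_cochain_aux[OF assms] by eventually_elim simp
qed

lemma pull_cocycle:
  assumes "c \<in> cocycles T' F' n"
  shows "pull_cochain T f \<theta> c \<in> cocycles T F n"
proof -
  have c: "c \<in> cochains T' F' n" "\<forall>\<^sub>F zs in near_filter T' (Suc (Suc n)). vdiff A' (hat val' c) zs = \<one>\<^bsub>A'\<^esub>"
    using assms unfolding src.cocycles_iff by auto
  have "\<forall>\<^sub>F zs in near_filter T (Suc n). hat val (pull_cochain T f \<theta> c) zs = push (hat val' c) zs
      \<and> push (hat val' c) zs \<in> carrier A"
    using hat_pull[OF c(1)] tgt.good_carrier[OF push_good[OF src.good_hat[OF c(1)]]]
    by eventually_elim simp
  from tgt.vdiff_cong[OF this] push_vdiff[OF src.good_carrier[OF src.good_hat[OF c(1)]]]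
    push_cong[OF c(2)] near_filter_last
  have "\<forall>\<^sub>F zs in near_filter T (Suc (Suc n)). vdiff A (hat val (pull_cochain T f \<theta> c)) zs = \<one>\<^bsub>A\<^esub>"
    by eventually_elim (simp add: push_one)
  then show ?thesis
    unfolding tgt.cocycles_iff using pull_cochain_cochain[OF c(1)] by blast
qed

lemma pull_coho_class:
  assumes c: "c \<in> cocycles T' F' (Suc n)"
  shows "pull_class T F (Suc n) f \<theta> (coho_class T' F' (Suc n) c) =
    coho_class T F (Suc n) (pull_cochain T f \<theta> c)"
proof -
  have c': "c \<in> cochains T' F' (Suc n)"
    using c by (simp add: src.cocycles_iff)
  have "coho_class T F (Suc n) (pull_cochain T f \<theta> d) = coho_class T F (Suc n) (pull_cochain T f \<theta> c)"
    if d: "d \<in> coho_class T' F' (Suc n) c" for d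
  proof (rule tgt.coho_class_eqI)
    have d': "d \<in> cochains T' F' (Suc n)" "src.cohomologous n (hat val' d) (hat val' c)"
      using d by (auto simp: src.coho_class_iff[OF c'] src.cocycles_iff)
    show p: "pull_cochain T f \<theta> d \<in> cochains T F (Suc n)" "pull_cochain T f \<theta> c \<in> cochains T F (Suc n)"
      using c' d' by (auto intro: pull_cochain_cochain)
    have pd: "good T S (Suc n) (push (hat val' d))" and pc: "good T S (Suc n) (push (hat val' c))"
      using c' d' by (auto intro: push_good src.good_hat)
    have 1: "tgt.cohomologous n (hat val (pull_cochain T f \<theta> d)) (push (hat val' d))"
      by (rule tgt.cohomologous_refl)
        (use hat_pull[OF d'(1)] tgt.good_carrier[OF pd] in eventually_elim, simp)
    have 2: "tgt.cohomologous n (push (hat val' c)) (hat val (pull_cochain T f \<theta> c))"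
      by (rule tgt.cohomologous_refl)
        (use hat_pull[OF c'] tgt.good_carrier[OF pc] in eventually_elim, simp)
    have 3: "tgt.cohomologous n (push (hat val' d)) (push (hat val' c))"
      by (rule push_cohomologous[OF d'(2) src.good_hat[OF c']])
    show "tgt.cohomologous n (hat val (pull_cochain T f \<theta> d)) (hat val (pull_cochain T f \<theta> c))"
      using tgt.cohomologous_trans[OF tgt.cohomologous_trans[OF 1 3 pc] 2 tgt.good_hat[OF p(2)]] .
  qed
  then show ?thesis
    unfolding pull_class_def using src.coho_class_self[OF c] by blast
qed

end

end

lemma (in fpresheaf) cocycle_cong:
  assumes "c \<in> cocycles T F n" "\<forall>\<^sub>F xs in near_filter T n. c xs = d xs"
  shows "d \<in> cocycles T F n \<and> (\<forall>\<^sub>F zs in near_filter T (Suc n). hat val d zs = hat val c zs)"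
proof -
  have c: "c \<in> cochains T F n" "\<forall>\<^sub>F zs in near_filter T (Suc (Suc n)). vdiff A (hat val c) zs = \<one>"
    using assms(1) unfolding cocycles_iff by auto
  have d: "d \<in> cochains T F n"
    by (rule cochainsI) (use cochains_germ[OF c(1)] assms(2) in eventually_elim, simp)
  have h: "\<forall>\<^sub>F zs in near_filter T (Suc n). hat val d zs = hat val c zs"
    unfolding eventually_near_filter_Suc using assms(2) by eventually_elim simp
  have "\<forall>\<^sub>F zs in near_filter T (Suc n). hat val d zs = hat val c zs \<and> hat val c zs \<in> carrier A"
    using h good_carrier[OF good_hat[OF c(1)]] by eventually_elim simp
  from vdiff_cong[OF this] c(2) have "\<forall>\<^sub>F zs in near_filter T (Suc (Suc n)). vdiff A (hat val d) zs = \<one>"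
    by eventually_elim simp
  with d h show ?thesis
    by (simp add: cocycles_iff)
qed

lemma (in fpresheaf) coho_class_cong:
  assumes "c \<in> cocycles T F (Suc n)" "\<forall>\<^sub>F xs in near_filter T (Suc n). c xs = d xs"
  shows "coho_class T F (Suc n) d = coho_class T F (Suc n) c"
proof (rule coho_class_eqI)
  have c: "c \<in> cochains T F (Suc n)"
    using assms(1) by (simp add: cocycles_iff)
  then show "c \<in> cochains T F (Suc n)" .
  note d = cocycle_cong[OF assms]
  then show "d \<in> cochains T F (Suc n)"
    by (simp add: cocycles_iff)
  show "cohomologous n (hat val d) (hat val c)"
    by (rule cohomologous_refl)
      (use conjunct2[OF d] good_carrier[OF good_hat[OF c]] in eventually_elim, simp)
qed

text \<open>
  An open set consists of points of the topology, so its preimage under the identity is itself. Thus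
  maps of sheaves over a fixed space are covered by the results on pullbacks.
\<close>

lemma (in fpresheaf) pull_cochain_id:
  assumes "c \<in> cochains T F n"
  shows "\<forall>\<^sub>F xs in near_filter T n. pull_cochain T id \<phi> c xs = cochain_map \<phi> c xs"
  using cochains_germ[OF assms]
proof eventually_elim
  case (elim xs)
  then have "{x \<in> topspace T. x \<in> fst (c xs)} = fst (c xs)"
    using openin_subset by (fastforce simp: is_germ_iff)
  then show ?case
    by (simp add: pull_cochain_def cochain_map_def case_prod_unfold)
qed

lemma map_coho_class:
  assumes "sheaf_map A' T F' val' S' A T F val S id \<omega>"
    and \<theta>_closed: "\<And>V s. openin T V \<Longrightarrow> s \<in> carrier (sections F' V) \<Longrightarrow>
      \<theta> V s \<in> carrier (sections F V)"
    and val_\<theta>: "\<And>V s y. openin T V \<Longrightarrow> s \<in> carrier (sections F' V) \<Longrightarrow>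
      y \<in> V \<Longrightarrow> val (\<theta> V s) y = \<omega> y (val' s y)"
    and c: "c \<in> cocycles T F' (Suc n)"
  shows "map_class T F (Suc n) \<theta> (coho_class T F' (Suc n) c) =
      coho_class T F (Suc n) (cochain_map \<theta> c)"
    and "cochain_map \<theta> c \<in> cocycles T F (Suc n)"
    and "\<forall>\<^sub>F zs in near_filter T (Suc (Suc n)). hat val (cochain_map \<theta> c) zs = \<omega> (last zs) (hat val' c zs)"
proof -
  interpret sheaf_map A' T F' val' S' A T F val S id \<omega> by fact
  have eq: "{x \<in> topspace T. id x \<in> V} = V" if "openin T V" for V
    using that openin_subset by fastforce
  have th: "\<And>V s. openin T V \<Longrightarrow> s \<in> carrier (sections F' V) \<Longrightarrow>
      \<theta> V s \<in> carrier (sections F {x\<in>topspace T. id x \<in> V})"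
    "\<And>V s y. openin T V \<Longrightarrow> s \<in> carrier (sections F' V) \<Longrightarrow> y \<in> topspace T \<Longrightarrow>
      id y \<in> V \<Longrightarrow> val (\<theta> V s) y = \<omega> y (val' s (id y))"
    using \<theta>_closed val_\<theta> eq by simp_all
  have ev: "\<forall>\<^sub>F xs in near_filter T (Suc n). pull_cochain T id \<theta> d xs = cochain_map \<theta> d xs"
    if "d \<in> cocycles T F' (Suc n)" for d
    using src.pull_cochain_id[of d "Suc n" \<theta>] that by (simp add: src.cocycles_iff)
  have cl: "coho_class T F (Suc n) (cochain_map \<theta> d) = coho_class T F (Suc n) (pull_cochain T id \<theta> d)"
    if "d \<in> cocycles T F' (Suc n)" for d
    by (rule tgt.coho_class_cong[OF pull_cocycle ev]) (use th that in auto)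
  have "d \<in> cocycles T F' (Suc n)" if "d \<in> coho_class T F' (Suc n) c" for d
    using that by (simp add: coho_class_def)
  then have "map_class T F (Suc n) \<theta> (coho_class T F' (Suc n) c) =
      pull_class T F (Suc n) id \<theta> (coho_class T F' (Suc n) c)"
    unfolding map_class_def pull_class_def using cl by auto
  also have "\<dots> = coho_class T F (Suc n) (pull_cochain T id \<theta> c)"
    by (rule pull_coho_class) (use th c in auto)
  finally show "map_class T F (Suc n) \<theta> (coho_class T F' (Suc n) c) =
      coho_class T F (Suc n) (cochain_map \<theta> c)"
    by (simp add: cl c)
  have pc: "pull_cochain T id \<theta> c \<in> cocycles T F (Suc n)"
    by (rule pull_cocycle) (use th c in auto)
  have cc: "c \<in> cochains T F' (Suc n)"
    using c by (simp add: src.cocycles_iff)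
  show "cochain_map \<theta> c \<in> cocycles T F (Suc n)"
    using tgt.cocycle_cong[OF pc ev[OF c]] by simp
  have hp: "\<forall>\<^sub>F zs in near_filter T (Suc (Suc n)). hat val (pull_cochain T id \<theta> c) zs = push (hat val' c) zs"
    by (rule hat_pull[OF _ _ cc]) (use th in auto)
  show "\<forall>\<^sub>F zs in near_filter T (Suc (Suc n)). hat val (cochain_map \<theta> c) zs = \<omega> (last zs) (hat val' c zs)"
    using conjunct2[OF tgt.cocycle_cong[OF pc ev[OF c]]] hp by eventually_elim (simp add: push_def)
qed


section \<open>The exponential sequence\<close>

lemma comm_group_R: "comm_group R_group"
  by (rule comm_groupI) (auto simp: R_group_def intro: exI[of _ "- _"])

lemma comm_group_Z: "comm_group Z_group"
  by (rule comm_groupI) (auto simp: Z_group_def intro: bexI[of _ "- _"])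

lemma comm_group_U1: "comm_group U1_group"
proof (rule comm_groupI)
  fix z assume "z \<in> carrier U1_group"
  then show "\<exists>w\<in>carrier U1_group. w \<otimes>\<^bsub>U1_group\<^esub> z = \<one>\<^bsub>U1_group\<^esub>"
    by (intro bexI[of _ "inverse z"]) (auto simp: U1_group_def norm_inverse intro!: left_inverse)
qed (auto simp: U1_group_def norm_mult)

lemma carrier_R [simp]: "carrier R_group = UNIV"
  and mult_R [simp]: "x \<otimes>\<^bsub>R_group\<^esub> y = x + y"
  and one_R [simp]: "\<one>\<^bsub>R_group\<^esub> = 0"
  and carrier_Z [simp]: "carrier Z_group = \<int>"
  and mult_Z [simp]: "x \<otimes>\<^bsub>Z_group\<^esub> y = x + y"
  and one_Z [simp]: "\<one>\<^bsub>Z_group\<^esub> = 0"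
  and carrier_U1 [simp]: "carrier U1_group = sphere 0 1"
  and mult_U1 [simp]: "z \<otimes>\<^bsub>U1_group\<^esub> w = z * w"
  and one_U1 [simp]: "\<one>\<^bsub>U1_group\<^esub> = 1"
  by (auto simp: R_group_def Z_group_def U1_group_def)

lemma inv_R [simp]: "inv\<^bsub>R_group\<^esub> x = - x"
  using comm_group.axioms(2)[OF comm_group_R] by (intro group.inv_equality) auto

lemma inv_Z: "x \<in> \<int> \<Longrightarrow> inv\<^bsub>Z_group\<^esub> x = - x"
  using comm_group.axioms(2)[OF comm_group_Z] by (intro group.inv_equality) auto

lemma inv_U1: "z \<in> sphere 0 1 \<Longrightarrow> inv\<^bsub>U1_group\<^esub> z = inverse z"
  using comm_group.axioms(2)[OF comm_group_U1]
  by (intro group.inv_equality) (auto simp: norm_inverse intro!: left_inverse)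

lemma finprod_R: "finprod R_group s K = sum s K"
proof -
  interpret comm_group R_group by (rule comm_group_R)
  show ?thesis
    by (induction K rule: infinite_finite_induct) auto
qed

lemma vdiff_R: "vdiff R_group u zs = (\<Sum>k<length zs - 1. (- 1) ^ k * u (omit k zs))"
  unfolding vdiff_def finprod_R by (rule sum.cong) auto

lemma hom_Z_R: "(\<lambda>x. x) \<in> hom Z_group R_group"
  by (auto simp: hom_def)

lemma exp_U1_add: "exp_U1 (s + t) = exp_U1 s * exp_U1 t"
  by (simp add: exp_U1_def cis_mult distrib_left)

lemma exp_U1_minus: "exp_U1 (s - t) = exp_U1 s / exp_U1 t"
  by (simp add: exp_U1_def cis_divide right_diff_distrib)

lemma norm_exp_U1 [simp]: "norm (exp_U1 t) = 1"
  by (simp add: exp_U1_def)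

lemma exp_U1_eq_1_iff: "exp_U1 t = 1 \<longleftrightarrow> t \<in> \<int>"
proof
  assume "exp_U1 t = 1"
  then have "cos (2 * pi * t) = 1"
    by (simp add: exp_U1_def complex_eq_iff)
  then obtain k :: int where "2 * pi * t = of_int k * 2 * pi"
    by (auto simp: cos_one_2pi_int)
  then have "t = of_int k"
    by simp
  then show "t \<in> \<int>" by simp
next
  assume "t \<in> \<int>"
  then show "exp_U1 t = 1"
    by (auto simp: exp_U1_def elim!: Ints_cases)
qed

lemma hom_exp_U1: "exp_U1 \<in> hom R_group U1_group"
  by (auto simp: hom_def exp_U1_add)

lemma nth_omit: "k < length zs \<Longrightarrow> i < length zs - 1 \<Longrightarrow> omit k zs ! i = zs ! (if i < k then i else Suc i)"
  by (auto simp: omit_def nth_append min_def)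

lemma omit_omit:
  assumes "k < j" "j < length zs"
  shows "omit k (omit j zs) = omit (j - 1) (omit k zs)"
  using assms by (intro nth_equalityI) (auto simp: length_omit nth_omit)

text \<open>
  The faces cancel in pairs: leaving out the \<open>j\<close>-th and then the \<open>k\<close>-th point, with \<open>k < j\<close>, is the same
  as leaving out the \<open>k\<close>-th and then the \<open>(j - 1)\<close>-th one, which occurs with the opposite sign.
\<close>

lemma vdiff_vdiff_R: "vdiff R_group (vdiff R_group u) zs = 0"
proof (cases "length zs \<le> 1")
  case False
  define m where "m = length zs - 1"
  define t where "t = (\<lambda>(j, k). (- 1) ^ j * ((- 1) ^ k * u (omit k (omit j zs)) :: real))"
  let ?A = "{(j, k). k < j \<and> j < m}" and ?B = "{(j, k). j \<le> k \<and> k < m - 1}"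
  have fin: "finite ?A" "finite ?B"
    by (rule finite_subset[of _ "{..<m} \<times> {..<m}"], auto)+
  have "vdiff R_group (vdiff R_group u) zs = (\<Sum>j<m. \<Sum>k<m - 1. t (j, k))"
    unfolding vdiff_R m_def
    by (rule sum.cong) (auto simp: t_def length_omit sum_distrib_left intro!: sum.cong)
  also have "\<dots> = sum t ({..<m} \<times> {..<m - 1})"
    by (simp add: sum.cartesian_product)
  also have "{..<m} \<times> {..<m - 1} = ?A \<union> ?B"
    by auto
  also have "sum t (?A \<union> ?B) = sum t ?A + sum t ?B"
    by (rule sum.union_disjoint) (use fin in auto)
  also have "sum t ?A = (\<Sum>p\<in>?B. - t p)"
  proof (rule sum.reindex_bij_witness[of _ "\<lambda>(j, k). (Suc k, j)" "\<lambda>(j, k). (k, j - 1)"])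
    fix p assume "p \<in> ?A"
    then obtain j k where p: "p = (j, k)" "k < j" "j < m" by auto
    then show "- t (case p of (j, k) \<Rightarrow> (k, j - 1)) = t p"
      using omit_omit[of k j zs] by (cases j) (auto simp: t_def m_def)
  qed auto
  finally show ?thesis
    by (simp add: sum_negf)
qed (simp add: vdiff_R)

text \<open>
  The exponential sequence in terms of values, where the maps \<open>\<phi>\<close> and \<open>\<psi>\<close> are the inclusion of the
  integers and the exponential map. Exactness on germs is \<open>SZ_iff\<close> and \<open>SU_lift\<close>.
\<close>

locale exp_sequence =
  Z: fpresheaf Z_group T FZ valZ SZ + R: fpresheaf R_group T FR valR SR +
  U: fpresheaf U1_group T FU valU SU
  for T :: "'x topology" and FZ :: "('x, 'z) presheaf" and valZ SZ
    and FR :: "('x, 'r) presheaf" and valR SR and FU :: "('x, 'u) presheaf" and valU SU +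
  fixes \<phi> :: "'x set \<Rightarrow> 'z \<Rightarrow> 'r" and \<psi> :: "'x set \<Rightarrow> 'r \<Rightarrow> 'u"
  assumes SZ_iff: "\<And>V g. openin T V \<Longrightarrow> SZ V g \<longleftrightarrow> SR V g \<and> (\<forall>y\<in>V. g y \<in> \<int>)"
    and SR_exp: "\<And>V g. openin T V \<Longrightarrow> SR V g \<Longrightarrow> SU V (\<lambda>y. exp_U1 (g y))"
    and SU_lift: "\<And>V g x. openin T V \<Longrightarrow> SU V g \<Longrightarrow> x \<in> V \<Longrightarrow>
      \<exists>W g'. openin T W \<and> x \<in> W \<and> W \<subseteq> V \<and> SR W g' \<and> (\<forall>y\<in>W. exp_U1 (g' y) = g y)"
    and \<phi>_closed: "\<And>V s. openin T V \<Longrightarrow> s \<in> carrier (sections FZ V) \<Longrightarrow> \<phi> V s \<in> carrier (sections FR V)"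
    and val_\<phi>: "\<And>V s y. openin T V \<Longrightarrow> s \<in> carrier (sections FZ V) \<Longrightarrow> y \<in> V \<Longrightarrow>
      valR (\<phi> V s) y = valZ s y"
    and \<psi>_closed: "\<And>V s. openin T V \<Longrightarrow> s \<in> carrier (sections FR V) \<Longrightarrow> \<psi> V s \<in> carrier (sections FU V)"
    and val_\<psi>: "\<And>V s y. openin T V \<Longrightarrow> s \<in> carrier (sections FR V) \<Longrightarrow> y \<in> V \<Longrightarrow>
      valU (\<psi> V s) y = exp_U1 (valR s y)"
begin

lemma good_Z_iff:
  "good T SZ n u \<longleftrightarrow> good T SR n u \<and> (\<forall>\<^sub>F zs in near_filter T (Suc n). u zs \<in> \<int>)"
proof
  assume "good T SZ n u"
  then show "good T SR n u \<and> (\<forall>\<^sub>F zs in near_filter T (Suc n). u zs \<in> \<int>)"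
    using Z.good_carrier by (auto simp: good_def SZ_iff elim!: eventually_mono)
next
  assume a: "good T SR n u \<and> (\<forall>\<^sub>F zs in near_filter T (Suc n). u zs \<in> \<int>)"
  then have "\<forall>\<^sub>F xs in near_filter T n. \<exists>W. openin T W \<and> last xs \<in> W \<and> SR W (\<lambda>y. u (xs @ [y]))"
      "\<forall>\<^sub>F xs in near_filter T n. \<forall>\<^sub>F y in nhdsin T (last xs). u (xs @ [y]) \<in> \<int>"
    by (auto simp: good_def eventually_near_filter_Suc)
  then show "good T SZ n u"
    unfolding good_def using near_filter_last
  proof eventually_elim
    case (elim xs)
    then obtain W where W: "openin T W" "last xs \<in> W" "SR W (\<lambda>y. u (xs @ [y]))" by blast
    obtain W' where W': "openin T W'" "last xs \<in> W'" "\<forall>y\<in>W'. u (xs @ [y]) \<in> \<int>"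
      using elim unfolding eventually_nhdsin by blast
    have o: "openin T (W \<inter> W')"
      using W W' by blast
    have "SZ (W \<inter> W') (\<lambda>y. u (xs @ [y]))"
      unfolding SZ_iff[OF o] using R.S_restrict[OF W(1) o _ W(3)] W' by auto
    with o W W' show ?case by blast
  qed
qed

lemma good_exp: "good T SR n u \<Longrightarrow> good T SU n (\<lambda>zs. exp_U1 (u zs))"
  unfolding good_def by (erule eventually_mono) (use SR_exp in blast)

text \<open>
  Logarithms are chosen separately for every list of points; cochains may do so without any coherence
  between the choices.
\<close>

lemma good_lift:
  assumes "good T SU n u"
  shows "\<exists>v. good T SR n v \<and> (\<forall>\<^sub>F zs in near_filter T (Suc n). exp_U1 (v zs) = u zs)"
proof -
  let ?P = "\<lambda>xs W g. openin T W \<and> last xs \<in> W \<and> SR W g \<and> (\<forall>y\<in>W. exp_U1 (g y) = u (xs @ [y]))"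
  define g where "g = (\<lambda>xs. SOME g. \<exists>W. ?P xs W g)"
  have ev: "\<forall>\<^sub>F xs in near_filter T n. \<exists>W. ?P xs W (g xs)"
    using assms unfolding good_def
  proof eventually_elim
    case (elim xs)
    then have "\<exists>g W. ?P xs W g"
      using SU_lift by meson
    then show ?case
      unfolding g_def by (rule someI_ex)
  qed
  define v where "v = (\<lambda>zs. g (butlast zs) (last zs))"
  have "good T SR n v"
    unfolding good_def v_def using ev by eventually_elim auto
  moreover have "\<forall>\<^sub>F zs in near_filter T (Suc n). exp_U1 (v zs) = u zs"
    unfolding eventually_near_filter_Suc v_def using ev
    by eventually_elim (auto simp: eventually_nhdsin)
  ultimately show ?thesis by blast
qed

lemma vdiff_exp: "vdiff U1_group (\<lambda>zs. exp_U1 (u zs)) zs = exp_U1 (vdiff R_group u zs)"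
  by (rule vdiff_hom[OF comm_group_R comm_group_U1 hom_exp_U1]) auto

lemma vdiff_Z:
  assumes "\<forall>\<^sub>F zs in near_filter T n. u zs \<in> \<int>"
  shows "\<forall>\<^sub>F zs in near_filter T (Suc n). vdiff Z_group u zs = vdiff R_group u zs"
proof -
  have "\<forall>\<^sub>F zs in near_filter T (Suc n). \<forall>k\<in>{..Suc n}. u (omit k zs) \<in> \<int>"
    by (rule eventually_ball_finite) (auto intro: near_filter_omit[OF assms])
  with near_filter_length show ?thesis
    by eventually_elim (rule vdiff_hom[OF comm_group_Z comm_group_R hom_Z_R, symmetric], auto)
qed

lemma cochain_map_\<psi>:
  assumes "b \<in> cochains T FR n"
  shows "cochain_map \<psi> b \<in> cochains T FU n"
    and "\<forall>\<^sub>F zs in near_filter T (Suc n). hat valU (cochain_map \<psi> b) zs = exp_U1 (hat valR b zs)"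
proof -
  show c: "cochain_map \<psi> b \<in> cochains T FU n"
    by (rule U.cochainsI, rule eventually_mono[OF R.cochains_germ[OF assms]])
      (auto simp: is_germ_iff cochain_map_def case_prod_unfold \<psi>_closed)
  show "\<forall>\<^sub>F zs in near_filter T (Suc n). hat valU (cochain_map \<psi> b) zs = exp_U1 (hat valR b zs)"
    by (rule U.eventually_fst[OF c], rule eventually_mono[OF R.cochains_germ[OF assms]])
      (auto simp: is_germ_iff cochain_map_def case_prod_unfold val_\<psi>)
qed

lemma cochain_map_\<phi>:
  assumes "a \<in> cochains T FZ n"
  shows "cochain_map \<phi> a \<in> cochains T FR n"
    and "\<forall>\<^sub>F zs in near_filter T (Suc n). hat valR (cochain_map \<phi> a) zs = hat valZ a zs"
proof -
  show c: "cochain_map \<phi> a \<in> cochains T FR n"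
    by (rule R.cochainsI, rule eventually_mono[OF Z.cochains_germ[OF assms]])
      (auto simp: is_germ_iff cochain_map_def case_prod_unfold \<phi>_closed)
  show "\<forall>\<^sub>F zs in near_filter T (Suc n). hat valR (cochain_map \<phi> a) zs = hat valZ a zs"
    by (rule R.eventually_fst[OF c], rule eventually_mono[OF Z.cochains_germ[OF assms]])
      (auto simp: is_germ_iff cochain_map_def case_prod_unfold val_\<phi>)
qed

text \<open>
  Here \<open>u\<close> is the real lift in the definition of the connecting morphism. That its exponential has to
  agree with \<open>c\<close> only up to a coboundary accounts for the choice of the representative.
\<close>

lemma connecting_iff:
  assumes c: "c \<in> cochains T FU (Suc n)"
  shows "a \<in> connecting T FZ FR FU \<phi> \<psi> (Suc n) (coho_class T FU (Suc n) c) \<longleftrightarrow>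
    a \<in> cocycles T FZ (Suc (Suc n)) \<and>
    (\<exists>u. good T SR (Suc n) u \<and> U.cohomologous n (\<lambda>zs. exp_U1 (u zs)) (hat valU c) \<and>
      (\<forall>\<^sub>F zs in near_filter T (Suc (Suc (Suc n))). hat valZ a zs = vdiff R_group u zs))"
    (is "_ \<longleftrightarrow> _ \<and> (\<exists>u. ?P u)")
proof (cases "a \<in> cocycles T FZ (Suc (Suc n))")
  case True
  then have a: "a \<in> cochains T FZ (Suc (Suc n))"
    by (simp add: Z.cocycles_iff)
  have "(\<exists>d\<in>coho_class T FU (Suc n) c. \<exists>b\<in>cochains T FR (Suc n). cochain_eq T FU (Suc n) (cochain_map \<psi> b) d \<and>
       cochain_eq T FR (Suc (Suc n)) (cochain_map \<phi> a) (coboundary FR b)) \<longleftrightarrow> (\<exists>u. ?P u)"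
  proof
    assume "\<exists>d\<in>coho_class T FU (Suc n) c. \<exists>b\<in>cochains T FR (Suc n). cochain_eq T FU (Suc n) (cochain_map \<psi> b) d \<and>
       cochain_eq T FR (Suc (Suc n)) (cochain_map \<phi> a) (coboundary FR b)"
    then obtain d b where d: "d \<in> cochains T FU (Suc n)" "U.cohomologous n (hat valU d) (hat valU c)"
      and b: "b \<in> cochains T FR (Suc n)"
      and e: "cochain_eq T FU (Suc n) (cochain_map \<psi> b) d"
        "cochain_eq T FR (Suc (Suc n)) (cochain_map \<phi> a) (coboundary FR b)"
      by (auto simp: U.coho_class_iff[OF c] U.cocycles_iff)
    have "\<forall>\<^sub>F zs in near_filter T (Suc (Suc n)).
        exp_U1 (hat valR b zs) = hat valU d zs \<and> hat valU d zs \<in> carrier U1_group"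
      using e(1)[unfolded U.cochain_eq_iff[OF cochain_map_\<psi>(1)[OF b] d(1)]] cochain_map_\<psi>(2)[OF b]
        U.good_carrier[OF U.good_hat[OF d(1)]]
      by eventually_elim simp
    from U.cohomologous_trans[OF U.cohomologous_refl[OF this] d(2) U.good_hat[OF c]]
    have "U.cohomologous n (\<lambda>zs. exp_U1 (hat valR b zs)) (hat valU c)" .
    moreover have "\<forall>\<^sub>F zs in near_filter T (Suc (Suc (Suc n))). hat valZ a zs = vdiff R_group (hat valR b) zs"
      using e(2)[unfolded R.cochain_eq_iff[OF cochain_map_\<phi>(1)[OF a] R.coboundary_cochain[OF b]]]
        cochain_map_\<phi>(2)[OF a] R.hat_coboundary[OF b]
      by eventually_elim simp
    ultimately show "\<exists>u. ?P u"
      using R.good_hat[OF b] by blast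
  next
    assume "\<exists>u. ?P u"
    then obtain u where u: "good T SR (Suc n) u" "U.cohomologous n (\<lambda>zs. exp_U1 (u zs)) (hat valU c)"
        "\<forall>\<^sub>F zs in near_filter T (Suc (Suc (Suc n))). hat valZ a zs = vdiff R_group u zs"
      by blast
    obtain b where b: "b \<in> cochains T FR (Suc n)" "\<forall>\<^sub>F zs in near_filter T (Suc (Suc n)). hat valR b zs = u zs"
      using R.realize_cochain[OF u(1)] by blast
    note pb = cochain_map_\<psi>[OF b(1)]
    have hp: "\<forall>\<^sub>F zs in near_filter T (Suc (Suc n)). hat valU (cochain_map \<psi> b) zs = exp_U1 (u zs) \<and>
        exp_U1 (u zs) \<in> carrier U1_group"
      using b(2) pb(2) by eventually_elim simp
    have vb: "\<forall>\<^sub>F zs in near_filter T (Suc (Suc (Suc n))). vdiff R_group (hat valR b) zs = vdiff R_group u zs"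
      by (rule R.vdiff_cong) (use b(2) in simp)
    have "cochain_map \<psi> b \<in> cocycles T FU (Suc n)"
      unfolding U.cocycles_iff
    proof (intro conjI pb(1))
      show "\<forall>\<^sub>F zs in near_filter T (Suc (Suc (Suc n))). vdiff U1_group (hat valU (cochain_map \<psi> b)) zs = \<one>\<^bsub>U1_group\<^esub>"
        using U.vdiff_cong[OF hp] u(3) Z.good_carrier[OF Z.good_hat[OF a]]
        by eventually_elim (simp add: vdiff_exp exp_U1_eq_1_iff)
    qed
    moreover have "U.cohomologous n (hat valU (cochain_map \<psi> b)) (hat valU c)"
      by (rule U.cohomologous_trans[OF U.cohomologous_refl[OF hp] u(2) U.good_hat[OF c]])
    ultimately have "cochain_map \<psi> b \<in> coho_class T FU (Suc n) c"
      by (simp add: U.coho_class_iff[OF c])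
    moreover have "cochain_eq T FU (Suc n) (cochain_map \<psi> b) (cochain_map \<psi> b)"
      by (simp add: U.cochain_eq_iff pb(1))
    moreover have "cochain_eq T FR (Suc (Suc n)) (cochain_map \<phi> a) (coboundary FR b)"
      unfolding R.cochain_eq_iff[OF cochain_map_\<phi>(1)[OF a] R.coboundary_cochain[OF b(1)]]
      using cochain_map_\<phi>(2)[OF a] R.hat_coboundary[OF b(1)] u(3) vb
      by eventually_elim simp
    ultimately show "\<exists>d\<in>coho_class T FU (Suc n) c. \<exists>b\<in>cochains T FR (Suc n). cochain_eq T FU (Suc n) (cochain_map \<psi> b) d \<and>
       cochain_eq T FR (Suc (Suc n)) (cochain_map \<phi> a) (coboundary FR b)"
      using b(1) by blast
  qed
  with True show ?thesis
    by (simp add: connecting_def)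
qed (simp add: connecting_def)

text \<open>
  Let \<open>u\<close> and \<open>v\<close> be real lifts. Their exponentials differ by the coboundary of some \<open>w\<close>; with a real
  lift \<open>w'\<close> of \<open>w\<close>, the function \<open>d = v - u - \<delta>w'\<close> is integral, and \<open>\<delta>d = \<delta>v - \<delta>u\<close>.
\<close>

lemma connecting_unique:
  assumes c: "c \<in> cochains T FU (Suc n)"
    and a: "a \<in> connecting T FZ FR FU \<phi> \<psi> (Suc n) (coho_class T FU (Suc n) c)"
    and a': "a' \<in> connecting T FZ FR FU \<phi> \<psi> (Suc n) (coho_class T FU (Suc n) c)"
  shows "Z.cohomologous (Suc n) (hat valZ a') (hat valZ a)"
proof -
  obtain u where u: "good T SR (Suc n) u" "U.cohomologous n (\<lambda>zs. exp_U1 (u zs)) (hat valU c)"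
      "\<forall>\<^sub>F zs in near_filter T (Suc (Suc (Suc n))). hat valZ a zs = vdiff R_group u zs"
    using a unfolding connecting_iff[OF c] by blast
  obtain v where v: "good T SR (Suc n) v" "U.cohomologous n (\<lambda>zs. exp_U1 (v zs)) (hat valU c)"
      "\<forall>\<^sub>F zs in near_filter T (Suc (Suc (Suc n))). hat valZ a' zs = vdiff R_group v zs"
    using a' unfolding connecting_iff[OF c] by blast
  have "U.cohomologous n (\<lambda>zs. exp_U1 (v zs)) (\<lambda>zs. exp_U1 (u zs))"
    by (rule U.cohomologous_trans[OF v(2) U.cohomologous_sym[OF u(2) U.good_hat[OF c]] good_exp[OF u(1)]])
  then obtain w where w: "good T SU n w"
      "\<forall>\<^sub>F zs in near_filter T (Suc (Suc n)). exp_U1 (v zs) = exp_U1 (u zs) * vdiff U1_group w zs"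
    unfolding U.cohomologous_def by auto
  obtain w' where w': "good T SR n w'" "\<forall>\<^sub>F zs in near_filter T (Suc n). exp_U1 (w' zs) = w zs"
    using good_lift[OF w(1)] by blast
  have "\<forall>\<^sub>F zs in near_filter T (Suc n). exp_U1 (w' zs) = w zs \<and> w zs \<in> carrier U1_group"
    using w'(2) U.good_carrier[OF w(1)] by eventually_elim simp
  note vw = U.vdiff_cong[OF this, unfolded vdiff_exp]
  define d where "d = (\<lambda>zs. v zs - u zs - vdiff R_group w' zs)"
  have d_eq: "d = (\<lambda>zs. (v zs \<otimes>\<^bsub>R_group\<^esub> inv\<^bsub>R_group\<^esub> u zs) \<otimes>\<^bsub>R_group\<^esub> inv\<^bsub>R_group\<^esub> vdiff R_group w' zs)"
    by (simp add: d_def fun_eq_iff)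
  have "good T SR (Suc n) d"
    unfolding d_eq by (intro R.good_mult R.good_inv u v w' R.good_vdiff)
  moreover have dZ: "\<forall>\<^sub>F zs in near_filter T (Suc (Suc n)). d zs \<in> \<int>"
    using vw w(2)
  proof eventually_elim
    case (elim zs)
    then show ?case
      by (simp add: d_def exp_U1_minus flip: exp_U1_eq_1_iff elim(1))
        (metis div_by_0 divide_self_if elim(1) mult_eq_0_iff norm_exp_U1 norm_zero zero_neq_one)
  qed
  ultimately have "good T SZ (Suc n) d"
    by (simp add: good_Z_iff)
  moreover have "\<forall>\<^sub>F zs in near_filter T (Suc (Suc (Suc n))). hat valZ a' zs = hat valZ a zs + vdiff Z_group d zs"
    using u(3) v(3) vdiff_Z[OF dZ]
  proof eventually_elim
    case (elim zs)
    have "vdiff R_group d zs = vdiff R_group v zs - vdiff R_group u zs - vdiff R_group (vdiff R_group w') zs"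
      by (simp add: vdiff_R d_def right_diff_distrib sum_subtractf)
    then show ?case
      using elim by (simp add: vdiff_vdiff_R)
  qed
  ultimately show ?thesis
    unfolding Z.cohomologous_def by auto
qed

text \<open>
  An integral coboundary can be absorbed in the real lift, since adding an integral function to \<open>u\<close>
  does not change its exponential.
\<close>

lemma connecting_eq_coho_class:
  assumes c: "c \<in> cochains T FU (Suc n)"
    and a: "a \<in> connecting T FZ FR FU \<phi> \<psi> (Suc n) (coho_class T FU (Suc n) c)"
  shows "connecting T FZ FR FU \<phi> \<psi> (Suc n) (coho_class T FU (Suc n) c) = coho_class T FZ (Suc (Suc n)) a"
proof -
  have ac: "a \<in> cochains T FZ (Suc (Suc n))"
    using a by (simp add: connecting_iff[OF c] Z.cocycles_iff)
  have "a' \<in> connecting T FZ FR FU \<phi> \<psi> (Suc n) (coho_class T FU (Suc n) c)"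
    if a': "a' \<in> coho_class T FZ (Suc (Suc n)) a" for a'
  proof -
    obtain u where u: "good T SR (Suc n) u" "U.cohomologous n (\<lambda>zs. exp_U1 (u zs)) (hat valU c)"
        "\<forall>\<^sub>F zs in near_filter T (Suc (Suc (Suc n))). hat valZ a zs = vdiff R_group u zs"
      using a unfolding connecting_iff[OF c] by blast
    obtain e where e: "good T SZ (Suc n) e"
        "\<forall>\<^sub>F zs in near_filter T (Suc (Suc (Suc n))). hat valZ a' zs = hat valZ a zs + vdiff Z_group e zs"
      using a' unfolding Z.coho_class_iff[OF ac] Z.cohomologous_def by auto
    have eR: "good T SR (Suc n) e" and eZ: "\<forall>\<^sub>F zs in near_filter T (Suc (Suc n)). e zs \<in> \<int>"
      using e(1) by (auto simp: good_Z_iff)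
    have "good T SR (Suc n) (\<lambda>zs. u zs + e zs)"
      using R.good_mult[OF u(1) eR] by simp
    moreover have "\<forall>\<^sub>F zs in near_filter T (Suc (Suc n)).
        exp_U1 (u zs + e zs) = exp_U1 (u zs) \<and> exp_U1 (u zs) \<in> carrier U1_group"
      using eZ by eventually_elim (simp add: exp_U1_add exp_U1_eq_1_iff[THEN iffD2])
    from U.cohomologous_trans[OF U.cohomologous_refl[OF this] u(2) U.good_hat[OF c]]
    have "U.cohomologous n (\<lambda>zs. exp_U1 (u zs + e zs)) (hat valU c)" .
    moreover have "\<forall>\<^sub>F zs in near_filter T (Suc (Suc (Suc n))). hat valZ a' zs = vdiff R_group (\<lambda>zs. u zs + e zs) zs"
      using u(3) e(2) vdiff_Z[OF eZ]
      by eventually_elim (simp add: vdiff_R distrib_left sum.distrib)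
    ultimately show ?thesis
      unfolding connecting_iff[OF c] using a' by (auto simp: coho_class_def)
  qed
  moreover have "a' \<in> coho_class T FZ (Suc (Suc n)) a"
    if "a' \<in> connecting T FZ FR FU \<phi> \<psi> (Suc n) (coho_class T FU (Suc n) c)" for a'
    using that connecting_unique[OF c a that] by (simp add: Z.coho_class_iff[OF ac] connecting_iff[OF c])
  ultimately show ?thesis by blast
qed

text \<open>A real lift \<open>u\<close> of the cocycle \<open>c\<close> has an integral coboundary, because the exponential of \<open>\<delta>u\<close> is \<open>\<delta>c\<close>.\<close>

lemma connecting_nonempty:
  assumes c: "c \<in> cocycles T FU (Suc n)"
  shows "\<exists>a. a \<in> connecting T FZ FR FU \<phi> \<psi> (Suc n) (coho_class T FU (Suc n) c)"
proof -
  have cc: "c \<in> cochains T FU (Suc n)"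
      "\<forall>\<^sub>F zs in near_filter T (Suc (Suc (Suc n))). vdiff U1_group (hat valU c) zs = 1"
    using c unfolding U.cocycles_iff by auto
  obtain u where u: "good T SR (Suc n) u" "\<forall>\<^sub>F zs in near_filter T (Suc (Suc n)). exp_U1 (u zs) = hat valU c zs"
    using good_lift[OF U.good_hat[OF cc(1)]] by blast
  have ev: "\<forall>\<^sub>F zs in near_filter T (Suc (Suc n)). exp_U1 (u zs) = hat valU c zs \<and> hat valU c zs \<in> carrier U1_group"
    using u(2) U.good_carrier[OF U.good_hat[OF cc(1)]] by eventually_elim simp
  have "\<forall>\<^sub>F zs in near_filter T (Suc (Suc (Suc n))). vdiff R_group u zs \<in> \<int>"
    using U.vdiff_cong[OF ev] cc(2)
    by eventually_elim (simp add: vdiff_exp flip: exp_U1_eq_1_iff)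
  with R.good_vdiff[OF u(1)] have "good T SZ (Suc (Suc n)) (vdiff R_group u)"
    by (simp add: good_Z_iff)
  then obtain a where a: "a \<in> cochains T FZ (Suc (Suc n))"
      "\<forall>\<^sub>F zs in near_filter T (Suc (Suc (Suc n))). hat valZ a zs = vdiff R_group u zs"
    using Z.realize_cochain by blast
  have "\<forall>\<^sub>F zs in near_filter T (Suc (Suc (Suc n))). hat valZ a zs \<in> \<int>"
    using Z.good_carrier[OF Z.good_hat[OF a(1)]] by simp
  moreover have "\<forall>\<^sub>F zs in near_filter T (Suc (Suc (Suc (Suc n)))). vdiff R_group (hat valZ a) zs = vdiff R_group (vdiff R_group u) zs"
    by (rule R.vdiff_cong) (use a(2) in simp)
  ultimately have "\<forall>\<^sub>F zs in near_filter T (Suc (Suc (Suc (Suc n)))). vdiff Z_group (hat valZ a) zs = 0"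
    by (auto dest!: vdiff_Z simp: vdiff_vdiff_R elim: eventually_elim2)
  then have "a \<in> cocycles T FZ (Suc (Suc n))"
    using a(1) by (simp add: Z.cocycles_iff)
  then show ?thesis
    unfolding connecting_iff[OF cc(1)] using u(1) U.cohomologous_refl[OF ev] a(2) by blast
qed

end

section \<open>Smooth functions of several variables\<close>

lemma Ck_on_continuous: "Ck_on k n U \<phi> \<Longrightarrow> continuous_map (subtopology (Euclidean_space n) U) euclideanreal \<phi>"
  by (cases k) auto

definition has_partial :: "nat \<Rightarrow> (nat \<Rightarrow> real) set \<Rightarrow> ((nat \<Rightarrow> real) \<Rightarrow> real) \<Rightarrow> ((nat \<Rightarrow> real) \<Rightarrow> real) \<Rightarrow> bool" where
  "has_partial i U \<phi> \<psi> \<longleftrightarrow> (\<forall>v\<in>U. ((\<lambda>t. \<phi> (v(i := t))) has_real_derivative \<psi> v) (at (v i)))"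

lemma has_partialI:
  "(\<And>v. v \<in> U \<Longrightarrow> ((\<lambda>t. \<phi> (v(i := t))) has_real_derivative \<psi> v) (at (v i))) \<Longrightarrow> has_partial i U \<phi> \<psi>"
  by (simp add: has_partial_def)

lemma has_partialD:
  "has_partial i U \<phi> \<psi> \<Longrightarrow> v \<in> U \<Longrightarrow> ((\<lambda>t. \<phi> (v(i := t))) has_real_derivative \<psi> v) (at (v i))"
  by (simp add: has_partial_def)

lemma has_partial_subset: "has_partial i U \<phi> \<psi> \<Longrightarrow> V \<subseteq> U \<Longrightarrow> has_partial i V \<phi> \<psi>"
  unfolding has_partial_def by (rule ballI, drule (1) subsetD, erule (1) bspec)

lemma Ck_on_Suc_iff:
  "Ck_on (Suc k) n U \<phi> \<longleftrightarrow> continuous_map (subtopology (Euclidean_space n) U) euclideanreal \<phi> \<and>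
     (\<forall>i<n. \<exists>\<psi>. has_partial i U \<phi> \<psi> \<and> Ck_on k n U \<psi>)"
  unfolding Ck_on.simps has_partial_def ..

declare Ck_on.simps(2) [simp del]

lemma Ck_on_SucE:
  assumes "Ck_on (Suc k) n U \<phi>" "i < n"
  obtains \<psi> where "has_partial i U \<phi> \<psi>" "Ck_on k n U \<psi>"
  using assms by (auto simp: Ck_on_Suc_iff)

lemma Ck_on_subset: "Ck_on k n U \<phi> \<Longrightarrow> V \<subseteq> U \<Longrightarrow> Ck_on k n V \<phi>"
proof (induction k arbitrary: \<phi>)
  case (Suc k)
  then show ?case
    unfolding Ck_on_Suc_iff by (meson continuous_map_from_subtopology_mono has_partial_subset)
qed (auto intro: continuous_map_from_subtopology_mono)

lemma Ck_on_Suc: "Ck_on (Suc k) n U \<phi> \<Longrightarrow> Ck_on k n U \<phi>"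
proof (induction k arbitrary: \<phi>)
  case (Suc k)
  then show ?case
    unfolding Ck_on_Suc_iff[of "Suc k"] Ck_on_Suc_iff[of k n U \<phi>] by blast
qed (simp add: Ck_on_Suc_iff)

text \<open>
  Partial derivatives at the points of an open set depend on the restriction of the function to that
  set only.
\<close>

lemma eventually_line_in_open:
  assumes U: "openin (Euclidean_space n) U" and "v \<in> U" "i < n"
  shows "\<forall>\<^sub>F t in nhds (v i). v(i := t) \<in> U"
proof -
  have v: "v \<in> topspace (Euclidean_space n)"
    using openin_subset[OF U] \<open>v \<in> U\<close> by blast
  have "continuous_map euclideanreal (Euclidean_space n) (\<lambda>t. v(i := t))"
    unfolding Euclidean_space_def
  proof (rule continuous_map_into_subtopology)
    show "continuous_map euclideanreal (powertop_real UNIV) (\<lambda>t. v(i := t))"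
      unfolding continuous_map_componentwise_UNIV
      by (intro allI) (auto simp: fun_upd_def)
    show "(\<lambda>t. v(i := t)) \<in> topspace euclideanreal \<rightarrow> {x. \<forall>i\<ge>n. x i = 0}"
      using v \<open>i < n\<close> by (auto simp: topspace_Euclidean_space)
  qed
  from openin_continuous_map_preimage[OF this U] have "open {t. v(i := t) \<in> U}"
    by simp
  then show ?thesis
    using \<open>v \<in> U\<close> unfolding eventually_nhds by (intro exI[of _ "{t. v(i := t) \<in> U}"]) auto
qed

lemma has_partial_cong:
  assumes U: "openin (Euclidean_space n) U" and eq: "\<And>v. v \<in> U \<Longrightarrow> \<phi> v = \<phi>' v" and "i < n"
    and "has_partial i U \<phi> \<psi>"
  shows "has_partial i U \<phi>' \<psi>"
proof (rule has_partialI)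
  fix v assume v: "v \<in> U"
  have ev: "\<forall>\<^sub>F t in nhds (v i). \<phi> (v(i := t)) = \<phi>' (v(i := t))"
    using eventually_line_in_open[OF U v \<open>i < n\<close>] by eventually_elim (rule eq)
  show "((\<lambda>t. \<phi>' (v(i := t))) has_real_derivative \<psi> v) (at (v i))"
    using has_partialD[OF assms(4) v] DERIV_cong_ev[OF refl ev refl] by simp
qed

lemma Ck_on_cong:
  assumes U: "openin (Euclidean_space n) U" and eq: "\<And>v. v \<in> U \<Longrightarrow> \<phi> v = \<phi>' v" and C: "Ck_on k n U \<phi>"
  shows "Ck_on k n U \<phi>'"
proof -
  have cont: "continuous_map (subtopology (Euclidean_space n) U) euclideanreal \<phi>'"
    by (rule continuous_map_eq[OF Ck_on_continuous[OF C]]) (use eq in auto)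
  show ?thesis
  proof (cases k)
    case (Suc l)
    have "\<exists>\<psi>. has_partial i U \<phi>' \<psi> \<and> Ck_on l n U \<psi>" if i: "i < n" for i
    proof -
      obtain \<psi> where "has_partial i U \<phi> \<psi>" "Ck_on l n U \<psi>"
        using C[unfolded Suc] i by (rule Ck_on_SucE)
      then show ?thesis
        using has_partial_cong[OF U, of \<phi> \<phi>', OF eq i] by blast
    qed
    then show ?thesis
      using cont by (simp add: Suc Ck_on_Suc_iff)
  qed (use cont in simp)
qed

lemma continuous_map_local:
  assumes loc: "\<forall>v\<in>U. \<exists>V. openin X V \<and> v \<in> V \<and> V \<subseteq> U \<and> continuous_map (subtopology X V) Y \<phi>"
  shows "continuous_map (subtopology X U) Y \<phi>"
  unfolding continuous_map_eq_topcontinuous_at topcontinuous_at_def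
proof (intro ballI conjI allI impI)
  show "\<phi> \<in> topspace (subtopology X U) \<rightarrow> topspace Y"
  proof
    fix v assume v: "v \<in> topspace (subtopology X U)"
    then obtain V where "v \<in> topspace (subtopology X V)" "continuous_map (subtopology X V) Y \<phi>"
      using loc by auto
    then show "\<phi> v \<in> topspace Y"
      using continuous_map_image_subset_topspace by blast
  qed
next
  fix v assume v: "v \<in> topspace (subtopology X U)"
  then show "v \<in> topspace (subtopology X U)" .
next
  fix v W assume v: "v \<in> topspace (subtopology X U)" and W: "openin Y W \<and> \<phi> v \<in> W"
  then obtain V where V: "openin X V" "v \<in> V" "V \<subseteq> U" "continuous_map (subtopology X V) Y \<phi>"
    using loc by auto
  have vV: "v \<in> topspace (subtopology X V)"
    using v V by auto
  let ?S = "{x \<in> topspace (subtopology X V). \<phi> x \<in> W}"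
  have "openin (subtopology X V) ?S"
    by (rule openin_continuous_map_preimage[OF V(4)]) (use W in simp)
  then have "openin X ?S"
    using V(1) openin_trans_full by blast
  then have "openin (subtopology X U) (?S \<inter> U)"
    by (auto simp: openin_subtopology)
  then show "\<exists>S. openin (subtopology X U) S \<and> v \<in> S \<and> (\<forall>y\<in>S. \<phi> y \<in> W)"
    using V vV W by (intro exI[of _ "?S \<inter> U"]) auto
qed

lemma Ck_on_local:
  assumes U: "openin (Euclidean_space n) U"
    and "\<forall>v\<in>U. \<exists>V. openin (Euclidean_space n) V \<and> v \<in> V \<and> V \<subseteq> U \<and> Ck_on k n V \<phi>"
  shows "Ck_on k n U \<phi>"
  using assms(2)
proof (induction k arbitrary: \<phi>)
  case 0
  then show ?case
    unfolding Ck_on.simps(1) by (rule continuous_map_local)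
next
  case (Suc k)
  have "continuous_map (subtopology (Euclidean_space n) U) euclideanreal \<phi>"
  proof (rule continuous_map_local, rule ballI)
    fix v assume "v \<in> U"
    then obtain V where "openin (Euclidean_space n) V" "v \<in> V" "V \<subseteq> U" "Ck_on (Suc k) n V \<phi>"
      using Suc.prems by blast
    then show "\<exists>V. openin (Euclidean_space n) V \<and> v \<in> V \<and> V \<subseteq> U \<and>
        continuous_map (subtopology (Euclidean_space n) V) euclideanreal \<phi>"
      using Ck_on_continuous by (intro exI[of _ V]) simp
  qed
  moreover have "\<exists>\<psi>. has_partial i U \<phi> \<psi> \<and> Ck_on k n U \<psi>"
    if i: "i < n" for i
  proof -
    \<comment> \<open>By uniqueness of derivatives the local partial derivatives are restrictions of one function.\<close>
    define \<psi> where "\<psi> = (\<lambda>v. THE d. ((\<lambda>t. \<phi> (v(i := t))) has_real_derivative d) (at (v i)))"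
    have \<psi>: "\<psi> v = d" if "((\<lambda>t. \<phi> (v(i := t))) has_real_derivative d) (at (v i))" for v d
    proof -
      have "(THE d'. ((\<lambda>t. \<phi> (v(i := t))) has_real_derivative d') (at (v i))) = d"
      proof (rule the_equality)
        show "((\<lambda>t. \<phi> (v(i := t))) has_real_derivative d) (at (v i))" by (rule that)
      qed (rule DERIV_unique[OF _ that])
      then show ?thesis
        unfolding \<psi>_def .
    qed
    have loc: "\<exists>V. openin (Euclidean_space n) V \<and> v \<in> V \<and> V \<subseteq> U \<and> has_partial i V \<phi> \<psi> \<and> Ck_on k n V \<psi>"
      if v: "v \<in> U" for v
    proof -
      obtain V where V: "openin (Euclidean_space n) V" "v \<in> V" "V \<subseteq> U" "Ck_on (Suc k) n V \<phi>"
        using Suc.prems v by blast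
      obtain \<eta> where \<eta>: "has_partial i V \<phi> \<eta>" "Ck_on k n V \<eta>"
        using V(4) i by (rule Ck_on_SucE)
      have eq: "\<eta> w = \<psi> w" if "w \<in> V" for w
        using \<psi>[OF has_partialD[OF \<eta>(1) that]] by simp
      have "has_partial i V \<phi> \<psi>"
      proof (rule has_partialI)
        fix w assume w: "w \<in> V"
        show "((\<lambda>t. \<phi> (w(i := t))) has_real_derivative \<psi> w) (at (w i))"
          using has_partialD[OF \<eta>(1) w] unfolding eq[OF w] .
      qed
      moreover have "Ck_on k n V \<psi>"
        by (rule Ck_on_cong[OF V(1) _ \<eta>(2)]) (rule eq)
      ultimately show ?thesis
        using V by (intro exI[of _ V] conjI)
    qed
    have "has_partial i U \<phi> \<psi>"
    proof (rule has_partialI)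
      fix v assume "v \<in> U"
      then obtain V where "v \<in> V" "has_partial i V \<phi> \<psi>"
        using loc by blast
      then show "((\<lambda>t. \<phi> (v(i := t))) has_real_derivative \<psi> v) (at (v i))"
        by (intro has_partialD)
    qed
    moreover have "Ck_on k n U \<psi>"
      by (rule Suc.IH) (use loc in blast)
    ultimately show ?thesis by blast
  qed
  ultimately show ?case
    by (simp add: Ck_on_Suc_iff)
qed

lemma Ck_on_const: "Ck_on k n U (\<lambda>_. c)"
proof (induction k arbitrary: c)
  case (Suc k)
  have "has_partial i U (\<lambda>_. c) (\<lambda>_. 0)" for i
    by (simp add: has_partial_def)
  then show ?case
    unfolding Ck_on_Suc_iff using Suc by auto
qed simp

lemma Ck_on_coordinate: "Ck_on k n U (\<lambda>v. v i)"
proof -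
  have cont: "continuous_map (subtopology (Euclidean_space n) U) euclideanreal (\<lambda>v. v i)"
    unfolding Euclidean_space_def
    by (intro continuous_map_from_subtopology continuous_map_product_projection) simp
  show ?thesis
  proof (cases k)
    case (Suc l)
    have "has_partial j U (\<lambda>v. v i) (\<lambda>_. if i = j then 1 else 0)" for j
      by (simp add: has_partial_def)
    then show ?thesis
      using cont Ck_on_const unfolding Suc Ck_on_Suc_iff by blast
  qed (use cont in simp)
qed

lemma Ck_on_add: "Ck_on k n U \<phi> \<Longrightarrow> Ck_on k n U \<psi> \<Longrightarrow> Ck_on k n U (\<lambda>v. \<phi> v + \<psi> v)"
proof (induction k arbitrary: \<phi> \<psi>)
  case (Suc k)
  have "\<exists>\<eta>. has_partial i U (\<lambda>v. \<phi> v + \<psi> v) \<eta> \<and> Ck_on k n U \<eta>" if i: "i < n" for i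
  proof -
    obtain \<phi>' where \<phi>': "has_partial i U \<phi> \<phi>'" "Ck_on k n U \<phi>'"
      using Suc.prems(1) i by (rule Ck_on_SucE)
    obtain \<psi>' where \<psi>': "has_partial i U \<psi> \<psi>'" "Ck_on k n U \<psi>'"
      using Suc.prems(2) i by (rule Ck_on_SucE)
    have "has_partial i U (\<lambda>v. \<phi> v + \<psi> v) (\<lambda>v. \<phi>' v + \<psi>' v)"
      by (rule has_partialI) (intro DERIV_add has_partialD[OF \<phi>'(1)] has_partialD[OF \<psi>'(1)])
    with Suc.IH[OF \<phi>'(2) \<psi>'(2)] show ?thesis by blast
  qed
  then show ?case
    using Suc.prems by (simp add: Ck_on_Suc_iff continuous_map_add)
qed (simp add: continuous_map_add)

lemma Ck_on_mult: "Ck_on k n U \<phi> \<Longrightarrow> Ck_on k n U \<psi> \<Longrightarrow> Ck_on k n U (\<lambda>v. \<phi> v * \<psi> v)"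
proof (induction k arbitrary: \<phi> \<psi>)
  case (Suc k)
  have "\<exists>\<eta>. has_partial i U (\<lambda>v. \<phi> v * \<psi> v) \<eta> \<and> Ck_on k n U \<eta>" if i: "i < n" for i
  proof -
    obtain \<phi>' where \<phi>': "has_partial i U \<phi> \<phi>'" "Ck_on k n U \<phi>'"
      using Suc.prems(1) i by (rule Ck_on_SucE)
    obtain \<psi>' where \<psi>': "has_partial i U \<psi> \<psi>'" "Ck_on k n U \<psi>'"
      using Suc.prems(2) i by (rule Ck_on_SucE)
    have "has_partial i U (\<lambda>v. \<phi> v * \<psi> v) (\<lambda>v. \<phi>' v * \<psi> v + \<psi>' v * \<phi> v)"
    proof (rule has_partialI)
      fix v assume v: "v \<in> U"
      show "((\<lambda>t. \<phi> (v(i := t)) * \<psi> (v(i := t))) has_real_derivative \<phi>' v * \<psi> v + \<psi>' v * \<phi> v) (at (v i))"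
        using DERIV_mult[OF has_partialD[OF \<phi>'(1) v] has_partialD[OF \<psi>'(1) v]] by simp
    qed
    moreover have "Ck_on k n U (\<lambda>v. \<phi>' v * \<psi> v + \<psi>' v * \<phi> v)"
      by (intro Ck_on_add Suc.IH \<phi>' \<psi>' Ck_on_Suc[OF Suc.prems(1)] Ck_on_Suc[OF Suc.prems(2)])
    ultimately show ?thesis by blast
  qed
  then show ?case
    using Suc.prems by (simp add: Ck_on_Suc_iff continuous_map_real_mult)
qed (simp add: continuous_map_real_mult)

lemma Ck_on_cmult: "Ck_on k n U \<phi> \<Longrightarrow> Ck_on k n U (\<lambda>v. c * \<phi> v)"
  using Ck_on_mult[OF Ck_on_const] .

lemma continuous_map_real_compose:
  assumes "continuous_map X euclideanreal f" "continuous_on UNIV h"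
  shows "continuous_map X euclideanreal (\<lambda>x. h (f x) :: real)"
proof -
  have "continuous_map euclideanreal euclideanreal h"
    using assms(2) by simp
  from continuous_map_compose[OF assms(1) this] show ?thesis
    by (simp add: comp_def)
qed

text \<open>Both at once, since the derivative of either function contains the other one.\<close>

lemma Ck_on_sin_cos: "Ck_on k n U \<phi> \<Longrightarrow> Ck_on k n U (\<lambda>v. sin (\<phi> v)) \<and> Ck_on k n U (\<lambda>v. cos (\<phi> v))"
proof (induction k arbitrary: \<phi>)
  case 0
  then show ?case
    using continuous_map_real_compose[of _ \<phi> sin] continuous_map_real_compose[of _ \<phi> cos]
    by (simp add: continuous_on_sin continuous_on_cos)
next
  case (Suc k)
  note sc = Suc.IH[OF Ck_on_Suc[OF Suc.prems]]
  have "(\<exists>\<eta>. has_partial i U (\<lambda>v. sin (\<phi> v)) \<eta> \<and> Ck_on k n U \<eta>) \<and>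
     (\<exists>\<eta>. has_partial i U (\<lambda>v. cos (\<phi> v)) \<eta> \<and> Ck_on k n U \<eta>)"
    if i: "i < n" for i
  proof -
    obtain \<phi>' where \<phi>': "has_partial i U \<phi> \<phi>'" "Ck_on k n U \<phi>'"
      using Suc.prems i by (rule Ck_on_SucE)
    have "has_partial i U (\<lambda>v. sin (\<phi> v)) (\<lambda>v. cos (\<phi> v) * \<phi>' v)"
      "has_partial i U (\<lambda>v. cos (\<phi> v)) (\<lambda>v. (-1) * sin (\<phi> v) * \<phi>' v)"
      by (rule has_partialI, drule has_partialD[OF \<phi>'(1)], auto intro!: derivative_eq_intros)+
    moreover have "Ck_on k n U (\<lambda>v. cos (\<phi> v) * \<phi>' v)" "Ck_on k n U (\<lambda>v. (-1) * sin (\<phi> v) * \<phi>' v)"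
      by (intro Ck_on_mult[OF _ \<phi>'(2)] Ck_on_cmult sc[THEN conjunct1] sc[THEN conjunct2])+
    ultimately show ?thesis by blast
  qed
  then show ?case
    using continuous_map_real_compose[OF Ck_on_continuous[OF Suc.prems], of sin]
      continuous_map_real_compose[OF Ck_on_continuous[OF Suc.prems], of cos]
    by (simp add: Ck_on_Suc_iff continuous_on_sin continuous_on_cos)
qed

text \<open>
  The derivative of the angle of a unit vector \<open>(x, y)\<close> is \<open>x y' - y x'\<close>, without a quotient; so the
  differentiability of products gives that of the angle.
\<close>

lemma Ck_on_angle:
  assumes x: "Ck_on k n U x" and y: "Ck_on k n U y"
    and unit: "\<And>v. v \<in> U \<Longrightarrow> (x v)\<^sup>2 + (y v)\<^sup>2 = 1" and pos: "\<And>v. v \<in> U \<Longrightarrow> x v > 0"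
  shows "Ck_on k n U (\<lambda>v. arctan (y v / x v))"
proof -
  have "continuous_map (subtopology (Euclidean_space n) U) euclideanreal (\<lambda>v. y v / x v)"
    by (intro continuous_map_real_divide Ck_on_continuous[OF x] Ck_on_continuous[OF y])
      (use pos in force)
  then have cont: "continuous_map (subtopology (Euclidean_space n) U) euclideanreal (\<lambda>v. arctan (y v / x v))"
    by (rule continuous_map_real_compose) (intro continuous_on_arctan continuous_on_id)
  show ?thesis
  proof (cases k)
    case (Suc l)
    have "\<exists>\<eta>. has_partial i U (\<lambda>v. arctan (y v / x v)) \<eta> \<and> Ck_on l n U \<eta>"
      if i: "i < n" for i
    proof -
      obtain x' where x': "has_partial i U x x'" "Ck_on l n U x'"
        using x[unfolded Suc] i by (rule Ck_on_SucE)
      obtain y' where y': "has_partial i U y y'" "Ck_on l n U y'"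
        using y[unfolded Suc] i by (rule Ck_on_SucE)
      have "has_partial i U (\<lambda>v. arctan (y v / x v)) (\<lambda>v. x v * y' v + (-1) * (y v * x' v))"
      proof (rule has_partialI)
        fix v assume v: "v \<in> U"
        have nz: "x v \<noteq> 0"
          using pos[OF v] by simp
        have "((\<lambda>t. arctan (y (v(i := t)) / x (v(i := t)))) has_real_derivative
           inverse (1 + (y v / x v)\<^sup>2) * ((y' v * x v - y v * x' v) / (x v * x v))) (at (v i))"
          using DERIV_chain'[OF DERIV_divide[OF has_partialD[OF y'(1) v] has_partialD[OF x'(1) v]] DERIV_arctan] nz
          by (simp add: mult.commute)
        moreover have "inverse (1 + (y v / x v)\<^sup>2) = (x v)\<^sup>2"
          using unit[OF v] nz by (simp add: power_divide field_simps)
        moreover have "(x v)\<^sup>2 * ((y' v * x v - y v * x' v) / (x v * x v)) = x v * y' v + (-1) * (y v * x' v)"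
          using nz by (simp add: power2_eq_square)
        ultimately show "((\<lambda>t. arctan (y (v(i := t)) / x (v(i := t)))) has_real_derivative
            x v * y' v + (-1) * (y v * x' v)) (at (v i))"
          by (simp only:)
      qed
      moreover have "Ck_on l n U (\<lambda>v. x v * y' v + (-1) * (y v * x' v))"
        by (intro Ck_on_add Ck_on_mult Ck_on_cmult x' y' Ck_on_Suc[OF x[unfolded Suc]] Ck_on_Suc[OF y[unfolded Suc]] Ck_on_const)
      ultimately show ?thesis by blast
    qed
    with cont show ?thesis
      by (simp add: Suc Ck_on_Suc_iff)
  qed (use cont in simp)
qed


section \<open>Local diffeologies and smooth groups\<close>

text \<open>
  Plots form a sheaf, but reparametrizations are limited to inclusions of open sets. This weakening of
  a diffeology determines the D-topology in the same way, and it passes to subspaces, products and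
  final diffeologies by local arguments alone, without the chain rule for functions of several
  variables. In particular it covers \<open>\<real>\<close>, \<open>U(1)\<close> and the universal bundle.
\<close>

definition local_diffeology :: "'a diff_space \<Rightarrow> bool" where
  "local_diffeology X \<longleftrightarrow>
     (\<forall>n U p. plots X n U p \<longrightarrow> openin (Euclidean_space n) U \<and> p ` U \<subseteq> points X) \<and>
     (\<forall>n U p p'. plots X n U p \<and> (\<forall>v\<in>U. p v = p' v) \<longrightarrow> plots X n U p') \<and>
     (\<forall>n U x. openin (Euclidean_space n) U \<and> x \<in> points X \<longrightarrow> plots X n U (\<lambda>_. x)) \<and>
     (\<forall>n U p. openin (Euclidean_space n) U \<and>
        (\<forall>v\<in>U. \<exists>V. openin (Euclidean_space n) V \<and> v \<in> V \<and> V \<subseteq> U \<and> plots X n V p) \<longrightarrow>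
        plots X n U p) \<and>
     (\<forall>n U V p. plots X n U p \<and> openin (Euclidean_space n) V \<and> V \<subseteq> U \<longrightarrow> plots X n V p)"

lemma local_diffeologyI:
  assumes "\<And>n U p. plots X n U p \<Longrightarrow> openin (Euclidean_space n) U"
    and "\<And>n U p v. plots X n U p \<Longrightarrow> v \<in> U \<Longrightarrow> p v \<in> points X"
    and "\<And>n U p p'. plots X n U p \<Longrightarrow> (\<And>v. v \<in> U \<Longrightarrow> p v = p' v) \<Longrightarrow> plots X n U p'"
    and "\<And>n U x. openin (Euclidean_space n) U \<Longrightarrow> x \<in> points X \<Longrightarrow> plots X n U (\<lambda>_. x)"
    and "\<And>n U p. openin (Euclidean_space n) U \<Longrightarrow>
      (\<And>v. v \<in> U \<Longrightarrow> \<exists>V. openin (Euclidean_space n) V \<and> v \<in> V \<and> V \<subseteq> U \<and> plots X n V p) \<Longrightarrow>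
      plots X n U p"
    and "\<And>n U V p. plots X n U p \<Longrightarrow> openin (Euclidean_space n) V \<Longrightarrow> V \<subseteq> U \<Longrightarrow> plots X n V p"
  shows "local_diffeology X"
  unfolding local_diffeology_def
proof (intro conjI allI impI; (elim conjE)?)
  fix n U p assume "plots X n U p"
  then show "openin (Euclidean_space n) U" "p ` U \<subseteq> points X"
    using assms(1,2) by (simp, intro image_subsetI)
next
  fix n U p p' assume "plots X n U p" "\<forall>v\<in>U. p v = p' v"
  then show "plots X n U p'"
    by (intro assms(3)[of n U p p']) (assumption, erule (1) bspec)
next
  fix n U x assume "openin (Euclidean_space n) U" "x \<in> points X"
  then show "plots X n U (\<lambda>_. x)" by (rule assms(4))
next
  fix n U p assume "openin (Euclidean_space n) U"
    "\<forall>v\<in>U. \<exists>V. openin (Euclidean_space n) V \<and> v \<in> V \<and> V \<subseteq> U \<and> plots X n V p"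
  then show "plots X n U p"
    by (intro assms(5)[of n U p]) (assumption, erule (1) bspec)
next
  fix n U V p assume "plots X n U p" "openin (Euclidean_space n) V" "V \<subseteq> U"
  then show "plots X n V p" by (rule assms(6))
qed

context
  fixes X :: "'a diff_space"
  assumes X: "local_diffeology X"
begin

lemma plot_open: "plots X n U p \<Longrightarrow> openin (Euclidean_space n) U"
  using X[unfolded local_diffeology_def, THEN conjunct1, rule_format, of n U p] by (rule conjunct1)

lemma plot_points: "plots X n U p \<Longrightarrow> v \<in> U \<Longrightarrow> p v \<in> points X"
  using X[unfolded local_diffeology_def, THEN conjunct1, rule_format, of n U p] by blast

lemma plot_cong: "plots X n U p \<Longrightarrow> (\<And>v. v \<in> U \<Longrightarrow> p v = p' v) \<Longrightarrow> plots X n U p'"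
  using X[unfolded local_diffeology_def, THEN conjunct2, THEN conjunct1, rule_format, of n U p p'] by simp

lemma plot_const: "openin (Euclidean_space n) U \<Longrightarrow> x \<in> points X \<Longrightarrow> plots X n U (\<lambda>_. x)"
  using X[unfolded local_diffeology_def, THEN conjunct2, THEN conjunct2, THEN conjunct1, rule_format, of n U x]
  by simp

lemma plot_local: "openin (Euclidean_space n) U \<Longrightarrow>
    (\<And>v. v \<in> U \<Longrightarrow> \<exists>V. openin (Euclidean_space n) V \<and> v \<in> V \<and> V \<subseteq> U \<and> plots X n V p) \<Longrightarrow>
    plots X n U p"
  using X[unfolded local_diffeology_def, THEN conjunct2, THEN conjunct2, THEN conjunct2, THEN conjunct1,
      rule_format, of n U p] by simp

lemma plot_restrict: "plots X n U p \<Longrightarrow> openin (Euclidean_space n) V \<Longrightarrow> V \<subseteq> U \<Longrightarrow> plots X n V p"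
  using X[unfolded local_diffeology_def, THEN conjunct2, THEN conjunct2, THEN conjunct2, THEN conjunct2,
      rule_format, of n U p V] by simp

end

lemma diffeological_imp_local:
  assumes "diffeological_space X"
  shows "local_diffeology X"
proof -
  note X = assms[unfolded diffeological_space_def]
  have "plots X n V p" if "plots X n U p" "openin (Euclidean_space n) V" "V \<subseteq> U" for n U V p
  proof -
    have "plots X n U p \<and> openin (Euclidean_space n) V \<and> (\<lambda>v. v) ` V \<subseteq> U \<and> (\<forall>i<n. smooth_fun n V (\<lambda>v. v i))"
      using that by (auto simp: smooth_fun_def Ck_on_coordinate)
    from X[THEN conjunct2, THEN conjunct2, THEN conjunct2, THEN conjunct2, rule_format, OF this]
    show ?thesis
      by (simp add: comp_def)
  qed
  then show ?thesis
    unfolding local_diffeology_def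
    by (intro conjI X[THEN conjunct1] X[THEN conjunct2, THEN conjunct1]
        X[THEN conjunct2, THEN conjunct2, THEN conjunct1]
        X[THEN conjunct2, THEN conjunct2, THEN conjunct2, THEN conjunct1] allI impI; elim conjE)
qed

lemma local_diffeology_real: "local_diffeology real_diff"
  unfolding real_diff_def smooth_fun_def
proof (rule local_diffeologyI; unfold diff_space.select_convs)
  fix n U and p p' :: "(nat \<Rightarrow> real) \<Rightarrow> real"
  assume "openin (Euclidean_space n) U \<and> (\<forall>k. Ck_on k n U p)" "\<And>v. v \<in> U \<Longrightarrow> p v = p' v"
  then show "openin (Euclidean_space n) U \<and> (\<forall>k. Ck_on k n U p')"
    using Ck_on_cong[of n U p p'] by simp
next
  fix n U and p :: "(nat \<Rightarrow> real) \<Rightarrow> real"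
  assume U: "openin (Euclidean_space n) U" and
    loc: "\<And>v. v \<in> U \<Longrightarrow> \<exists>V. openin (Euclidean_space n) V \<and> v \<in> V \<and> V \<subseteq> U \<and>
      openin (Euclidean_space n) V \<and> (\<forall>k. Ck_on k n V p)"
  have "Ck_on k n U p" for k
    by (rule Ck_on_local[OF U]) (use loc in blast)
  with U show "openin (Euclidean_space n) U \<and> (\<forall>k. Ck_on k n U p)" by simp
next
  fix n U V and p :: "(nat \<Rightarrow> real) \<Rightarrow> real"
  assume "openin (Euclidean_space n) U \<and> (\<forall>k. Ck_on k n U p)" "openin (Euclidean_space n) V" "V \<subseteq> U"
  then show "openin (Euclidean_space n) V \<and> (\<forall>k. Ck_on k n V p)"
    using Ck_on_subset[of _ n U p V] by simp
qed (simp_all add: Ck_on_const)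

lemma local_diffeology_complex: "local_diffeology complex_diff"
  unfolding complex_diff_def smooth_fun_def comp_def
proof (rule local_diffeologyI; unfold diff_space.select_convs)
  fix n U and p p' :: "(nat \<Rightarrow> real) \<Rightarrow> complex"
  assume "openin (Euclidean_space n) U \<and> (\<forall>k. Ck_on k n U (\<lambda>v. Re (p v))) \<and> (\<forall>k. Ck_on k n U (\<lambda>v. Im (p v)))"
    "\<And>v. v \<in> U \<Longrightarrow> p v = p' v"
  then show "openin (Euclidean_space n) U \<and> (\<forall>k. Ck_on k n U (\<lambda>v. Re (p' v))) \<and> (\<forall>k. Ck_on k n U (\<lambda>v. Im (p' v)))"
    using Ck_on_cong[of n U "\<lambda>v. Re (p v)" "\<lambda>v. Re (p' v)"] Ck_on_cong[of n U "\<lambda>v. Im (p v)" "\<lambda>v. Im (p' v)"]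
    by simp
next
  fix n U and p :: "(nat \<Rightarrow> real) \<Rightarrow> complex"
  assume U: "openin (Euclidean_space n) U" and
    loc: "\<And>v. v \<in> U \<Longrightarrow> \<exists>V. openin (Euclidean_space n) V \<and> v \<in> V \<and> V \<subseteq> U \<and>
      openin (Euclidean_space n) V \<and> (\<forall>k. Ck_on k n V (\<lambda>v. Re (p v))) \<and> (\<forall>k. Ck_on k n V (\<lambda>v. Im (p v)))"
  have loc': "\<exists>V. openin (Euclidean_space n) V \<and> v \<in> V \<and> V \<subseteq> U \<and>
      Ck_on k n V (\<lambda>v. Re (p v)) \<and> Ck_on k n V (\<lambda>v. Im (p v))" if v: "v \<in> U" for v k
  proof -
    obtain V where "openin (Euclidean_space n) V" "v \<in> V" "V \<subseteq> U"
        "\<forall>k. Ck_on k n V (\<lambda>v. Re (p v))" "\<forall>k. Ck_on k n V (\<lambda>v. Im (p v))"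
      using loc[OF v] by auto
    then show ?thesis
      by (intro exI[of _ V]) simp
  qed
  have "Ck_on k n U (\<lambda>v. Re (p v))" for k
    by (rule Ck_on_local[OF U], rule ballI, drule loc'[of _ k], elim exE conjE, intro exI conjI)
  moreover have "Ck_on k n U (\<lambda>v. Im (p v))" for k
    by (rule Ck_on_local[OF U], rule ballI, drule loc'[of _ k], elim exE conjE, intro exI conjI)
  ultimately show "openin (Euclidean_space n) U \<and> (\<forall>k. Ck_on k n U (\<lambda>v. Re (p v))) \<and> (\<forall>k. Ck_on k n U (\<lambda>v. Im (p v)))"
    using U by simp
next
  fix n U V and p :: "(nat \<Rightarrow> real) \<Rightarrow> complex"
  assume "openin (Euclidean_space n) U \<and> (\<forall>k. Ck_on k n U (\<lambda>v. Re (p v))) \<and> (\<forall>k. Ck_on k n U (\<lambda>v. Im (p v)))"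
    "openin (Euclidean_space n) V" "V \<subseteq> U"
  then show "openin (Euclidean_space n) V \<and> (\<forall>k. Ck_on k n V (\<lambda>v. Re (p v))) \<and> (\<forall>k. Ck_on k n V (\<lambda>v. Im (p v)))"
    using Ck_on_subset[of _ n U "\<lambda>v. Re (p v)" V] Ck_on_subset[of _ n U "\<lambda>v. Im (p v)" V] by simp
qed (simp_all add: Ck_on_const)

lemma local_diffeology_subspace:
  assumes "local_diffeology X"
  shows "local_diffeology (subspace_diff X A)"
  unfolding subspace_diff_def
proof (rule local_diffeologyI; unfold diff_space.select_convs)
  fix n U p p' assume p: "plots X n U p \<and> p ` U \<subseteq> A" and eq: "\<And>v. v \<in> U \<Longrightarrow> p v = p' v"
  show "plots X n U p' \<and> p' ` U \<subseteq> A"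
    using plot_cong[OF assms p[THEN conjunct1] eq] p eq by (simp add: image_subset_iff)
next
  fix n U p
  assume U: "openin (Euclidean_space n) U" and
    loc: "\<And>v. v \<in> U \<Longrightarrow> \<exists>V. openin (Euclidean_space n) V \<and> v \<in> V \<and> V \<subseteq> U \<and> plots X n V p \<and> p ` V \<subseteq> A"
  have "plots X n U p"
    by (rule plot_local[OF assms U]) (use loc in blast)
  then show "plots X n U p \<and> p ` U \<subseteq> A"
    using loc by blast
next
  fix n U V p assume "plots X n U p \<and> p ` U \<subseteq> A" "openin (Euclidean_space n) V" "V \<subseteq> U"
  then show "plots X n V p \<and> p ` V \<subseteq> A"
    using plot_restrict[OF assms, of n U p V] image_mono[of V U p] by auto
next
  fix n U p v assume "plots X n U p \<and> p ` U \<subseteq> A" "v \<in> U"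
  then show "p v \<in> points X \<inter> A"
    using plot_points[OF assms, of n U p v] by (simp add: image_subset_iff)
next
  fix n U x assume "openin (Euclidean_space n) U" "x \<in> points X \<inter> A"
  then show "plots X n U (\<lambda>_. x) \<and> (\<lambda>_. x) ` U \<subseteq> A"
    using plot_const[OF assms, of n U x] by (simp add: image_subset_iff)
next
  fix n U p assume "plots X n U p \<and> p ` U \<subseteq> A"
  then show "openin (Euclidean_space n) U"
    using plot_open[OF assms, of n U p] by simp
qed

lemma local_diffeology_prod:
  assumes X: "local_diffeology X" and Y: "local_diffeology Y"
  shows "local_diffeology (prod_diff X Y)"
  unfolding prod_diff_def comp_def
proof (rule local_diffeologyI; unfold diff_space.select_convs)
  fix n U and p p' :: "(nat \<Rightarrow> real) \<Rightarrow> 'a \<times> 'b"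
  assume p: "plots X n U (\<lambda>v. fst (p v)) \<and> plots Y n U (\<lambda>v. snd (p v))" and eq: "\<And>v. v \<in> U \<Longrightarrow> p v = p' v"
  show "plots X n U (\<lambda>v. fst (p' v)) \<and> plots Y n U (\<lambda>v. snd (p' v))"
    using plot_cong[OF X p[THEN conjunct1], of "\<lambda>v. fst (p' v)"] plot_cong[OF Y p[THEN conjunct2], of "\<lambda>v. snd (p' v)"] eq
    by simp
next
  fix n U and p :: "(nat \<Rightarrow> real) \<Rightarrow> 'a \<times> 'b"
  assume U: "openin (Euclidean_space n) U" and
    loc: "\<And>v. v \<in> U \<Longrightarrow> \<exists>V. openin (Euclidean_space n) V \<and> v \<in> V \<and> V \<subseteq> U \<and>
      plots X n V (\<lambda>v. fst (p v)) \<and> plots Y n V (\<lambda>v. snd (p v))"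
  have "plots X n U (\<lambda>v. fst (p v))"
    by (rule plot_local[OF X U]) (use loc in blast)
  moreover have "plots Y n U (\<lambda>v. snd (p v))"
    by (rule plot_local[OF Y U]) (use loc in blast)
  ultimately show "plots X n U (\<lambda>v. fst (p v)) \<and> plots Y n U (\<lambda>v. snd (p v))" ..
next
  fix n U v and p :: "(nat \<Rightarrow> real) \<Rightarrow> 'a \<times> 'b"
  assume p: "plots X n U (\<lambda>v. fst (p v)) \<and> plots Y n U (\<lambda>v. snd (p v))" and "v \<in> U"
  then show "p v \<in> points X \<times> points Y"
    using plot_points[OF X p[THEN conjunct1]] plot_points[OF Y p[THEN conjunct2]] by (simp add: mem_Times_iff)
next
  fix n U x assume "openin (Euclidean_space n) U" "x \<in> points X \<times> points Y"
  then show "plots X n U (\<lambda>_. fst x) \<and> plots Y n U (\<lambda>_. snd x)"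
    using plot_const[OF X] plot_const[OF Y] by (simp add: mem_Times_iff)
next
  fix n U V and p :: "(nat \<Rightarrow> real) \<Rightarrow> 'a \<times> 'b"
  assume "plots X n U (\<lambda>v. fst (p v)) \<and> plots Y n U (\<lambda>v. snd (p v))" "openin (Euclidean_space n) V" "V \<subseteq> U"
  then show "plots X n V (\<lambda>v. fst (p v)) \<and> plots Y n V (\<lambda>v. snd (p v))"
    using plot_restrict[OF X, of n U "\<lambda>v. fst (p v)" V] plot_restrict[OF Y, of n U "\<lambda>v. snd (p v)" V] by simp
next
  fix n U and p :: "(nat \<Rightarrow> real) \<Rightarrow> 'a \<times> 'b"
  assume "plots X n U (\<lambda>v. fst (p v)) \<and> plots Y n U (\<lambda>v. snd (p v))"
  then show "openin (Euclidean_space n) U"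
    using plot_open[OF X, of n U "\<lambda>v. fst (p v)"] by simp
qed

lemma local_diffeology_power:
  assumes X: "local_diffeology X"
  shows "local_diffeology (power_diff I X)"
  unfolding power_diff_def
proof (rule local_diffeologyI; unfold diff_space.select_convs)
  fix n U and p p' :: "(nat \<Rightarrow> real) \<Rightarrow> 'b \<Rightarrow> 'a"
  assume p: "openin (Euclidean_space n) U \<and> p ` U \<subseteq> I \<rightarrow>\<^sub>E points X \<and> (\<forall>i\<in>I. plots X n U (\<lambda>v. p v i))"
    and eq: "\<And>v. v \<in> U \<Longrightarrow> p v = p' v"
  have "plots X n U (\<lambda>v. p' v i)" if "i \<in> I" for i
    by (rule plot_cong[OF X, of n U "\<lambda>v. p v i"]) (use p eq that in auto)
  moreover have "p' ` U = p ` U"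
    using eq by (intro image_cong) auto
  ultimately show "openin (Euclidean_space n) U \<and> p' ` U \<subseteq> I \<rightarrow>\<^sub>E points X \<and> (\<forall>i\<in>I. plots X n U (\<lambda>v. p' v i))"
    using p by simp
next
  fix n U and x :: "'b \<Rightarrow> 'a"
  assume U: "openin (Euclidean_space n) U" and x: "x \<in> I \<rightarrow>\<^sub>E points X"
  have "plots X n U (\<lambda>_. x i)" if "i \<in> I" for i
    using PiE_mem[OF x that] by (rule plot_const[OF X U])
  then show "openin (Euclidean_space n) U \<and> (\<lambda>_. x) ` U \<subseteq> I \<rightarrow>\<^sub>E points X \<and> (\<forall>i\<in>I. plots X n U (\<lambda>_. x i))"
    using U x by (simp add: image_subset_iff)
next
  fix n U and p :: "(nat \<Rightarrow> real) \<Rightarrow> 'b \<Rightarrow> 'a"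
  assume U: "openin (Euclidean_space n) U" and
    loc: "\<And>v. v \<in> U \<Longrightarrow> \<exists>V. openin (Euclidean_space n) V \<and> v \<in> V \<and> V \<subseteq> U \<and> openin (Euclidean_space n) V \<and>
      p ` V \<subseteq> I \<rightarrow>\<^sub>E points X \<and> (\<forall>i\<in>I. plots X n V (\<lambda>v. p v i))"
  have "plots X n U (\<lambda>v. p v i)" if i: "i \<in> I" for i
  proof (rule plot_local[OF X U])
    fix v assume v: "v \<in> U"
    obtain V where "openin (Euclidean_space n) V" "v \<in> V" "V \<subseteq> U" "\<forall>i\<in>I. plots X n V (\<lambda>v. p v i)"
      using loc[OF v] by (elim exE conjE)
    then show "\<exists>V. openin (Euclidean_space n) V \<and> v \<in> V \<and> V \<subseteq> U \<and> plots X n V (\<lambda>v. p v i)"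
      using i by (intro exI[of _ V]) simp
  qed
  moreover have "p ` U \<subseteq> I \<rightarrow>\<^sub>E points X"
  proof (rule image_subsetI)
    fix v assume "v \<in> U"
    from loc[OF this] show "p v \<in> I \<rightarrow>\<^sub>E points X" by blast
  qed
  ultimately show "openin (Euclidean_space n) U \<and> p ` U \<subseteq> I \<rightarrow>\<^sub>E points X \<and> (\<forall>i\<in>I. plots X n U (\<lambda>v. p v i))"
    using U by simp
next
  fix n U V and p :: "(nat \<Rightarrow> real) \<Rightarrow> 'b \<Rightarrow> 'a"
  assume p: "openin (Euclidean_space n) U \<and> p ` U \<subseteq> I \<rightarrow>\<^sub>E points X \<and> (\<forall>i\<in>I. plots X n U (\<lambda>v. p v i))"
    and V: "openin (Euclidean_space n) V" "V \<subseteq> U"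
  have "plots X n V (\<lambda>v. p v i)" if "i \<in> I" for i
    by (rule plot_restrict[OF X _ V]) (use p that in simp)
  moreover have "p ` V \<subseteq> I \<rightarrow>\<^sub>E points X"
    by (rule order_trans[OF image_mono[OF V(2)]]) (use p in simp)
  ultimately show "openin (Euclidean_space n) V \<and> p ` V \<subseteq> I \<rightarrow>\<^sub>E points X \<and> (\<forall>i\<in>I. plots X n V (\<lambda>v. p v i))"
    using V by simp
next
  fix n U v and p :: "(nat \<Rightarrow> real) \<Rightarrow> 'b \<Rightarrow> 'a"
  assume "openin (Euclidean_space n) U \<and> p ` U \<subseteq> I \<rightarrow>\<^sub>E points X \<and> (\<forall>i\<in>I. plots X n U (\<lambda>v. p v i))" "v \<in> U"
  then show "p v \<in> I \<rightarrow>\<^sub>E points X"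
    by (simp add: image_subset_iff)
qed simp

lemma local_diffeology_final:
  assumes "\<And>S \<psi>. (S, \<psi>) \<in> \<F> \<Longrightarrow> local_diffeology S"
  shows "local_diffeology (final_diff Y \<F>)"
proof -
  define Q where "Q = (\<lambda>n V p. (\<exists>y. \<forall>w\<in>V. p w = y) \<or>
    (\<exists>(S, \<psi>)\<in>\<F>. \<exists>r. plots S n V r \<and> (\<forall>w\<in>V. p w = \<psi> (r w))))"
  have Q_sub: "Q n V' p" if "Q n V p" "openin (Euclidean_space n) V'" "V' \<subseteq> V" for n V V' p
    using that(1) unfolding Q_def
  proof
    assume "\<exists>(S, \<psi>)\<in>\<F>. \<exists>r. plots S n V r \<and> (\<forall>w\<in>V. p w = \<psi> (r w))"
    then obtain S \<psi> r where r: "(S, \<psi>) \<in> \<F>" "plots S n V r" "\<forall>w\<in>V. p w = \<psi> (r w)"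
      by auto
    have "plots S n V' r"
      by (rule plot_restrict[OF assms[OF r(1)] r(2) that(2,3)])
    with r that(3) have "\<exists>(S, \<psi>)\<in>\<F>. \<exists>r. plots S n V' r \<and> (\<forall>w\<in>V'. p w = \<psi> (r w))"
      by (intro bexI[of _ "(S, \<psi>)"]) auto
    then show "(\<exists>y. \<forall>w\<in>V'. p w = y) \<or> (\<exists>(S, \<psi>)\<in>\<F>. \<exists>r. plots S n V' r \<and> (\<forall>w\<in>V'. p w = \<psi> (r w)))" ..
  next
    assume "\<exists>y. \<forall>w\<in>V. p w = y"
    then have "\<exists>y. \<forall>w\<in>V'. p w = y"
      using that(3) by blast
    then show "(\<exists>y. \<forall>w\<in>V'. p w = y) \<or> (\<exists>(S, \<psi>)\<in>\<F>. \<exists>r. plots S n V' r \<and> (\<forall>w\<in>V'. p w = \<psi> (r w)))" ..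
  qed
  have Q_cong: "Q n V p'" if "Q n V p" "\<And>v. v \<in> V \<Longrightarrow> p v = p' v" for n V p p'
    using that by (simp add: Q_def cong: ball_cong)
  have "local_diffeology \<lparr>points = Y, plots = (\<lambda>n U p. openin (Euclidean_space n) U \<and> p ` U \<subseteq> Y \<and>
       (\<forall>v\<in>U. \<exists>V. openin (Euclidean_space n) V \<and> v \<in> V \<and> V \<subseteq> U \<and> Q n V p))\<rparr>"
  proof (rule local_diffeologyI; unfold diff_space.select_convs)
    fix n U p p'
    assume p: "openin (Euclidean_space n) U \<and> p ` U \<subseteq> Y \<and>
       (\<forall>v\<in>U. \<exists>V. openin (Euclidean_space n) V \<and> v \<in> V \<and> V \<subseteq> U \<and> Q n V p)"
      and eq: "\<And>v. v \<in> U \<Longrightarrow> p v = p' v"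
    have "\<exists>V. openin (Euclidean_space n) V \<and> v \<in> V \<and> V \<subseteq> U \<and> Q n V p'" if v: "v \<in> U" for v
    proof -
      obtain V where V: "openin (Euclidean_space n) V" "v \<in> V" "V \<subseteq> U" "Q n V p"
        using p v by blast
      have "Q n V p'"
        by (rule Q_cong[OF V(4)]) (use eq V(3) in auto)
      with V show ?thesis by blast
    qed
    then show "openin (Euclidean_space n) U \<and> p' ` U \<subseteq> Y \<and>
       (\<forall>v\<in>U. \<exists>V. openin (Euclidean_space n) V \<and> v \<in> V \<and> V \<subseteq> U \<and> Q n V p')"
      using p eq by (simp add: image_subset_iff)
  next
    fix n U p
    assume U: "openin (Euclidean_space n) U" and
      loc: "\<And>v. v \<in> U \<Longrightarrow> \<exists>V. openin (Euclidean_space n) V \<and> v \<in> V \<and> V \<subseteq> U \<and>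
        openin (Euclidean_space n) V \<and> p ` V \<subseteq> Y \<and>
        (\<forall>v\<in>V. \<exists>V'. openin (Euclidean_space n) V' \<and> v \<in> V' \<and> V' \<subseteq> V \<and> Q n V' p)"
    have "p v \<in> Y \<and> (\<exists>V. openin (Euclidean_space n) V \<and> v \<in> V \<and> V \<subseteq> U \<and> Q n V p)" if v: "v \<in> U" for v
    proof -
      obtain V where V: "v \<in> V" "V \<subseteq> U" "p ` V \<subseteq> Y"
          "\<forall>v\<in>V. \<exists>V'. openin (Euclidean_space n) V' \<and> v \<in> V' \<and> V' \<subseteq> V \<and> Q n V' p"
        using loc[OF v] by blast
      then obtain V' where "openin (Euclidean_space n) V'" "v \<in> V'" "V' \<subseteq> V" "Q n V' p"
        by blast
      with V show ?thesis by blast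
    qed
    with U show "openin (Euclidean_space n) U \<and> p ` U \<subseteq> Y \<and>
        (\<forall>v\<in>U. \<exists>V. openin (Euclidean_space n) V \<and> v \<in> V \<and> V \<subseteq> U \<and> Q n V p)"
      by (simp add: image_subset_iff)
  next
    fix n U V p
    assume p: "openin (Euclidean_space n) U \<and> p ` U \<subseteq> Y \<and>
        (\<forall>v\<in>U. \<exists>V. openin (Euclidean_space n) V \<and> v \<in> V \<and> V \<subseteq> U \<and> Q n V p)"
      and V: "openin (Euclidean_space n) V" "V \<subseteq> U"
    have "\<exists>V'. openin (Euclidean_space n) V' \<and> v \<in> V' \<and> V' \<subseteq> V \<and> Q n V' p" if v: "v \<in> V" for v
    proof -
      obtain V' where V': "openin (Euclidean_space n) V'" "v \<in> V'" "Q n V' p"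
        using p v V by blast
      have o: "openin (Euclidean_space n) (V \<inter> V')"
        using V V' by blast
      from Q_sub[OF V'(3) o] V' v o show ?thesis
        by (intro exI[of _ "V \<inter> V'"]) simp
    qed
    moreover have "p ` V \<subseteq> Y"
      by (rule order_trans[OF image_mono[OF V(2)]]) (use p in simp)
    ultimately show "openin (Euclidean_space n) V \<and> p ` V \<subseteq> Y \<and>
        (\<forall>v\<in>V. \<exists>V'. openin (Euclidean_space n) V' \<and> v \<in> V' \<and> V' \<subseteq> V \<and> Q n V' p)"
      using V by simp
  next
    fix n U y assume U: "openin (Euclidean_space n) U" and "y \<in> Y"
    moreover have Q: "Q n U (\<lambda>_. y)"
      by (simp add: Q_def)
    ultimately show "openin (Euclidean_space n) U \<and> (\<lambda>_. y) ` U \<subseteq> Y \<and>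
        (\<forall>v\<in>U. \<exists>V. openin (Euclidean_space n) V \<and> v \<in> V \<and> V \<subseteq> U \<and> Q n V (\<lambda>_. y))"
      by (intro conjI ballI exI[of _ U]) (simp_all add: image_subset_iff)
  qed (simp, simp add: image_subset_iff)
  then show ?thesis
    unfolding final_diff_def Q_def .
qed

lemma local_diffeology_discrete: "local_diffeology (discrete_diff A)"
  unfolding discrete_diff_def
proof (rule local_diffeologyI; unfold diff_space.select_convs)
  fix n U and p p' :: "(nat \<Rightarrow> real) \<Rightarrow> 'a"
  assume p: "openin (Euclidean_space n) U \<and> p ` U \<subseteq> A \<and>
     (\<forall>v\<in>U. \<exists>V. openin (Euclidean_space n) V \<and> v \<in> V \<and> V \<subseteq> U \<and> (\<forall>w\<in>V. p w = p v))"
    and eq: "\<And>v. v \<in> U \<Longrightarrow> p v = p' v"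
  have "\<exists>V. openin (Euclidean_space n) V \<and> v \<in> V \<and> V \<subseteq> U \<and> (\<forall>w\<in>V. p' w = p' v)" if v: "v \<in> U" for v
  proof -
    obtain V where V: "openin (Euclidean_space n) V" "v \<in> V" "V \<subseteq> U" "\<forall>w\<in>V. p w = p v"
      using bspec[OF p[THEN conjunct2, THEN conjunct2] v] by (elim exE conjE)
    have "p' w = p' v" if w: "w \<in> V" for w
      using eq[OF subsetD[OF V(3) w]] eq[OF v] bspec[OF V(4) w] by simp
    then show ?thesis
      by (intro exI[of _ V] conjI ballI V(1-3))
  qed
  then show "openin (Euclidean_space n) U \<and> p' ` U \<subseteq> A \<and>
     (\<forall>v\<in>U. \<exists>V. openin (Euclidean_space n) V \<and> v \<in> V \<and> V \<subseteq> U \<and> (\<forall>w\<in>V. p' w = p' v))"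
    using p eq by (simp add: image_subset_iff)
next
  fix n U and p :: "(nat \<Rightarrow> real) \<Rightarrow> 'a"
  assume U: "openin (Euclidean_space n) U" and
    loc: "\<And>v. v \<in> U \<Longrightarrow> \<exists>V. openin (Euclidean_space n) V \<and> v \<in> V \<and> V \<subseteq> U \<and>
      openin (Euclidean_space n) V \<and> p ` V \<subseteq> A \<and>
      (\<forall>v\<in>V. \<exists>V'. openin (Euclidean_space n) V' \<and> v \<in> V' \<and> V' \<subseteq> V \<and> (\<forall>w\<in>V'. p w = p v))"
  have "p v \<in> A \<and> (\<exists>V. openin (Euclidean_space n) V \<and> v \<in> V \<and> V \<subseteq> U \<and> (\<forall>w\<in>V. p w = p v))" if v: "v \<in> U" for v
  proof -
    obtain V where V: "v \<in> V" "V \<subseteq> U" "p ` V \<subseteq> A"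
        "\<forall>v\<in>V. \<exists>V'. openin (Euclidean_space n) V' \<and> v \<in> V' \<and> V' \<subseteq> V \<and> (\<forall>w\<in>V'. p w = p v)"
      using loc[OF v] by (elim exE conjE)
    obtain V' where V': "openin (Euclidean_space n) V'" "v \<in> V'" "V' \<subseteq> V" "\<forall>w\<in>V'. p w = p v"
      using bspec[OF V(4) V(1)] by (elim exE conjE)
    have "p v \<in> A"
      using V by blast
    moreover have "V' \<subseteq> U"
      using V V' by blast
    ultimately show ?thesis
      by (intro conjI exI[of _ V'] V')
  qed
  with U show "openin (Euclidean_space n) U \<and> p ` U \<subseteq> A \<and>
      (\<forall>v\<in>U. \<exists>V. openin (Euclidean_space n) V \<and> v \<in> V \<and> V \<subseteq> U \<and> (\<forall>w\<in>V. p w = p v))"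
    by (simp add: image_subset_iff)
next
  fix n U V and p :: "(nat \<Rightarrow> real) \<Rightarrow> 'a"
  assume p: "openin (Euclidean_space n) U \<and> p ` U \<subseteq> A \<and>
     (\<forall>v\<in>U. \<exists>V. openin (Euclidean_space n) V \<and> v \<in> V \<and> V \<subseteq> U \<and> (\<forall>w\<in>V. p w = p v))"
    and V: "openin (Euclidean_space n) V" "V \<subseteq> U"
  have "\<exists>V'. openin (Euclidean_space n) V' \<and> v \<in> V' \<and> V' \<subseteq> V \<and> (\<forall>w\<in>V'. p w = p v)" if v: "v \<in> V" for v
  proof -
    obtain V' where "openin (Euclidean_space n) V'" "v \<in> V'" "\<forall>w\<in>V'. p w = p v"
      using p[THEN conjunct2, THEN conjunct2, THEN bspec, OF subsetD[OF V(2) v]] by (elim exE conjE)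
    then show ?thesis
      using v V by (intro exI[of _ "V \<inter> V'"] conjI ballI openin_Int) (blast | simp)+
  qed
  moreover have "p ` V \<subseteq> A"
    by (rule order_trans[OF image_mono[OF V(2)]]) (use p in simp)
  ultimately show "openin (Euclidean_space n) V \<and> p ` V \<subseteq> A \<and>
      (\<forall>v\<in>V. \<exists>V'. openin (Euclidean_space n) V' \<and> v \<in> V' \<and> V' \<subseteq> V \<and> (\<forall>w\<in>V'. p w = p v))"
    using V by simp
next
  fix n U and x :: 'a assume "openin (Euclidean_space n) U" "x \<in> A"
  then show "openin (Euclidean_space n) U \<and> (\<lambda>_. x) ` U \<subseteq> A \<and>
      (\<forall>v\<in>U. \<exists>V. openin (Euclidean_space n) V \<and> v \<in> V \<and> V \<subseteq> U \<and> (\<forall>w\<in>V. x = x))"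
    by (intro conjI ballI exI[of _ U]) (simp_all add: image_subset_iff)
qed (simp, simp add: image_subset_iff)

lemma topspace_D_topology:
  assumes "local_diffeology X"
  shows "topspace (D_topology X) = points X"
proof -
  have "openin (D_topology X) (points X)"
    unfolding openin_D_topology
  proof (intro conjI allI impI subset_refl)
    fix n U p assume p: "plots X n U p"
    then have "{v \<in> U. p v \<in> points X} = U"
      using plot_points[OF assms p] by blast
    then show "openin (Euclidean_space n) {v \<in> U. p v \<in> points X}"
      using plot_open[OF assms p] by simp
  qed
  moreover have "topspace (D_topology X) \<subseteq> points X"
    using openin_topspace[of "D_topology X"] unfolding openin_D_topology by blast
  ultimately show ?thesis
    using openin_subset by blast
qed

lemma continuous_map_D_topology:
  assumes "local_diffeology X" "local_diffeology Y" "smooth_map X Y f"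
  shows "continuous_map (D_topology X) (D_topology Y) f"
  unfolding continuous_map_def topspace_D_topology[OF assms(1)] topspace_D_topology[OF assms(2)]
proof (intro conjI allI impI)
  show "f \<in> points X \<rightarrow> points Y"
    using assms(3) by (auto simp: smooth_map_def)
  fix W assume W: "openin (D_topology Y) W"
  show "openin (D_topology X) {x \<in> points X. f x \<in> W}"
    unfolding openin_D_topology
  proof (intro conjI allI impI)
    fix n U p assume p: "plots X n U p"
    then have "plots Y n U (f \<circ> p)"
      using assms(3) by (simp add: smooth_map_def)
    then have "openin (Euclidean_space n) {v \<in> U. (f \<circ> p) v \<in> W}"
      using W unfolding openin_D_topology by blast
    moreover have "{v \<in> U. (f \<circ> p) v \<in> W} = {v \<in> U. p v \<in> {x \<in> points X. f x \<in> W}}"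
      using plot_points[OF assms(1) p] by auto
    ultimately show "openin (Euclidean_space n) {v \<in> U. p v \<in> {x \<in> points X. f x \<in> W}}"
      by simp
  qed auto
qed

abbreviation smooth_on :: "'x diff_space \<Rightarrow> 'x set \<Rightarrow> 'a diff_group \<Rightarrow> ('x \<Rightarrow> 'a) \<Rightarrow> bool" where
  "smooth_on X W A g \<equiv> smooth_map (subspace_diff X W) (dspace A) g"

lemma smooth_on_iff:
  "smooth_on X W A g \<longleftrightarrow> (\<forall>x\<in>points X \<inter> W. g x \<in> carrier A) \<and>
    (\<forall>n U p. plots X n U p \<and> p ` U \<subseteq> W \<longrightarrow> gplots A n U (\<lambda>v. g (p v)))"
  by (auto simp: smooth_map_def subspace_diff_def dspace_def comp_def)

lemma smooth_onI:
  assumes "\<And>x. x \<in> points X \<Longrightarrow> x \<in> W \<Longrightarrow> g x \<in> carrier A"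
    and "\<And>n U p. plots X n U p \<Longrightarrow> p ` U \<subseteq> W \<Longrightarrow> gplots A n U (\<lambda>v. g (p v))"
  shows "smooth_on X W A g"
  unfolding smooth_on_iff using assms by simp

lemma smooth_on_carrier: "smooth_on X W A g \<Longrightarrow> x \<in> points X \<Longrightarrow> x \<in> W \<Longrightarrow> g x \<in> carrier A"
  unfolding smooth_on_iff by simp

lemma smooth_onD: "smooth_on X W A g \<Longrightarrow> plots X n U p \<Longrightarrow> p ` U \<subseteq> W \<Longrightarrow> gplots A n U (\<lambda>v. g (p v))"
  unfolding smooth_on_iff by simp

lemma smooth_on_subset:
  assumes "smooth_on X W A g" "V \<subseteq> W"
  shows "smooth_on X V A g"
proof (rule smooth_onI)
  fix n U p assume "plots X n U p" "p ` U \<subseteq> V"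
  then show "gplots A n U (\<lambda>v. g (p v))"
    using smooth_onD[OF assms(1), of n U p] assms(2) by simp
qed (use smooth_on_carrier[OF assms(1)] assms(2) in blast)

text \<open>
  A group with smooth operations and a local diffeology. This covers \<open>G\<close> and its extension as well as the
  coefficient groups \<open>\<int>\<^sub>2\<close>, \<open>\<real>\<close>, \<open>\<int>\<close> and \<open>U(1)\<close>.
\<close>

locale smooth_group = group A for A :: "'a diff_group" (structure) +
  assumes local: "local_diffeology (dspace A)"
    and gplots_mult: "\<And>n U p p'. gplots A n U p \<Longrightarrow> gplots A n U p' \<Longrightarrow> gplots A n U (\<lambda>v. p v \<otimes> p' v)"
    and gplots_inv: "\<And>n U p. gplots A n U p \<Longrightarrow> gplots A n U (\<lambda>v. inv p v)"
begin

lemmas gplot_open = plot_open[OF local, unfolded dspace_def diff_space.select_convs]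
  and gplot_carrier = plot_points[OF local, unfolded dspace_def diff_space.select_convs]
  and gplot_cong = plot_cong[OF local, unfolded dspace_def diff_space.select_convs]
  and gplot_const = plot_const[OF local, unfolded dspace_def diff_space.select_convs]
  and gplot_local = plot_local[OF local, unfolded dspace_def diff_space.select_convs]
  and gplot_restrict = plot_restrict[OF local, unfolded dspace_def diff_space.select_convs]

lemma smooth_on_mult:
  assumes g: "smooth_on X W A g" and h: "smooth_on X W A h"
  shows "smooth_on X W A (\<lambda>x. g x \<otimes> h x)"
proof (rule smooth_onI)
  fix n U p assume p: "plots X n U p" "p ` U \<subseteq> W"
  show "gplots A n U (\<lambda>v. g (p v) \<otimes> h (p v))"
    by (rule gplots_mult[OF smooth_onD[OF g p] smooth_onD[OF h p]])
qed (simp add: smooth_on_carrier[OF g] smooth_on_carrier[OF h])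

lemma smooth_on_inv:
  assumes g: "smooth_on X W A g"
  shows "smooth_on X W A (\<lambda>x. inv g x)"
proof (rule smooth_onI)
  fix n U p assume p: "plots X n U p" "p ` U \<subseteq> W"
  show "gplots A n U (\<lambda>v. inv g (p v))"
    by (rule gplots_inv[OF smooth_onD[OF g p]])
qed (simp add: smooth_on_carrier[OF g])

lemma smooth_on_const:
  assumes "local_diffeology X" "a \<in> carrier A"
  shows "smooth_on X W A (\<lambda>_. a)"
proof (rule smooth_onI)
  fix n U p assume "plots X n U p"
  then show "gplots A n U (\<lambda>v. a)"
    by (intro gplot_const assms(2) plot_open[OF assms(1)])
qed (simp add: assms(2))

lemma smooth_on_cong:
  assumes g: "smooth_on X W A g" and eq: "\<And>x. x \<in> W \<Longrightarrow> g x = h x"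
  shows "smooth_on X W A h"
proof (rule smooth_onI)
  fix n U p assume p: "plots X n U p" "p ` U \<subseteq> W"
  show "gplots A n U (\<lambda>v. h (p v))"
    by (rule gplot_cong[OF smooth_onD[OF g p]]) (use p(2) eq in \<open>simp add: image_subset_iff\<close>)
next
  fix x assume "x \<in> points X" "x \<in> W"
  then show "h x \<in> carrier A"
    using smooth_on_carrier[OF g, of x] eq[of x] by simp
qed

lemma smooth_on_local:
  assumes X: "local_diffeology X"
    and loc: "\<And>x. x \<in> points X \<inter> W \<Longrightarrow> \<exists>V. openin (D_topology X) V \<and> x \<in> V \<and> smooth_on X (W \<inter> V) A g"
  shows "smooth_on X W A g"
proof (rule smooth_onI)
  fix x assume x: "x \<in> points X" "x \<in> W"
  then obtain V where "x \<in> V" "smooth_on X (W \<inter> V) A g"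
    using loc by blast
  then show "g x \<in> carrier A"
    using smooth_on_carrier[of X "W \<inter> V" A g x] x by simp
next
  fix n U p assume p: "plots X n U p" "p ` U \<subseteq> W"
  show "gplots A n U (\<lambda>v. g (p v))"
  proof (rule gplot_local)
    show U: "openin (Euclidean_space n) U"
      by (rule plot_open[OF X p(1)])
    fix v assume v: "v \<in> U"
    then have "p v \<in> points X \<inter> W"
      using plot_points[OF X p(1)] p(2) by blast
    then obtain V where V: "openin (D_topology X) V" "p v \<in> V" "smooth_on X (W \<inter> V) A g"
      using loc by blast
    let ?U = "{w \<in> U. p w \<in> V}"
    have o: "openin (Euclidean_space n) ?U"
      using V(1) p unfolding openin_D_topology by blast
    have "plots X n ?U p"
      by (rule plot_restrict[OF X p(1) o]) blast
    then have "gplots A n ?U (\<lambda>v. g (p v))"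
      by (rule smooth_onD[OF V(3)]) (use p(2) in blast)
    then show "\<exists>V. openin (Euclidean_space n) V \<and> v \<in> V \<and> V \<subseteq> U \<and> gplots A n V (\<lambda>v. g (p v))"
      using o v V(2) by (intro exI[of _ ?U]) auto
  qed
qed

end

lemma diffeological_group_smooth:
  assumes "diffeological_group A"
  shows "smooth_group A"
proof -
  interpret group A
    using assms by (simp add: diffeological_group_def)
  show ?thesis
  proof
    show "local_diffeology (dspace A)"
      using assms by (simp add: diffeological_group_def diffeological_imp_local)
    fix n U p assume p: "gplots A n U p"
    show "gplots A n U (\<lambda>v. inv\<^bsub>A\<^esub> p v)"
      using assms p by (simp add: diffeological_group_def smooth_map_def dspace_def comp_def)
    fix p' assume p': "gplots A n U p'"
    have "plots (prod_diff (dspace A) (dspace A)) n U (\<lambda>v. (p v, p' v))"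
      using p p' by (simp add: prod_diff_def dspace_def comp_def)
    moreover have "smooth_map (prod_diff (dspace A) (dspace A)) (dspace A) (\<lambda>(x, y). x \<otimes>\<^bsub>A\<^esub> y)"
      using assms by (simp add: diffeological_group_def)
    ultimately have "plots (dspace A) n U ((\<lambda>(x, y). x \<otimes>\<^bsub>A\<^esub> y) \<circ> (\<lambda>v. (p v, p' v)))"
      by (auto simp: smooth_map_def)
    then show "gplots A n U (\<lambda>v. p v \<otimes>\<^bsub>A\<^esub> p' v)"
      by (simp add: dspace_def comp_def)
  qed
qed

lemma comm_group_Z2: "comm_group Z2_group"
  by (rule comm_groupI) (auto simp: Z2_group_def)

lemma carrier_Z2 [simp]: "carrier Z2_group = {1, -1}"
  and mult_Z2 [simp]: "x \<otimes>\<^bsub>Z2_group\<^esub> y = x * y"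
  and one_Z2 [simp]: "\<one>\<^bsub>Z2_group\<^esub> = 1"
  by (auto simp: Z2_group_def)

lemma inv_Z2: "x \<in> {1, -1} \<Longrightarrow> inv\<^bsub>Z2_group\<^esub> x = x"
  using comm_group.axioms(2)[OF comm_group_Z2] by (intro group.inv_equality) auto

lemma gplots_Z2: "gplots Z2_group n U p \<longleftrightarrow> openin (Euclidean_space n) U \<and> p ` U \<subseteq> {1, -1} \<and>
    (\<forall>v\<in>U. \<exists>V. openin (Euclidean_space n) V \<and> v \<in> V \<and> V \<subseteq> U \<and> (\<forall>w\<in>V. p w = p v))"
  by (simp add: Z2_group_def discrete_diff_def)

lemma gplots_R: "gplots R_group n U p \<longleftrightarrow> openin (Euclidean_space n) U \<and> smooth_fun n U p"
  by (simp add: R_group_def real_diff_def)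

lemma gplots_Z: "gplots Z_group n U p \<longleftrightarrow> gplots R_group n U p \<and> p ` U \<subseteq> \<int>"
  by (simp add: R_group_def Z_group_def subspace_diff_def)

lemma gplots_U1: "gplots U1_group n U p \<longleftrightarrow> openin (Euclidean_space n) U \<and>
    smooth_fun n U (\<lambda>v. Re (p v)) \<and> smooth_fun n U (\<lambda>v. Im (p v)) \<and> p ` U \<subseteq> sphere 0 1"
  by (simp add: U1_group_def subspace_diff_def complex_diff_def comp_def)

lemma smooth_group_Z2: "smooth_group Z2_group"
proof -
  interpret comm_group Z2_group by (rule comm_group_Z2)
  have eq: "dspace Z2_group = discrete_diff {1, -1}"
    by (simp add: dspace_def Z2_group_def discrete_diff_def)
  show ?thesis
  proof
    show loc: "local_diffeology (dspace Z2_group)"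
      unfolding eq by (rule local_diffeology_discrete)
    fix n U p assume p: "gplots Z2_group n U p"
    have pv: "p v \<in> {1, -1}" if "v \<in> U" for v
      using p that by (auto simp: gplots_Z2)
    have "plots (dspace Z2_group) n U (\<lambda>v. inv\<^bsub>Z2_group\<^esub> p v)"
      by (rule plot_cong[OF loc, of n U p]) (simp_all only: dspace_def p diff_space.select_convs inv_Z2[OF pv])
    then show "gplots Z2_group n U (\<lambda>v. inv\<^bsub>Z2_group\<^esub> p v)"
      by (simp add: dspace_def)
    fix p' assume p': "gplots Z2_group n U p'"
    have pv': "p' v \<in> {1, -1}" if "v \<in> U" for v
      using p' that by (auto simp: gplots_Z2)
    show "gplots Z2_group n U (\<lambda>v. p v \<otimes>\<^bsub>Z2_group\<^esub> p' v)"
      unfolding gplots_Z2 mult_Z2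
    proof (intro conjI ballI image_subsetI)
      show "openin (Euclidean_space n) U"
        using p by (simp add: gplots_Z2)
      fix v assume v: "v \<in> U"
      show "p v * p' v \<in> {1, -1}"
        using pv[OF v] pv'[OF v] by auto
      obtain V where V: "openin (Euclidean_space n) V" "v \<in> V" "V \<subseteq> U" "\<forall>w\<in>V. p w = p v"
        using bspec[OF p[unfolded gplots_Z2, THEN conjunct2, THEN conjunct2] v] by (elim exE conjE)
      obtain V' where V': "openin (Euclidean_space n) V'" "v \<in> V'" "V' \<subseteq> U" "\<forall>w\<in>V'. p' w = p' v"
        using bspec[OF p'[unfolded gplots_Z2, THEN conjunct2, THEN conjunct2] v] by (elim exE conjE)
      have "p w * p' w = p v * p' v" if "w \<in> V \<inter> V'" for w
        using that bspec[OF V(4), of w] bspec[OF V'(4), of w] by simp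
      then show "\<exists>V. openin (Euclidean_space n) V \<and> v \<in> V \<and> V \<subseteq> U \<and> (\<forall>w\<in>V. p w * p' w = p v * p' v)"
        using V(2) V'(2) by (intro exI[of _ "V \<inter> V'"] conjI ballI openin_Int V(1) V'(1) IntI le_infI1[OF V(3)])
    qed
  qed
qed

lemma smooth_group_R: "smooth_group R_group"
proof -
  interpret comm_group R_group by (rule comm_group_R)
  have eq: "dspace R_group = real_diff"
    by (simp add: dspace_def R_group_def real_diff_def)
  show ?thesis
  proof
    show "local_diffeology (dspace R_group)"
      unfolding eq by (rule local_diffeology_real)
  qed (auto simp: gplots_R smooth_fun_def intro: Ck_on_add Ck_on_cmult[where c = "-1", simplified])
qed

lemma smooth_group_Z: "smooth_group Z_group"
proof -
  interpret comm_group Z_group by (rule comm_group_Z)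
  have eq: "dspace Z_group = subspace_diff real_diff \<int>"
    by (simp add: dspace_def Z_group_def real_diff_def subspace_diff_def)
  show ?thesis
  proof
    show loc: "local_diffeology (dspace Z_group)"
      unfolding eq by (intro local_diffeology_subspace local_diffeology_real)
    fix n U p assume p: "gplots Z_group n U p"
    then have m: "gplots Z_group n U (\<lambda>v. - p v)"
      using smooth_group.gplots_inv[OF smooth_group_R, of n U p] by (auto simp: gplots_Z)
    have pv: "p v \<in> \<int>" if "v \<in> U" for v
      using p that by (auto simp: gplots_Z)
    have "plots (dspace Z_group) n U (\<lambda>v. inv\<^bsub>Z_group\<^esub> p v)"
      by (rule plot_cong[OF loc, of n U "\<lambda>v. - p v"]) (simp_all add: dspace_def m inv_Z pv)
    then show "gplots Z_group n U (\<lambda>v. inv\<^bsub>Z_group\<^esub> p v)"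
      by (simp add: dspace_def)
    fix p' assume p': "gplots Z_group n U p'"
    then show "gplots Z_group n U (\<lambda>v. p v \<otimes>\<^bsub>Z_group\<^esub> p' v)"
      using p smooth_group.gplots_mult[OF smooth_group_R, of n U p p'] by (auto simp: gplots_Z image_subset_iff)
  qed
qed

lemma inverse_U1: "z \<in> sphere 0 1 \<Longrightarrow> inverse z = cnj z"
  by (simp add: inverse_complex_def complex_eq_iff cmod_def)

lemma gplots_U1_cnj: "gplots U1_group n U p \<Longrightarrow> gplots U1_group n U (\<lambda>v. cnj (p v))"
  using Ck_on_cmult[where c = "-1"] by (auto simp: gplots_U1 smooth_fun_def)

lemma smooth_group_U1: "smooth_group U1_group"
proof -
  interpret comm_group U1_group by (rule comm_group_U1)
  have eq: "dspace U1_group = subspace_diff complex_diff (sphere 0 1)"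
    by (simp add: dspace_def U1_group_def complex_diff_def subspace_diff_def)
  show ?thesis
  proof
    show loc: "local_diffeology (dspace U1_group)"
      unfolding eq by (intro local_diffeology_subspace local_diffeology_complex)
    fix n U p assume p: "gplots U1_group n U p"
    have pv: "p v \<in> sphere 0 1" if "v \<in> U" for v
      using p that by (auto simp: gplots_U1)
    have "plots (dspace U1_group) n U (\<lambda>v. inv\<^bsub>U1_group\<^esub> p v)"
    proof (rule plot_cong[OF loc, of n U "\<lambda>v. cnj (p v)"])
      show "plots (dspace U1_group) n U (\<lambda>v. cnj (p v))"
        using gplots_U1_cnj[OF p] by (simp add: dspace_def)
    qed (simp only: inv_U1[OF pv] inverse_U1[OF pv])
    then show "gplots U1_group n U (\<lambda>v. inv\<^bsub>U1_group\<^esub> p v)"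
      by (simp add: dspace_def)
    fix p' assume p': "gplots U1_group n U p'"
    show "gplots U1_group n U (\<lambda>v. p v \<otimes>\<^bsub>U1_group\<^esub> p' v)"
      unfolding gplots_U1 mult_U1 smooth_fun_def
    proof (intro conjI allI)
      fix k
      have C: "Ck_on k n U (\<lambda>v. Re (p v))" "Ck_on k n U (\<lambda>v. Im (p v))"
          "Ck_on k n U (\<lambda>v. Re (p' v))" "Ck_on k n U (\<lambda>v. Im (p' v))"
        using p p' by (auto simp: gplots_U1 smooth_fun_def)
      show "Ck_on k n U (\<lambda>v. Re (p v * p' v))"
        using Ck_on_add[OF Ck_on_mult[OF C(1,3)] Ck_on_cmult[OF Ck_on_mult[OF C(2,4)], of "-1"]] by simp
      show "Ck_on k n U (\<lambda>v. Im (p v * p' v))"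
        using Ck_on_add[OF Ck_on_mult[OF C(1,4)] Ck_on_mult[OF C(2,3)]] by simp
    qed (use p p' in \<open>auto simp: gplots_U1 norm_mult image_subset_iff\<close>)
  qed
qed

lemma gplots_exp_U1: "gplots R_group n U p \<Longrightarrow> gplots U1_group n U (\<lambda>v. exp_U1 (p v))"
  by (auto simp: gplots_R gplots_U1 smooth_fun_def exp_U1_def intro!: Ck_on_sin_cos[THEN conjunct1]
      Ck_on_sin_cos[THEN conjunct2] Ck_on_cmult)

lemma smooth_on_exp_U1: "smooth_on X W R_group g \<Longrightarrow> smooth_on X W U1_group (\<lambda>x. exp_U1 (g x))"
  by (rule smooth_onI) (simp, rule gplots_exp_U1, rule smooth_onD)

lemma smooth_on_Z_iff: "smooth_on X W Z_group g \<longleftrightarrow> smooth_on X W R_group g \<and> (\<forall>x\<in>points X \<inter> W. g x \<in> \<int>)"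
  if X: "local_diffeology X"
proof
  assume Z: "smooth_on X W Z_group g"
  have "smooth_on X W R_group g"
  proof (rule smooth_onI)
    fix n U p assume "plots X n U p" "p ` U \<subseteq> W"
    from smooth_onD[OF Z this] show "gplots R_group n U (\<lambda>v. g (p v))"
      by (simp add: gplots_Z)
  qed simp
  then show "smooth_on X W R_group g \<and> (\<forall>x\<in>points X \<inter> W. g x \<in> \<int>)"
    using smooth_on_carrier[OF Z] by simp
next
  assume R: "smooth_on X W R_group g \<and> (\<forall>x\<in>points X \<inter> W. g x \<in> \<int>)"
  show "smooth_on X W Z_group g"
  proof (rule smooth_onI)
    fix n U p assume p: "plots X n U p" "p ` U \<subseteq> W"
    have "g (p v) \<in> \<int>" if "v \<in> U" for v
      using R p plot_points[OF X p(1) \<open>v \<in> U\<close>] \<open>v \<in> U\<close> by blast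
    then show "gplots Z_group n U (\<lambda>v. g (p v))"
      using smooth_onD[OF conjunct1[OF R] p] by (simp add: gplots_Z image_subset_iff)
  qed (use R in simp)
qed

lemma gplots_angle:
  assumes "gplots U1_group n U p" "\<And>v. v \<in> U \<Longrightarrow> Re (p v) > 0"
  shows "gplots R_group n U (\<lambda>v. arctan (Im (p v) / Re (p v)) / (2 * pi))"
proof -
  have "(Re (p v))\<^sup>2 + (Im (p v))\<^sup>2 = 1" if "v \<in> U" for v
    using assms(1) that by (auto simp: gplots_U1 cmod_def image_subset_iff)
  then have "Ck_on k n U (\<lambda>v. arctan (Im (p v) / Re (p v)))" for k
    using assms by (intro Ck_on_angle) (auto simp: gplots_U1 smooth_fun_def)
  from Ck_on_cmult[OF this, of _ "inverse (2 * pi)"] show ?thesis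
    using assms(1) by (simp add: gplots_R gplots_U1 smooth_fun_def field_simps)
qed

lemma exp_U1_angle:
  assumes "z \<in> sphere 0 1" "Re z > 0"
  shows "exp_U1 (arctan (Im z / Re z) / (2 * pi)) = z"
proof -
  have "(Re z)\<^sup>2 + (Im z)\<^sup>2 = 1"
    using assms(1) by (auto simp: cmod_def)
  then have "1 + (Im z / Re z)\<^sup>2 = 1 / (Re z)\<^sup>2"
    using assms(2) by (simp add: power_divide field_simps)
  then have "sqrt (1 + (Im z / Re z)\<^sup>2) = 1 / Re z"
    using assms(2) by (simp add: real_sqrt_divide)
  then show ?thesis
    using assms(2) by (simp add: exp_U1_def complex_eq_iff cos_arctan sin_arctan)
qed

lemma exp_U1_surj: "z \<in> sphere 0 1 \<Longrightarrow> \<exists>t. exp_U1 t = z"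
proof -
  assume "z \<in> sphere 0 1"
  then have "z = cis (Arg z)"
    using rcis_cmod_Arg[of z] by (simp add: rcis_def)
  then show ?thesis
    by (intro exI[of _ "Arg z / (2 * pi)"]) (simp add: exp_U1_def)
qed

text \<open>
  Near \<open>x\<close> the function \<open>z = g / g(x)\<close> takes values in the right half circle, where the arctangent
  gives a logarithm; adding a logarithm \<open>t\<close> of \<open>g(x)\<close> gives one of \<open>g\<close>.
\<close>

lemma smooth_on_log:
  assumes X: "local_diffeology X" and g: "smooth_on X V U1_group g" and V: "openin (D_topology X) V" and x: "x \<in> V"
  shows "\<exists>W h. openin (D_topology X) W \<and> x \<in> W \<and> W \<subseteq> V \<and> smooth_on X W R_group h \<and> (\<forall>y\<in>W. exp_U1 (h y) = g y)"
proof -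
  interpret U: smooth_group U1_group by (rule smooth_group_U1)
  interpret R: smooth_group R_group by (rule smooth_group_R)
  have VX: "V \<subseteq> points X"
    using V unfolding openin_D_topology by blast
  have gV: "g y \<in> sphere 0 1" if "y \<in> V" for y
    using smooth_on_carrier[OF g, of y] that VX by auto
  obtain t where t: "exp_U1 t = g x"
    using exp_U1_surj gV[OF x] by blast
  define z where "z = (\<lambda>y. g y * cnj (g x))"
  have zV: "z y \<in> sphere 0 1" if "y \<in> V" for y
    using gV that x by (simp add: z_def norm_mult)
  have z: "smooth_on X V U1_group z"
    unfolding z_def using U.smooth_on_mult[OF g U.smooth_on_const[OF X, of "cnj (g x)"]] gV[OF x] by simp
  define W where "W = {y \<in> V. Re (z y) > 0}"
  have W: "openin (D_topology X) W"
    unfolding openin_D_topology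
  proof (intro conjI allI impI)
    fix n U p assume p: "plots X n U p"
    let ?U = "{v \<in> U. p v \<in> V}"
    have o: "openin (Euclidean_space n) ?U"
      using V p unfolding openin_D_topology by blast
    have "plots X n ?U p"
      by (rule plot_restrict[OF X p o]) blast
    then have "gplots U1_group n ?U (\<lambda>v. z (p v))"
      by (rule smooth_onD[OF z]) blast
    then have "continuous_map (subtopology (Euclidean_space n) ?U) euclideanreal (\<lambda>v. Re (z (p v)))"
      by (auto simp: gplots_U1 smooth_fun_def intro: Ck_on_continuous)
    from openin_continuous_map_preimage[OF this, of "{0<..}"]
    have "openin (subtopology (Euclidean_space n) ?U) {v \<in> topspace (subtopology (Euclidean_space n) ?U). Re (z (p v)) \<in> {0<..}}"
      by simp
    then have "openin (Euclidean_space n) {v \<in> topspace (subtopology (Euclidean_space n) ?U). Re (z (p v)) \<in> {0<..}}"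
      using o openin_trans_full by blast
    also have "{v \<in> topspace (subtopology (Euclidean_space n) ?U). Re (z (p v)) \<in> {0<..}} = {v \<in> U. p v \<in> W}"
      using openin_subset[OF o] by (auto simp: W_def)
    finally show "openin (Euclidean_space n) {v \<in> U. p v \<in> W}" .
  qed (use VX in \<open>auto simp: W_def\<close>)
  have xW: "x \<in> W"
    using gV[OF x] x by (simp add: W_def z_def complex_mult_cnj cmod_def power2_eq_square)
  define h where "h = (\<lambda>y. arctan (Im (z y) / Re (z y)) / (2 * pi) + t)"
  have "smooth_on X W R_group (\<lambda>y. arctan (Im (z y) / Re (z y)) / (2 * pi))"
  proof (rule smooth_onI)
    fix n U p assume p: "plots X n U p" "p ` U \<subseteq> W"
    have "gplots U1_group n U (\<lambda>v. z (p v))"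
      by (rule smooth_onD[OF z p(1)]) (use p(2) W_def in blast)
    then show "gplots R_group n U (\<lambda>v. arctan (Im (z (p v)) / Re (z (p v))) / (2 * pi))"
      by (rule gplots_angle) (use p in \<open>auto simp: W_def\<close>)
  qed auto
  from R.smooth_on_mult[OF this R.smooth_on_const[OF X, of t]]
  have "smooth_on X W R_group h"
    by (simp add: h_def)
  moreover have "exp_U1 (h y) = g y" if "y \<in> W" for y
  proof -
    have "exp_U1 (h y) = z y * g x"
      using that zV exp_U1_angle[of "z y"] by (simp add: h_def exp_U1_add t W_def)
    also have "\<dots> = g y * (g x * cnj (g x))"
      by (simp add: z_def)
    also have "g x * cnj (g x) = 1"
      using gV[OF x] by (simp add: complex_norm_square[symmetric])
    finally show ?thesis by simp
  qed
  ultimately show ?thesis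
    using W xW W_def by blast
qed

section \<open>Smooth actions of the group with two elements\<close>

locale smooth_z2_group = smooth_group A for A :: "'a diff_group" (structure) +
  fixes \<rho> :: "int \<Rightarrow> 'a \<Rightarrow> 'a"
  assumes \<rho>_closed: "\<And>\<epsilon> a. \<epsilon> \<in> {1, -1} \<Longrightarrow> a \<in> carrier A \<Longrightarrow> \<rho> \<epsilon> a \<in> carrier A"
    and \<rho>_mult: "\<And>\<epsilon> a b. \<epsilon> \<in> {1, -1} \<Longrightarrow> a \<in> carrier A \<Longrightarrow> b \<in> carrier A \<Longrightarrow>
      \<rho> \<epsilon> (a \<otimes> b) = \<rho> \<epsilon> a \<otimes> \<rho> \<epsilon> b"
    and \<rho>_1: "\<And>a. a \<in> carrier A \<Longrightarrow> \<rho> 1 a = a"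
    and \<rho>_comp: "\<And>\<epsilon> \<delta> a. \<epsilon> \<in> {1, -1} \<Longrightarrow> \<delta> \<in> {1, -1} \<Longrightarrow> a \<in> carrier A \<Longrightarrow>
      \<rho> \<epsilon> (\<rho> \<delta> a) = \<rho> (\<epsilon> * \<delta>) a"
    and gplots_\<rho>: "\<And>\<epsilon> n U p. \<epsilon> \<in> {1, -1} \<Longrightarrow> gplots A n U p \<Longrightarrow> gplots A n U (\<lambda>v. \<rho> \<epsilon> (p v))"
begin

lemma \<rho>_hom: "\<epsilon> \<in> {1, -1} \<Longrightarrow> \<rho> \<epsilon> \<in> hom A A"
  by (auto simp: hom_def intro: \<rho>_closed \<rho>_mult)

lemma \<rho>_one: "\<epsilon> \<in> {1, -1} \<Longrightarrow> \<rho> \<epsilon> \<one> = \<one>"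
  by (rule hom_one[OF \<rho>_hom is_group is_group])

lemma \<rho>_inv: "\<epsilon> \<in> {1, -1} \<Longrightarrow> a \<in> carrier A \<Longrightarrow> \<rho> \<epsilon> (inv a) = inv (\<rho> \<epsilon> a)"
  using group_hom.hom_inv[of A A "\<rho> \<epsilon>" a] \<rho>_hom[of \<epsilon>] is_group
  by (simp add: group_hom_def group_hom_axioms_def)

text \<open>A smooth function to \<open>\<int>\<^sub>2\<close> is constant near each parameter of a plot, so locally a fixed element acts.\<close>

lemma smooth_on_act:
  assumes g: "smooth_on X W A g" and e: "smooth_on X W Z2_group e"
  shows "smooth_on X W A (\<lambda>x. \<rho> (e x) (g x))"
proof (rule smooth_onI)
  fix x assume x: "x \<in> points X" "x \<in> W"
  show "\<rho> (e x) (g x) \<in> carrier A"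
    using smooth_on_carrier[OF g x] smooth_on_carrier[OF e x] by (intro \<rho>_closed) simp_all
next
  fix n U p assume p: "plots X n U p" "p ` U \<subseteq> W"
  note gp = smooth_onD[OF g p]
  note ep = smooth_onD[OF e p, unfolded gplots_Z2]
  show "gplots A n U (\<lambda>v. \<rho> (e (p v)) (g (p v)))"
  proof (rule gplot_local)
    show "openin (Euclidean_space n) U"
      by (rule gplot_open[OF gp])
    fix v assume v: "v \<in> U"
    obtain V where V: "openin (Euclidean_space n) V" "v \<in> V" "V \<subseteq> U" "\<forall>w\<in>V. e (p w) = e (p v)"
      using bspec[OF ep[THEN conjunct2, THEN conjunct2] v] by (elim exE conjE)
    have ev: "e (p v) \<in> {1, -1}"
      using ep[THEN conjunct2, THEN conjunct1] v by (simp add: image_subset_iff)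
    have "gplots A n V (\<lambda>w. \<rho> (e (p v)) (g (p w)))"
      by (rule gplots_\<rho>[OF ev gplot_restrict[OF gp V(1,3)]])
    then have "gplots A n V (\<lambda>w. \<rho> (e (p w)) (g (p w)))"
      by (rule gplot_cong) (simp add: bspec[OF V(4)])
    with V show "\<exists>V. openin (Euclidean_space n) V \<and> v \<in> V \<and> V \<subseteq> U \<and> gplots A n V (\<lambda>v. \<rho> (e (p v)) (g (p v)))"
      by (intro exI[of _ V] conjI)
  qed
qed

end

lemma smooth_Z2_action_imp:
  assumes "smooth_group A" "smooth_Z2_action A \<rho>"
  shows "smooth_z2_group A \<rho>"
proof -
  interpret smooth_group A by fact
  have iso: "\<rho> \<epsilon> \<in> iso A A" if "\<epsilon> \<in> {1, -1}" for \<epsilon>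
    using assms(2) that by (auto simp: smooth_Z2_action_def)
  then have hom: "\<rho> \<epsilon> \<in> hom A A" if "\<epsilon> \<in> {1, -1}" for \<epsilon>
    using that by (auto simp: iso_def)
  have sm: "smooth_map (prod_diff (dspace Z2_group) (dspace A)) (dspace A) (\<lambda>(\<epsilon>, g). \<rho> \<epsilon> g)"
    using assms(2) by (simp add: smooth_Z2_action_def)
  show ?thesis
  proof
    fix \<epsilon> :: int and n U p assume e: "\<epsilon> \<in> {1, -1}" and p: "gplots A n U p"
    have "gplots Z2_group n U (\<lambda>_. \<epsilon>)"
      using e gplot_open[OF p] by (intro smooth_group.gplot_const[OF smooth_group_Z2]) simp_all
    with p have "plots (prod_diff (dspace Z2_group) (dspace A)) n U (\<lambda>v. (\<epsilon>, p v))"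
      by (simp add: prod_diff_def dspace_def comp_def)
    then have "plots (dspace A) n U ((\<lambda>(\<epsilon>, g). \<rho> \<epsilon> g) \<circ> (\<lambda>v. (\<epsilon>, p v)))"
      using sm unfolding smooth_map_def by simp
    then show "gplots A n U (\<lambda>v. \<rho> \<epsilon> (p v))"
      by (simp add: dspace_def comp_def)
  next
    fix \<epsilon> :: int and a b assume "\<epsilon> \<in> {1, -1}" "a \<in> carrier A" "b \<in> carrier A"
    then show "\<rho> \<epsilon> (a \<otimes>\<^bsub>A\<^esub> b) = \<rho> \<epsilon> a \<otimes>\<^bsub>A\<^esub> \<rho> \<epsilon> b"
      using hom_mult[OF hom] by blast
  next
    fix \<epsilon> :: int and a assume "\<epsilon> \<in> {1, -1}" "a \<in> carrier A"
    then show "\<rho> \<epsilon> a \<in> carrier A"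
      using hom_in_carrier[OF hom] by blast
  next
    fix a assume "a \<in> carrier A"
    then show "\<rho> 1 a = a"
      by (rule bspec[OF assms(2)[unfolded smooth_Z2_action_def, THEN conjunct2, THEN conjunct1]])
  next
    fix \<epsilon> \<delta> :: int and a assume e: "\<epsilon> \<in> {1, -1}" "\<delta> \<in> {1, -1}" and a: "a \<in> carrier A"
    have "\<epsilon> \<in> carrier Z2_group" "\<delta> \<in> carrier Z2_group"
      using e by simp_all
    from assms(2)[unfolded smooth_Z2_action_def, THEN conjunct2, THEN conjunct2, THEN conjunct1,
        THEN bspec, OF this(1), THEN bspec, OF this(2), THEN bspec, OF a]
    show "\<rho> \<epsilon> (\<rho> \<delta> a) = \<rho> (\<epsilon> * \<delta>) a" ..
  qed
qed

text \<open>
  Such a homomorphism solves \<open>H' = a H\<close>, so \<open>H t * exp (- a t)\<close> is constant, and \<open>a\<close> is imaginary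
  because \<open>H\<close> stays on the circle.
\<close>

lemma smooth_hom_circle:
  fixes H :: "real \<Rightarrow> complex"
  assumes diff: "(H has_vector_derivative a) (at 0)"
    and add: "\<And>s t. H (s + t) = H s * H t" and norm: "\<And>t. norm (H t) = 1"
  shows "\<exists>c. \<forall>t. H t = exp_U1 (c * t)"
proof -
  have "H 0 \<noteq> 0"
    using norm[of 0] by auto
  then have H0: "H 0 = 1"
    using add[of 0 0] by simp
  have dH: "(H has_vector_derivative H t * a) (at t)" for t
  proof -
    have "((\<lambda>s. s - t) has_vector_derivative 1) (at t)"
      by (auto intro!: derivative_eq_intros)
    from vector_diff_chain_at[OF this, of H a] diff
    have "((\<lambda>s. H (s - t)) has_vector_derivative a) (at t)"
      by (simp add: comp_def)
    from has_vector_derivative_mult_right[OF this, of "H t"]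
    show ?thesis
      by (simp flip: add)
  qed
  define K where "K = (\<lambda>t. H t * exp (- (of_real t * a)))"
  have "(K has_vector_derivative 0) (at t)" for t
  proof -
    have "((\<lambda>t. exp (- (of_real t * a))) has_vector_derivative - a * exp (- (of_real t * a))) (at t)"
    proof -
      have "((\<lambda>t. of_real t :: complex) has_vector_derivative of_real 1) (at t)"
        by (rule has_vector_derivative_of_real) simp
      then have "((\<lambda>t. of_real t * (- a)) has_vector_derivative of_real 1 * (- a)) (at t)"
        by (rule has_vector_derivative_mult_left)
      from field_vector_diff_chain_at[OF this DERIV_exp]
      show ?thesis
        by (simp add: comp_def)
    qed
    from has_vector_derivative_mult[OF dH this] show ?thesis
      by (simp add: K_def algebra_simps)
  qed
  then have "K t = K 0" for t
    using has_vector_derivative_zero_constant[of UNIV K] by (metis UNIV_I convex_UNIV)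
  then have K1: "H t * exp (- (of_real t * a)) = 1" for t
    by (simp add: K_def H0)
  have H: "H t = exp (of_real t * a)" for t
    using K1[of t] by (simp add: exp_minus field_simps)
  have "Re a = 0"
    using norm[of 1] by (simp add: H)
  then have ta: "of_real t * a = \<i> * of_real (2 * pi * (Im a / (2 * pi) * t))" for t
    by (simp add: complex_eq_iff)
  have "H t = exp_U1 (Im a / (2 * pi) * t)" for t
    unfolding H exp_U1_def cis_conv_exp ta ..
  then show ?thesis by blast
qed

lemma Ints_linear_zero:
  fixes k :: real
  assumes "\<And>t. k * t \<in> \<int>"
  shows "k = 0"
proof (rule ccontr)
  assume "k \<noteq> 0"
  then have "(1 / 2 :: real) \<in> \<int>"
    using assms[of "1 / (2 * k)"] by (simp add: field_simps)
  then show False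
    by (auto elim!: Ints_cases)
qed

locale equivariant_ext =
  fixes G :: "'g diff_group" and \<sigma> :: "int \<Rightarrow> 'g \<Rightarrow> 'g" and X :: "('g, 'e) ext"
  assumes G: "diffeological_group G" and \<sigma>: "smooth_Z2_action G \<sigma>" and ext: "equivariant_extension G \<sigma> X"
begin

abbreviation E where "E \<equiv> ext_grp X"
abbreviation \<iota> where "\<iota> \<equiv> ext_incl X"
abbreviation q where "q \<equiv> ext_q X"
abbreviation \<sigma>' where "\<sigma>' \<equiv> ext_sigma X"

lemma cext: "central_extension G X"
  using ext by (simp add: equivariant_extension_def)

sublocale G: smooth_z2_group G \<sigma>
  by (rule smooth_Z2_action_imp[OF diffeological_group_smooth[OF G] \<sigma>])

sublocale E: smooth_z2_group E \<sigma>'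
  using ext by (intro smooth_Z2_action_imp diffeological_group_smooth)
    (simp_all add: equivariant_extension_def central_extension_def)

lemma \<iota>_hom: "\<iota> \<in> hom U1_group E"
  and q_hom: "q \<in> hom E G"
  and kernel_q: "kernel E G q = \<iota> ` sphere 0 1"
  and \<iota>_central: "z \<in> sphere 0 1 \<Longrightarrow> g \<in> carrier E \<Longrightarrow> \<iota> z \<otimes>\<^bsub>E\<^esub> g = g \<otimes>\<^bsub>E\<^esub> \<iota> z"
  and \<iota>_diffeo: "diffeomorphism (dspace U1_group) (subspace_diff (dspace E) (\<iota> ` carrier U1_group)) \<iota>"
  using cext by (simp_all add: central_extension_def)

lemma q_\<sigma>: "\<epsilon> \<in> {1, -1} \<Longrightarrow> g \<in> carrier E \<Longrightarrow> q (\<sigma>' \<epsilon> g) = \<sigma> \<epsilon> (q g)"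
  using ext unfolding equivariant_extension_def by auto

lemma \<iota>_closed: "z \<in> sphere 0 1 \<Longrightarrow> \<iota> z \<in> carrier E"
  using hom_in_carrier[OF \<iota>_hom, of z] by simp

lemma \<iota>_mult: "z \<in> sphere 0 1 \<Longrightarrow> w \<in> sphere 0 1 \<Longrightarrow> \<iota> (z * w) = \<iota> z \<otimes>\<^bsub>E\<^esub> \<iota> w"
  using hom_mult[OF \<iota>_hom, of z w] by simp

lemma \<iota>_inj: "inj_on \<iota> (sphere 0 1)"
  using \<iota>_diffeo by (simp add: diffeomorphism_def bij_betw_def dspace_def)

definition \<iota>_inv :: "'e \<Rightarrow> complex" where
  "\<iota>_inv = inv_into (carrier U1_group) \<iota>"

lemma \<iota>_inv_\<iota>: "z \<in> sphere 0 1 \<Longrightarrow> \<iota>_inv (\<iota> z) = z"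
  using \<iota>_inj by (simp add: \<iota>_inv_def)

lemma q_kernel:
  assumes "g \<in> carrier E" "q g = \<one>\<^bsub>G\<^esub>"
  shows "\<iota>_inv g \<in> sphere 0 1" "\<iota> (\<iota>_inv g) = g"
proof -
  have g: "g \<in> \<iota> ` sphere 0 1"
    using assms unfolding kernel_q[symmetric] kernel_def by simp
  show "\<iota>_inv g \<in> sphere 0 1" "\<iota> (\<iota>_inv g) = g"
    using inv_into_into[OF g] f_inv_into_f[OF g] by (simp_all add: \<iota>_inv_def)
qed

lemma q_\<iota>: "z \<in> sphere 0 1 \<Longrightarrow> q (\<iota> z) = \<one>\<^bsub>G\<^esub>"
  using kernel_q by (auto simp: kernel_def)

lemma gplots_\<iota>: 
  assumes "gplots U1_group n U p"
  shows "gplots E n U (\<lambda>v. \<iota> (p v))"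
proof -
  have "plots (subspace_diff (dspace E) (\<iota> ` carrier U1_group)) n U (\<iota> \<circ> p)"
    using \<iota>_diffeo assms unfolding diffeomorphism_def smooth_map_def by (simp add: dspace_def)
  then show ?thesis
    by (simp add: subspace_diff_def dspace_def comp_def)
qed

lemma gplots_\<iota>_inv:
  assumes "gplots E n U p" "\<And>v. v \<in> U \<Longrightarrow> q (p v) = \<one>\<^bsub>G\<^esub>"
  shows "gplots U1_group n U (\<lambda>v. \<iota>_inv (p v))"
proof -
  have "p v \<in> \<iota> ` sphere 0 1" if "v \<in> U" for v
    using q_kernel[OF E.gplot_carrier[OF assms(1) that] assms(2)[OF that]] by (metis imageI)
  then have p: "plots (subspace_diff (dspace E) (\<iota> ` carrier U1_group)) n U p"
    using assms(1) by (simp add: subspace_diff_def dspace_def image_subset_iff)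
  have "smooth_map (subspace_diff (dspace E) (\<iota> ` carrier U1_group)) (dspace U1_group)
      (inv_into (points (dspace U1_group)) \<iota>)"
    using \<iota>_diffeo unfolding diffeomorphism_def by simp
  then have "plots (dspace U1_group) n U (inv_into (points (dspace U1_group)) \<iota> \<circ> p)"
    using p unfolding smooth_map_def by simp
  then show ?thesis
    by (simp add: dspace_def comp_def \<iota>_inv_def)
qed

lemma U1_act_eq: "U1_act X \<epsilon> z = \<iota>_inv (\<sigma>' \<epsilon> (\<iota> z))"
  by (simp add: U1_act_def \<iota>_inv_def)

lemma
  assumes e: "\<epsilon> \<in> {1, -1}" and z: "z \<in> sphere 0 1"
  shows U1_act_closed: "U1_act X \<epsilon> z \<in> sphere 0 1"
    and \<iota>_U1_act: "\<iota> (U1_act X \<epsilon> z) = \<sigma>' \<epsilon> (\<iota> z)"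
proof -
  have "q (\<sigma>' \<epsilon> (\<iota> z)) = \<one>\<^bsub>G\<^esub>"
    using e z by (simp only: q_\<sigma>[OF e \<iota>_closed[OF z]] q_\<iota>[OF z] G.\<rho>_one[OF e])
  from q_kernel[OF E.\<rho>_closed[OF e \<iota>_closed[OF z]] this]
  show "U1_act X \<epsilon> z \<in> sphere 0 1" "\<iota> (U1_act X \<epsilon> z) = \<sigma>' \<epsilon> (\<iota> z)"
    by (simp_all only: U1_act_eq)
qed

lemma U1_act_mult:
  assumes e: "\<epsilon> \<in> {1, -1}" and z: "z \<in> sphere 0 1" and w: "w \<in> sphere 0 1"
  shows "U1_act X \<epsilon> (z * w) = U1_act X \<epsilon> z * U1_act X \<epsilon> w"
proof -
  have zw: "z * w \<in> sphere 0 1" "U1_act X \<epsilon> z * U1_act X \<epsilon> w \<in> sphere 0 1"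
    using z w U1_act_closed[OF e z] U1_act_closed[OF e w] by (auto simp: norm_mult)
  have "\<iota> (U1_act X \<epsilon> (z * w)) = \<iota> (U1_act X \<epsilon> z * U1_act X \<epsilon> w)"
    unfolding \<iota>_U1_act[OF e zw(1)] \<iota>_mult[OF z w] \<iota>_mult[OF U1_act_closed[OF e z] U1_act_closed[OF e w]]
      \<iota>_U1_act[OF e z] \<iota>_U1_act[OF e w]
    by (rule E.\<rho>_mult[OF e \<iota>_closed[OF z] \<iota>_closed[OF w]])
  then show ?thesis
    using inj_onD[OF \<iota>_inj _ U1_act_closed[OF e zw(1)] zw(2)] by blast
qed

lemma gplots_U1_act:
  assumes e: "\<epsilon> \<in> {1, -1}" and p: "gplots U1_group n U p"
  shows "gplots U1_group n U (\<lambda>v. U1_act X \<epsilon> (p v))"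
  unfolding U1_act_eq
proof (rule gplots_\<iota>_inv)
  show "gplots E n U (\<lambda>v. \<sigma>' \<epsilon> (\<iota> (p v)))"
    by (rule E.gplots_\<rho>[OF e gplots_\<iota>[OF p]])
  fix v assume "v \<in> U"
  then have z: "p v \<in> sphere 0 1"
    using smooth_group.gplot_carrier[OF smooth_group_U1 p] by simp
  show "q (\<sigma>' \<epsilon> (\<iota> (p v))) = \<one>\<^bsub>G\<^esub>"
    by (simp only: q_\<sigma>[OF e \<iota>_closed[OF z]] q_\<iota>[OF z] G.\<rho>_one[OF e])
qed

text \<open>
  The action of \<open>\<epsilon>\<close> on \<open>U(1)\<close>, composed with the exponential map, is a homomorphism from the line to
  the circle. It is differentiable at \<open>0\<close> because it is a plot of dimension \<open>1\<close>.
\<close>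

lemma U1_act_lift:
  assumes e: "\<epsilon> \<in> {1, -1}"
  shows "\<exists>c. \<forall>t. U1_act X \<epsilon> (exp_U1 t) = exp_U1 (c * t)"
proof -
  define H where "H = (\<lambda>t. U1_act X \<epsilon> (exp_U1 t))"
  let ?U = "topspace (Euclidean_space 1)"
  have "gplots R_group 1 ?U (\<lambda>v. v 0)"
    by (simp add: gplots_R smooth_fun_def Ck_on_coordinate)
  from gplots_U1_act[OF e gplots_exp_U1[OF this]]
  have C: "Ck_on (Suc 0) 1 ?U (\<lambda>v. Re (H (v 0)))" "Ck_on (Suc 0) 1 ?U (\<lambda>v. Im (H (v 0)))"
    by (auto simp: gplots_U1 smooth_fun_def H_def)
  define v0 :: "nat \<Rightarrow> real" where "v0 = (\<lambda>_. 0)"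
  have v0: "v0 \<in> ?U"
    by (simp add: v0_def topspace_Euclidean_space)
  obtain \<psi> where "has_partial 0 ?U (\<lambda>v. Re (H (v 0))) \<psi>"
    using C(1) by (rule Ck_on_SucE[where i = 0]) simp
  from has_partialD[OF this v0] have re: "((\<lambda>t. Re (H t)) has_real_derivative \<psi> v0) (at 0)"
    by (simp add: v0_def)
  obtain \<eta> where "has_partial 0 ?U (\<lambda>v. Im (H (v 0))) \<eta>"
    using C(2) by (rule Ck_on_SucE[where i = 0]) simp
  from has_partialD[OF this v0] have im: "((\<lambda>t. Im (H t)) has_real_derivative \<eta> v0) (at 0)"
    by (simp add: v0_def)
  have "(H has_vector_derivative Complex (\<psi> v0) (\<eta> v0)) (at 0)"
    using has_vector_derivative_complex_iff[of H "Complex (\<psi> v0) (\<eta> v0)" "at 0"] re im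
    by (simp add: has_real_derivative_iff_has_vector_derivative)
  then have "\<exists>c. \<forall>t. H t = exp_U1 (c * t)"
  proof (rule smooth_hom_circle)
    show "H (s + t) = H s * H t" for s t
      by (simp add: H_def exp_U1_add U1_act_mult[OF e])
    show "norm (H t) = 1" for t
      using U1_act_closed[OF e, of "exp_U1 t"] by (simp add: H_def)
  qed
  then show ?thesis
    by (simp add: H_def)
qed

text \<open>
  The factor by which \<open>\<epsilon>\<close> acts on the Lie algebra of \<open>U(1)\<close>. It is unique by \<open>exp_U1_linear_inj\<close>
  and equals \<open>1\<close> or \<open>-1\<close> because \<open>\<epsilon>\<close> acts as an involution.
\<close>

definition sign :: "int \<Rightarrow> real" where
  "sign \<epsilon> = (SOME c. \<forall>t. U1_act X \<epsilon> (exp_U1 t) = exp_U1 (c * t))"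

lemma U1_act_exp: "\<epsilon> \<in> {1, -1} \<Longrightarrow> U1_act X \<epsilon> (exp_U1 t) = exp_U1 (sign \<epsilon> * t)"
  using someI_ex[OF U1_act_lift] unfolding sign_def by blast

text \<open>The difference of the slopes takes all real numbers to integers, so it vanishes.\<close>

lemma exp_U1_linear_inj:
  assumes "\<And>t. exp_U1 (a * t) = exp_U1 (b * t)"
  shows "a = b"
proof -
  have "exp_U1 (a * t - b * t) = 1" for t
    unfolding exp_U1_minus using assms[of t] by (metis divide_self norm_exp_U1 norm_zero zero_neq_one)
  then have "(a - b) * t \<in> \<int>" for t
    by (simp add: exp_U1_eq_1_iff left_diff_distrib)
  then show ?thesis
    using Ints_linear_zero[of "a - b"] by simp
qed

lemma sign_mult:
  assumes "\<epsilon> \<in> {1, -1}" "\<delta> \<in> {1, -1}"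
  shows "sign (\<epsilon> * \<delta>) = sign \<epsilon> * sign \<delta>"
proof (rule exp_U1_linear_inj)
  fix t
  have ed: "\<epsilon> * \<delta> \<in> {1, -1}"
    using assms by auto
  have t: "exp_U1 s \<in> sphere 0 1" for s
    by simp
  have "\<iota> (U1_act X (\<epsilon> * \<delta>) (exp_U1 t)) = \<iota> (U1_act X \<epsilon> (U1_act X \<delta> (exp_U1 t)))"
    by (simp only: \<iota>_U1_act[OF ed t] \<iota>_U1_act[OF assms(1) U1_act_closed[OF assms(2) t]] \<iota>_U1_act[OF assms(2) t]
        E.\<rho>_comp[OF assms \<iota>_closed[OF t]])
  then have "U1_act X (\<epsilon> * \<delta>) (exp_U1 t) = U1_act X \<epsilon> (U1_act X \<delta> (exp_U1 t))"
    using inj_onD[OF \<iota>_inj _ U1_act_closed[OF ed t] U1_act_closed[OF assms(1) U1_act_closed[OF assms(2) t]]] by blast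
  then show "exp_U1 (sign (\<epsilon> * \<delta>) * t) = exp_U1 (sign \<epsilon> * sign \<delta> * t)"
    using assms ed by (simp only: U1_act_exp mult.assoc)
qed

lemma sign_1: "sign 1 = 1"
proof (rule exp_U1_linear_inj)
  fix t
  have t: "exp_U1 t \<in> sphere 0 1"
    by simp
  have "U1_act X 1 (exp_U1 t) = exp_U1 t"
    unfolding U1_act_eq by (simp only: E.\<rho>_1[OF \<iota>_closed[OF t]] \<iota>_inv_\<iota>[OF t])
  then show "exp_U1 (sign 1 * t) = exp_U1 (1 * t)"
    using U1_act_exp[of 1 t] by simp
qed

lemma sign: "\<epsilon> \<in> {1, -1} \<Longrightarrow> sign \<epsilon> \<in> {1, -1}"
proof -
  assume "\<epsilon> \<in> {1, -1}"
  then have "sign \<epsilon> * sign \<epsilon> = 1"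
    using sign_mult[of \<epsilon> \<epsilon>] sign_1 by auto
  then show ?thesis
    by (simp add: square_eq_1_iff)
qed

lemma R_act_eq: 
  assumes e: "\<epsilon> \<in> {1, -1}"
  shows "R_act X \<epsilon> t = sign \<epsilon> * t"
proof -
  have "R_act X \<epsilon> = (\<lambda>t. sign \<epsilon> * t)"
    unfolding R_act_def
  proof (rule the_equality)
    show "linear (\<lambda>t. sign \<epsilon> * t) \<and> (\<forall>t. exp_U1 (sign \<epsilon> * t) = U1_act X \<epsilon> (exp_U1 t))"
      using U1_act_exp[OF e] by (simp add: linear_times)
    fix r assume r: "linear r \<and> (\<forall>t. exp_U1 (r t) = U1_act X \<epsilon> (exp_U1 t))"
    then have rt: "r t = r 1 * t" for t
      using linear_cmul[of r t 1] by (simp add: mult.commute)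
    have "r 1 = sign \<epsilon>"
    proof (rule exp_U1_linear_inj)
      fix t
      have "exp_U1 (r t) = U1_act X \<epsilon> (exp_U1 t)"
        using r by simp
      then show "exp_U1 (r 1 * t) = exp_U1 (sign \<epsilon> * t)"
        by (simp only: rt[of t, symmetric] U1_act_exp[OF e])
    qed
    with rt show "r = (\<lambda>t. sign \<epsilon> * t)"
      by (simp add: fun_eq_iff)
  qed
  then show ?thesis by simp
qed

lemma exp_R_act: "\<epsilon> \<in> {1, -1} \<Longrightarrow> exp_U1 (R_act X \<epsilon> t) = U1_act X \<epsilon> (exp_U1 t)"
  by (simp only: R_act_eq U1_act_exp)

lemma smooth_z2_R: "smooth_z2_group R_group (R_act X)"
proof -
  interpret smooth_group R_group by (rule smooth_group_R)
  show ?thesis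
  proof
    fix \<epsilon> :: int and n U p assume e: "\<epsilon> \<in> {1, -1}" and p: "gplots R_group n U p"
    show "gplots R_group n U (\<lambda>v. R_act X \<epsilon> (p v))"
      unfolding R_act_eq[OF e] using p by (simp add: gplots_R smooth_fun_def Ck_on_cmult)
  next
    fix \<epsilon> \<delta> :: int and a assume e: "\<epsilon> \<in> {1, -1}" "\<delta> \<in> {1, -1}"
    then have "\<epsilon> * \<delta> \<in> {1, -1}" by auto
    then show "R_act X \<epsilon> (R_act X \<delta> a) = R_act X (\<epsilon> * \<delta>) a"
      by (simp only: R_act_eq e sign_mult mult.assoc)
  qed (simp_all add: R_act_eq sign_1 distrib_left)
qed

lemma R_act_Ints: "\<epsilon> \<in> {1, -1} \<Longrightarrow> a \<in> \<int> \<Longrightarrow> R_act X \<epsilon> a \<in> \<int>"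
  using sign[of \<epsilon>] by (simp only: R_act_eq) auto

lemma smooth_z2_Z: "smooth_z2_group Z_group (R_act X)"
proof -
  interpret smooth_group Z_group by (rule smooth_group_Z)
  interpret R: smooth_z2_group R_group "R_act X" by (rule smooth_z2_R)
  show ?thesis
  proof
    fix \<epsilon> :: int and n U p assume e: "\<epsilon> \<in> {1, -1}" and p: "gplots Z_group n U p"
    then show "gplots Z_group n U (\<lambda>v. R_act X \<epsilon> (p v))"
      using R.gplots_\<rho>[OF e, of n U p] R_act_Ints[OF e] by (simp add: gplots_Z image_subset_iff)
  next
    fix \<epsilon> \<delta> :: int and a assume "\<epsilon> \<in> {1, -1}" "\<delta> \<in> {1, -1}"
    then show "R_act X \<epsilon> (R_act X \<delta> a) = R_act X (\<epsilon> * \<delta>) a"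
      by (intro R.\<rho>_comp) simp_all
  next
    fix \<epsilon> :: int and a assume "\<epsilon> \<in> {1, -1}" "a \<in> carrier Z_group"
    then show "R_act X \<epsilon> a \<in> carrier Z_group"
      using R_act_Ints by simp
  qed (simp_all add: R_act_eq sign_1 distrib_left)
qed

text \<open>Writing the elements of \<open>U(1)\<close> as exponentials reduces the laws of an action to those of \<open>sign\<close>.\<close>

lemma smooth_z2_U1: "smooth_z2_group U1_group (U1_act X)"
proof -
  interpret smooth_group U1_group by (rule smooth_group_U1)
  show ?thesis
  proof
    fix \<epsilon> :: int and n U p assume "\<epsilon> \<in> {1, -1}" "gplots U1_group n U p"
    then show "gplots U1_group n U (\<lambda>v. U1_act X \<epsilon> (p v))"
      by (rule gplots_U1_act)
  next
    fix \<epsilon> \<delta> :: int and a assume e: "\<epsilon> \<in> {1, -1}" "\<delta> \<in> {1, -1}" and "a \<in> carrier U1_group"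
    then obtain t where t: "a = exp_U1 t"
      using exp_U1_surj[of a] by auto
    have "\<epsilon> * \<delta> \<in> {1, -1}"
      using e by auto
    then show "U1_act X \<epsilon> (U1_act X \<delta> a) = U1_act X (\<epsilon> * \<delta>) a"
      using e by (simp only: t U1_act_exp sign_mult mult.assoc)
  next
    fix a assume "a \<in> carrier U1_group"
    then obtain t where t: "a = exp_U1 t"
      using exp_U1_surj[of a] by auto
    show "U1_act X 1 a = a"
      using U1_act_exp[of 1 t] by (simp add: t sign_1)
  next
    fix \<epsilon> :: int and a b assume "\<epsilon> \<in> {1, -1}" "a \<in> carrier U1_group" "b \<in> carrier U1_group"
    then show "U1_act X \<epsilon> (a \<otimes>\<^bsub>U1_group\<^esub> b) = U1_act X \<epsilon> a \<otimes>\<^bsub>U1_group\<^esub> U1_act X \<epsilon> b"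
      unfolding mult_U1 carrier_U1 by (rule U1_act_mult)
  next
    fix \<epsilon> :: int and a assume "\<epsilon> \<in> {1, -1}" "a \<in> carrier U1_group"
    then show "U1_act X \<epsilon> a \<in> carrier U1_group"
      unfolding carrier_U1 by (rule U1_act_closed)
  qed
qed

end

section \<open>Smooth functions and twisted coefficients as sheaves of functions\<close>

lemma openin_D_points: "openin (D_topology X) V \<Longrightarrow> V \<subseteq> points X"
  by (simp add: openin_D_topology)

lemma fpresheaf_smooth_sheaf:
  fixes X :: "'x diff_space"
  assumes A: "smooth_group A" and comm: "comm_group A" and X: "local_diffeology X"
  shows "fpresheaf A (D_topology X) (smooth_sheaf X A) (\<lambda>s. s) (\<lambda>W. smooth_on X W A)"
proof -
  interpret smooth_group A by fact
  interpret comm_group A by fact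
  have car: "s \<in> carrier (sections (smooth_sheaf X A) V) \<longleftrightarrow> s \<in> extensional V \<and> smooth_on X V A s" for s V
    by (simp add: smooth_sheaf_def)
  have restrict_sm: "smooth_on X V A (restrict g V)" if "smooth_on X V A g" for g V
    by (rule smooth_on_cong[OF that]) simp
  show ?thesis
  proof unfold_locales
    fix V s assume "openin (D_topology X) V" "s \<in> carrier (sections (smooth_sheaf X A) V)"
    then show "smooth_on X V A s"
      by (simp add: car)
  next
    fix V g assume "openin (D_topology X) V" "smooth_on X V A g"
    then show "\<exists>s\<in>carrier (sections (smooth_sheaf X A) V). \<forall>y\<in>V. s y = g y"
      by (intro bexI[of _ "restrict g V"]) (simp_all add: car restrict_sm)
  next
    fix V s t assume "openin (D_topology X) V" "s \<in> carrier (sections (smooth_sheaf X A) V)"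
      "t \<in> carrier (sections (smooth_sheaf X A) V)" "\<And>y. y \<in> V \<Longrightarrow> s y = t y"
    then show "s = t"
      unfolding car by (intro extensionalityI[of s V t]) auto
  next
    fix V W s assume W: "W \<subseteq> V" and s: "s \<in> carrier (sections (smooth_sheaf X A) V)"
    have "smooth_on X W A (restrict s W)"
      by (rule restrict_sm[OF smooth_on_subset[OF _ W]]) (use s car in blast)
    then show "res (smooth_sheaf X A) V W s \<in> carrier (sections (smooth_sheaf X A) W)"
      unfolding car by (simp add: smooth_sheaf_def)
  next
    fix V W :: "'x set" and s y assume "y \<in> W"
    then show "res (smooth_sheaf X A) V W s y = s y"
      by (simp add: smooth_sheaf_def)
  next
    fix V g y assume "openin (D_topology X) V" "smooth_on X V A g" "y \<in> V"
    then show "g y \<in> carrier A"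
      using openin_D_points[of X V] by (intro smooth_on_carrier[of X V A g]) auto
  next
    fix V g g' assume "smooth_on X V A g" "\<And>y. y \<in> V \<Longrightarrow> g y = g' y"
    then show "smooth_on X V A g'"
      by (rule smooth_on_cong)
  next
    fix V g assume "smooth_on X V A g"
    then show "smooth_on X V A (\<lambda>y. inv\<^bsub>A\<^esub> g y)"
      by (rule smooth_on_inv)
  next
    fix V s t assume "s \<in> carrier (sections (smooth_sheaf X A) V)" "t \<in> carrier (sections (smooth_sheaf X A) V)"
    then have "smooth_on X V A s" "smooth_on X V A t"
      by (simp_all add: car)
    from restrict_sm[OF smooth_on_mult[OF this]]
    show "s \<otimes>\<^bsub>sections (smooth_sheaf X A) V\<^esub> t \<in> carrier (sections (smooth_sheaf X A) V)"
      unfolding car by (simp add: smooth_sheaf_def)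
  next
    fix V :: "'x set" and s t y assume "y \<in> V"
    then show "(s \<otimes>\<^bsub>sections (smooth_sheaf X A) V\<^esub> t) y = s y \<otimes>\<^bsub>A\<^esub> t y"
      by (simp add: smooth_sheaf_def)
  next
    fix V show "\<one>\<^bsub>sections (smooth_sheaf X A) V\<^esub> \<in> carrier (sections (smooth_sheaf X A) V)"
      unfolding car using restrict_sm[OF smooth_on_const[OF X one_closed]] by (simp add: smooth_sheaf_def)
  next
    fix V :: "'x set" and y assume "y \<in> V"
    then show "\<one>\<^bsub>sections (smooth_sheaf X A) V\<^esub> y = \<one>\<^bsub>A\<^esub>"
      by (simp add: smooth_sheaf_def)
  qed
qed

locale twisted_cover =
  fixes X :: "'x diff_space" and I :: "'i set" and U :: "'i \<Rightarrow> 'x set" and \<epsilon> :: "'i \<Rightarrow> 'i \<Rightarrow> 'x \<Rightarrow> int"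
  assumes X: "local_diffeology X"
    and U_open: "\<And>i. i \<in> I \<Longrightarrow> openin (D_topology X) (U i)"
    and cover: "points X = (\<Union>i\<in>I. U i)"
    and \<epsilon>: "\<And>i j x. i \<in> I \<Longrightarrow> j \<in> I \<Longrightarrow> x \<in> U i \<Longrightarrow> x \<in> U j \<Longrightarrow> \<epsilon> i j x \<in> {1, -1}"
    and \<epsilon>_comp: "\<And>i j k x. i \<in> I \<Longrightarrow> j \<in> I \<Longrightarrow> k \<in> I \<Longrightarrow> x \<in> U i \<Longrightarrow> x \<in> U j \<Longrightarrow> x \<in> U k \<Longrightarrow>
      \<epsilon> i j x * \<epsilon> j k x = \<epsilon> i k x"
    and \<epsilon>_smooth: "\<And>i j. i \<in> I \<Longrightarrow> j \<in> I \<Longrightarrow> smooth_on X (U i \<inter> U j) Z2_group (\<epsilon> i j)"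
begin

abbreviation "T \<equiv> D_topology X"

text \<open>
  The index that \<^const>\<open>cech_class\<close> chooses. Sections are evaluated with respect to the same choice.
\<close>

definition frame :: "'x \<Rightarrow> 'i" where
  "frame x = (SOME i. i \<in> I \<and> x \<in> U i)"

lemma topspace: "topspace T = points X"
  by (rule topspace_D_topology[OF X])

lemma frame:
  assumes "x \<in> points X"
  shows "frame x \<in> I" "x \<in> U (frame x)"
proof -
  have "\<exists>i. i \<in> I \<and> x \<in> U i"
    using assms cover by auto
  from someI_ex[OF this] show "frame x \<in> I" "x \<in> U (frame x)"
    by (simp_all add: frame_def)
qed

lemma \<epsilon>_same: "i \<in> I \<Longrightarrow> x \<in> U i \<Longrightarrow> \<epsilon> i i x = 1"
  using \<epsilon>[of i i x] \<epsilon>_comp[of i i i x] by auto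

end

locale twisted_coefficients = twisted_cover X I U \<epsilon> + smooth_z2_group A \<rho> + comm_group A
  for X :: "'x diff_space" and I :: "'i set" and U \<epsilon> and A :: "'a diff_group" (structure) and \<rho>
begin

definition val :: "('i \<Rightarrow> 'x \<Rightarrow> 'a) \<Rightarrow> 'x \<Rightarrow> 'a" where
  "val m y = m (frame y) y"

text \<open>
  The function \<open>g\<close> itself jumps wherever the choice of frames does; it is smooth after the change to a
  fixed frame \<open>i\<close>.
\<close>

definition sec :: "'x set \<Rightarrow> ('x \<Rightarrow> 'a) \<Rightarrow> bool" where
  "sec W g \<longleftrightarrow> (\<forall>y\<in>W. g y \<in> carrier A) \<and>
     (\<forall>i\<in>I. smooth_on X (W \<inter> U i) A (\<lambda>y. \<rho> (\<epsilon> i (frame y) y) (g y)))"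

abbreviation "F \<equiv> twisted_sheaf X A \<rho> I U \<epsilon>"

lemma \<rho>_\<epsilon>: 
  assumes "i \<in> I" "j \<in> I" "k \<in> I" "x \<in> U i" "x \<in> U j" "x \<in> U k" "a \<in> carrier A"
  shows "\<rho> (\<epsilon> i j x) (\<rho> (\<epsilon> j k x) a) = \<rho> (\<epsilon> i k x) a"
  using assms by (simp only: \<rho>_comp[OF \<epsilon> \<epsilon>] \<epsilon>_comp)

lemma \<rho>_same: "i \<in> I \<Longrightarrow> x \<in> U i \<Longrightarrow> a \<in> carrier A \<Longrightarrow> \<rho> (\<epsilon> i i x) a = a"
  by (simp add: \<epsilon>_same \<rho>_1)

lemma in_sections_iff: "m \<in> carrier (sections F W) \<longleftrightarrow> family_on I U W m = m \<and>
    (\<forall>i\<in>I. smooth_on X (W \<inter> U i) A (m i)) \<and>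
    (\<forall>i\<in>I. \<forall>j\<in>I. \<forall>x\<in>W \<inter> U i \<inter> U j. m i x = \<rho> (\<epsilon> i j x) (m j x))"
  by (simp add: twisted_sheaf_def)

lemma section_smooth:
  assumes m: "m \<in> carrier (sections F W)" and i: "i \<in> I"
  shows "smooth_on X (W \<inter> U i) A (m i)"
  by (rule m[unfolded in_sections_iff, THEN conjunct2, THEN conjunct1, THEN bspec, OF i])

lemma section_family_on: "m \<in> carrier (sections F W) \<Longrightarrow> family_on I U W m = m"
  unfolding in_sections_iff by (rule conjunct1)

lemma section_change:
  assumes m: "m \<in> carrier (sections F W)" and i: "i \<in> I" and j: "j \<in> I"
    and x: "x \<in> W" "x \<in> U i" "x \<in> U j"
  shows "m i x = \<rho> (\<epsilon> i j x) (m j x)"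
proof (rule m[unfolded in_sections_iff, THEN conjunct2, THEN conjunct2, THEN bspec, OF i, THEN bspec, OF j,
      THEN bspec])
  show "x \<in> W \<inter> U i \<inter> U j"
    using x by simp
qed

lemma family_on_idem [simp]: "family_on I U W (family_on I U V m) = family_on I U (V \<inter> W) m"
  by (auto simp: family_on_def fun_eq_iff)

lemma family_on_apply: "i \<in> I \<Longrightarrow> x \<in> W \<Longrightarrow> x \<in> U i \<Longrightarrow> family_on I U W m i x = m i x"
  by (simp add: family_on_def)

lemma smooth_family_on: "i \<in> I \<Longrightarrow> smooth_on X (W \<inter> U i) A (m i) \<Longrightarrow> smooth_on X (W \<inter> U i) A (family_on I U W m i)"
  by (erule smooth_on_cong) (simp add: family_on_def)

lemma section_carrier:
  assumes "m \<in> carrier (sections F W)" "i \<in> I" "x \<in> W" "x \<in> U i" "W \<subseteq> points X"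
  shows "m i x \<in> carrier A"
  by (rule smooth_on_carrier[OF section_smooth[OF assms(1,2)]]) (use assms in auto)

lemma family_in_sections:
  assumes W: "W \<subseteq> points X" and sm: "\<And>i. i \<in> I \<Longrightarrow> smooth_on X (W \<inter> U i) A (m i)"
    and change: "\<And>i j x. i \<in> I \<Longrightarrow> j \<in> I \<Longrightarrow> x \<in> W \<Longrightarrow> x \<in> U i \<Longrightarrow> x \<in> U j \<Longrightarrow> m i x = \<rho> (\<epsilon> i j x) (m j x)"
  shows "family_on I U W m \<in> carrier (sections F W)"
  unfolding in_sections_iff
proof (intro conjI ballI)
  fix i assume "i \<in> I"
  then show "smooth_on X (W \<inter> U i) A (family_on I U W m i)"
    using sm by (intro smooth_family_on)
next
  fix i j x assume "i \<in> I" "j \<in> I" "x \<in> W \<inter> U i \<inter> U j"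
  then show "family_on I U W m i x = \<rho> (\<epsilon> i j x) (family_on I U W m j x)"
    using change[of i j x] by (simp add: family_on_apply)
qed simp

text \<open>The change of frames recovers a section from its values in the chosen frames.\<close>

lemma fpresheaf: "fpresheaf A T F val sec"
proof unfold_locales
  fix V s assume V: "openin T V" and s: "s \<in> carrier (sections F V)"
  note VX = openin_D_points[OF V]
  show "sec V (val s)"
    unfolding sec_def
  proof (intro conjI ballI)
    fix y assume "y \<in> V"
    then show "val s y \<in> carrier A"
      unfolding val_def using VX frame[of y] by (intro section_carrier[OF s _ _ _ VX]) auto
  next
    fix i assume i: "i \<in> I"
    show "smooth_on X (V \<inter> U i) A (\<lambda>y. \<rho> (\<epsilon> i (frame y) y) (val s y))"
    proof (rule smooth_on_cong[OF section_smooth[OF s i]])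
      fix y assume y: "y \<in> V \<inter> U i"
      then have "y \<in> points X"
        using VX by blast
      then show "s i y = \<rho> (\<epsilon> i (frame y) y) (val s y)"
        unfolding val_def using y i frame by (intro section_change[OF s]) auto
    qed
  qed
next
  fix V g assume V: "openin T V" and g: "sec V g"
  note VX = openin_D_points[OF V]
  have gc: "g y \<in> carrier A" if "y \<in> V" for y
    using g that by (simp add: sec_def)
  have fr: "frame y \<in> I" "y \<in> U (frame y)" if "y \<in> V" for y
    using frame that VX by auto
  let ?m = "\<lambda>i y. \<rho> (\<epsilon> i (frame y) y) (g y)"
  have "family_on I U V ?m \<in> carrier (sections F V)"
  proof (rule family_in_sections[OF VX])
    show "smooth_on X (V \<inter> U i) A (?m i)" if "i \<in> I" for i
      using g that by (simp add: sec_def)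
    show "?m i x = \<rho> (\<epsilon> i j x) (?m j x)" if "i \<in> I" "j \<in> I" "x \<in> V" "x \<in> U i" "x \<in> U j" for i j x
      using that by (simp only: \<rho>_\<epsilon> fr gc)
  qed
  moreover have "val (family_on I U V ?m) y = g y" if "y \<in> V" for y
    unfolding val_def using that fr gc by (simp add: family_on_apply \<rho>_same)
  ultimately show "\<exists>s\<in>carrier (sections F V). \<forall>y\<in>V. val s y = g y"
    by (intro bexI[of _ "family_on I U V ?m"] ballI)
next
  fix V s t assume V: "openin T V" and s: "s \<in> carrier (sections F V)" and t: "t \<in> carrier (sections F V)"
    and eq: "\<And>y. y \<in> V \<Longrightarrow> val s y = val t y"
  have fam: "family_on I U V s = s" "family_on I U V t = t"
    by (rule section_family_on[OF s], rule section_family_on[OF t])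
  have "family_on I U V s = family_on I U V t"
    unfolding family_on_def fun_eq_iff
  proof (intro allI, rule if_cong)
    fix i y assume iy: "i \<in> I \<and> y \<in> V \<inter> U i"
    then have y: "y \<in> points X"
      using openin_D_points[OF V] by blast
    show "s i y = t i y"
      using section_change[OF s, of i "frame y" y] section_change[OF t, of i "frame y" y] frame[OF y] iy eq[of y]
      by (simp add: val_def)
  qed simp_all
  then show "s = t"
    by (simp only: fam)
next
  fix V W s assume V: "openin T V" and W: "openin T W" "W \<subseteq> V" and s: "s \<in> carrier (sections F V)"
  have r: "res F V W s = family_on I U W s"
    by (simp add: twisted_sheaf_def)
  show "res F V W s \<in> carrier (sections F W)"
    unfolding r
  proof (rule family_in_sections[OF openin_D_points[OF W(1)]])
    show "smooth_on X (W \<inter> U i) A (s i)" if "i \<in> I" for i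
      by (rule smooth_on_subset[OF section_smooth[OF s that]]) (use W(2) in blast)
    show "s i x = \<rho> (\<epsilon> i j x) (s j x)" if "i \<in> I" "j \<in> I" "x \<in> W" "x \<in> U i" "x \<in> U j" for i j x
      by (rule section_change[OF s that(1,2) _ that(4,5)]) (use W(2) that in blast)
  qed
  fix y assume y: "y \<in> W"
  then have "y \<in> points X"
    using openin_D_points[OF W(1)] by blast
  then show "val (res F V W s) y = val s y"
    unfolding r val_def using y frame by (simp add: family_on_apply)
next
  fix V g y assume "sec V g" "y \<in> V"
  then show "g y \<in> carrier A"
    by (simp add: sec_def)
next
  fix V g g' assume g: "sec V g" and eq: "\<And>y. y \<in> V \<Longrightarrow> g y = g' y"
  show "sec V g'"
    unfolding sec_def
  proof (intro conjI ballI)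
    fix y assume y: "y \<in> V"
    have "g y \<in> carrier A"
      using g y by (simp add: sec_def)
    then show "g' y \<in> carrier A"
      by (simp only: eq[OF y])
  next
    fix i assume "i \<in> I"
    then have "smooth_on X (V \<inter> U i) A (\<lambda>y. \<rho> (\<epsilon> i (frame y) y) (g y))"
      using g by (simp add: sec_def)
    then show "smooth_on X (V \<inter> U i) A (\<lambda>y. \<rho> (\<epsilon> i (frame y) y) (g' y))"
      by (rule smooth_on_cong) (simp add: eq)
  qed
next
  fix V g assume V: "openin T V" and g: "sec V g"
  have gc: "g y \<in> carrier A" if "y \<in> V" for y
    using g that by (simp add: sec_def)
  show "sec V (\<lambda>y. inv g y)"
    unfolding sec_def
  proof (intro conjI ballI)
    fix y assume "y \<in> V"
    then show "inv g y \<in> carrier A"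
      using gc by simp
  next
    fix i assume i: "i \<in> I"
    then have "smooth_on X (V \<inter> U i) A (\<lambda>y. \<rho> (\<epsilon> i (frame y) y) (g y))"
      using g by (simp add: sec_def)
    from smooth_on_inv[OF this] show "smooth_on X (V \<inter> U i) A (\<lambda>y. \<rho> (\<epsilon> i (frame y) y) (inv g y))"
    proof (rule smooth_on_cong)
      fix y assume y: "y \<in> V \<inter> U i"
      then have "y \<in> points X"
        using openin_D_points[OF V] by blast
      from frame[OF this] y i show "inv \<rho> (\<epsilon> i (frame y) y) (g y) = \<rho> (\<epsilon> i (frame y) y) (inv g y)"
        by (intro \<rho>_inv[symmetric] \<epsilon> gc) auto
    qed
  qed
next
  fix V s t assume V: "openin T V" and s: "s \<in> carrier (sections F V)" and t: "t \<in> carrier (sections F V)"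
  note VX = openin_D_points[OF V]
  have m: "s \<otimes>\<^bsub>sections F V\<^esub> t = family_on I U V (\<lambda>i x. s i x \<otimes> t i x)"
    by (simp add: twisted_sheaf_def)
  show "s \<otimes>\<^bsub>sections F V\<^esub> t \<in> carrier (sections F V)"
    unfolding m
  proof (rule family_in_sections[OF VX])
    show "smooth_on X (V \<inter> U i) A (\<lambda>x. s i x \<otimes> t i x)" if "i \<in> I" for i
      by (rule smooth_on_mult[OF section_smooth[OF s that] section_smooth[OF t that]])
    show "s i x \<otimes> t i x = \<rho> (\<epsilon> i j x) (s j x \<otimes> t j x)"
      if "i \<in> I" "j \<in> I" "x \<in> V" "x \<in> U i" "x \<in> U j" for i j x
      unfolding section_change[OF s that] section_change[OF t that]
      by (rule \<rho>_mult[symmetric]) (intro \<epsilon> section_carrier[OF s _ _ _ VX] section_carrier[OF t _ _ _ VX] that)+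
  qed
  fix y assume y: "y \<in> V"
  then have "y \<in> points X"
    using VX by blast
  then show "val (s \<otimes>\<^bsub>sections F V\<^esub> t) y = val s y \<otimes> val t y"
    unfolding m val_def using y frame by (simp add: family_on_apply)
next
  fix V assume V: "openin T V"
  note VX = openin_D_points[OF V]
  have o: "\<one>\<^bsub>sections F V\<^esub> = family_on I U V (\<lambda>i x. \<one>)"
    by (simp add: twisted_sheaf_def)
  show "\<one>\<^bsub>sections F V\<^esub> \<in> carrier (sections F V)"
    unfolding o by (rule family_in_sections[OF VX]) (simp_all only: smooth_on_const[OF X one_closed] \<rho>_one[OF \<epsilon>])
  fix y assume y: "y \<in> V"
  then have "y \<in> points X"
    using VX by blast
  then show "val \<one>\<^bsub>sections F V\<^esub> y = \<one>"
    unfolding o val_def using y frame by (simp add: family_on_apply)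
qed

text \<open>
  Over a subset of \<open>U i\<close> every smooth function is a section in the frame \<open>i\<close>; this is how sections with
  prescribed values are constructed.
\<close>

lemma sec_in_frame:
  assumes W: "W \<subseteq> points X" and i: "i \<in> I" "W \<subseteq> U i" and h: "smooth_on X W A h"
  shows "sec W (\<lambda>y. \<rho> (\<epsilon> (frame y) i y) (h y))"
  unfolding sec_def
proof (intro conjI ballI)
  have hc: "h y \<in> carrier A" if "y \<in> W" for y
    using smooth_on_carrier[OF h] that W by blast
  have fr: "frame y \<in> I" "y \<in> U (frame y)" if "y \<in> W" for y
    using frame that W by auto
  {
    fix y assume "y \<in> W"
    then show "\<rho> (\<epsilon> (frame y) i y) (h y) \<in> carrier A"
      using fr i hc by (intro \<rho>_closed \<epsilon>) auto
  next
    fix j assume j: "j \<in> I"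
    have "smooth_on X (W \<inter> U j) A (\<lambda>y. \<rho> (\<epsilon> j i y) (h y))"
    proof (rule smooth_on_act)
      show "smooth_on X (W \<inter> U j) A h"
        by (rule smooth_on_subset[OF h]) blast
      show "smooth_on X (W \<inter> U j) Z2_group (\<epsilon> j i)"
        by (rule smooth_on_subset[OF \<epsilon>_smooth[OF j i(1)]]) (use i(2) in blast)
    qed
    then show "smooth_on X (W \<inter> U j) A (\<lambda>y. \<rho> (\<epsilon> j (frame y) y) (\<rho> (\<epsilon> (frame y) i y) (h y)))"
    proof (rule smooth_on_cong)
      fix y assume "y \<in> W \<inter> U j"
      then show "\<rho> (\<epsilon> j i y) (h y) = \<rho> (\<epsilon> j (frame y) y) (\<rho> (\<epsilon> (frame y) i y) (h y))"
        using i j fr hc by (intro \<rho>_\<epsilon>[symmetric]) auto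
    qed
  }
qed

lemma sec_frame: "sec W g \<Longrightarrow> i \<in> I \<Longrightarrow> smooth_on X (W \<inter> U i) A (\<lambda>y. \<rho> (\<epsilon> i (frame y) y) (g y))"
  by (simp add: sec_def)

lemma sec_carrier: "sec W g \<Longrightarrow> y \<in> W \<Longrightarrow> g y \<in> carrier A"
  by (simp add: sec_def)

end

locale twisted_ext = twisted_cover X I U \<epsilon> + equivariant_ext G \<sigma> Ext
  for X :: "'x diff_space" and I :: "'i set" and U \<epsilon>
    and G :: "'g diff_group" and \<sigma> and Ext :: "('g, 'e) ext"
begin

sublocale Z: twisted_coefficients X I U \<epsilon> Z_group "R_act Ext"
  by (intro twisted_coefficients.intro twisted_cover_axioms smooth_z2_Z comm_group_Z)

sublocale R: twisted_coefficients X I U \<epsilon> R_group "R_act Ext"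
  by (intro twisted_coefficients.intro twisted_cover_axioms smooth_z2_R comm_group_R)

sublocale U: twisted_coefficients X I U \<epsilon> U1_group "U1_act Ext"
  by (intro twisted_coefficients.intro twisted_cover_axioms smooth_z2_U1 comm_group_U1)

lemma sec_Z_iff:
  assumes V: "openin T V"
  shows "Z.sec V g \<longleftrightarrow> R.sec V g \<and> (\<forall>y\<in>V. g y \<in> \<int>)"
proof -
  note VX = openin_D_points[OF V]
  have "R_act Ext (\<epsilon> i (frame y) y) (g y) \<in> \<int>"
    if "i \<in> I" "y \<in> points X \<inter> (V \<inter> U i)" "\<forall>y\<in>V. g y \<in> \<int>" for i y
    using that frame[of y] by (intro R_act_Ints \<epsilon>) auto
  then show ?thesis
    unfolding Z.sec_def R.sec_def smooth_on_Z_iff[OF X] by auto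
qed

text \<open>
  A local logarithm is taken in a fixed frame \<open>i\<close> and carried to the other frames by the action on \<open>\<real>\<close>,
  which the exponential map intertwines with the action on \<open>U(1)\<close>.
\<close>

lemma exp_sequence:
  "exp_sequence T Z.F Z.val Z.sec R.F R.val R.sec U.F U.val U.sec
     (\<lambda>W m. m) (\<lambda>W m. family_on I U W (\<lambda>i x. exp_U1 (m i x)))"
proof (intro exp_sequence.intro Z.fpresheaf R.fpresheaf U.fpresheaf exp_sequence_axioms.intro)
  fix V g assume V: "openin T V"
  show "Z.sec V g \<longleftrightarrow> R.sec V g \<and> (\<forall>y\<in>V. g y \<in> \<int>)"
    by (rule sec_Z_iff[OF V])
next
  fix V g assume V: "openin T V" and g: "R.sec V g"
  show "U.sec V (\<lambda>y. exp_U1 (g y))"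
    unfolding U.sec_def
  proof (intro conjI ballI)
    fix i assume i: "i \<in> I"
    show "smooth_on X (V \<inter> U i) U1_group (\<lambda>y. U1_act Ext (\<epsilon> i (frame y) y) (exp_U1 (g y)))"
    proof (rule U.smooth_on_cong[OF smooth_on_exp_U1[OF R.sec_frame[OF g i]]])
      fix y assume y: "y \<in> V \<inter> U i"
      then have "y \<in> points X"
        using openin_D_points[OF V] by blast
      from frame[OF this] y i
      show "exp_U1 (R_act Ext (\<epsilon> i (frame y) y) (g y)) = U1_act Ext (\<epsilon> i (frame y) y) (exp_U1 (g y))"
        by (intro exp_R_act \<epsilon>) auto
    qed
  qed simp
next
  fix V g x assume V: "openin T V" and g: "U.sec V g" and x: "x \<in> V"
  note VX = openin_D_points[OF V]
  define i where "i = frame x"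
  have i: "i \<in> I" "x \<in> U i"
    unfolding i_def using frame x VX by auto
  have "openin T (V \<inter> U i)" "x \<in> V \<inter> U i"
    using V U_open i x by auto
  from smooth_on_log[OF X U.sec_frame[OF g i(1)] this]
  obtain W h where W: "openin T W" "x \<in> W" "W \<subseteq> V \<inter> U i" and h: "smooth_on X W R_group h"
    and eh: "\<forall>y\<in>W. exp_U1 (h y) = U1_act Ext (\<epsilon> i (frame y) y) (g y)"
    by (elim exE conjE)
  have "R.sec W (\<lambda>y. R_act Ext (\<epsilon> (frame y) i y) (h y))"
    using W(3) by (intro R.sec_in_frame openin_D_points[OF W(1)] i(1) h) blast
  moreover have "exp_U1 (R_act Ext (\<epsilon> (frame y) i y) (h y)) = g y" if y: "y \<in> W" for y
  proof -
    have "y \<in> points X"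
      using openin_D_points[OF W(1)] y by blast
    note fr = frame[OF this]
    have "exp_U1 (R_act Ext (\<epsilon> (frame y) i y) (h y)) = U1_act Ext (\<epsilon> (frame y) i y) (exp_U1 (h y))"
      using W(3) y fr i by (intro exp_R_act \<epsilon>) auto
    also have "\<dots> = U1_act Ext (\<epsilon> (frame y) i y) (U1_act Ext (\<epsilon> i (frame y) y) (g y))"
      using eh y by simp
    also have "\<dots> = U1_act Ext (\<epsilon> (frame y) (frame y) y) (g y)"
      using W(3) y fr i by (intro U.\<rho>_\<epsilon> U.sec_carrier[OF g]) auto
    also have "\<dots> = g y"
      using W(3) y fr by (intro U.\<rho>_same U.sec_carrier[OF g]) auto
    finally show ?thesis .
  qed
  ultimately show "\<exists>W g'. openin T W \<and> x \<in> W \<and> W \<subseteq> V \<and> R.sec W g' \<and> (\<forall>y\<in>W. exp_U1 (g' y) = g y)"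
    using W by (intro exI[of _ W] exI[of _ "\<lambda>y. R_act Ext (\<epsilon> (frame y) i y) (h y)"]) auto
next
  fix V s assume V: "openin T V" and s: "s \<in> carrier (sections Z.F V)"
  then show "s \<in> carrier (sections R.F V)"
    unfolding Z.in_sections_iff R.in_sections_iff smooth_on_Z_iff[OF X] by blast
  fix y show "R.val s y = Z.val s y"
    by (simp add: R.val_def Z.val_def)
next
  fix V s assume V: "openin T V" and s: "s \<in> carrier (sections R.F V)"
  note VX = openin_D_points[OF V]
  show "family_on I U V (\<lambda>i x. exp_U1 (s i x)) \<in> carrier (sections U.F V)"
  proof (rule U.family_in_sections[OF VX])
    show "smooth_on X (V \<inter> U i) U1_group (\<lambda>x. exp_U1 (s i x))" if "i \<in> I" for i
      by (rule smooth_on_exp_U1[OF R.section_smooth[OF s that]])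
    show "exp_U1 (s i x) = U1_act Ext (\<epsilon> i j x) (exp_U1 (s j x))"
      if "i \<in> I" "j \<in> I" "x \<in> V" "x \<in> U i" "x \<in> U j" for i j x
      unfolding R.section_change[OF s that] by (rule exp_R_act[OF \<epsilon>]) (use that in auto)
  qed
  fix y assume y: "y \<in> V"
  then have "y \<in> points X"
    using VX by blast
  then show "U.val (family_on I U V (\<lambda>i x. exp_U1 (s i x))) y = exp_U1 (R.val s y)"
    unfolding U.val_def R.val_def using y frame by (simp add: U.family_on_apply)
qed

end

section \<open>Transition functions\<close>

text \<open>
  The properties of a trivialized bundle that determine its transition functions. Simple transitivity
  on the fibres is contained in the equivariance of the charts together with \<open>torsor\<close>.
\<close>

locale bundle_triv = H: smooth_group H
  for H :: "'h diff_group" and P :: "('p, 'x, 'h) gbundle" and T :: "('i, 'x, 'p, 'h) trivs" +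
  assumes base: "local_diffeology (base P)"
    and triv: "trivialization H P T"
    and torsor: "\<And>p p'. p \<in> points (total P) \<Longrightarrow> p' \<in> points (total P) \<Longrightarrow> proj P p = proj P p' \<Longrightarrow>
      \<exists>h\<in>carrier H. p' = act P h p"
begin

abbreviation part :: "'i \<Rightarrow> 'p diff_space" where
  "part i \<equiv> subspace_diff (total P) {p. proj P p \<in> cov T i}"

definition triv_map :: "'i \<Rightarrow> 'p \<Rightarrow> 'x \<times> 'h" where
  "triv_map i p = (proj P p, chart T i p)"

lemma cover: "points (base P) = (\<Union>i\<in>idx T. cov T i)"
  using triv by (simp add: trivialization_def)

lemma local_triv: "i \<in> idx T \<Longrightarrow> local_trivialization H P (cov T i) (chart T i)"
  using triv by (simp add: trivialization_def)

lemma cov_open: "i \<in> idx T \<Longrightarrow> openin (D_topology (base P)) (cov T i)"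
  using local_triv[of i] by (simp add: local_trivialization_def)

lemma diffeo: "i \<in> idx T \<Longrightarrow> diffeomorphism (part i)
    (prod_diff (subspace_diff (base P) (cov T i)) (dspace H)) (triv_map i)"
  using local_triv[of i] unfolding local_trivialization_def triv_map_def by simp

lemma chart_act: "i \<in> idx T \<Longrightarrow> h \<in> carrier H \<Longrightarrow> p \<in> points (total P) \<Longrightarrow> proj P p \<in> cov T i \<Longrightarrow>
    chart T i (act P h p) = h \<otimes>\<^bsub>H\<^esub> chart T i p"
  using local_triv[of i] unfolding local_trivialization_def by simp

lemma triv_bij: "i \<in> idx T \<Longrightarrow> bij_betw (triv_map i) {p \<in> points (total P). proj P p \<in> cov T i}
    ((points (base P) \<inter> cov T i) \<times> carrier H)"
proof -
  assume "i \<in> idx T"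
  from diffeo[OF this]
  have "bij_betw (triv_map i) (points (part i)) (points (prod_diff (subspace_diff (base P) (cov T i)) (dspace H)))"
    by (simp add: diffeomorphism_def)
  moreover have "points (part i) = {p \<in> points (total P). proj P p \<in> cov T i}"
    by (auto simp: subspace_diff_def)
  moreover have "points (prod_diff (subspace_diff (base P) (cov T i)) (dspace H)) = (points (base P) \<inter> cov T i) \<times> carrier H"
    by (simp add: subspace_diff_def prod_diff_def dspace_def)
  ultimately show ?thesis by simp
qed

lemma chart_closed:
  assumes "i \<in> idx T" "p \<in> points (total P)" "proj P p \<in> cov T i"
  shows "chart T i p \<in> carrier H"
  using bij_betwE[OF triv_bij[OF assms(1)]] assms by (auto simp: triv_map_def)

text \<open>The smooth local section along which the chart is constantly \<open>\<one>\<close>.\<close>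

definition lsec :: "'i \<Rightarrow> 'x \<Rightarrow> 'p" where
  "lsec i x = inv_into (points (part i)) (triv_map i) (x, \<one>\<^bsub>H\<^esub>)"

lemma lsec:
  assumes i: "i \<in> idx T" and x: "x \<in> cov T i"
  shows "lsec i x \<in> points (total P)" "proj P (lsec i x) = x" "chart T i (lsec i x) = \<one>\<^bsub>H\<^esub>"
proof -
  have eq: "points (part i) = {p \<in> points (total P). proj P p \<in> cov T i}"
    by (auto simp: subspace_diff_def)
  have "x \<in> points (base P)"
    using cover i x by blast
  then have "(x, \<one>\<^bsub>H\<^esub>) \<in> (points (base P) \<inter> cov T i) \<times> carrier H"
    using x by simp
  then have img: "(x, \<one>\<^bsub>H\<^esub>) \<in> triv_map i ` points (part i)"
    using triv_bij[OF i] unfolding eq bij_betw_def by simp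
  have "lsec i x \<in> points (part i)"
    unfolding lsec_def by (rule inv_into_into[OF img])
  then show "lsec i x \<in> points (total P)"
    by (simp add: eq)
  have "triv_map i (lsec i x) = (x, \<one>\<^bsub>H\<^esub>)"
    unfolding lsec_def by (rule f_inv_into_f[OF img])
  then show "proj P (lsec i x) = x" "chart T i (lsec i x) = \<one>\<^bsub>H\<^esub>"
    by (simp_all add: triv_map_def)
qed

lemma plots_lsec:
  assumes i: "i \<in> idx T" and r: "plots (base P) n V r" "r ` V \<subseteq> cov T i"
  shows "plots (total P) n V (\<lambda>v. lsec i (r v))"
proof -
  have "gplots H n V (\<lambda>_. \<one>\<^bsub>H\<^esub>)"
    by (rule H.gplot_const[OF plot_open[OF base r(1)] H.one_closed])
  with r have "plots (prod_diff (subspace_diff (base P) (cov T i)) (dspace H)) n V (\<lambda>v. (r v, \<one>\<^bsub>H\<^esub>))"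
    by (simp add: prod_diff_def subspace_diff_def dspace_def comp_def)
  moreover have "smooth_map (prod_diff (subspace_diff (base P) (cov T i)) (dspace H)) (part i)
      (inv_into (points (part i)) (triv_map i))"
    using diffeo[OF i] by (simp add: diffeomorphism_def)
  ultimately have "plots (part i) n V (inv_into (points (part i)) (triv_map i) \<circ> (\<lambda>v. (r v, \<one>\<^bsub>H\<^esub>)))"
    unfolding smooth_map_def by simp
  then show ?thesis
    by (simp add: subspace_diff_def comp_def lsec_def)
qed

lemma gplots_chart:
  assumes i: "i \<in> idx T" and r: "plots (total P) n V r" "\<And>v. v \<in> V \<Longrightarrow> proj P (r v) \<in> cov T i"
  shows "gplots H n V (\<lambda>v. chart T i (r v))"
proof -
  have "plots (part i) n V r"
    using r by (simp add: subspace_diff_def image_subset_iff)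
  moreover have "smooth_map (part i) (prod_diff (subspace_diff (base P) (cov T i)) (dspace H)) (triv_map i)"
    using diffeo[OF i] by (simp add: diffeomorphism_def)
  ultimately have "plots (prod_diff (subspace_diff (base P) (cov T i)) (dspace H)) n V (triv_map i \<circ> r)"
    unfolding smooth_map_def by simp
  then show ?thesis
    by (simp add: prod_diff_def dspace_def comp_def triv_map_def)
qed

lemma fibre_point:
  assumes "x \<in> points (base P)"
  shows "fibre_point P x \<in> points (total P)" "proj P (fibre_point P x) = x"
proof -
  obtain i where "i \<in> idx T" "x \<in> cov T i"
    using assms cover by auto
  then have "\<exists>p. p \<in> points (total P) \<and> proj P p = x"
    using lsec by blast
  from someI_ex[OF this] show "fibre_point P x \<in> points (total P)" "proj P (fibre_point P x) = x"
    by (simp_all add: fibre_point_def)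
qed

text \<open>Moving the point of the fibre by \<open>h\<close> cancels in \<open>\<eta>\<^sub>i\<^sup>-\<^sup>1 \<eta>\<^sub>j\<close>.\<close>

lemma quotient_translate:
  assumes "a \<in> carrier H" "b \<in> carrier H" "h \<in> carrier H"
  shows "inv\<^bsub>H\<^esub> (h \<otimes>\<^bsub>H\<^esub> a) \<otimes>\<^bsub>H\<^esub> (h \<otimes>\<^bsub>H\<^esub> b) = inv\<^bsub>H\<^esub> a \<otimes>\<^bsub>H\<^esub> b"
proof -
  have "inv\<^bsub>H\<^esub> h \<otimes>\<^bsub>H\<^esub> (h \<otimes>\<^bsub>H\<^esub> b) = b"
    using assms by (simp flip: H.m_assoc)
  then show ?thesis
    using assms by (simp add: H.inv_mult_group H.m_assoc)
qed

lemma quotient_comp: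
  assumes "a \<in> carrier H" "b \<in> carrier H" "c \<in> carrier H"
  shows "(inv\<^bsub>H\<^esub> a \<otimes>\<^bsub>H\<^esub> b) \<otimes>\<^bsub>H\<^esub> (inv\<^bsub>H\<^esub> b \<otimes>\<^bsub>H\<^esub> c) = inv\<^bsub>H\<^esub> a \<otimes>\<^bsub>H\<^esub> c"
proof -
  have "b \<otimes>\<^bsub>H\<^esub> (inv\<^bsub>H\<^esub> b \<otimes>\<^bsub>H\<^esub> c) = c"
    using assms by (simp flip: H.m_assoc)
  then show ?thesis
    using assms by (simp add: H.m_assoc)
qed

text \<open>
  Transition functions are defined at an arbitrarily chosen point of each fibre, which need not vary
  smoothly. Being independent of that point, they can be computed along local sections.
\<close>

lemma transition_eq:
  assumes i: "i \<in> idx T" "proj P p \<in> cov T i" and j: "j \<in> idx T" "proj P p \<in> cov T j"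
    and p: "p \<in> points (total P)" "proj P p = x"
  shows "transition H P T i j x = inv\<^bsub>H\<^esub> (chart T i p) \<otimes>\<^bsub>H\<^esub> chart T j p"
proof -
  have "x \<in> points (base P)"
    using cover i p(2) by blast
  note fp = fibre_point[OF this]
  then obtain h where h: "h \<in> carrier H" "fibre_point P x = act P h p"
    using torsor[OF p(1) fp(1)] p(2) by auto
  show ?thesis
    unfolding transition_def h(2) chart_act[OF i(1) h(1) p(1) i(2)] chart_act[OF j(1) h(1) p(1) j(2)]
    by (rule quotient_translate[OF chart_closed[OF i(1) p(1) i(2)] chart_closed[OF j(1) p(1) j(2)] h(1)])
qed

lemma transition_closed:
  assumes "i \<in> idx T" "j \<in> idx T" "x \<in> cov T i" "x \<in> cov T j"
  shows "transition H P T i j x \<in> carrier H"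
proof -
  have "x \<in> points (base P)"
    using cover assms by blast
  from fibre_point[OF this] assms show ?thesis
    unfolding transition_def by (intro H.m_closed H.inv_closed chart_closed) simp_all
qed

lemma transition_comp:
  assumes "i \<in> idx T" "j \<in> idx T" "k \<in> idx T" "x \<in> cov T i" "x \<in> cov T j" "x \<in> cov T k"
  shows "transition H P T i j x \<otimes>\<^bsub>H\<^esub> transition H P T j k x = transition H P T i k x"
proof -
  have "x \<in> points (base P)"
    using cover assms by blast
  from fibre_point[OF this] assms show ?thesis
    unfolding transition_def by (intro quotient_comp chart_closed) simp_all
qed

lemma transition_smooth:
  assumes i: "i \<in> idx T" and j: "j \<in> idx T"
  shows "smooth_on (base P) (cov T i \<inter> cov T j) H (transition H P T i j)"
proof (rule smooth_onI)
  fix x assume "x \<in> cov T i \<inter> cov T j"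
  then show "transition H P T i j x \<in> carrier H"
    using i j by (intro transition_closed) auto
next
  fix n V r assume r: "plots (base P) n V r" "r ` V \<subseteq> cov T i \<inter> cov T j"
  have ri: "r ` V \<subseteq> cov T i"
    using r by blast
  have rij: "r v \<in> cov T i" "r v \<in> cov T j" if "v \<in> V" for v
    using r that by auto
  have "gplots H n V (\<lambda>v. chart T j (lsec i (r v)))"
    by (rule gplots_chart[OF j plots_lsec[OF i r(1) ri]]) (simp add: lsec(2)[OF i] rij)
  then show "gplots H n V (\<lambda>v. transition H P T i j (r v))"
  proof (rule H.gplot_cong)
    fix v assume v: "v \<in> V"
    note l = lsec[OF i rij(1)[OF v]]
    have "transition H P T i j (r v) = inv\<^bsub>H\<^esub> (chart T i (lsec i (r v))) \<otimes>\<^bsub>H\<^esub> chart T j (lsec i (r v))"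
      using l rij[OF v] by (intro transition_eq i j) simp_all
    also have "\<dots> = chart T j (lsec i (r v))"
      using l rij[OF v] chart_closed[OF j l(1)] by simp
    finally show "chart T j (lsec i (r v)) = transition H P T i j (r v)" ..
  qed
qed

end

text \<open>
  In a chart two points of a fibre differ by an element of \<open>H\<close>, and injectivity of the local
  trivialization shows that this element takes one point to the other.
\<close>

lemma bundle_triv_principal:
  assumes P: "principal_bundle H P" and T: "trivialization H P T"
  shows "bundle_triv H P T"
proof -
  have H: "diffeological_group H"
    using P by (simp add: principal_bundle_def)
  interpret H: smooth_group H
    by (rule diffeological_group_smooth[OF H])
  show ?thesis
  proof
    show "local_diffeology (base P)"
      using P by (simp add: principal_bundle_def diffeological_imp_local)
    show "trivialization H P T" by fact
    fix p p' assume p: "p \<in> points (total P)" "p' \<in> points (total P)" "proj P p = proj P p'"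
    have "proj P p \<in> points (base P)"
      using P p(1) by (auto simp: principal_bundle_def smooth_map_def)
    then obtain i where i: "i \<in> idx T" "proj P p \<in> cov T i"
      using T unfolding trivialization_def by blast
    define \<eta> where "\<eta> = chart T i"
    let ?\<Phi> = "\<lambda>p. (proj P p, \<eta> p)"
    have lt: "local_trivialization H P (cov T i) \<eta>"
      using T i by (simp add: trivialization_def \<eta>_def)
    then have "bij_betw ?\<Phi> (points (subspace_diff (total P) {p. proj P p \<in> cov T i}))
        (points (prod_diff (subspace_diff (base P) (cov T i)) (dspace H)))"
      by (simp add: local_trivialization_def diffeomorphism_def)
    then have inj: "inj_on ?\<Phi> (points (total P) \<inter> {p. proj P p \<in> cov T i})"
      and im: "?\<Phi> ` (points (total P) \<inter> {p. proj P p \<in> cov T i}) = (points (base P) \<inter> cov T i) \<times> carrier H"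
      by (simp_all add: bij_betw_def subspace_diff_def prod_diff_def dspace_def)
    have \<eta>: "\<eta> p \<in> carrier H" "\<eta> p' \<in> carrier H"
      using im p i by auto
    define h where "h = \<eta> p' \<otimes>\<^bsub>H\<^esub> inv\<^bsub>H\<^esub> \<eta> p"
    have h: "h \<in> carrier H"
      unfolding h_def using \<eta> by simp
    have ap: "act P h p \<in> points (total P)"
    proof -
      have "smooth_map (prod_diff (dspace H) (total P)) (total P) (\<lambda>(h, p). act P h p)"
        using P by (simp add: principal_bundle_def)
      moreover have "(h, p) \<in> points (prod_diff (dspace H) (total P))"
        using h p by (simp add: prod_diff_def dspace_def)
      ultimately have "(\<lambda>(h, p). act P h p) (h, p) \<in> points (total P)"
        unfolding smooth_map_def by blast
      then show ?thesis by simp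
    qed
    have pr: "proj P (act P h p) = proj P p"
      using P h p by (simp add: principal_bundle_def)
    have "\<eta> (act P h p) = h \<otimes>\<^bsub>H\<^esub> \<eta> p"
      using lt h p i by (simp add: local_trivialization_def)
    also have "\<dots> = \<eta> p'"
      unfolding h_def using \<eta> by (simp add: H.m_assoc)
    finally have "?\<Phi> (act P h p) = ?\<Phi> p'"
      using pr p by simp
    then have "act P h p = p'"
      using inj ap pr p i by (elim inj_onD) auto
    then show "\<exists>h\<in>carrier H. p' = act P h p"
      using h by blast
  qed
qed

lemma local_diffeology_E_sph:
  assumes "diffeological_group G"
  shows "local_diffeology (E_sph G)"
  unfolding E_sph_def
proof (rule local_diffeology_final)
  fix S \<psi> assume "(S, \<psi>) \<in> {(prod_diff (sphere_diff I) (power_diff I (dspace G)), psi_sph G I) |I. finite I}"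
  then obtain I where "S = prod_diff (sphere_diff I) (power_diff I (dspace G))"
    by blast
  then show "local_diffeology S"
    using smooth_group.local[OF diffeological_group_smooth[OF assms]]
    by (simp add: sphere_diff_def local_diffeology_prod local_diffeology_subspace local_diffeology_power
        local_diffeology_real)
qed

lemma local_diffeology_B_sph:
  assumes "diffeological_group G"
  shows "local_diffeology (B_sph G \<sigma>)"
  unfolding B_sph_def using local_diffeology_E_sph[OF assms] by (intro local_diffeology_final) simp

lemma act_sph_one:
  assumes G: "group G" and \<sigma>: "\<And>g. g \<in> carrier G \<Longrightarrow> \<sigma> 1 g = g" and \<xi>: "\<xi> \<in> points (E_sph G)"
  shows "act_sph G \<sigma> (\<one>\<^bsub>G\<^esub>, 1) \<xi> = \<xi>"
proof -
  interpret group G by fact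
  have "\<xi> \<in> sph_families G // sph_rel G"
    using \<xi> by (simp add: E_sph_def final_diff_def)
  then have sub: "\<xi> \<subseteq> sph_families G"
    unfolding quotient_def sph_rel_def by auto
  have "(\<lambda>(x, g). (\<lambda>i. of_int 1 * x i, \<lambda>i. \<one>\<^bsub>G\<^esub> \<otimes>\<^bsub>G\<^esub> \<sigma> 1 (g i))) xg = xg" if "xg \<in> \<xi>" for xg
  proof -
    obtain x g where xg: "xg = (x, g)" by fastforce
    then have "g i \<in> carrier G" for i
      using that sub by (auto simp: sph_families_def)
    then show ?thesis
      by (simp add: xg \<sigma>)
  qed
  then show ?thesis
    unfolding act_sph_def by force
qed

text \<open>
  The projection of the universal bundle sends a point to its orbit, so two points of a fibre lie in
  one orbit.
\<close>

lemma bundle_triv_univ: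
  assumes G: "diffeological_group G" and \<sigma>: "smooth_Z2_action G \<sigma>" and H: "diffeological_group (H_group G \<sigma>)"
    and T: "trivialization (H_group G \<sigma>) (univ_bundle G \<sigma>) T"
  shows "bundle_triv (H_group G \<sigma>) (univ_bundle G \<sigma>) T"
proof -
  interpret H: smooth_group "H_group G \<sigma>"
    by (rule diffeological_group_smooth[OF H])
  interpret G: smooth_z2_group G \<sigma>
    by (rule smooth_Z2_action_imp[OF diffeological_group_smooth[OF G] \<sigma>])
  show ?thesis
  proof
    show "local_diffeology (base (univ_bundle G \<sigma>))"
      using local_diffeology_B_sph[OF G] by (simp add: univ_bundle_def)
    show "trivialization (H_group G \<sigma>) (univ_bundle G \<sigma>) T" by fact
    fix p p' assume p: "p' \<in> points (total (univ_bundle G \<sigma>))"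
      and "proj (univ_bundle G \<sigma>) p = proj (univ_bundle G \<sigma>) p'"
    then have eq: "orbit_sph G \<sigma> p = orbit_sph G \<sigma> p'"
      by (simp add: univ_bundle_def)
    have "act_sph G \<sigma> (\<one>\<^bsub>G\<^esub>, 1) p' = p'"
      by (rule act_sph_one[of G \<sigma>, OF G.is_group G.\<rho>_1]) (use p in \<open>simp_all add: univ_bundle_def\<close>)
    moreover have "(\<one>\<^bsub>G\<^esub>, 1) \<in> carrier (H_group G \<sigma>)"
      by (simp add: H_group_def)
    ultimately have "p' \<in> orbit_sph G \<sigma> p'"
      unfolding orbit_sph_def by (metis imageI)
    then show "\<exists>h\<in>carrier (H_group G \<sigma>). p' = act (univ_bundle G \<sigma>) h p"
      unfolding eq[symmetric] by (auto simp: orbit_sph_def univ_bundle_def)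
  qed
qed

lemma carrier_H: "carrier (H_group G \<sigma>) = carrier G \<times> {1, -1}"
  and mult_H: "a \<otimes>\<^bsub>H_group G \<sigma>\<^esub> b = (fst a \<otimes>\<^bsub>G\<^esub> \<sigma> (snd a) (fst b), snd a * snd b)"
  by (simp_all add: H_group_def case_prod_unfold)

lemma gplots_H: "gplots (H_group G \<sigma>) n U p \<longleftrightarrow> gplots G n U (\<lambda>v. fst (p v)) \<and> gplots Z2_group n U (\<lambda>v. snd (p v))"
  by (simp add: H_group_def prod_diff_def dspace_def comp_def)

lemma smooth_on_H_fst:
  assumes s: "smooth_on X W (H_group G \<sigma>) s"
  shows "smooth_on X W G (\<lambda>x. fst (s x))"
proof (rule smooth_onI)
  fix x assume "x \<in> points X" "x \<in> W"
  from smooth_on_carrier[OF s this] show "fst (s x) \<in> carrier G"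
    by (simp add: carrier_H mem_Times_iff)
next
  fix n U p assume "plots X n U p" "p ` U \<subseteq> W"
  from smooth_onD[OF s this] show "gplots G n U (\<lambda>v. fst (s (p v)))"
    by (simp add: gplots_H)
qed

lemma smooth_on_H_snd:
  assumes s: "smooth_on X W (H_group G \<sigma>) s"
  shows "smooth_on X W Z2_group (\<lambda>x. snd (s x))"
proof (rule smooth_onI)
  fix x assume "x \<in> points X" "x \<in> W"
  from smooth_on_carrier[OF s this] show "snd (s x) \<in> carrier Z2_group"
    by (simp add: carrier_H mem_Times_iff)
next
  fix n U p assume "plots X n U p" "p ` U \<subseteq> W"
  from smooth_onD[OF s this] show "gplots Z2_group n U (\<lambda>v. snd (s (p v)))"
    by (simp add: gplots_H)
qed

locale H_cocycle =
  fixes G :: "'g diff_group" and \<sigma> :: "int \<Rightarrow> 'g \<Rightarrow> 'g" and X :: "'x diff_space" and I :: "'i set"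
    and U :: "'i \<Rightarrow> 'x set" and h :: "'i \<Rightarrow> 'i \<Rightarrow> 'x \<Rightarrow> 'g \<times> int"
  assumes X: "local_diffeology X"
    and U_open: "\<And>i. i \<in> I \<Longrightarrow> openin (D_topology X) (U i)"
    and cover: "points X = (\<Union>i\<in>I. U i)"
    and h_closed: "\<And>i j x. i \<in> I \<Longrightarrow> j \<in> I \<Longrightarrow> x \<in> U i \<Longrightarrow> x \<in> U j \<Longrightarrow> h i j x \<in> carrier (H_group G \<sigma>)"
    and h_comp: "\<And>i j k x. i \<in> I \<Longrightarrow> j \<in> I \<Longrightarrow> k \<in> I \<Longrightarrow> x \<in> U i \<Longrightarrow> x \<in> U j \<Longrightarrow> x \<in> U k \<Longrightarrow>
      h i j x \<otimes>\<^bsub>H_group G \<sigma>\<^esub> h j k x = h i k x"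
    and h_smooth: "\<And>i j. i \<in> I \<Longrightarrow> j \<in> I \<Longrightarrow> smooth_on X (U i \<inter> U j) (H_group G \<sigma>) (h i j)"
begin

sublocale twisted_cover X I U "\<lambda>i j x. snd (h i j x)"
proof
  fix i j x assume "i \<in> I" "j \<in> I" "x \<in> U i" "x \<in> U j"
  from h_closed[OF this] show "snd (h i j x) \<in> {1, - 1}"
    by (simp add: carrier_H mem_Times_iff)
next
  fix i j k x assume "i \<in> I" "j \<in> I" "k \<in> I" "x \<in> U i" "x \<in> U j" "x \<in> U k"
  from h_comp[OF this] show "snd (h i j x) * snd (h j k x) = snd (h i k x)"
    by (simp add: mult_H prod_eq_iff)
next
  fix i j assume "i \<in> I" "j \<in> I"
  then show "smooth_on X (U i \<inter> U j) Z2_group (\<lambda>x. snd (h i j x))"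
    by (intro smooth_on_H_snd[of _ _ G \<sigma>] h_smooth)
qed (use X U_open cover in simp_all)

end

lemma bundle_triv_H_cocycle:
  assumes P: "bundle_triv H P T" and H: "H = H_group G \<sigma>"
  shows "H_cocycle G \<sigma> (base P) (idx T) (cov T) (transition H P T)"
proof -
  interpret bundle_triv H P T by (rule P)
  show ?thesis
    using transition_closed transition_comp transition_smooth cov_open base cover
    by unfold_locales (simp_all only: H[symmetric])
qed

text \<open>
  The functions \<open>k\<^sub>i\<^sub>j\<close> are transition functions between a trivialization over \<open>U i\<close> of a bundle on \<open>X\<close>
  and the pullback of a trivialization over \<open>V j\<close> of a bundle on \<open>Y\<close>, when the former bundle is
  isomorphic to the pullback of the latter.
\<close>

locale comparison =
  P: H_cocycle G \<sigma> X I U h + E: H_cocycle G \<sigma> Y J V h'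
  for G :: "'g diff_group" and \<sigma> and X :: "'x diff_space" and I :: "'i set" and U h
    and Y :: "'y diff_space" and J :: "'j set" and V h' +
  fixes f :: "'x \<Rightarrow> 'y" and k :: "'i \<Rightarrow> 'j \<Rightarrow> 'x \<Rightarrow> 'g \<times> int"
  assumes f: "smooth_map X Y f"
    and k_closed: "\<And>i j x. i \<in> I \<Longrightarrow> j \<in> J \<Longrightarrow> x \<in> U i \<Longrightarrow> f x \<in> V j \<Longrightarrow> k i j x \<in> carrier (H_group G \<sigma>)"
    and k_left: "\<And>i i' j x. i \<in> I \<Longrightarrow> i' \<in> I \<Longrightarrow> j \<in> J \<Longrightarrow> x \<in> U i \<Longrightarrow> x \<in> U i' \<Longrightarrow> f x \<in> V j \<Longrightarrow>
      h i i' x \<otimes>\<^bsub>H_group G \<sigma>\<^esub> k i' j x = k i j x"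
    and k_right: "\<And>i j j' x. i \<in> I \<Longrightarrow> j \<in> J \<Longrightarrow> j' \<in> J \<Longrightarrow> x \<in> U i \<Longrightarrow> f x \<in> V j \<Longrightarrow> f x \<in> V j' \<Longrightarrow>
      k i j x \<otimes>\<^bsub>H_group G \<sigma>\<^esub> h' j j' (f x) = k i j' x"
    and k_smooth: "\<And>i j. i \<in> I \<Longrightarrow> j \<in> J \<Longrightarrow> smooth_on X (U i \<inter> preim X f (V j)) (H_group G \<sigma>) (k i j)"

text \<open>
  The isomorphism \<open>\<Psi>\<close> gives an equivariant map \<open>e\<close> of total spaces over \<open>f\<close>. As with transition functions,
  the value of \<open>k\<close> does not depend on the point of the fibre, and along a local section of \<open>P\<close> it is the
  chart of \<open>E\<close> applied to a smooth function.
\<close>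

lemma comparison_bundles:
  fixes H :: "('g \<times> int) diff_group"
  assumes H: "H = H_group G \<sigma>" and P: "bundle_triv H P T" and E: "bundle_triv H E T'"
    and f: "smooth_map (base P) (base E) f" and \<Psi>: "bundle_iso H P (pullback_bundle (base P) f E) \<Psi>"
  shows "comparison G \<sigma> (base P) (idx T) (cov T) (transition H P T)
    (base E) (idx T') (cov T') (transition H E T') f
    (\<lambda>i j x. inv\<^bsub>H\<^esub> (chart T i (fibre_point P x)) \<otimes>\<^bsub>H\<^esub> chart T' j (snd (\<Psi> (fibre_point P x))))"
proof -
  interpret P: bundle_triv H P T by fact
  interpret E: bundle_triv H E T' by fact
  interpret PC: H_cocycle G \<sigma> "base P" "idx T" "cov T" "transition H P T"
    by (rule bundle_triv_H_cocycle[OF P H])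
  interpret EC: H_cocycle G \<sigma> "base E" "idx T'" "cov T'" "transition H E T'"
    by (rule bundle_triv_H_cocycle[OF E H])
  define e where "e = (\<lambda>p. snd (\<Psi> p))"
  let ?Q = "pullback_bundle (base P) f E"
  have bij: "bij_betw \<Psi> (points (total P)) (points (total ?Q))" and sm: "smooth_map (total P) (total ?Q) \<Psi>"
    and pr: "\<And>p. p \<in> points (total P) \<Longrightarrow> proj ?Q (\<Psi> p) = proj P p"
    and eqv: "\<And>g p. g \<in> carrier H \<Longrightarrow> p \<in> points (total P) \<Longrightarrow> \<Psi> (act P g p) = act ?Q g (\<Psi> p)"
    using \<Psi> by (simp_all add: bundle_iso_def diffeomorphism_def)
  have e: "e p \<in> points (total E)" "proj E (e p) = f (proj P p)" if p: "p \<in> points (total P)" for p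
  proof -
    have "\<Psi> p \<in> points (total ?Q)"
      using bij_betwE[OF bij] p by blast
    then show "e p \<in> points (total E)" "proj E (e p) = f (proj P p)"
      using pr[OF p] unfolding e_def
      by (auto simp: pullback_bundle_def subspace_diff_def prod_diff_def)
  qed
  have e_act: "e (act P g p) = act E g (e p)" if "g \<in> carrier H" "p \<in> points (total P)" for g p
    using eqv[OF that] by (simp add: e_def pullback_bundle_def case_prod_unfold)
  have e_plots: "plots (total E) n W (\<lambda>v. e (r v))" if "plots (total P) n W r" for n W r
  proof -
    have "plots (total ?Q) n W (\<Psi> \<circ> r)"
      using sm that unfolding smooth_map_def by simp
    then show ?thesis
      by (simp add: pullback_bundle_def subspace_diff_def prod_diff_def comp_def e_def)
  qed
  define k where "k = (\<lambda>i j x. inv\<^bsub>H\<^esub> (chart T i (fibre_point P x)) \<otimes>\<^bsub>H\<^esub> chart T' j (e (fibre_point P x)))"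
  have fX: "f x \<in> points (base E)" if "x \<in> points (base P)" for x
    using f that unfolding smooth_map_def by blast
  have fp: "fibre_point P x \<in> points (total P)" "proj P (fibre_point P x) = x" if "i \<in> idx T" "x \<in> cov T i" for i x
    using that P.cover by (auto intro!: P.fibre_point)
  have k_eq: "k i j x = inv\<^bsub>H\<^esub> (chart T i p) \<otimes>\<^bsub>H\<^esub> chart T' j (e p)"
    if i: "i \<in> idx T" and j: "j \<in> idx T'" and x: "x \<in> cov T i" "f x \<in> cov T' j"
      and p: "p \<in> points (total P)" "proj P p = x" for i j x p
  proof -
    obtain g where g: "g \<in> carrier H" "fibre_point P x = act P g p"
      using P.torsor[OF p(1) fp(1)[OF i x(1)]] p(2) fp(2)[OF i x(1)] by auto
    have pi: "proj P p \<in> cov T i" and ej: "proj E (e p) \<in> cov T' j"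
      using x p e(2)[OF p(1)] by simp_all
    show ?thesis
      unfolding k_def g(2) e_act[OF g(1) p(1)] P.chart_act[OF i g(1) p(1) pi] E.chart_act[OF j g(1) e(1)[OF p(1)] ej]
      by (rule P.quotient_translate[OF P.chart_closed[OF i p(1) pi] E.chart_closed[OF j e(1)[OF p(1)] ej] g(1)])
  qed
  have "comparison G \<sigma> (base P) (idx T) (cov T) (transition H P T)
    (base E) (idx T') (cov T') (transition H E T') f k"
  proof (unfold_locales)
    show "smooth_map (base P) (base E) f" by fact
  next
    fix i j x assume i: "i \<in> idx T" and j: "j \<in> idx T'" and x: "x \<in> cov T i" "f x \<in> cov T' j"
    note p = fp[OF i x(1)]
    show "k i j x \<in> carrier (H_group G \<sigma>)"
      unfolding k_def H[symmetric]
      using p e[OF p(1)] i j x by (intro P.H.m_closed P.H.inv_closed P.chart_closed E.chart_closed) simp_all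
    fix i' assume i': "i' \<in> idx T" "x \<in> cov T i'"
    show "transition H P T i i' x \<otimes>\<^bsub>H_group G \<sigma>\<^esub> k i' j x = k i j x"
      unfolding k_def H[symmetric] transition_def
      using p e[OF p(1)] i j x i' by (intro P.quotient_comp P.chart_closed E.chart_closed) simp_all
  next
    fix i j j' x assume i: "i \<in> idx T" and j: "j \<in> idx T'" "j' \<in> idx T'"
      and x: "x \<in> cov T i" "f x \<in> cov T' j" "f x \<in> cov T' j'"
    note p = fp[OF i x(1)]
    have t: "transition H E T' j j' (f x) =
        inv\<^bsub>H\<^esub> (chart T' j (e (fibre_point P x))) \<otimes>\<^bsub>H\<^esub> chart T' j' (e (fibre_point P x))"
      using p e[OF p(1)] j x by (intro E.transition_eq) simp_all
    show "k i j x \<otimes>\<^bsub>H_group G \<sigma>\<^esub> transition H E T' j j' (f x) = k i j' x"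
      unfolding k_def H[symmetric] t
      using p e[OF p(1)] i j x by (intro P.quotient_comp P.chart_closed E.chart_closed) simp_all
  next
    fix i j assume i: "i \<in> idx T" and j: "j \<in> idx T'"
    show "smooth_on (base P) (cov T i \<inter> preim (base P) f (cov T' j)) (H_group G \<sigma>) (k i j)"
      unfolding H[symmetric]
    proof (rule smooth_onI)
      fix x assume "x \<in> cov T i \<inter> preim (base P) f (cov T' j)"
      then have x: "x \<in> cov T i" "f x \<in> cov T' j"
        by (simp_all add: preim_def)
      note p = fp[OF i x(1)]
      show "k i j x \<in> carrier H"
        unfolding k_def
        using p e[OF p(1)] i j x by (intro P.H.m_closed P.H.inv_closed P.chart_closed E.chart_closed) simp_all
    next
      fix n W r assume r: "plots (base P) n W r" "r ` W \<subseteq> cov T i \<inter> preim (base P) f (cov T' j)"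
      then have ri: "r ` W \<subseteq> cov T i"
        by blast
      have rij: "r v \<in> cov T i" "f (r v) \<in> cov T' j" if "v \<in> W" for v
        using r(2) that by (auto simp: preim_def)
      have "gplots H n W (\<lambda>v. chart T' j (e (P.lsec i (r v))))"
        by (rule E.gplots_chart[OF j e_plots[OF P.plots_lsec[OF i r(1) ri]]])
          (simp add: e P.lsec[OF i] rij)
      then show "gplots H n W (\<lambda>v. k i j (r v))"
      proof (rule P.H.gplot_cong)
        fix v assume v: "v \<in> W"
        note l = P.lsec[OF i rij(1)[OF v]]
        have c: "chart T' j (e (P.lsec i (r v))) \<in> carrier H"
          using e[OF l(1)] l rij[OF v] by (intro E.chart_closed j) simp_all
        have "k i j (r v) = inv\<^bsub>H\<^esub> (chart T i (P.lsec i (r v))) \<otimes>\<^bsub>H\<^esub> chart T' j (e (P.lsec i (r v)))"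
          by (rule k_eq[OF i j rij[OF v] l(1,2)])
        then show "chart T' j (e (P.lsec i (r v))) = k i j (r v)"
          using l(3) c by simp
      qed
    qed
  qed
  then show ?thesis
    unfolding k_def e_def .
qed

section \<open>Coefficients over a comparison of cocycles\<close>

lemma preim_iff: "x \<in> preim X f W \<longleftrightarrow> x \<in> points X \<and> f x \<in> W"
  by (simp add: preim_def)

lemma smooth_on_compose:
  assumes f: "smooth_map X Y f" and g: "smooth_on Y W A g"
  shows "smooth_on X (preim X f W) A (\<lambda>x. g (f x))"
proof (rule smooth_onI)
  fix x assume "x \<in> points X" "x \<in> preim X f W"
  then have "f x \<in> points Y" "f x \<in> W"
    using f by (auto simp: smooth_map_def preim_iff)
  then show "g (f x) \<in> carrier A"
    by (rule smooth_on_carrier[OF g])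
next
  fix n U p assume p: "plots X n U p" "p ` U \<subseteq> preim X f W"
  have "plots Y n U (f \<circ> p)"
    using f p(1) unfolding smooth_map_def by simp
  moreover have "(f \<circ> p) ` U \<subseteq> W"
    using p(2) by (auto simp: preim_iff)
  ultimately have "gplots A n U (\<lambda>v. g ((f \<circ> p) v))"
    by (rule smooth_onD[OF g])
  then show "gplots A n U (\<lambda>v. g (f (p v)))"
    by simp
qed

context comparison
begin

lemma f_points: "x \<in> points X \<Longrightarrow> f x \<in> points Y"
  using f unfolding smooth_map_def by blast

lemma f_continuous: "continuous_map P.T E.T f"
  by (rule continuous_map_D_topology[OF P.X E.X f])

lemma preim_eq: "preim X f W = {x \<in> topspace P.T. f x \<in> W}"
  by (auto simp: preim_iff P.topspace)

lemma preim_open: "openin E.T W \<Longrightarrow> openin P.T (preim X f W)"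
  unfolding preim_eq using f_continuous by (simp add: continuous_map_def)

lemma preim_Int: "preim X f (W \<inter> W') = preim X f W \<inter> preim X f W'"
  by (auto simp: preim_iff)

text \<open>The pulled back cover and cocycle, which define the pulled back local systems.\<close>

sublocale Q: twisted_cover X J "\<lambda>j. preim X f (V j)" "\<lambda>i j x. snd (h' i j (f x))"
proof
  show "local_diffeology X" by (rule P.X)
  show "openin P.T (preim X f (V j))" if "j \<in> J" for j
    by (rule preim_open[OF E.U_open[OF that]])
  show "points X = (\<Union>j\<in>J. preim X f (V j))"
    using f_points E.cover by (auto simp: preim_iff)
  show "snd (h' i j (f x)) \<in> {1, -1}" if "i \<in> J" "j \<in> J" "x \<in> preim X f (V i)" "x \<in> preim X f (V j)" for i j x
    using that by (intro E.\<epsilon>) (simp_all add: preim_iff)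
  show "snd (h' i j (f x)) * snd (h' j k (f x)) = snd (h' i k (f x))"
    if "i \<in> J" "j \<in> J" "k \<in> J" "x \<in> preim X f (V i)" "x \<in> preim X f (V j)" "x \<in> preim X f (V k)" for i j k x
    using that by (intro E.\<epsilon>_comp) (simp_all add: preim_iff)
  show "smooth_on X (preim X f (V i) \<inter> preim X f (V j)) Z2_group (\<lambda>x. snd (h' i j (f x)))"
    if "i \<in> J" "j \<in> J" for i j
    using smooth_on_compose[OF f E.\<epsilon>_smooth[OF that]] by (simp add: preim_Int)
qed

lemma frame_Q: "x \<in> points X \<Longrightarrow> Q.frame x = E.frame (f x)"
  by (simp add: Q.frame_def E.frame_def preim_iff)

lemma frame_E: "x \<in> points X \<Longrightarrow> E.frame (f x) \<in> J \<and> f x \<in> V (E.frame (f x))"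
  using E.frame f_points by blast

text \<open>The sign of the change from the pulled back frame \<open>j\<close> to the frame \<open>i\<close>.\<close>

definition \<delta> :: "'i \<Rightarrow> 'j \<Rightarrow> 'x \<Rightarrow> int" where
  "\<delta> i j x = snd (k i j x)"

lemma \<delta>: "i \<in> I \<Longrightarrow> j \<in> J \<Longrightarrow> x \<in> U i \<Longrightarrow> f x \<in> V j \<Longrightarrow> \<delta> i j x \<in> {1, -1}"
  using k_closed[of i j x] by (simp add: carrier_H mem_Times_iff \<delta>_def)

lemma \<delta>_left: "i \<in> I \<Longrightarrow> i' \<in> I \<Longrightarrow> j \<in> J \<Longrightarrow> x \<in> U i \<Longrightarrow> x \<in> U i' \<Longrightarrow> f x \<in> V j \<Longrightarrow>
    snd (h i i' x) * \<delta> i' j x = \<delta> i j x"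
  using k_left[of i i' j x] by (simp add: mult_H prod_eq_iff \<delta>_def)

lemma \<delta>_right: "i \<in> I \<Longrightarrow> j \<in> J \<Longrightarrow> j' \<in> J \<Longrightarrow> x \<in> U i \<Longrightarrow> f x \<in> V j \<Longrightarrow> f x \<in> V j' \<Longrightarrow>
    \<delta> i j x * snd (h' j j' (f x)) = \<delta> i j' x"
  using k_right[of i j j' x] by (simp add: mult_H prod_eq_iff \<delta>_def)

lemma \<delta>_smooth: "i \<in> I \<Longrightarrow> j \<in> J \<Longrightarrow> smooth_on X (U i \<inter> preim X f (V j)) Z2_group (\<delta> i j)"
  unfolding \<delta>_def[abs_def] by (rule smooth_on_H_snd[OF k_smooth])

lemma near_U: "\<forall>\<^sub>F zs in near_filter P.T n. \<forall>x\<in>set zs. x \<in> points X \<and> last zs \<in> U (P.frame x) \<and>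
    f (last zs) \<in> V (E.frame (f x))"
proof -
  have "\<forall>\<^sub>F zs in near_filter P.T n. \<forall>x\<in>set zs. last zs \<in> U (P.frame x) \<inter> preim X f (V (E.frame (f x)))"
  proof (rule near_filter_neighbourhoods)
    fix x assume "x \<in> topspace P.T"
    then have x: "x \<in> points X"
      by (simp add: P.topspace)
    show "openin P.T (U (P.frame x) \<inter> preim X f (V (E.frame (f x)))) \<and>
        x \<in> U (P.frame x) \<inter> preim X f (V (E.frame (f x)))"
      using P.frame[OF x] frame_E[OF x] x
      by (intro conjI openin_Int P.U_open preim_open E.U_open) (simp_all add: preim_iff)
  qed
  then show ?thesis
    using near_filter_topspace by eventually_elim (auto simp: preim_iff P.topspace)
qed

end

locale comparison_coefficients = comparison G \<sigma> X I U h Y J V h' f k + smooth_z2_group A \<rho> + comm_group A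
  for G :: "'g diff_group" and \<sigma> and X :: "'x diff_space" and I :: "'i set" and U h
    and Y :: "'y diff_space" and J :: "'j set" and V h' f k and A :: "'a diff_group" (structure) and \<rho>
begin

sublocale PA: twisted_coefficients X I U "\<lambda>i j x. snd (h i j x)" A \<rho>
  by (intro twisted_coefficients.intro P.twisted_cover_axioms smooth_z2_group_axioms comm_group_axioms)

sublocale EA: twisted_coefficients Y J V "\<lambda>i j x. snd (h' i j x)" A \<rho>
  by (intro twisted_coefficients.intro E.twisted_cover_axioms smooth_z2_group_axioms comm_group_axioms)

sublocale QA: twisted_coefficients X J "\<lambda>j. preim X f (V j)" "\<lambda>i j x. snd (h' i j (f x))" A \<rho>
  by (intro twisted_coefficients.intro Q.twisted_cover_axioms smooth_z2_group_axioms comm_group_axioms)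

text \<open>The identification of the pulled back coefficients with those over \<open>X\<close>, in the frames chosen at \<open>y\<close>.\<close>

definition \<omega> :: "'x \<Rightarrow> 'a \<Rightarrow> 'a" where
  "\<omega> y a = \<rho> (\<delta> (P.frame y) (E.frame (f y)) y) a"

lemma \<omega>_hom: "y \<in> points X \<Longrightarrow> \<omega> y \<in> hom A A"
  unfolding \<omega>_def[abs_def] using P.frame[of y] frame_E[of y] by (intro \<rho>_hom \<delta>) simp_all

lemma sec_pull:
  assumes g: "EA.sec W g"
  shows "QA.sec (preim X f W) (\<lambda>y. g (f y))"
  unfolding QA.sec_def
proof (intro conjI ballI)
  fix y assume "y \<in> preim X f W"
  then show "g (f y) \<in> carrier A"
    using EA.sec_carrier[OF g, of "f y"] by (simp add: preim_iff)
next
  fix j assume j: "j \<in> J"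
  from smooth_on_compose[OF f EA.sec_frame[OF g j]]
  have "smooth_on X (preim X f W \<inter> preim X f (V j)) A (\<lambda>x. \<rho> (snd (h' j (E.frame (f x)) (f x))) (g (f x)))"
    by (simp add: preim_Int)
  then show "smooth_on X (preim X f W \<inter> preim X f (V j)) A (\<lambda>y. \<rho> (snd (h' j (Q.frame y) (f y))) (g (f y)))"
    by (rule smooth_on_cong) (simp add: frame_Q preim_iff)
qed

text \<open>
  The frame \<open>E.frame (f y)\<close> varies with \<open>y\<close>, but by \<open>\<delta>_right\<close> it may be replaced near a given point by a
  fixed one.
\<close>

lemma ident_smooth:
  assumes W: "openin P.T W" and g: "QA.sec W g" and i: "i \<in> I"
  shows "smooth_on X (W \<inter> U i) A (\<lambda>y. \<rho> (\<delta> i (E.frame (f y)) y) (g y))"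
proof (rule smooth_on_local[OF P.X])
  fix x assume x: "x \<in> points X \<inter> (W \<inter> U i)"
  define j where "j = E.frame (f x)"
  have j: "j \<in> J" "f x \<in> V j"
    using frame_E[of x] x by (simp_all add: j_def)
  let ?V = "preim X f (V j)"
  have "smooth_on X (W \<inter> U i \<inter> ?V) A (\<lambda>y. \<rho> (\<delta> i j y) (\<rho> (snd (h' j (Q.frame y) (f y))) (g y)))"
  proof (rule smooth_on_act)
    show "smooth_on X (W \<inter> U i \<inter> ?V) A (\<lambda>y. \<rho> (snd (h' j (Q.frame y) (f y))) (g y))"
      by (rule smooth_on_subset[OF QA.sec_frame[OF g j(1)]]) blast
    show "smooth_on X (W \<inter> U i \<inter> ?V) Z2_group (\<delta> i j)"
      by (rule smooth_on_subset[OF \<delta>_smooth[OF i j(1)]]) blast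
  qed
  then have "smooth_on X (W \<inter> U i \<inter> ?V) A (\<lambda>y. \<rho> (\<delta> i (E.frame (f y)) y) (g y))"
  proof (rule smooth_on_cong)
    fix y assume y: "y \<in> W \<inter> U i \<inter> ?V"
    then have yX: "y \<in> points X"
      by (simp add: preim_iff)
    note fr = frame_E[OF yX]
    have fy: "f y \<in> V j" "y \<in> U i"
      using y by (simp_all add: preim_iff)
    have gy: "g y \<in> carrier A"
      using QA.sec_carrier[OF g] y by blast
    have s: "snd (h' j (E.frame (f y)) (f y)) \<in> {1, -1}" "\<delta> i j y \<in> {1, -1}"
      using fr j fy i by (intro E.\<epsilon> \<delta>; simp)+
    show "\<rho> (\<delta> i j y) (\<rho> (snd (h' j (Q.frame y) (f y))) (g y)) = \<rho> (\<delta> i (E.frame (f y)) y) (g y)"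
      unfolding frame_Q[OF yX] \<rho>_comp[OF s(2,1) gy]
      using fr j fy i by (subst \<delta>_right) simp_all
  qed
  moreover have "openin P.T ?V"
    by (rule preim_open[OF E.U_open[OF j(1)]])
  ultimately show "\<exists>V. openin P.T V \<and> x \<in> V \<and> smooth_on X (W \<inter> U i \<inter> V) A (\<lambda>y. \<rho> (\<delta> i (E.frame (f y)) y) (g y))"
    using x j by (intro exI[of _ ?V]) (simp add: preim_iff)
qed

lemma ident_change:
  assumes i: "i \<in> I" "i' \<in> I" and x: "x \<in> U i" "x \<in> U i'" and a: "a \<in> carrier A"
  shows "\<rho> (snd (h i i' x)) (\<rho> (\<delta> i' (E.frame (f x)) x) a) = \<rho> (\<delta> i (E.frame (f x)) x) a"
proof -
  have "x \<in> points X"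
    using P.cover i x by blast
  note fr = frame_E[OF this]
  have s: "snd (h i i' x) \<in> {1, -1}" "\<delta> i' (E.frame (f x)) x \<in> {1, -1}"
    using fr i x by (intro P.\<epsilon> \<delta>; simp)+
  show ?thesis
    unfolding \<rho>_comp[OF s a] using fr i x by (subst \<delta>_left) simp_all
qed

lemma sec_ident:
  assumes W: "openin P.T W" and g: "QA.sec W g"
  shows "PA.sec W (\<lambda>y. \<omega> y (g y))"
  unfolding PA.sec_def
proof (intro conjI ballI)
  have WX: "W \<subseteq> points X"
    by (rule openin_D_points[OF W])
  {
    fix y assume y: "y \<in> W"
    then have yX: "y \<in> points X"
      using WX by blast
    show "\<omega> y (g y) \<in> carrier A"
      using hom_in_carrier[OF \<omega>_hom[OF yX]] QA.sec_carrier[OF g y] .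
  next
    fix i assume i: "i \<in> I"
    from ident_smooth[OF W g i]
    show "smooth_on X (W \<inter> U i) A (\<lambda>y. \<rho> (snd (h i (P.frame y) y)) (\<omega> y (g y)))"
    proof (rule smooth_on_cong)
      fix y assume y: "y \<in> W \<inter> U i"
      then have "y \<in> points X"
        using WX by blast
      note fr = P.frame[OF this]
      show "\<rho> (\<delta> i (E.frame (f y)) y) (g y) = \<rho> (snd (h i (P.frame y) y)) (\<omega> y (g y))"
        unfolding \<omega>_def using y i fr by (intro ident_change[symmetric] QA.sec_carrier[OF g]) simp_all
    qed
  }
qed

lemma sheaf_map_pull: "sheaf_map A E.T EA.F EA.val EA.sec A P.T QA.F QA.val QA.sec f (\<lambda>_ a. a)"
proof (intro sheaf_map.intro sheaf_map_axioms.intro EA.fpresheaf QA.fpresheaf f_continuous)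
  show "(\<lambda>a. a) \<in> hom A A"
    by (simp add: hom_def)
  show "QA.sec {x \<in> topspace P.T. f x \<in> W} (\<lambda>y. g (f y))" if "EA.sec W g" for W g
    unfolding preim_eq[symmetric] by (rule sec_pull[OF that])
qed

lemma sheaf_map_ident: "sheaf_map A P.T QA.F QA.val QA.sec A P.T PA.F PA.val PA.sec id \<omega>"
proof (intro sheaf_map.intro sheaf_map_axioms.intro PA.fpresheaf QA.fpresheaf)
  show "continuous_map P.T P.T id"
    by simp
  show "\<omega> y \<in> hom A A" if "y \<in> topspace P.T" for y
    using that by (intro \<omega>_hom) (simp add: P.topspace)
  show "PA.sec {x \<in> topspace P.T. id x \<in> W} (\<lambda>y. \<omega> y (g (id y)))" if "openin P.T W" "QA.sec W g" for W g
  proof -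
    have "{x \<in> topspace P.T. id x \<in> W} = W"
      using openin_subset[OF that(1)] by auto
    then show ?thesis
      using sec_ident[OF that] by simp
  qed
qed

text \<open>
  The composite of the two preceding maps, which carries cochains with coefficients in \<open>\<real>\<close> and \<open>U(1)\<close>
  over \<open>Y\<close> directly to \<open>X\<close>.
\<close>

lemma sheaf_map_total: "sheaf_map A E.T EA.F EA.val EA.sec A P.T PA.F PA.val PA.sec f \<omega>"
proof (intro sheaf_map.intro sheaf_map_axioms.intro EA.fpresheaf PA.fpresheaf f_continuous)
  show "\<omega> y \<in> hom A A" if "y \<in> topspace P.T" for y
    using that by (intro \<omega>_hom) (simp add: P.topspace)
  show "PA.sec {x \<in> topspace P.T. f x \<in> W} (\<lambda>y. \<omega> y (g (f y)))" if "openin E.T W" "EA.sec W g" for W g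
    unfolding preim_eq[symmetric] by (rule sec_ident[OF preim_open[OF that(1)] sec_pull[OF that(2)]])
qed

text \<open>
  Together with \<open>ident_map\<close>, the map on sections through which integral classes are pulled back, here for
  arbitrary coefficients.
\<close>

definition pull_map :: "'y set \<Rightarrow> ('j \<Rightarrow> 'y \<Rightarrow> 'a) \<Rightarrow> 'j \<Rightarrow> 'x \<Rightarrow> 'a" where
  "pull_map W m = family_on J (\<lambda>j. preim X f (V j)) (preim X f W) (\<lambda>j x. m j (f x))"

lemma pull_map:
  assumes W: "openin E.T W" and m: "m \<in> carrier (sections EA.F W)"
  shows "pull_map W m \<in> carrier (sections QA.F {x \<in> topspace P.T. f x \<in> W})"
    and "y \<in> topspace P.T \<Longrightarrow> f y \<in> W \<Longrightarrow> QA.val (pull_map W m) y = EA.val m (f y)"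
proof -
  show "pull_map W m \<in> carrier (sections QA.F {x \<in> topspace P.T. f x \<in> W})"
    unfolding preim_eq[symmetric] pull_map_def
  proof (rule QA.family_in_sections)
    show "preim X f W \<subseteq> points X"
      by (auto simp: preim_iff)
    show "smooth_on X (preim X f W \<inter> preim X f (V j)) A (\<lambda>x. m j (f x))" if "j \<in> J" for j
      using smooth_on_compose[OF f EA.section_smooth[OF m that]] by (simp add: preim_Int)
    show "m i (f x) = \<rho> (snd (h' i j (f x))) (m j (f x))"
      if "i \<in> J" "j \<in> J" "x \<in> preim X f W" "x \<in> preim X f (V i)" "x \<in> preim X f (V j)" for i j x
      using that by (intro EA.section_change[OF m]) (simp_all add: preim_iff)
  qed
  show "QA.val (pull_map W m) y = EA.val m (f y)" if "y \<in> topspace P.T" "f y \<in> W"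
    using that frame_E[of y] frame_Q[of y]
    by (simp add: QA.val_def EA.val_def pull_map_def QA.family_on_apply preim_iff P.topspace)
qed

definition ident_map :: "'x set \<Rightarrow> ('j \<Rightarrow> 'x \<Rightarrow> 'a) \<Rightarrow> 'i \<Rightarrow> 'x \<Rightarrow> 'a" where
  "ident_map W m = family_on I U W (\<lambda>i x. \<rho> (\<delta> i (E.frame (f x)) x) (m (E.frame (f x)) x))"

lemma ident_map:
  assumes W: "openin P.T W" and m: "m \<in> carrier (sections QA.F W)"
  shows "ident_map W m \<in> carrier (sections PA.F W)"
    and "y \<in> W \<Longrightarrow> PA.val (ident_map W m) y = \<omega> y (QA.val m y)"
proof -
  interpret Qsheaf: fpresheaf A P.T QA.F QA.val QA.sec by (rule QA.fpresheaf)
  have WX: "W \<subseteq> points X"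
    by (rule openin_D_points[OF W])
  have v: "QA.val m y = m (E.frame (f y)) y" if "y \<in> W" for y
    using that WX by (auto simp: QA.val_def frame_Q)
  note s = Qsheaf.val_S[OF W m]
  show "ident_map W m \<in> carrier (sections PA.F W)"
    unfolding ident_map_def
  proof (rule PA.family_in_sections[OF WX])
    fix i assume i: "i \<in> I"
    from ident_smooth[OF W s i]
    show "smooth_on X (W \<inter> U i) A (\<lambda>x. \<rho> (\<delta> i (E.frame (f x)) x) (m (E.frame (f x)) x))"
      by (rule smooth_on_cong) (simp add: v)
  next
    fix i j x assume ij: "i \<in> I" "j \<in> I" "x \<in> W" "x \<in> U i" "x \<in> U j"
    then have "m (E.frame (f x)) x \<in> carrier A"
      using QA.sec_carrier[OF s, of x] v[of x] by simp
    then show "\<rho> (\<delta> i (E.frame (f x)) x) (m (E.frame (f x)) x) =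
        \<rho> (snd (h i j x)) (\<rho> (\<delta> j (E.frame (f x)) x) (m (E.frame (f x)) x))"
      using ij by (intro ident_change[symmetric])
  qed
  show "PA.val (ident_map W m) y = \<omega> y (QA.val m y)" if "y \<in> W"
    unfolding PA.val_def ident_map_def \<omega>_def v[OF that]
    using that WX P.frame[of y] by (subst PA.family_on_apply) auto
qed

end


section \<open>The class of the double cover\<close>

text \<open>The coboundary in degrees \<open>0\<close>, \<open>1\<close> and \<open>2\<close>, with the last point as the point of evaluation.\<close>

lemma (in comm_group) vdiff_2:
  assumes "u [b, y] \<in> carrier G" "u [a, y] \<in> carrier G"
  shows "vdiff G u [a, b, y] = u [b, y] \<otimes> inv u [a, y]"
  using assms by (simp add: vdiff_def lessThan_Suc omit_def m_comm)

lemma (in comm_group) vdiff_3: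
  assumes "u [b, c, y] \<in> carrier G" "u [a, c, y] \<in> carrier G" "u [a, b, y] \<in> carrier G"
  shows "vdiff G u [a, b, c, y] = u [b, c, y] \<otimes> (inv u [a, c, y] \<otimes> u [a, b, y])"
  using assms by (simp add: vdiff_def lessThan_Suc omit_def m_ac)

lemma (in comm_group) vdiff_4:
  assumes "u [b, c, d, y] \<in> carrier G" "u [a, c, d, y] \<in> carrier G" "u [a, b, d, y] \<in> carrier G"
    "u [a, b, c, y] \<in> carrier G"
  shows "vdiff G u [a, b, c, d, y] =
    u [b, c, d, y] \<otimes> u [a, b, d, y] \<otimes> inv (u [a, c, d, y] \<otimes> u [a, b, c, y])"
  using assms by (simp add: vdiff_def lessThan_Suc omit_def m_ac inv_mult)

context twisted_cover
begin

definition cech_cochain :: "('i list \<Rightarrow> 's) \<Rightarrow> ('x, 's) cochain" where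
  "cech_cochain a = (\<lambda>xs. (\<Inter>x\<in>set xs. U (frame x), a (map frame xs)))"

lemma cech_class_eq: "cech_class T F I U n a = coho_class T F n (cech_cochain a)"
  unfolding cech_class_def Let_def cech_cochain_def frame_def ..

lemma near_frames: "\<forall>\<^sub>F zs in near_filter T n. \<forall>x\<in>set zs. x \<in> points X \<and> last zs \<in> U (frame x)"
proof -
  have "\<forall>\<^sub>F zs in near_filter T n. \<forall>x\<in>set zs. last zs \<in> U (frame x)"
  proof (rule near_filter_neighbourhoods)
    fix x assume "x \<in> topspace T"
    then show "openin T (U (frame x)) \<and> x \<in> U (frame x)"
      using frame[of x] U_open by (simp add: topspace)
  qed
  then show ?thesis
    using near_filter_topspace by eventually_elim (auto simp: topspace)
qed

lemma cech_cochain_in_cochains: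
  assumes "\<And>xs. length xs = Suc n \<Longrightarrow> set xs \<subseteq> points X \<Longrightarrow>
    a (map frame xs) \<in> carrier (sections F (\<Inter>x\<in>set xs. U (frame x)))"
  shows "cech_cochain a \<in> cochains T F n"
  unfolding cochains_def mem_Collect_eq eventually_near_filter[symmetric]
  using near_frames near_filter_length near_filter_nonempty
proof eventually_elim
  case (elim xs)
  have "openin T (\<Inter>x\<in>set xs. U (frame x))"
    using elim frame U_open by (intro openin_INT2) auto
  then show ?case
    using elim assms[of xs] by (auto simp: is_germ_iff cech_cochain_def)
qed

end

context H_cocycle
begin

abbreviation "SZ2 \<equiv> smooth_sheaf X Z2_group"

definition alpha_cochain :: "('x, 'x \<Rightarrow> int) cochain" where
  "alpha_cochain = cech_cochain
     (\<lambda>is. \<lambda>x\<in>U (is ! 0) \<inter> U (is ! 1). snd (h (is ! 0) (is ! 1) x))"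

lemma alpha_fpresheaf: "fpresheaf Z2_group T SZ2 (\<lambda>s. s) (\<lambda>W. smooth_on X W Z2_group)"
  by (rule fpresheaf_smooth_sheaf[OF smooth_group_Z2 comm_group_Z2 X])

lemma alpha_cochains: "alpha_cochain \<in> cochains T SZ2 1"
  unfolding alpha_cochain_def
proof (rule cech_cochain_in_cochains)
  fix xs :: "'x list" assume "length xs = Suc 1" and sub: "set xs \<subseteq> points X"
  then obtain a b where xs: "xs = [a, b]"
    by (auto simp: length_Suc_conv)
  have fr: "frame a \<in> I" "frame b \<in> I"
    using sub xs frame by auto
  interpret Z2: smooth_group Z2_group by (rule smooth_group_Z2)
  show "(\<lambda>is. \<lambda>x\<in>U (is ! 0) \<inter> U (is ! 1). snd (h (is ! 0) (is ! 1) x)) (map frame xs)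
      \<in> carrier (sections SZ2 (\<Inter>x\<in>set xs. U (frame x)))"
    using Z2.smooth_on_cong[OF \<epsilon>_smooth[OF fr], of "\<lambda>x\<in>U (frame a) \<inter> U (frame b). snd (h (frame a) (frame b) x)"]
    by (simp add: xs smooth_sheaf_def)
qed

lemma hat_alpha: "\<forall>\<^sub>F zs in near_filter T (Suc 1). \<exists>a b y. zs = [a, b, y] \<and>
    hat (\<lambda>s. s) alpha_cochain zs = snd (h (frame a) (frame b) y)"
  using near_frames near_filter_length
proof eventually_elim
  case (elim zs)
  then obtain a b y where "zs = [a, b, y]"
    by (auto simp: length_Suc_conv)
  with elim show ?case
    by (simp add: hat_def alpha_cochain_def cech_cochain_def)
qed

lemma hat_alpha_eq: "\<forall>\<^sub>F zs in near_filter T (Suc 1).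
    hat (\<lambda>s. s) alpha_cochain zs = snd (h (frame (zs ! 0)) (frame (zs ! 1)) (zs ! 2))"
  by (rule eventually_mono[OF hat_alpha]) auto

lemma alpha_cocycle: "alpha_cochain \<in> cocycles T SZ2 1"
proof -
  interpret S: fpresheaf Z2_group T SZ2 "\<lambda>s. s" "\<lambda>W. smooth_on X W Z2_group"
    by (rule alpha_fpresheaf)
  let ?v = "\<lambda>zs. snd (h (frame (zs ! 0)) (frame (zs ! 1)) (zs ! 2))"
  have "\<forall>\<^sub>F zs in near_filter T (Suc 1). hat (\<lambda>s. s) alpha_cochain zs = ?v zs \<and> ?v zs \<in> carrier Z2_group"
    using hat_alpha_eq S.good_carrier[OF S.good_hat[OF alpha_cochains]]
    by eventually_elim simp
  from S.vdiff_cong[OF this] near_frames near_filter_length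
  have "\<forall>\<^sub>F zs in near_filter T (Suc (Suc 1)). vdiff Z2_group (hat (\<lambda>s. s) alpha_cochain) zs = \<one>\<^bsub>Z2_group\<^esub>"
  proof eventually_elim
    case (elim zs)
    then obtain a b c y where zs: "zs = [a, b, c, y]"
      by (auto simp: length_Suc_conv)
    define i j l where ijl: "i = frame a" "j = frame b" "l = frame c"
    have fr: "i \<in> I" "j \<in> I" "l \<in> I" "y \<in> U i" "y \<in> U j" "y \<in> U l"
      using elim(2) frame by (auto simp: zs ijl)
    have e: "snd (h i j y) \<in> {1, -1}" "snd (h j l y) \<in> {1, -1}" "snd (h i l y) \<in> {1, -1}"
      using fr \<epsilon>[of i j y] \<epsilon>[of j l y] \<epsilon>[of i l y] by simp_all
    have "vdiff Z2_group ?v zs = snd (h j l y) * (snd (h i l y) * snd (h i j y))"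
      unfolding zs by (subst S.vdiff_3) (use e in \<open>simp_all add: ijl inv_Z2\<close>)
    also have "snd (h i l y) = snd (h i j y) * snd (h j l y)"
      by (rule \<epsilon>_comp[symmetric]) (use fr in auto)
    finally show ?case
      using elim(1) e by auto
  qed
  then show ?thesis
    unfolding S.cocycles_iff using alpha_cochains by blast
qed

end

context comparison
begin

text \<open>
  In degree \<open>0\<close> the germ at \<open>x\<close> of the function \<open>\<delta>\<^sub>i\<^sub>j\<close>, where \<open>i\<close> and \<open>j\<close> are the frames at \<open>x\<close> and \<open>f x\<close>, is a
  cochain \<open>w\<close>. The relation \<open>\<delta>\<^sub>0 \<epsilon>'\<^sub>0\<^sub>1 = \<epsilon>\<^sub>0\<^sub>1 \<delta>\<^sub>1\<close> says that the pulled back cocycle is the cocycle of the bundle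
  on \<open>X\<close> times the coboundary of \<open>w\<close>, as signs are their own inverses.
\<close>

lemma alpha_natural:
  "pull_class P.T P.SZ2 1 f (\<lambda>V s. \<lambda>x\<in>preim X f V. s (f x)) (coho_class E.T E.SZ2 1 E.alpha_cochain) =
    coho_class P.T P.SZ2 1 P.alpha_cochain"
proof -
  let ?\<theta> = "\<lambda>V s. \<lambda>x\<in>preim X f V. s (f x)"
  interpret Z2: smooth_group Z2_group by (rule smooth_group_Z2)
  interpret sm: sheaf_map Z2_group E.T E.SZ2 "\<lambda>s. s" "\<lambda>W. smooth_on Y W Z2_group"
    Z2_group P.T P.SZ2 "\<lambda>s. s" "\<lambda>W. smooth_on X W Z2_group" f "\<lambda>_ a. a"
  proof (intro sheaf_map.intro sheaf_map_axioms.intro P.alpha_fpresheaf E.alpha_fpresheaf f_continuous)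
    show "(\<lambda>a. a) \<in> hom Z2_group Z2_group"
      by (simp add: hom_def)
    show "smooth_on X {x \<in> topspace P.T. f x \<in> W} Z2_group (\<lambda>y. g (f y))"
      if "smooth_on Y W Z2_group g" for W g
      unfolding preim_eq[symmetric] by (rule smooth_on_compose[OF f that])
  qed
  have \<theta>1: "?\<theta> W s \<in> carrier (sections P.SZ2 {x \<in> topspace P.T. f x \<in> W})"
    if "s \<in> carrier (sections E.SZ2 W)" for W s
    unfolding preim_eq[symmetric]
    using that Z2.smooth_on_cong[OF smooth_on_compose[OF f, of W Z2_group s], of "?\<theta> W s"]
    by (simp add: smooth_sheaf_def)
  have \<theta>2: "?\<theta> W s y = s (f y)" if "y \<in> topspace P.T" "f y \<in> W" for W and s :: "'y \<Rightarrow> int" and y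
    using that by (simp add: preim_iff P.topspace)
  let ?c = "pull_cochain P.T f ?\<theta> E.alpha_cochain"
  have "pull_class P.T P.SZ2 (Suc 0) f ?\<theta> (coho_class E.T E.SZ2 (Suc 0) E.alpha_cochain) =
      coho_class P.T P.SZ2 (Suc 0) ?c"
    by (rule sm.pull_coho_class) (use \<theta>1 \<theta>2 E.alpha_cocycle in simp_all)
  also have "\<dots> = coho_class P.T P.SZ2 (Suc 0) P.alpha_cochain"
  proof (rule sm.tgt.coho_class_eqI)
    have ac: "E.alpha_cochain \<in> cochains E.T E.SZ2 (Suc 0)"
      using E.alpha_cochains by simp
    show "?c \<in> cochains P.T P.SZ2 (Suc 0)"
      by (rule sm.pull_cochain_cochain[OF _ _ ac]) (use \<theta>1 \<theta>2 in simp_all)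
    show "P.alpha_cochain \<in> cochains P.T P.SZ2 (Suc 0)"
      using P.alpha_cochains by simp
    have hc: "\<forall>\<^sub>F zs in near_filter P.T (Suc (Suc 0)). hat (\<lambda>s. s) ?c zs = sm.push (hat (\<lambda>s. s) E.alpha_cochain) zs"
      by (rule sm.hat_pull[OF _ _ ac]) (use \<theta>1 \<theta>2 in simp_all)
    have he: "\<forall>\<^sub>F zs in near_filter P.T (Suc (Suc 0)). hat (\<lambda>s. s) E.alpha_cochain (map f zs) =
        snd (h' (E.frame (map f zs ! 0)) (E.frame (map f zs ! 1)) (map f zs ! 2))"
      using near_filter_map[OF f_continuous E.hat_alpha_eq] by simp
    define w where "w = (\<lambda>zs. \<delta> (P.frame (zs ! 0)) (E.frame (f (zs ! 0))) (last zs))"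
    have "good P.T (\<lambda>W. smooth_on X W Z2_group) 0 w"
      unfolding good_def eventually_near_filter_0
    proof
      fix x assume "x \<in> topspace P.T"
      then have x: "x \<in> points X"
        by (simp add: P.topspace)
      let ?W = "U (P.frame x) \<inter> preim X f (V (E.frame (f x)))"
      have "smooth_on X ?W Z2_group (\<lambda>y. w ([x] @ [y]))"
        using \<delta>_smooth[of "P.frame x" "E.frame (f x)"] P.frame[OF x] frame_E[OF x] by (simp add: w_def)
      moreover have "openin P.T ?W" "x \<in> ?W"
        using P.frame[OF x] frame_E[OF x] x by (auto intro!: openin_Int P.U_open preim_open E.U_open simp: preim_iff simp del: openin_Int)
      ultimately show "\<exists>W. openin P.T W \<and> last [x] \<in> W \<and> smooth_on X W Z2_group (\<lambda>y. w ([x] @ [y]))"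
        by (intro exI[of _ ?W]) simp
    qed
    moreover have "\<forall>\<^sub>F zs in near_filter P.T (Suc (Suc 0)).
        hat (\<lambda>s. s) ?c zs = hat (\<lambda>s. s) P.alpha_cochain zs \<otimes>\<^bsub>Z2_group\<^esub> vdiff Z2_group w zs"
      using hc he P.hat_alpha_eq[simplified] near_U near_filter_length
    proof eventually_elim
      case (elim zs)
      then obtain a b y where zs: "zs = [a, b, y]"
        by (auto simp: length_Suc_conv)
      define i i' j j' where ij: "i = P.frame a" "i' = P.frame b" "j = E.frame (f a)" "j' = E.frame (f b)"
      have fr: "i \<in> I" "i' \<in> I" "j \<in> J" "j' \<in> J" "y \<in> U i" "y \<in> U i'" "f y \<in> V j" "f y \<in> V j'"
        using elim(4) P.frame[of a] P.frame[of b] frame_E[of a] frame_E[of b] by (auto simp: zs ij)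
      have d: "\<delta> i j y \<in> {1, -1}" "\<delta> i' j' y \<in> {1, -1}" "snd (h i i' y) \<in> {1, -1}"
        using fr \<delta>[of i j y] \<delta>[of i' j' y] P.\<epsilon>[of i i' y] by simp_all
      have v: "vdiff Z2_group w zs = \<delta> i' j' y * \<delta> i j y"
        unfolding zs by (subst comm_group.vdiff_2[OF comm_group_Z2]) (use d in \<open>simp_all add: w_def ij inv_Z2\<close>)
      have eq: "\<delta> i j y * snd (h' j j' (f y)) = snd (h i i' y) * \<delta> i' j' y"
        using fr by (simp add: \<delta>_left \<delta>_right)
      have "snd (h' j j' (f y)) = snd (h i i' y) * (\<delta> i' j' y * \<delta> i j y)"
        using eq d by auto
      then show ?case
        using elim(1,2,3) v by (simp add: zs sm.push_def ij)
    qed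
    ultimately show "sm.tgt.cohomologous 0 (hat (\<lambda>s. s) ?c) (hat (\<lambda>s. s) P.alpha_cochain)"
      unfolding sm.tgt.cohomologous_def by blast
  qed
  finally show ?thesis
    by simp
qed

end

section \<open>Lifts to the central extension\<close>

context equivariant_ext
begin

lemma \<iota>_cancel:
  assumes "z \<in> sphere 0 1" "w \<in> sphere 0 1" "g \<in> carrier E" "\<iota> z \<otimes>\<^bsub>E\<^esub> g = \<iota> w \<otimes>\<^bsub>E\<^esub> g"
  shows "z = w"
proof -
  have "\<iota> z = \<iota> w"
    using E.right_cancel[OF assms(3) \<iota>_closed[OF assms(1)] \<iota>_closed[OF assms(2)]] assms(4) by simp
  then show ?thesis
    using inj_onD[OF \<iota>_inj _ assms(1,2)] by blast
qed

lemma \<iota>_\<iota>: "z \<in> sphere 0 1 \<Longrightarrow> w \<in> sphere 0 1 \<Longrightarrow> g \<in> carrier E \<Longrightarrow>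
    \<iota> z \<otimes>\<^bsub>E\<^esub> (\<iota> w \<otimes>\<^bsub>E\<^esub> g) = \<iota> (z * w) \<otimes>\<^bsub>E\<^esub> g"
  by (simp only: \<iota>_mult E.m_assoc \<iota>_closed)

lemma \<iota>_left: 
  assumes "z \<in> sphere 0 1" "g \<in> carrier E" "g' \<in> carrier E"
  shows "g \<otimes>\<^bsub>E\<^esub> (\<iota> z \<otimes>\<^bsub>E\<^esub> g') = \<iota> z \<otimes>\<^bsub>E\<^esub> (g \<otimes>\<^bsub>E\<^esub> g')"
proof -
  have "g \<otimes>\<^bsub>E\<^esub> (\<iota> z \<otimes>\<^bsub>E\<^esub> g') = (g \<otimes>\<^bsub>E\<^esub> \<iota> z) \<otimes>\<^bsub>E\<^esub> g'"
    using assms by (simp only: E.m_assoc \<iota>_closed)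
  also have "g \<otimes>\<^bsub>E\<^esub> \<iota> z = \<iota> z \<otimes>\<^bsub>E\<^esub> g"
    using assms by (simp only: \<iota>_central)
  finally show ?thesis
    using assms by (simp only: E.m_assoc \<iota>_closed)
qed

lemma \<sigma>'_\<iota>: "\<epsilon> \<in> {1, -1} \<Longrightarrow> z \<in> sphere 0 1 \<Longrightarrow> g \<in> carrier E \<Longrightarrow>
    \<sigma>' \<epsilon> (\<iota> z \<otimes>\<^bsub>E\<^esub> g) = \<iota> (U1_act X \<epsilon> z) \<otimes>\<^bsub>E\<^esub> \<sigma>' \<epsilon> g"
  by (simp only: E.\<rho>_mult \<iota>_U1_act \<iota>_closed)

lemma q_mult: "a \<in> carrier E \<Longrightarrow> b \<in> carrier E \<Longrightarrow> q (a \<otimes>\<^bsub>E\<^esub> b) = q a \<otimes>\<^bsub>G\<^esub> q b"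
  by (rule hom_mult[OF q_hom])

lemma q_closed: "a \<in> carrier E \<Longrightarrow> q a \<in> carrier G"
  by (rule hom_in_carrier[OF q_hom])

lemma q_quotient:
  assumes "a \<in> carrier E" "b \<in> carrier E" "q a = q b"
  shows "q (a \<otimes>\<^bsub>E\<^esub> inv\<^bsub>E\<^esub> b) = \<one>\<^bsub>G\<^esub>"
proof -
  have "q (inv\<^bsub>E\<^esub> b) = inv\<^bsub>G\<^esub> q b"
    using group_hom.hom_inv[of E G q b] q_hom assms(2) E.is_group G.is_group
    by (simp add: group_hom_def group_hom_axioms_def)
  then show ?thesis
    using assms q_closed by (simp add: q_mult)
qed

lemma quotient_in_kernel:
  assumes "a \<in> carrier E" "b \<in> carrier E" "q a = q b"
  shows "\<iota>_inv (a \<otimes>\<^bsub>E\<^esub> inv\<^bsub>E\<^esub> b) \<in> sphere 0 1" "a = \<iota> (\<iota>_inv (a \<otimes>\<^bsub>E\<^esub> inv\<^bsub>E\<^esub> b)) \<otimes>\<^bsub>E\<^esub> b"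
proof -
  note k = q_kernel[OF _ q_quotient[OF assms]]
  have c: "a \<otimes>\<^bsub>E\<^esub> inv\<^bsub>E\<^esub> b \<in> carrier E"
    using assms by simp
  show "\<iota>_inv (a \<otimes>\<^bsub>E\<^esub> inv\<^bsub>E\<^esub> b) \<in> sphere 0 1"
    by (rule k(1)[OF c])
  show "a = \<iota> (\<iota>_inv (a \<otimes>\<^bsub>E\<^esub> inv\<^bsub>E\<^esub> b)) \<otimes>\<^bsub>E\<^esub> b"
    unfolding k(2)[OF c] using assms by (simp add: E.m_assoc)
qed

lemma smooth_on_quotient:
  assumes a: "smooth_on Y W E a" and b: "smooth_on Y W E b" and W: "W \<subseteq> points Y"
    and eq: "\<And>x. x \<in> W \<Longrightarrow> q (a x) = q (b x)"
  shows "smooth_on Y W U1_group (\<lambda>x. \<iota>_inv (a x \<otimes>\<^bsub>E\<^esub> inv\<^bsub>E\<^esub> b x))"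
proof (rule smooth_onI)
  fix x assume "x \<in> points Y" "x \<in> W"
  then show "\<iota>_inv (a x \<otimes>\<^bsub>E\<^esub> inv\<^bsub>E\<^esub> b x) \<in> carrier U1_group"
    unfolding carrier_U1
    by (intro quotient_in_kernel(1) smooth_on_carrier[OF a] smooth_on_carrier[OF b] eq)
next
  fix n V p assume p: "plots Y n V p" "p ` V \<subseteq> W"
  show "gplots U1_group n V (\<lambda>v. \<iota>_inv (a (p v) \<otimes>\<^bsub>E\<^esub> inv\<^bsub>E\<^esub> b (p v)))"
  proof (rule gplots_\<iota>_inv)
    show "gplots E n V (\<lambda>v. a (p v) \<otimes>\<^bsub>E\<^esub> inv\<^bsub>E\<^esub> b (p v))"
      by (rule E.gplots_mult[OF smooth_onD[OF a p] E.gplots_inv[OF smooth_onD[OF b p]]])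
    fix v assume "v \<in> V"
    then have "p v \<in> W" "p v \<in> points Y"
      using p(2) W by auto
    then show "q (a (p v) \<otimes>\<^bsub>E\<^esub> inv\<^bsub>E\<^esub> b (p v)) = \<one>\<^bsub>G\<^esub>"
      by (intro q_quotient smooth_on_carrier[OF a] smooth_on_carrier[OF b] eq)
  qed
qed

text \<open>Associativity of the product of three lifts gives the twisted cocycle identity.\<close>

lemma defect_cocycle:
  assumes e: "e01 \<in> {1, -1}" "e12 \<in> {1, -1}" "e01 * e12 = e02"
    and g: "g01 \<in> carrier E" "g12 \<in> carrier E" "g23 \<in> carrier E" "g02 \<in> carrier E" "g13 \<in> carrier E" "g03 \<in> carrier E"
    and z: "a012 \<in> sphere 0 1" "a123 \<in> sphere 0 1" "a023 \<in> sphere 0 1" "a013 \<in> sphere 0 1"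
    and r: "g01 \<otimes>\<^bsub>E\<^esub> \<sigma>' e01 g12 = \<iota> a012 \<otimes>\<^bsub>E\<^esub> g02"
      "g12 \<otimes>\<^bsub>E\<^esub> \<sigma>' e12 g23 = \<iota> a123 \<otimes>\<^bsub>E\<^esub> g13"
      "g02 \<otimes>\<^bsub>E\<^esub> \<sigma>' e02 g23 = \<iota> a023 \<otimes>\<^bsub>E\<^esub> g03"
      "g01 \<otimes>\<^bsub>E\<^esub> \<sigma>' e01 g13 = \<iota> a013 \<otimes>\<^bsub>E\<^esub> g03"
  shows "U1_act X e01 a123 * a013 = a012 * a023"
proof (rule \<iota>_cancel[OF _ _ g(6)])
  have s: "\<sigma>' e01 g12 \<in> carrier E" "\<sigma>' e12 g23 \<in> carrier E" "\<sigma>' e01 (\<sigma>' e12 g23) \<in> carrier E" "\<sigma>' e01 g13 \<in> carrier E"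
    using e g by (simp_all only: E.\<rho>_closed)
  have u: "U1_act X e01 a123 \<in> sphere 0 1"
    by (rule U1_act_closed[OF e(1) z(2)])
  show "U1_act X e01 a123 * a013 \<in> sphere 0 1" "a012 * a023 \<in> sphere 0 1"
    using u z by (simp_all add: norm_mult)
  have "\<iota> (U1_act X e01 a123 * a013) \<otimes>\<^bsub>E\<^esub> g03 = \<iota> (U1_act X e01 a123) \<otimes>\<^bsub>E\<^esub> (g01 \<otimes>\<^bsub>E\<^esub> \<sigma>' e01 g13)"
    unfolding r(4) by (rule \<iota>_\<iota>[symmetric, OF u z(4) g(6)])
  also have "\<dots> = g01 \<otimes>\<^bsub>E\<^esub> (\<iota> (U1_act X e01 a123) \<otimes>\<^bsub>E\<^esub> \<sigma>' e01 g13)"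
    by (rule \<iota>_left[symmetric, OF u g(1) s(4)])
  also have "\<dots> = g01 \<otimes>\<^bsub>E\<^esub> \<sigma>' e01 (g12 \<otimes>\<^bsub>E\<^esub> \<sigma>' e12 g23)"
    unfolding r(2) \<sigma>'_\<iota>[OF e(1) z(2) g(5)] ..
  also have "\<dots> = (g01 \<otimes>\<^bsub>E\<^esub> \<sigma>' e01 g12) \<otimes>\<^bsub>E\<^esub> \<sigma>' e01 (\<sigma>' e12 g23)"
    unfolding E.\<rho>_mult[OF e(1) g(2) s(2)] by (rule E.m_assoc[symmetric, OF g(1) s(1) s(3)])
  also have "\<dots> = \<iota> a012 \<otimes>\<^bsub>E\<^esub> (g02 \<otimes>\<^bsub>E\<^esub> \<sigma>' e01 (\<sigma>' e12 g23))"
    unfolding r(1) by (rule E.m_assoc[OF \<iota>_closed[OF z(1)] g(4) s(3)])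
  also have "\<dots> = \<iota> a012 \<otimes>\<^bsub>E\<^esub> (\<iota> a023 \<otimes>\<^bsub>E\<^esub> g03)"
    unfolding E.\<rho>_comp[OF e(1,2) g(3)] e(3) r(3) ..
  also have "\<dots> = \<iota> (a012 * a023) \<otimes>\<^bsub>E\<^esub> g03"
    by (rule \<iota>_\<iota>[OF z(1,3) g(6)])
  finally show "\<iota> (U1_act X e01 a123 * a013) \<otimes>\<^bsub>E\<^esub> g03 = \<iota> (a012 * a023) \<otimes>\<^bsub>E\<^esub> g03" .
qed

text \<open>
  Evaluating \<open>k\<^sub>0 h'\<^sub>0\<^sub>1 h'\<^sub>1\<^sub>2\<close> on lifts in two ways, by multiplying the \<open>h'\<close> first or by moving the \<open>k\<close> past
  them one after the other, compares the two cocycles.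
\<close>

lemma defect_comparison:
  assumes e: "e01 \<in> {1, -1}" "e12 \<in> {1, -1}" "e02 \<in> {1, -1}" "e01 * e12 = e02"
    and d: "d0 \<in> {1, -1}" "d1 \<in> {1, -1}" "f01 \<in> {1, -1}" "d0 * f01 = e01 * d1"
    and g: "g01 \<in> carrier E" "g12 \<in> carrier E" "g02 \<in> carrier E"
    and g': "g'01 \<in> carrier E" "g'12 \<in> carrier E" "g'02 \<in> carrier E"
    and k: "k0 \<in> carrier E" "k1 \<in> carrier E" "k2 \<in> carrier E"
    and z: "a \<in> sphere 0 1" "a' \<in> sphere 0 1" "b01 \<in> sphere 0 1" "b12 \<in> sphere 0 1" "b02 \<in> sphere 0 1"
    and r: "g01 \<otimes>\<^bsub>E\<^esub> \<sigma>' e01 g12 = \<iota> a \<otimes>\<^bsub>E\<^esub> g02"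
      "g'01 \<otimes>\<^bsub>E\<^esub> \<sigma>' f01 g'12 = \<iota> a' \<otimes>\<^bsub>E\<^esub> g'02"
      "k0 \<otimes>\<^bsub>E\<^esub> \<sigma>' d0 g'01 = \<iota> b01 \<otimes>\<^bsub>E\<^esub> (g01 \<otimes>\<^bsub>E\<^esub> \<sigma>' e01 k1)"
      "k1 \<otimes>\<^bsub>E\<^esub> \<sigma>' d1 g'12 = \<iota> b12 \<otimes>\<^bsub>E\<^esub> (g12 \<otimes>\<^bsub>E\<^esub> \<sigma>' e12 k2)"
      "k0 \<otimes>\<^bsub>E\<^esub> \<sigma>' d0 g'02 = \<iota> b02 \<otimes>\<^bsub>E\<^esub> (g02 \<otimes>\<^bsub>E\<^esub> \<sigma>' e02 k2)"
  shows "U1_act X d0 a' * b02 = b01 * (U1_act X e01 b12 * a)"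
proof -
  let ?R = "g02 \<otimes>\<^bsub>E\<^esub> \<sigma>' e02 k2"
  have s: "\<sigma>' d0 g'01 \<in> carrier E" "\<sigma>' f01 g'12 \<in> carrier E" "\<sigma>' d0 (\<sigma>' f01 g'12) \<in> carrier E"
      "\<sigma>' d0 g'02 \<in> carrier E" "\<sigma>' e01 k1 \<in> carrier E" "\<sigma>' d1 g'12 \<in> carrier E"
      "\<sigma>' e01 (\<sigma>' d1 g'12) \<in> carrier E" "\<sigma>' e12 k2 \<in> carrier E" "\<sigma>' e01 (\<sigma>' e12 k2) \<in> carrier E"
      "\<sigma>' e02 k2 \<in> carrier E" "\<sigma>' e01 g12 \<in> carrier E"
    using e d g g' k by (simp_all only: E.\<rho>_closed)
  have R: "?R \<in> carrier E"
    by (rule E.m_closed[OF g(3) s(10)])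
  have u: "U1_act X d0 a' \<in> sphere 0 1" "U1_act X e01 b12 \<in> sphere 0 1"
    by (rule U1_act_closed[OF d(1) z(2)], rule U1_act_closed[OF e(1) z(4)])
  have m: "U1_act X e01 b12 * a \<in> sphere 0 1"
    using u z by (simp add: norm_mult)
  have L: "k0 \<otimes>\<^bsub>E\<^esub> \<sigma>' d0 (g'01 \<otimes>\<^bsub>E\<^esub> \<sigma>' f01 g'12) = \<iota> (U1_act X d0 a' * b02) \<otimes>\<^bsub>E\<^esub> ?R"
  proof -
    have "k0 \<otimes>\<^bsub>E\<^esub> \<sigma>' d0 (g'01 \<otimes>\<^bsub>E\<^esub> \<sigma>' f01 g'12) = k0 \<otimes>\<^bsub>E\<^esub> (\<iota> (U1_act X d0 a') \<otimes>\<^bsub>E\<^esub> \<sigma>' d0 g'02)"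
      unfolding r(2) \<sigma>'_\<iota>[OF d(1) z(2) g'(3)] ..
    also have "\<dots> = \<iota> (U1_act X d0 a') \<otimes>\<^bsub>E\<^esub> (k0 \<otimes>\<^bsub>E\<^esub> \<sigma>' d0 g'02)"
      by (rule \<iota>_left[OF u(1) k(1) s(4)])
    also have "\<dots> = \<iota> (U1_act X d0 a' * b02) \<otimes>\<^bsub>E\<^esub> ?R"
      unfolding r(5) by (rule \<iota>_\<iota>[OF u(1) z(5) R])
    finally show ?thesis .
  qed
  have "k0 \<otimes>\<^bsub>E\<^esub> \<sigma>' d0 (g'01 \<otimes>\<^bsub>E\<^esub> \<sigma>' f01 g'12) = (k0 \<otimes>\<^bsub>E\<^esub> \<sigma>' d0 g'01) \<otimes>\<^bsub>E\<^esub> \<sigma>' d0 (\<sigma>' f01 g'12)"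
    unfolding E.\<rho>_mult[OF d(1) g'(1) s(2)] by (rule E.m_assoc[symmetric, OF k(1) s(1) s(3)])
  also have "\<dots> = \<iota> b01 \<otimes>\<^bsub>E\<^esub> ((g01 \<otimes>\<^bsub>E\<^esub> \<sigma>' e01 k1) \<otimes>\<^bsub>E\<^esub> \<sigma>' d0 (\<sigma>' f01 g'12))"
    unfolding r(3) by (rule E.m_assoc[OF \<iota>_closed[OF z(3)] E.m_closed[OF g(1) s(5)] s(3)])
  also have "\<sigma>' d0 (\<sigma>' f01 g'12) = \<sigma>' e01 (\<sigma>' d1 g'12)"
    unfolding E.\<rho>_comp[OF d(1,3) g'(2)] E.\<rho>_comp[OF e(1) d(2) g'(2)] d(4) ..
  also have "(g01 \<otimes>\<^bsub>E\<^esub> \<sigma>' e01 k1) \<otimes>\<^bsub>E\<^esub> \<sigma>' e01 (\<sigma>' d1 g'12) = g01 \<otimes>\<^bsub>E\<^esub> \<sigma>' e01 (k1 \<otimes>\<^bsub>E\<^esub> \<sigma>' d1 g'12)"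
    unfolding E.\<rho>_mult[OF e(1) k(2) s(6)] by (rule E.m_assoc[OF g(1) s(5) s(7)])
  also have "\<dots> = g01 \<otimes>\<^bsub>E\<^esub> (\<iota> (U1_act X e01 b12) \<otimes>\<^bsub>E\<^esub> (\<sigma>' e01 g12 \<otimes>\<^bsub>E\<^esub> \<sigma>' e01 (\<sigma>' e12 k2)))"
    unfolding r(4) \<sigma>'_\<iota>[OF e(1) z(4) E.m_closed[OF g(2) s(8)]] E.\<rho>_mult[OF e(1) g(2) s(8)] ..
  also have "\<dots> = \<iota> (U1_act X e01 b12) \<otimes>\<^bsub>E\<^esub> (g01 \<otimes>\<^bsub>E\<^esub> (\<sigma>' e01 g12 \<otimes>\<^bsub>E\<^esub> \<sigma>' e01 (\<sigma>' e12 k2)))"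
    by (rule \<iota>_left[OF u(2) g(1) E.m_closed[OF s(11,9)]])
  also have "g01 \<otimes>\<^bsub>E\<^esub> (\<sigma>' e01 g12 \<otimes>\<^bsub>E\<^esub> \<sigma>' e01 (\<sigma>' e12 k2)) = (\<iota> a \<otimes>\<^bsub>E\<^esub> g02) \<otimes>\<^bsub>E\<^esub> \<sigma>' e01 (\<sigma>' e12 k2)"
    unfolding r(1)[symmetric] by (rule E.m_assoc[symmetric, OF g(1) s(11) s(9)])
  also have "\<dots> = \<iota> a \<otimes>\<^bsub>E\<^esub> ?R"
    unfolding E.\<rho>_comp[OF e(1,2) k(3)] e(4) by (rule E.m_assoc[OF \<iota>_closed[OF z(1)] g(3) s(10)])
  also have "\<iota> (U1_act X e01 b12) \<otimes>\<^bsub>E\<^esub> (\<iota> a \<otimes>\<^bsub>E\<^esub> ?R) = \<iota> (U1_act X e01 b12 * a) \<otimes>\<^bsub>E\<^esub> ?R"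
    by (rule \<iota>_\<iota>[OF u(2) z(1) R])
  also have "\<iota> b01 \<otimes>\<^bsub>E\<^esub> (\<iota> (U1_act X e01 b12 * a) \<otimes>\<^bsub>E\<^esub> ?R) = \<iota> (b01 * (U1_act X e01 b12 * a)) \<otimes>\<^bsub>E\<^esub> ?R"
    by (rule \<iota>_\<iota>[OF z(3) m R])
  finally have "\<iota> (U1_act X d0 a' * b02) \<otimes>\<^bsub>E\<^esub> ?R = \<iota> (b01 * (U1_act X e01 b12 * a)) \<otimes>\<^bsub>E\<^esub> ?R"
    unfolding L .
  then show ?thesis
    by (rule \<iota>_cancel[rotated 3]) (use u z m R in \<open>simp_all add: norm_mult\<close>)
qed

text \<open>
  The lift is the composite with a local section of the extension. Its domain is open for the
  D-topology because this can be tested on plots.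
\<close>

lemma local_lift:
  assumes Y: "local_diffeology Y" and M: "openin (D_topology Y) M" and g: "smooth_on Y M G g" and x: "x \<in> M"
  shows "\<exists>N s. openin (D_topology Y) N \<and> x \<in> N \<and> N \<subseteq> M \<and> smooth_on Y N E s \<and> (\<forall>y\<in>N. q (s y) = g y)"
proof -
  have MY: "M \<subseteq> points Y"
    by (rule openin_D_points[OF M])
  have gx: "g x \<in> carrier G"
    using smooth_on_carrier[OF g _ x] x MY by blast
  have "\<forall>g\<in>carrier G. \<exists>W s. openin (D_topology (dspace G)) W \<and> g \<in> W \<and>
        smooth_map (subspace_diff (dspace G) W) (dspace E) s \<and> (\<forall>w\<in>W. q (s w) = w)"
    using cext unfolding central_extension_def by (elim conjE)
  from bspec[OF this gx] obtain W s where W: "openin (D_topology (dspace G)) W" "g x \<in> W" and s: "smooth_on (dspace G) W E s"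
    and qs: "\<forall>w\<in>W. q (s w) = w"
    by (elim exE conjE)
  define N where "N = {y \<in> M. g y \<in> W}"
  have "openin (D_topology Y) N"
    unfolding openin_D_topology
  proof (intro conjI allI impI)
    show "N \<subseteq> points Y"
      using MY by (auto simp: N_def)
    fix n V p assume p: "plots Y n V p"
    let ?V = "{v \<in> V. p v \<in> M}"
    have o: "openin (Euclidean_space n) ?V"
      using M p unfolding openin_D_topology by blast
    have p': "plots Y n ?V p"
      by (rule plot_restrict[OF Y p o]) blast
    have "gplots G n ?V (\<lambda>v. g (p v))"
      by (rule smooth_onD[OF g p']) blast
    then have "plots (dspace G) n ?V (\<lambda>v. g (p v))"
      by (simp add: dspace_def)
    then have "openin (Euclidean_space n) {v \<in> ?V. g (p v) \<in> W}"
      by (rule W(1)[unfolded openin_D_topology, THEN conjunct2, THEN spec, THEN spec, THEN spec, THEN mp])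
    moreover have "{v \<in> ?V. g (p v) \<in> W} = {v \<in> V. p v \<in> N}"
      by (auto simp: N_def)
    ultimately show "openin (Euclidean_space n) {v \<in> V. p v \<in> N}"
      by simp
  qed
  moreover have "smooth_on Y N E (\<lambda>y. s (g y))"
  proof (rule smooth_onI)
    fix y assume "y \<in> points Y" "y \<in> N"
    then have "g y \<in> carrier G" "g y \<in> W"
      using smooth_on_carrier[OF g] by (auto simp: N_def)
    then show "s (g y) \<in> carrier E"
      by (intro smooth_on_carrier[OF s]) (simp_all add: dspace_def)
  next
    fix n V p assume p: "plots Y n V p" "p ` V \<subseteq> N"
    then have "gplots G n V (\<lambda>v. g (p v))"
      by (intro smooth_onD[OF g p(1)]) (auto simp: N_def)
    then have "plots (dspace G) n V (\<lambda>v. g (p v))"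
      by (simp add: dspace_def)
    then show "gplots E n V (\<lambda>v. s (g (p v)))"
      by (rule smooth_onD[OF s]) (use p(2) in \<open>auto simp: N_def\<close>)
  qed
  ultimately show ?thesis
    using x W(2) qs by (intro exI[of _ N] exI[of _ "\<lambda>y. s (g y)"]) (auto simp: N_def)
qed

end

locale lifted_cocycle = H_cocycle G \<sigma> X I U h + equivariant_ext G \<sigma> Ext
  for G :: "'g diff_group" and \<sigma> and X :: "'x diff_space" and I :: "'i set" and U h
    and Ext :: "('g, 'e) ext" +
  fixes gh :: "'i \<Rightarrow> 'i \<Rightarrow> 'x \<Rightarrow> 'e"
  assumes gh_smooth: "\<And>i j. i \<in> I \<Longrightarrow> j \<in> I \<Longrightarrow> smooth_on X (U i \<inter> U j) (ext_grp Ext) (gh i j)"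
    and q_gh: "\<And>i j x. i \<in> I \<Longrightarrow> j \<in> I \<Longrightarrow> x \<in> U i \<Longrightarrow> x \<in> U j \<Longrightarrow> ext_q Ext (gh i j x) = fst (h i j x)"
begin

sublocale twisted_ext X I U "\<lambda>i j x. snd (h i j x)" G \<sigma> Ext ..

abbreviation act where "act \<equiv> U1_act Ext"

definition coc :: "'i \<Rightarrow> 'i \<Rightarrow> 'i \<Rightarrow> 'x \<Rightarrow> complex" where
  "coc = lift_coc Ext (\<lambda>i j x. snd (h i j x)) gh"

lemma coc_eq: "coc i j l x =
    \<iota>_inv ((gh i j x \<otimes>\<^bsub>E\<^esub> \<sigma>' (snd (h i j x)) (gh j l x)) \<otimes>\<^bsub>E\<^esub> inv\<^bsub>E\<^esub> gh i l x)"
  by (simp add: coc_def lift_coc_def \<iota>_inv_def)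

lemma in_points: "i \<in> I \<Longrightarrow> x \<in> U i \<Longrightarrow> x \<in> points X"
  using cover by blast

lemma gh_closed: "i \<in> I \<Longrightarrow> j \<in> I \<Longrightarrow> x \<in> U i \<Longrightarrow> x \<in> U j \<Longrightarrow> gh i j x \<in> carrier E"
  using smooth_on_carrier[OF gh_smooth, of i j x] in_points by simp

lemma gh_prod:
  assumes "i \<in> I" "j \<in> I" "l \<in> I" "x \<in> U i" "x \<in> U j" "x \<in> U l"
  shows "gh i j x \<otimes>\<^bsub>E\<^esub> \<sigma>' (snd (h i j x)) (gh j l x) \<in> carrier E"
    and "q (gh i j x \<otimes>\<^bsub>E\<^esub> \<sigma>' (snd (h i j x)) (gh j l x)) = q (gh i l x)"
proof -
  have g: "gh i j x \<in> carrier E" "gh j l x \<in> carrier E"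
    using assms by (simp_all add: gh_closed)
  have e: "snd (h i j x) \<in> {1, -1}"
    using assms by (intro \<epsilon>)
  show "gh i j x \<otimes>\<^bsub>E\<^esub> \<sigma>' (snd (h i j x)) (gh j l x) \<in> carrier E"
    by (rule E.m_closed[OF g(1) E.\<rho>_closed[OF e g(2)]])
  have "q (gh i j x \<otimes>\<^bsub>E\<^esub> \<sigma>' (snd (h i j x)) (gh j l x)) = fst (h i j x) \<otimes>\<^bsub>G\<^esub> \<sigma> (snd (h i j x)) (fst (h j l x))"
    unfolding q_mult[OF g(1) E.\<rho>_closed[OF e g(2)]] q_\<sigma>[OF e g(2)] using assms by (simp only: q_gh)
  also have "\<dots> = fst (h i l x)"
    using h_comp[OF assms] by (simp add: mult_H prod_eq_iff)
  also have "\<dots> = q (gh i l x)"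
    using assms by (simp only: q_gh)
  finally show "q (gh i j x \<otimes>\<^bsub>E\<^esub> \<sigma>' (snd (h i j x)) (gh j l x)) = q (gh i l x)" .
qed

text \<open>
  Both sides have the same image in \<open>G\<close> by the cocycle identity of the transition functions, so they
  differ by an element of \<open>U(1)\<close>.
\<close>

lemma coc:
  assumes "i \<in> I" "j \<in> I" "l \<in> I" "x \<in> U i" "x \<in> U j" "x \<in> U l"
  shows "coc i j l x \<in> sphere 0 1"
    and "gh i j x \<otimes>\<^bsub>E\<^esub> \<sigma>' (snd (h i j x)) (gh j l x) = \<iota> (coc i j l x) \<otimes>\<^bsub>E\<^esub> gh i l x"
proof -
  have "gh i l x \<in> carrier E"
    using assms by (simp add: gh_closed)
  from quotient_in_kernel[OF gh_prod(1)[OF assms] this gh_prod(2)[OF assms]]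
  show "coc i j l x \<in> sphere 0 1"
    "gh i j x \<otimes>\<^bsub>E\<^esub> \<sigma>' (snd (h i j x)) (gh j l x) = \<iota> (coc i j l x) \<otimes>\<^bsub>E\<^esub> gh i l x"
    unfolding coc_eq by (simp_all only:)
qed

lemma coc_smooth:
  assumes i: "i \<in> I" "j \<in> I" "l \<in> I"
  shows "smooth_on X (U i \<inter> U j \<inter> U l) U1_group (coc i j l)"
proof -
  let ?W = "U i \<inter> U j \<inter> U l"
  have "smooth_on X ?W E (\<lambda>x. \<sigma>' (snd (h i j x)) (gh j l x))"
  proof (rule E.smooth_on_act)
    show "smooth_on X ?W E (gh j l)"
      by (rule smooth_on_subset[OF gh_smooth[OF i(2,3)]]) blast
    show "smooth_on X ?W Z2_group (\<lambda>x. snd (h i j x))"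
      by (rule smooth_on_subset[OF \<epsilon>_smooth[OF i(1,2)]]) blast
  qed
  moreover have "smooth_on X ?W E (gh i j)" "smooth_on X ?W E (gh i l)"
    by (rule smooth_on_subset[OF gh_smooth[OF i(1,2)]], blast)
      (rule smooth_on_subset[OF gh_smooth[OF i(1,3)]], blast)
  ultimately have "smooth_on X ?W U1_group (\<lambda>x.
      \<iota>_inv ((gh i j x \<otimes>\<^bsub>E\<^esub> \<sigma>' (snd (h i j x)) (gh j l x)) \<otimes>\<^bsub>E\<^esub> inv\<^bsub>E\<^esub> gh i l x))"
    using i in_points by (intro smooth_on_quotient E.smooth_on_mult gh_prod(2)) auto
  then show ?thesis
    by (rule U.smooth_on_cong) (simp add: coc_eq)
qed

text \<open>The function \<open>a\<^sub>i\<^sub>j\<^sub>k\<close> is the expression of a section in the frame \<open>i\<close>.\<close>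

definition beta_cochain :: "('x, 'i \<Rightarrow> 'x \<Rightarrow> complex) cochain" where
  "beta_cochain = cech_cochain (\<lambda>is. let i = is ! 0; j = is ! 1; k = is ! 2 in
     family_on I U (U i \<inter> U j \<inter> U k) (\<lambda>l x. act (snd (h l i x)) (coc i j k x)))"

lemma beta_cochains: "beta_cochain \<in> cochains T U.F 2"
  unfolding beta_cochain_def
proof (rule cech_cochain_in_cochains)
  fix xs :: "'x list" assume "length xs = Suc 2" and sub: "set xs \<subseteq> points X"
  then obtain a b c where xs: "xs = [a, b, c]"
    by (auto simp: length_Suc_conv numeral_2_eq_2)
  define i j k where ijk: "i = frame a" "j = frame b" "k = frame c"
  have fr: "i \<in> I" "j \<in> I" "k \<in> I"
    using sub xs frame by (auto simp: ijk)
  let ?W = "U i \<inter> U j \<inter> U k"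
  have "family_on I U ?W (\<lambda>l x. act (snd (h l i x)) (coc i j k x)) \<in> carrier (sections U.F ?W)"
  proof (rule U.family_in_sections)
    show "?W \<subseteq> points X"
      using fr in_points by blast
    show "smooth_on X (?W \<inter> U l) U1_group (\<lambda>x. act (snd (h l i x)) (coc i j k x))" if "l \<in> I" for l
    proof (rule U.smooth_on_act)
      show "smooth_on X (?W \<inter> U l) U1_group (coc i j k)"
        by (rule smooth_on_subset[OF coc_smooth[OF fr]]) blast
      show "smooth_on X (?W \<inter> U l) Z2_group (\<lambda>x. snd (h l i x))"
        by (rule smooth_on_subset[OF \<epsilon>_smooth[OF that fr(1)]]) blast
    qed
    show "act (snd (h l i x)) (coc i j k x) = act (snd (h l m x)) (act (snd (h m i x)) (coc i j k x))"
      if "l \<in> I" "m \<in> I" "x \<in> ?W" "x \<in> U l" "x \<in> U m" for l m x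
      using that fr coc(1)[OF fr, of x] by (intro U.\<rho>_\<epsilon>[symmetric]) simp_all
  qed
  moreover have "(\<Inter>x\<in>set xs. U (frame x)) = ?W"
    by (auto simp: xs ijk)
  ultimately show "(let i = map frame xs ! 0; j = map frame xs ! 1; k = map frame xs ! 2 in
      family_on I U (U i \<inter> U j \<inter> U k) (\<lambda>l x. act (snd (h l i x)) (coc i j k x)))
      \<in> carrier (sections U.F (\<Inter>x\<in>set xs. U (frame x)))"
    by (simp add: xs ijk Let_def)
qed

text \<open>The values of the cochain, in the frame at the last point.\<close>

definition beta_val :: "'x list \<Rightarrow> complex" where
  "beta_val zs = act (snd (h (frame (last zs)) (frame (zs ! 0)) (last zs)))
     (coc (frame (zs ! 0)) (frame (zs ! 1)) (frame (zs ! 2)) (last zs))"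

lemma hat_beta: "\<forall>\<^sub>F zs in near_filter T (Suc 2). hat U.val beta_cochain zs = beta_val zs"
  using near_frames near_filter_length
proof eventually_elim
  case (elim zs)
  then obtain a b c y where "zs = [a, b, c, y]"
    by (auto simp: length_Suc_conv numeral_2_eq_2)
  with elim frame[of y] show ?case
    by (simp add: hat_def beta_cochain_def cech_cochain_def beta_val_def U.val_def U.family_on_apply Let_def)
qed

text \<open>
  The twisted cocycle identity of \<open>a\<close> holds in the frame \<open>i\<close> of the first point. The change from there to
  the frame \<open>e\<close> of the last point turns it into the vanishing of the coboundary.
\<close>

lemma beta_cocycle: "beta_cochain \<in> cocycles T U.F 2"
proof -
  interpret S: fpresheaf U1_group T U.F U.val U.sec
    by (rule U.fpresheaf)
  have "\<forall>\<^sub>F zs in near_filter T (Suc 2). hat U.val beta_cochain zs = beta_val zs \<and> beta_val zs \<in> carrier U1_group"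
    using hat_beta S.good_carrier[OF S.good_hat[OF beta_cochains]]
    by eventually_elim simp
  from S.vdiff_cong[OF this] near_frames near_filter_length
  have "\<forall>\<^sub>F zs in near_filter T (Suc (Suc 2)). vdiff U1_group (hat U.val beta_cochain) zs = \<one>\<^bsub>U1_group\<^esub>"
  proof eventually_elim
    case (elim zs)
    then obtain a b c d y where zs: "zs = [a, b, c, d, y]"
      by (auto simp: length_Suc_conv numeral_2_eq_2)
    define i j l m e where ijl: "i = frame a" "j = frame b" "l = frame c" "m = frame d" "e = frame y"
    have fr: "i \<in> I" "j \<in> I" "l \<in> I" "m \<in> I" "e \<in> I" "y \<in> U i" "y \<in> U j" "y \<in> U l" "y \<in> U m" "y \<in> U e"
      using elim(2) frame by (auto simp: zs ijl)
    have s: "snd (h i j y) \<in> {1, -1}" "snd (h j l y) \<in> {1, -1}" "snd (h e i y) \<in> {1, -1}" "snd (h e j y) \<in> {1, -1}"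
      using fr \<epsilon>[of i j y] \<epsilon>[of j l y] \<epsilon>[of e i y] \<epsilon>[of e j y] by simp_all
    have C: "coc i j l y \<in> sphere 0 1" "coc j l m y \<in> sphere 0 1" "coc i l m y \<in> sphere 0 1" "coc i j m y \<in> sphere 0 1"
      using coc(1)[of i j l y] coc(1)[of j l m y] coc(1)[of i l m y] coc(1)[of i j m y] fr by simp_all
    have g: "gh i j y \<in> carrier E" "gh j l y \<in> carrier E" "gh l m y \<in> carrier E" "gh i l y \<in> carrier E"
        "gh j m y \<in> carrier E" "gh i m y \<in> carrier E"
      using gh_closed[of i j y] gh_closed[of j l y] gh_closed[of l m y] gh_closed[of i l y] gh_closed[of j m y]
        gh_closed[of i m y] fr by simp_all
    have "act (snd (h i j y)) (coc j l m y) * coc i j m y = coc i j l y * coc i l m y"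
      by (rule defect_cocycle[OF s(1,2) \<epsilon>_comp[OF fr(1-3,6-8)] g C(1,2,3,4)
          coc(2)[OF fr(1-3,6-8)] coc(2)[OF fr(2-4,7-9)] coc(2)[OF fr(1,3,4,6,8,9)] coc(2)[OF fr(1,2,4,6,7,9)]])
    moreover have A: "act (snd (h i j y)) (coc j l m y) \<in> sphere 0 1"
      by (rule U1_act_closed[OF s(1) C(2)])
    ultimately have "act (snd (h e i y)) (act (snd (h i j y)) (coc j l m y)) * act (snd (h e i y)) (coc i j m y) =
        act (snd (h e i y)) (coc i j l y) * act (snd (h e i y)) (coc i l m y)"
      by (simp only: U1_act_mult[OF s(3), symmetric] C)
    moreover have "act (snd (h e i y)) (act (snd (h i j y)) (coc j l m y)) = act (snd (h e j y)) (coc j l m y)"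
      using fr C(2) by (intro U.\<rho>_\<epsilon>) simp_all
    ultimately have eq: "act (snd (h e j y)) (coc j l m y) * act (snd (h e i y)) (coc i j m y) =
        act (snd (h e i y)) (coc i l m y) * act (snd (h e i y)) (coc i j l y)"
      by (simp add: mult.commute)
    have B: "act (snd (h e i y)) (coc i j l y) \<in> sphere 0 1" "act (snd (h e j y)) (coc j l m y) \<in> sphere 0 1"
        "act (snd (h e i y)) (coc i l m y) \<in> sphere 0 1" "act (snd (h e i y)) (coc i j m y) \<in> sphere 0 1"
      by (rule U1_act_closed[OF s(3) C(1)], rule U1_act_closed[OF s(4) C(2)],
          rule U1_act_closed[OF s(3) C(3)], rule U1_act_closed[OF s(3) C(4)])
    have bv: "beta_val [a, b, c, y] = act (snd (h e i y)) (coc i j l y)"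
        "beta_val [b, c, d, y] = act (snd (h e j y)) (coc j l m y)"
        "beta_val [a, c, d, y] = act (snd (h e i y)) (coc i l m y)"
        "beta_val [a, b, d, y] = act (snd (h e i y)) (coc i j m y)"
      by (simp_all add: beta_val_def ijl)
    have "vdiff U1_group beta_val zs = beta_val [b, c, d, y] \<otimes>\<^bsub>U1_group\<^esub> beta_val [a, b, d, y] \<otimes>\<^bsub>U1_group\<^esub>
        inv\<^bsub>U1_group\<^esub> (beta_val [a, c, d, y] \<otimes>\<^bsub>U1_group\<^esub> beta_val [a, b, c, y])"
      unfolding zs by (rule comm_group.vdiff_4[OF comm_group_U1]) (simp_all only: bv B carrier_U1)
    also have "\<dots> = \<one>\<^bsub>U1_group\<^esub>"
    proof -
      have p: "act (snd (h e i y)) (coc i l m y) * act (snd (h e i y)) (coc i j l y) \<in> carrier U1_group"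
        using B by (simp add: norm_mult)
      show ?thesis
        unfolding bv mult_U1 eq using U.r_inv[OF p] by simp
    qed
    finally show ?case
      using elim(1) by simp
  qed
  then show ?thesis
    unfolding S.cocycles_iff using beta_cochains by blast
qed

abbreviation "exp_map \<equiv> (\<lambda>W m. family_on I U W (\<lambda>i x. exp_U1 (m i x)))"

definition DD where
  "DD = connecting T Z.F R.F U.F (\<lambda>W m. m) exp_map 2 (coho_class T U.F 2 beta_cochain)"

end


section \<open>Naturality of the twisted Dixmier-Douady class\<close>

locale lifted_comparison = comparison G \<sigma> X I U h Y J V h' f k +
  PL: lifted_cocycle G \<sigma> X I U h Ext gh + EL: lifted_cocycle G \<sigma> Y J V h' Ext gh'
  for G :: "'g diff_group" and \<sigma> and X :: "'x diff_space" and I :: "'i set" and U h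
    and Y :: "'y diff_space" and J :: "'j set" and V h' f k and Ext :: "('g, 'e) ext" and gh gh'
begin

sublocale CZ: comparison_coefficients G \<sigma> X I U h Y J V h' f k Z_group "R_act Ext"
  by (intro comparison_coefficients.intro comparison_axioms PL.smooth_z2_Z comm_group_Z)

sublocale CR: comparison_coefficients G \<sigma> X I U h Y J V h' f k R_group "R_act Ext"
  by (intro comparison_coefficients.intro comparison_axioms PL.smooth_z2_R comm_group_R)

sublocale CU: comparison_coefficients G \<sigma> X I U h Y J V h' f k U1_group "U1_act Ext"
  by (intro comparison_coefficients.intro comparison_axioms PL.smooth_z2_U1 comm_group_U1)

text \<open>
  The point \<open>x\<close> is made part of the statement, so that neighbourhoods \<open>nbh x\<close> and lifts \<open>kh x\<close> can be
  chosen for all points at once.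
\<close>

lemma k_lift:
  "\<exists>N s. x \<in> points X \<longrightarrow> openin P.T N \<and> x \<in> N \<and> N \<subseteq> U (P.frame x) \<inter> preim X f (V (E.frame (f x))) \<and>
     smooth_on X N PL.E s \<and> (\<forall>y\<in>N. PL.q (s y) = fst (k (P.frame x) (E.frame (f x)) y))"
proof (cases "x \<in> points X")
  case True
  note fr = P.frame[OF True] frame_E[OF True]
  let ?M = "U (P.frame x) \<inter> preim X f (V (E.frame (f x)))"
  have o: "openin P.T ?M"
    using fr by (intro openin_Int P.U_open preim_open E.U_open) simp_all
  have sm: "smooth_on X ?M G (\<lambda>y. fst (k (P.frame x) (E.frame (f x)) y))"
    using fr by (intro smooth_on_H_fst[of _ _ G \<sigma>] k_smooth) simp_all
  have x: "x \<in> ?M"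
    using fr True by (simp add: preim_iff)
  from PL.local_lift[OF P.X o sm x] obtain N s where "openin P.T N" "x \<in> N" "N \<subseteq> ?M" "smooth_on X N PL.E s"
      "\<forall>y\<in>N. PL.q (s y) = fst (k (P.frame x) (E.frame (f x)) y)"
    by (elim exE conjE)
  then show ?thesis
    by (intro exI[of _ N] exI[of _ s] impI conjI)
qed simp

definition nbh :: "'x \<Rightarrow> 'x set" where
  "nbh x = (SOME N. \<exists>s. x \<in> points X \<longrightarrow> openin P.T N \<and> x \<in> N \<and> N \<subseteq> U (P.frame x) \<inter> preim X f (V (E.frame (f x))) \<and>
     smooth_on X N PL.E s \<and> (\<forall>y\<in>N. PL.q (s y) = fst (k (P.frame x) (E.frame (f x)) y)))"

definition kh :: "'x \<Rightarrow> 'x \<Rightarrow> 'e" where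
  "kh x = (SOME s. x \<in> points X \<longrightarrow> openin P.T (nbh x) \<and> x \<in> nbh x \<and>
     nbh x \<subseteq> U (P.frame x) \<inter> preim X f (V (E.frame (f x))) \<and>
     smooth_on X (nbh x) PL.E s \<and> (\<forall>y\<in>nbh x. PL.q (s y) = fst (k (P.frame x) (E.frame (f x)) y)))"

lemma kh_nbh:
  assumes x: "x \<in> points X"
  shows "openin P.T (nbh x)" "x \<in> nbh x" "nbh x \<subseteq> U (P.frame x) \<inter> preim X f (V (E.frame (f x)))"
    "smooth_on X (nbh x) PL.E (kh x)"
    "y \<in> nbh x \<Longrightarrow> PL.q (kh x y) = fst (k (P.frame x) (E.frame (f x)) y)"
proof -
  have "\<exists>s. x \<in> points X \<longrightarrow> openin P.T (nbh x) \<and> x \<in> nbh x \<and>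
     nbh x \<subseteq> U (P.frame x) \<inter> preim X f (V (E.frame (f x))) \<and>
     smooth_on X (nbh x) PL.E s \<and> (\<forall>y\<in>nbh x. PL.q (s y) = fst (k (P.frame x) (E.frame (f x)) y))"
    unfolding nbh_def by (rule someI_ex[OF k_lift])
  from someI_ex[OF this, folded kh_def, rule_format, OF x]
  show "openin P.T (nbh x)" "x \<in> nbh x" "nbh x \<subseteq> U (P.frame x) \<inter> preim X f (V (E.frame (f x)))"
    "smooth_on X (nbh x) PL.E (kh x)"
    "y \<in> nbh x \<Longrightarrow> PL.q (kh x y) = fst (k (P.frame x) (E.frame (f x)) y)"
    by simp_all
qed

text \<open>
  Two products of lifts with the same image \<open>k\<^sub>0 h'\<^sub>0\<^sub>1 = h\<^sub>0\<^sub>1 k\<^sub>1\<close> in \<open>H\<^sub>\<sigma>\<close>; they differ by the function \<open>b\<close>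
  below.
\<close>

definition lhs :: "'x \<Rightarrow> 'x \<Rightarrow> 'x \<Rightarrow> 'e" where
  "lhs a0 a1 y = kh a0 y \<otimes>\<^bsub>PL.E\<^esub>
     PL.\<sigma>' (\<delta> (P.frame a0) (E.frame (f a0)) y) (gh' (E.frame (f a0)) (E.frame (f a1)) (f y))"

definition rhs :: "'x \<Rightarrow> 'x \<Rightarrow> 'x \<Rightarrow> 'e" where
  "rhs a0 a1 y = gh (P.frame a0) (P.frame a1) y \<otimes>\<^bsub>PL.E\<^esub> PL.\<sigma>' (snd (h (P.frame a0) (P.frame a1) y)) (kh a1 y)"

definition b :: "'x \<Rightarrow> 'x \<Rightarrow> 'x \<Rightarrow> complex" where
  "b a0 a1 y = PL.\<iota>_inv (lhs a0 a1 y \<otimes>\<^bsub>PL.E\<^esub> inv\<^bsub>PL.E\<^esub> rhs a0 a1 y)"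

lemma nbh_D:
  assumes "a \<in> points X" "y \<in> nbh a"
  shows "y \<in> points X" "P.frame a \<in> I" "E.frame (f a) \<in> J" "y \<in> U (P.frame a)" "f y \<in> V (E.frame (f a))" "kh a y \<in> carrier PL.E"
proof -
  show yX: "y \<in> points X"
    using assms(2) openin_D_points[OF kh_nbh(1)[OF assms(1)]] by blast
  show "P.frame a \<in> I" "E.frame (f a) \<in> J"
    using P.frame[OF assms(1)] frame_E[OF assms(1)] by simp_all
  show "y \<in> U (P.frame a)" "f y \<in> V (E.frame (f a))"
    using kh_nbh(3)[OF assms(1)] assms(2) by (auto simp: preim_iff)
  show "kh a y \<in> carrier PL.E"
    by (rule smooth_on_carrier[OF kh_nbh(4)[OF assms(1)] yX assms(2)])
qed

lemma lhs_rhs: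
  assumes a: "a0 \<in> points X" "a1 \<in> points X" and y: "y \<in> nbh a0" "y \<in> nbh a1"
  shows "lhs a0 a1 y \<in> carrier PL.E" "rhs a0 a1 y \<in> carrier PL.E" "PL.q (lhs a0 a1 y) = PL.q (rhs a0 a1 y)"
proof -
  note n0 = nbh_D[OF a(1) y(1)] and n1 = nbh_D[OF a(2) y(2)]
  define i i' j j' where ij: "i = P.frame a0" "i' = P.frame a1" "j = E.frame (f a0)" "j' = E.frame (f a1)"
  have fr: "i \<in> I" "i' \<in> I" "j \<in> J" "j' \<in> J" "y \<in> U i" "y \<in> U i'" "f y \<in> V j" "f y \<in> V j'"
    using n0 n1 by (simp_all add: ij)
  have e: "\<delta> i j y \<in> {1, -1}" "snd (h i i' y) \<in> {1, -1}"
    using fr \<delta>[of i j y] P.\<epsilon>[of i i' y] by simp_all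
  have c: "gh' j j' (f y) \<in> carrier PL.E" "gh i i' y \<in> carrier PL.E"
    using fr EL.gh_closed[of j j' "f y"] PL.gh_closed[of i i' y] by simp_all
  have s: "PL.\<sigma>' (\<delta> i j y) (gh' j j' (f y)) \<in> carrier PL.E" "PL.\<sigma>' (snd (h i i' y)) (kh a1 y) \<in> carrier PL.E"
    by (rule PL.E.\<rho>_closed[OF e(1) c(1)], rule PL.E.\<rho>_closed[OF e(2) n1(6)])
  show "lhs a0 a1 y \<in> carrier PL.E" "rhs a0 a1 y \<in> carrier PL.E"
    unfolding lhs_def rhs_def ij[symmetric] by (rule PL.E.m_closed[OF n0(6) s(1)], rule PL.E.m_closed[OF c(2) s(2)])
  have "PL.q (lhs a0 a1 y) = fst (k i j y) \<otimes>\<^bsub>G\<^esub> \<sigma> (snd (k i j y)) (fst (h' j j' (f y)))"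
    unfolding lhs_def ij[symmetric] PL.q_mult[OF n0(6) s(1)] PL.q_\<sigma>[OF e(1) c(1)] kh_nbh(5)[OF a(1) y(1)]
      EL.q_gh[OF fr(3,4,7,8)] unfolding \<delta>_def ..
  also have "\<dots> = fst (k i j' y)"
    using k_right[of i j j' y] fr by (simp add: mult_H prod_eq_iff)
  also have "\<dots> = fst (h i i' y) \<otimes>\<^bsub>G\<^esub> \<sigma> (snd (h i i' y)) (fst (k i' j' y))"
    using k_left[of i i' j' y] fr by (simp add: mult_H prod_eq_iff)
  also have "\<dots> = PL.q (rhs a0 a1 y)"
    unfolding rhs_def ij[symmetric] PL.q_mult[OF c(2) s(2)] PL.q_\<sigma>[OF e(2) n1(6)] kh_nbh(5)[OF a(2) y(2)]
      PL.q_gh[OF fr(1,2,5,6)] ..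
  finally show "PL.q (lhs a0 a1 y) = PL.q (rhs a0 a1 y)" .
qed

lemma b:
  assumes "a0 \<in> points X" "a1 \<in> points X" "y \<in> nbh a0" "y \<in> nbh a1"
  shows "b a0 a1 y \<in> sphere 0 1" "lhs a0 a1 y = PL.\<iota> (b a0 a1 y) \<otimes>\<^bsub>PL.E\<^esub> rhs a0 a1 y"
  unfolding b_def by (rule PL.quotient_in_kernel[OF lhs_rhs[OF assms]])+

lemma b_smooth:
  assumes a: "a0 \<in> points X" "a1 \<in> points X"
  shows "smooth_on X (nbh a0 \<inter> nbh a1) U1_group (b a0 a1)"
  unfolding b_def[abs_def]
proof (rule PL.smooth_on_quotient)
  let ?W = "nbh a0 \<inter> nbh a1"
  note fr0 = P.frame[OF a(1)] frame_E[OF a(1)] and fr1 = P.frame[OF a(2)] frame_E[OF a(2)]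
  show "?W \<subseteq> points X"
    using openin_D_points[OF kh_nbh(1)[OF a(1)]] by blast
  show "PL.q (lhs a0 a1 x) = PL.q (rhs a0 a1 x)" if "x \<in> ?W" for x
    using that by (intro lhs_rhs a) simp_all
  have W0: "?W \<subseteq> U (P.frame a0) \<inter> preim X f (V (E.frame (f a0)))"
    using kh_nbh(3)[OF a(1)] by blast
  have W1: "?W \<subseteq> U (P.frame a1) \<inter> preim X f (V (E.frame (f a1)))"
    using kh_nbh(3)[OF a(2)] by blast
  have k0: "smooth_on X ?W PL.E (kh a0)"
    by (rule smooth_on_subset[OF kh_nbh(4)[OF a(1)]]) blast
  have k1: "smooth_on X ?W PL.E (kh a1)"
    by (rule smooth_on_subset[OF kh_nbh(4)[OF a(2)]]) blast
  have d: "smooth_on X ?W Z2_group (\<delta> (P.frame a0) (E.frame (f a0)))"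
    using smooth_on_subset[OF \<delta>_smooth W0] fr0 by blast
  have e: "smooth_on X ?W Z2_group (\<lambda>x. snd (h (P.frame a0) (P.frame a1) x))"
    by (rule smooth_on_subset[OF P.\<epsilon>_smooth]) (use fr0 fr1 W0 W1 in auto)
  have g: "smooth_on X ?W PL.E (gh (P.frame a0) (P.frame a1))"
    by (rule smooth_on_subset[OF PL.gh_smooth]) (use fr0 fr1 W0 W1 in auto)
  have "smooth_on X (preim X f (V (E.frame (f a0)) \<inter> V (E.frame (f a1)))) PL.E
      (\<lambda>x. gh' (E.frame (f a0)) (E.frame (f a1)) (f x))"
    using fr0 fr1 by (intro smooth_on_compose[OF f] EL.gh_smooth) simp_all
  then have g': "smooth_on X ?W PL.E (\<lambda>x. gh' (E.frame (f a0)) (E.frame (f a1)) (f x))"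
    by (rule smooth_on_subset) (use W0 W1 in \<open>auto simp: preim_Int\<close>)
  show "smooth_on X ?W PL.E (lhs a0 a1)"
    unfolding lhs_def[abs_def] by (rule PL.E.smooth_on_mult[OF k0 PL.E.smooth_on_act[OF g' d]])
  show "smooth_on X ?W PL.E (rhs a0 a1)"
    unfolding rhs_def[abs_def] by (rule PL.E.smooth_on_mult[OF g PL.E.smooth_on_act[OF k1 e]])
qed

text \<open>
  The function \<open>b a0 a1\<close> is the expression of a section in the frame of \<open>a0\<close>; this cochain of degree \<open>1\<close>
  accounts for the difference of the two cocycles.
\<close>

definition w :: "'x list \<Rightarrow> complex" where
  "w zs = U1_act Ext (snd (h (P.frame (last zs)) (P.frame (zs ! 0)) (last zs))) (b (zs ! 0) (zs ! 1) (last zs))"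

lemma near_nbh: "\<forall>\<^sub>F zs in near_filter P.T n. \<forall>x\<in>set zs. x \<in> points X \<and> last zs \<in> nbh x"
proof -
  have "\<forall>\<^sub>F zs in near_filter P.T n. \<forall>x\<in>set zs. last zs \<in> nbh x"
    by (rule near_filter_neighbourhoods) (simp add: P.topspace kh_nbh)
  then show ?thesis
    using near_filter_topspace by eventually_elim (auto simp: P.topspace)
qed

lemma w_good: "good P.T PL.U.sec 1 w"
  unfolding good_def using near_nbh near_filter_length
proof eventually_elim
  case (elim xs)
  then obtain a0 a1 where xs: "xs = [a0, a1]"
    by (auto simp: length_Suc_conv)
  have a: "a0 \<in> points X" "a1 \<in> points X" "a1 \<in> nbh a0" "a1 \<in> nbh a1"
    using elim by (simp_all add: xs)
  let ?W = "nbh a0 \<inter> nbh a1"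
  have o: "openin P.T ?W"
    using kh_nbh(1) a by (intro openin_Int)
  have "PL.U.sec ?W (\<lambda>y. U1_act Ext (snd (h (P.frame y) (P.frame a0) y)) (b a0 a1 y))"
    using openin_D_points[OF o] P.frame[OF a(1)] kh_nbh(3)[OF a(1)] b_smooth[OF a(1,2)]
    by (intro PL.U.sec_in_frame) auto
  then show ?case
    using o a by (intro exI[of _ ?W]) (simp add: xs w_def)
qed

text \<open>
  The identity of \<open>defect_comparison\<close> holds in the frame \<open>i0\<close> of the first point; \<open>\<phi>\<close> is the change to the
  frame \<open>e\<close> of the last one.
\<close>

lemma beta_comparison:
  "\<forall>\<^sub>F zs in near_filter P.T (Suc 2). CU.\<omega> (last zs) (EL.beta_val (map f zs)) =
     PL.beta_val zs * vdiff U1_group w zs"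
  using near_nbh near_filter_length
proof eventually_elim
  case (elim zs)
  then obtain a0 a1 a2 y where zs: "zs = [a0, a1, a2, y]"
    by (auto simp: length_Suc_conv numeral_2_eq_2)
  have a: "a0 \<in> points X" "a1 \<in> points X" "a2 \<in> points X" "y \<in> points X"
    and n: "y \<in> nbh a0" "y \<in> nbh a1" "y \<in> nbh a2"
    using elim by (simp_all add: zs)
  note n0 = nbh_D[OF a(1) n(1)] and n1 = nbh_D[OF a(2) n(2)] and n2 = nbh_D[OF a(3) n(3)]
  define e i0 i1 i2 where i: "e = P.frame y" "i0 = P.frame a0" "i1 = P.frame a1" "i2 = P.frame a2"
  define e' j0 j1 j2 where j: "e' = E.frame (f y)" "j0 = E.frame (f a0)" "j1 = E.frame (f a1)" "j2 = E.frame (f a2)"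
  have fr: "e \<in> I" "i0 \<in> I" "i1 \<in> I" "i2 \<in> I" "y \<in> U e" "y \<in> U i0" "y \<in> U i1" "y \<in> U i2"
    and fr': "e' \<in> J" "j0 \<in> J" "j1 \<in> J" "j2 \<in> J" "f y \<in> V e'" "f y \<in> V j0" "f y \<in> V j1" "f y \<in> V j2"
    using n0 n1 n2 P.frame[OF a(4)] frame_E[OF a(4)] by (simp_all add: i j)
  have s: "snd (h i0 i1 y) \<in> {1, -1}" "snd (h i1 i2 y) \<in> {1, -1}" "snd (h i0 i2 y) \<in> {1, -1}" "snd (h e i0 y) \<in> {1, -1}"
      "snd (h e i1 y) \<in> {1, -1}"
    using fr P.\<epsilon>[of i0 i1 y] P.\<epsilon>[of i1 i2 y] P.\<epsilon>[of i0 i2 y] P.\<epsilon>[of e i0 y] P.\<epsilon>[of e i1 y] by simp_all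
  have d: "\<delta> i0 j0 y \<in> {1, -1}" "\<delta> i1 j1 y \<in> {1, -1}" "\<delta> e e' y \<in> {1, -1}" "\<delta> e j0 y \<in> {1, -1}"
    using fr fr' \<delta>[of i0 j0 y] \<delta>[of i1 j1 y] \<delta>[of e e' y] \<delta>[of e j0 y] by simp_all
  have s': "snd (h' j0 j1 (f y)) \<in> {1, -1}" "snd (h' e' j0 (f y)) \<in> {1, -1}"
    using fr' E.\<epsilon>[of j0 j1 "f y"] E.\<epsilon>[of e' j0 "f y"] by simp_all
  let ?c = "PL.coc i0 i1 i2 y" and ?c' = "EL.coc j0 j1 j2 (f y)"
  have C: "?c \<in> sphere 0 1" "?c' \<in> sphere 0 1"
    using PL.coc(1)[OF fr(2-4,6-8)] EL.coc(1)[OF fr'(2-4,6-8)] by simp_all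
  have B: "b a0 a1 y \<in> sphere 0 1" "b a1 a2 y \<in> sphere 0 1" "b a0 a2 y \<in> sphere 0 1"
    by (rule b(1)[OF a(1,2) n(1,2)], rule b(1)[OF a(2,3) n(2,3)], rule b(1)[OF a(1,3) n(1,3)])
  have r: "kh a0 y \<otimes>\<^bsub>PL.E\<^esub> PL.\<sigma>' (\<delta> i0 j0 y) (gh' j0 j1 (f y)) =
        PL.\<iota> (b a0 a1 y) \<otimes>\<^bsub>PL.E\<^esub> (gh i0 i1 y \<otimes>\<^bsub>PL.E\<^esub> PL.\<sigma>' (snd (h i0 i1 y)) (kh a1 y))"
      "kh a1 y \<otimes>\<^bsub>PL.E\<^esub> PL.\<sigma>' (\<delta> i1 j1 y) (gh' j1 j2 (f y)) =
        PL.\<iota> (b a1 a2 y) \<otimes>\<^bsub>PL.E\<^esub> (gh i1 i2 y \<otimes>\<^bsub>PL.E\<^esub> PL.\<sigma>' (snd (h i1 i2 y)) (kh a2 y))"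
      "kh a0 y \<otimes>\<^bsub>PL.E\<^esub> PL.\<sigma>' (\<delta> i0 j0 y) (gh' j0 j2 (f y)) =
        PL.\<iota> (b a0 a2 y) \<otimes>\<^bsub>PL.E\<^esub> (gh i0 i2 y \<otimes>\<^bsub>PL.E\<^esub> PL.\<sigma>' (snd (h i0 i2 y)) (kh a2 y))"
    using b(2)[OF a(1,2) n(1,2)] b(2)[OF a(2,3) n(2,3)] b(2)[OF a(1,3) n(1,3)]
    by (simp_all only: lhs_def rhs_def i j)
  have g: "gh i0 i1 y \<in> carrier PL.E" "gh i1 i2 y \<in> carrier PL.E" "gh i0 i2 y \<in> carrier PL.E"
    using fr PL.gh_closed[of i0 i1 y] PL.gh_closed[of i1 i2 y] PL.gh_closed[of i0 i2 y] by simp_all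
  have g': "gh' j0 j1 (f y) \<in> carrier PL.E" "gh' j1 j2 (f y) \<in> carrier PL.E" "gh' j0 j2 (f y) \<in> carrier PL.E"
    using fr' EL.gh_closed[of j0 j1 "f y"] EL.gh_closed[of j1 j2 "f y"] EL.gh_closed[of j0 j2 "f y"] by simp_all
  have dd: "\<delta> i0 j0 y * snd (h' j0 j1 (f y)) = snd (h i0 i1 y) * \<delta> i1 j1 y"
    using fr fr' by (simp add: \<delta>_left \<delta>_right)
  have id: "U1_act Ext (\<delta> i0 j0 y) ?c' * b a0 a2 y = b a0 a1 y * (U1_act Ext (snd (h i0 i1 y)) (b a1 a2 y) * ?c)"
    by (rule PL.defect_comparison[OF s(1-3) P.\<epsilon>_comp[OF fr(2-4,6-8)] d(1,2) s'(1) dd g g' n0(6) n1(6) n2(6) C B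
          PL.coc(2)[OF fr(2-4,6-8)] EL.coc(2)[OF fr'(2-4,6-8)] r])
  define \<phi> where "\<phi> = U1_act Ext (snd (h e i0 y))"
  have D: "U1_act Ext (\<delta> i0 j0 y) ?c' \<in> sphere 0 1" "U1_act Ext (snd (h i0 i1 y)) (b a1 a2 y) \<in> sphere 0 1"
    by (rule PL.U1_act_closed[OF d(1) C(2)], rule PL.U1_act_closed[OF s(1) B(2)])
  have D2: "U1_act Ext (snd (h i0 i1 y)) (b a1 a2 y) * ?c \<in> sphere 0 1"
    using D C by (simp add: norm_mult)
  have \<phi>: "\<phi> (z * z') = \<phi> z * \<phi> z'" if "z \<in> sphere 0 1" "z' \<in> sphere 0 1" for z z'
    unfolding \<phi>_def by (rule PL.U1_act_mult[OF s(4) that])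
  have \<phi>_closed: "\<phi> z \<in> sphere 0 1" if "z \<in> sphere 0 1" for z
    unfolding \<phi>_def by (rule PL.U1_act_closed[OF s(4) that])
  have id': "\<phi> (U1_act Ext (\<delta> i0 j0 y) ?c') * \<phi> (b a0 a2 y) =
      \<phi> (b a0 a1 y) * (\<phi> (U1_act Ext (snd (h i0 i1 y)) (b a1 a2 y)) * \<phi> ?c)"
    using arg_cong[OF id, of \<phi>] by (simp only: \<phi>[OF D(1) B(3)] \<phi>[OF B(1) D2] \<phi>[OF D(2) C(1)])
  have w01: "w [a0, a1, y] = \<phi> (b a0 a1 y)" and w02: "w [a0, a2, y] = \<phi> (b a0 a2 y)"
    by (simp_all add: w_def \<phi>_def i)
  have w12: "w [a1, a2, y] = \<phi> (U1_act Ext (snd (h i0 i1 y)) (b a1 a2 y))"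
  proof -
    have "\<phi> (U1_act Ext (snd (h i0 i1 y)) (b a1 a2 y)) = U1_act Ext (snd (h e i1 y)) (b a1 a2 y)"
      unfolding \<phi>_def using fr B(2) by (intro PL.U.\<rho>_\<epsilon>) simp_all
    then show ?thesis
      by (simp add: w_def i)
  qed
  have "vdiff U1_group w zs = w [a1, a2, y] \<otimes>\<^bsub>U1_group\<^esub> (inv\<^bsub>U1_group\<^esub> w [a0, a2, y] \<otimes>\<^bsub>U1_group\<^esub> w [a0, a1, y])"
    unfolding zs
    by (rule comm_group.vdiff_3[OF comm_group_U1]) (simp_all only: w01 w02 w12 carrier_U1 \<phi>_closed B D)
  then have v: "vdiff U1_group w zs = \<phi> (U1_act Ext (snd (h i0 i1 y)) (b a1 a2 y)) * (inverse (\<phi> (b a0 a2 y)) * \<phi> (b a0 a1 y))"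
    by (simp only: w01 w02 w12 mult_U1 inv_U1[OF \<phi>_closed[OF B(3)]])
  have nz: "\<phi> (b a0 a2 y) \<noteq> 0"
    using \<phi>_closed[OF B(3)] by auto
  have "CU.\<omega> y (EL.beta_val (map f zs)) = U1_act Ext (\<delta> e e' y) (U1_act Ext (snd (h' e' j0 (f y))) ?c')"
    by (simp add: CU.\<omega>_def EL.beta_val_def zs i j)
  also have "\<dots> = U1_act Ext (\<delta> e e' y * snd (h' e' j0 (f y))) ?c'"
    by (rule PL.U.\<rho>_comp[OF d(3) s'(2)]) (use C in simp)
  also have "\<delta> e e' y * snd (h' e' j0 (f y)) = snd (h e i0 y) * \<delta> i0 j0 y"
    using fr fr' by (simp add: \<delta>_left \<delta>_right)
  also have "U1_act Ext (snd (h e i0 y) * \<delta> i0 j0 y) ?c' = \<phi> (U1_act Ext (\<delta> i0 j0 y) ?c')"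
    unfolding \<phi>_def by (rule PL.U.\<rho>_comp[OF s(4) d(1), symmetric]) (use C in simp)
  also have "\<dots> = \<phi> ?c * vdiff U1_group w zs"
    unfolding v using id' nz by (simp add: field_simps)
  also have "\<phi> ?c = PL.beta_val zs"
    by (simp add: \<phi>_def PL.beta_val_def zs i)
  finally show ?case
    by (simp add: zs)
qed

text \<open>
  Let \<open>a\<close> represent the class over \<open>Y\<close>, with real lift \<open>u\<close>. Then the transported \<open>a\<close> represents the class
  over \<open>X\<close>, with the transported \<open>u\<close> as real lift: the exponential map commutes with the transport of
  \<open>u\<close>, so its exponential is cohomologous to the transport of \<open>\<beta>\<close>, which is cohomologous to \<open>\<beta>\<close> over
  \<open>X\<close> by \<open>beta_comparison\<close>. Since both classes are full, one common representative makes them equal.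
\<close>

lemma DD_natural:
  "map_class P.T PL.Z.F 3 CZ.ident_map (pull_class P.T CZ.QA.F 3 f CZ.pull_map EL.DD) = PL.DD"
proof -
  interpret MU: sheaf_map U1_group E.T EL.U.F EL.U.val EL.U.sec U1_group P.T PL.U.F PL.U.val PL.U.sec f CU.\<omega>
    by (rule CU.sheaf_map_total)
  interpret MR: sheaf_map R_group E.T EL.R.F EL.R.val EL.R.sec R_group P.T PL.R.F PL.R.val PL.R.sec f CR.\<omega>
    by (rule CR.sheaf_map_total)
  interpret MQ: sheaf_map Z_group E.T EL.Z.F EL.Z.val EL.Z.sec Z_group P.T CZ.QA.F CZ.QA.val CZ.QA.sec f "\<lambda>_ a. a"
    by (rule CZ.sheaf_map_pull)
  interpret XE: exp_sequence E.T EL.Z.F EL.Z.val EL.Z.sec EL.R.F EL.R.val EL.R.sec EL.U.F EL.U.val EL.U.sec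
    "\<lambda>W m. m" EL.exp_map
    by (rule EL.exp_sequence)
  interpret XP: exp_sequence P.T PL.Z.F PL.Z.val PL.Z.sec PL.R.F PL.R.val PL.R.sec PL.U.F PL.U.val PL.U.sec
    "\<lambda>W m. m" PL.exp_map
    by (rule PL.exp_sequence)
  have bE: "EL.beta_cochain \<in> cocycles E.T EL.U.F (Suc 1)" and bE': "EL.beta_cochain \<in> cochains E.T EL.U.F (Suc 1)"
    and bP: "PL.beta_cochain \<in> cochains P.T PL.U.F (Suc 1)"
    using EL.beta_cocycle EL.beta_cochains PL.beta_cochains by (simp_all add: numeral_2_eq_2)
  have DDE: "EL.DD = connecting E.T EL.Z.F EL.R.F EL.U.F (\<lambda>W m. m) EL.exp_map (Suc 1)
      (coho_class E.T EL.U.F (Suc 1) EL.beta_cochain)"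
    and DDP: "PL.DD = connecting P.T PL.Z.F PL.R.F PL.U.F (\<lambda>W m. m) PL.exp_map (Suc 1)
      (coho_class P.T PL.U.F (Suc 1) PL.beta_cochain)"
    by (simp_all add: EL.DD_def PL.DD_def numeral_2_eq_2)
  obtain a where a: "a \<in> EL.DD"
    using XE.connecting_nonempty[OF bE] unfolding DDE by blast
  have DDE_a: "EL.DD = coho_class E.T EL.Z.F 3 a"
    using XE.connecting_eq_coho_class[OF bE'] a unfolding DDE by (simp add: numeral_3_eq_3)
  obtain u where ac: "a \<in> cocycles E.T EL.Z.F (Suc 2)" and u: "good E.T EL.R.sec (Suc 1) u"
      "MU.src.cohomologous 1 (\<lambda>zs. exp_U1 (u zs)) (hat EL.U.val EL.beta_cochain)"
      "\<forall>\<^sub>F zs in near_filter E.T (Suc (Suc (Suc 1))). hat EL.Z.val a zs = vdiff R_group u zs"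
    using a unfolding DDE XE.connecting_iff[OF bE'] by (auto simp: numeral_2_eq_2)
  let ?p = "pull_cochain P.T f CZ.pull_map a"
  have p_class: "pull_class P.T CZ.QA.F (Suc 2) f CZ.pull_map (coho_class E.T EL.Z.F (Suc 2) a) =
      coho_class P.T CZ.QA.F (Suc 2) ?p"
    by (rule MQ.pull_coho_class[OF CZ.pull_map(1) CZ.pull_map(2) ac])
  have p: "?p \<in> cocycles P.T CZ.QA.F (Suc 2)"
    by (rule MQ.pull_cocycle[OF CZ.pull_map(1) CZ.pull_map(2) ac])
  have a': "a \<in> cochains E.T EL.Z.F (Suc 2)"
    using ac unfolding MQ.src.cocycles_iff by blast
  have hp: "\<forall>\<^sub>F zs in near_filter P.T (Suc (Suc 2)). hat CZ.QA.val ?p zs = MQ.push (hat EL.Z.val a) zs"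
    by (rule MQ.hat_pull[OF CZ.pull_map(1) CZ.pull_map(2) a'])
  let ?a = "cochain_map CZ.ident_map ?p"
  have id: "map_class P.T PL.Z.F (Suc 2) CZ.ident_map (coho_class P.T CZ.QA.F (Suc 2) ?p) =
        coho_class P.T PL.Z.F (Suc 2) ?a"
      "?a \<in> cocycles P.T PL.Z.F (Suc 2)"
      "\<forall>\<^sub>F zs in near_filter P.T (Suc (Suc 2)). hat PL.Z.val ?a zs = CZ.\<omega> (last zs) (hat CZ.QA.val ?p zs)"
    by (rule map_coho_class[OF CZ.sheaf_map_ident _ _ p], erule (1) CZ.ident_map, erule (2) CZ.ident_map)+
  have "?a \<in> PL.DD"
    unfolding DDP XP.connecting_iff[OF bP]
  proof (intro conjI exI)
    show "?a \<in> cocycles P.T PL.Z.F (Suc (Suc 1))"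
      using id(2) by (simp add: numeral_2_eq_2)
    show "good P.T PL.R.sec (Suc 1) (MR.push u)"
      by (rule MR.push_good[OF u(1)])
    have "\<forall>\<^sub>F zs in near_filter P.T (Suc (Suc 1)). exp_U1 (MR.push u zs) = MU.push (\<lambda>zs. exp_U1 (u zs)) zs
        \<and> MU.push (\<lambda>zs. exp_U1 (u zs)) zs \<in> carrier U1_group"
      using near_filter_last MU.tgt.good_carrier[OF MU.push_good[OF XE.good_exp[OF u(1)]]]
    proof eventually_elim
      case (elim zs)
      then have "last zs \<in> points X"
        by (simp add: P.topspace)
      then have "\<delta> (P.frame (last zs)) (E.frame (f (last zs))) (last zs) \<in> {1, -1}"
        using P.frame frame_E by (intro \<delta>) simp_all
      from PL.exp_R_act[OF this] elim(2) show ?case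
        by (simp add: MR.push_def MU.push_def CR.\<omega>_def CU.\<omega>_def)
    qed
    note c1 = MU.tgt.cohomologous_refl[OF this]
    note c2 = MU.push_cohomologous[OF u(2) MU.src.good_hat[OF bE']]
    have "\<forall>\<^sub>F zs in near_filter P.T (Suc (Suc 1)). MU.push (hat EL.U.val EL.beta_cochain) zs =
        hat PL.U.val PL.beta_cochain zs \<otimes>\<^bsub>U1_group\<^esub> vdiff U1_group w zs"
      using beta_comparison[folded One_nat_def, unfolded numeral_2_eq_2] PL.hat_beta[unfolded numeral_2_eq_2]
        near_filter_map[OF f_continuous EL.hat_beta, unfolded numeral_2_eq_2]
      unfolding One_nat_def
      by eventually_elim (simp add: MU.push_def)
    then have c3: "MU.tgt.cohomologous 1 (MU.push (hat EL.U.val EL.beta_cochain)) (hat PL.U.val PL.beta_cochain)"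
      unfolding MU.tgt.cohomologous_def using w_good by blast
    have g: "good P.T PL.U.sec (Suc 1) (MU.push (hat EL.U.val EL.beta_cochain))"
      by (rule MU.push_good[OF MU.src.good_hat[OF bE']])
    show "MU.tgt.cohomologous 1 (\<lambda>zs. exp_U1 (MR.push u zs)) (hat PL.U.val PL.beta_cochain)"
      by (rule MU.tgt.cohomologous_trans[OF MU.tgt.cohomologous_trans[OF c1 c2 g] c3 MU.tgt.good_hat[OF bP]])
    have "\<forall>\<^sub>F zs in near_filter P.T (Suc (Suc (Suc 1))). hat PL.Z.val ?a zs = CZ.\<omega> (last zs) (hat CZ.QA.val ?p zs)"
      using id(3) by (simp add: numeral_2_eq_2)
    moreover have "\<forall>\<^sub>F zs in near_filter P.T (Suc (Suc (Suc 1))). hat CZ.QA.val ?p zs = hat EL.Z.val a (map f zs)"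
      using hp by (simp add: numeral_2_eq_2 MQ.push_def)
    moreover note near_filter_map[OF f_continuous u(3)] MR.push_vdiff[OF MR.src.good_carrier[OF u(1)]]
    ultimately show "\<forall>\<^sub>F zs in near_filter P.T (Suc (Suc (Suc 1))). hat PL.Z.val ?a zs = vdiff R_group (MR.push u) zs"
      by eventually_elim (simp add: MR.push_def[of "vdiff R_group u"] CZ.\<omega>_def CR.\<omega>_def)
  qed
  then have "PL.DD = coho_class P.T PL.Z.F (Suc 2) ?a"
    using XP.connecting_eq_coho_class[OF bP] unfolding DDP by (simp add: numeral_2_eq_2)
  also have "\<dots> = map_class P.T PL.Z.F 3 CZ.ident_map (pull_class P.T CZ.QA.F 3 f CZ.pull_map EL.DD)"
    unfolding DDE_a using p_class id(1) by (simp add: numeral_3_eq_3 numeral_2_eq_2)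
  finally show ?thesis ..
qed

end

theorem theorem7p9:
  fixes G :: "'g diff_group" and \<sigma> :: "int \<Rightarrow> 'g \<Rightarrow> 'g" and Ext :: "('g, 'e) ext"
    and X :: "'x diff_space" and P :: "('p, 'x, 'g \<times> int) gbundle"
    and f :: "'x \<Rightarrow> 'g sph_family set set" and \<Psi> :: "'p \<Rightarrow> 'x \<times> 'g sph_family set"
    and T :: "('i, 'x, 'p, 'g \<times> int) trivs"
    and T_univ :: "('j, 'g sph_family set set, 'g sph_family set, 'g \<times> int) trivs"
  assumes "diffeological_group G"
    and "smooth_Z2_action G \<sigma>"
    and "equivariant_extension G \<sigma> Ext"
    and "diffeological_space X"
    and "principal_bundle (H_group G \<sigma>) P" and "base P = X"
    and "smooth_map X (B_sph G \<sigma>) f"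
    and "bundle_iso (H_group G \<sigma>) P (pullback_bundle X f (univ_bundle G \<sigma>)) \<Psi>"
    and "trivialization (H_group G \<sigma>) P T"
    and "trivialization (H_group G \<sigma>) (univ_bundle G \<sigma>) T_univ"
  shows "alpha_class G \<sigma> P T = pull_alpha X f (alpha_class G \<sigma> (univ_bundle G \<sigma>) T_univ) \<and>
    (\<forall>gh gh_univ.
       smooth_lifts G \<sigma> Ext P T gh \<and> smooth_lifts G \<sigma> Ext (univ_bundle G \<sigma>) T_univ gh_univ \<longrightarrow>
       tau G \<sigma> Ext P T gh =
         pull_tau G \<sigma> Ext P T f (univ_bundle G \<sigma>) T_univ \<Psi>
           (tau G \<sigma> Ext (univ_bundle G \<sigma>) T_univ gh_univ))"
proof -
  let ?H = "H_group G \<sigma>" and ?E = "univ_bundle G \<sigma>"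
  let ?h = "transition ?H P T" and ?h' = "transition ?H ?E T_univ"
  \<comment> \<open>The sign of \<open>?k\<close> is, by definition, the one through which \<^const>\<open>ident_Z\<close> identifies local systems.\<close>
  let ?k = "\<lambda>i j x. inv\<^bsub>?H\<^esub> (chart T i (fibre_point P x)) \<otimes>\<^bsub>?H\<^esub> chart T_univ j (snd (\<Psi> (fibre_point P x)))"
  have H: "diffeological_group ?H"
    using assms(5) by (simp add: principal_bundle_def)
  have base_E: "base ?E = B_sph G \<sigma>"
    by (simp add: univ_bundle_def)
  have comp: "comparison G \<sigma> (base P) (idx T) (cov T) ?h (base ?E) (idx T_univ) (cov T_univ) ?h' f ?k"
    by (rule comparison_bundles[OF refl bundle_triv_principal[OF assms(5,9)] bundle_triv_univ[OF assms(1,2) H assms(10)]])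
      (use assms(6,7,8) base_E in simp_all)
  interpret C: comparison G \<sigma> "base P" "idx T" "cov T" ?h "base ?E" "idx T_univ" "cov T_univ" ?h' f ?k
    by (rule comp)
  have epsP: "eps_coc G \<sigma> P T = (\<lambda>i j x. snd (?h i j x))"
    and epsE: "eps_coc G \<sigma> ?E T_univ = (\<lambda>i j x. snd (?h' i j x))"
    by (simp_all add: fun_eq_iff eps_coc_def)
  have alphaP: "alpha_class G \<sigma> P T = coho_class C.P.T C.P.SZ2 1 C.P.alpha_cochain"
    unfolding alpha_class_def C.P.cech_class_eq C.P.alpha_cochain_def epsP ..
  have alphaE: "alpha_class G \<sigma> ?E T_univ = coho_class C.E.T C.E.SZ2 1 C.E.alpha_cochain"
    unfolding alpha_class_def C.E.cech_class_eq C.E.alpha_cochain_def epsE ..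
  have alpha: "alpha_class G \<sigma> P T = pull_alpha (base P) f (alpha_class G \<sigma> ?E T_univ)"
    unfolding alphaP alphaE pull_alpha_def by (rule C.alpha_natural[symmetric])
  have "tau G \<sigma> Ext P T gh = pull_tau G \<sigma> Ext P T f ?E T_univ \<Psi> (tau G \<sigma> Ext ?E T_univ gh')"
    if gh: "smooth_lifts G \<sigma> Ext P T gh" and gh': "smooth_lifts G \<sigma> Ext ?E T_univ gh'" for gh gh'
  proof -
    interpret ext: equivariant_ext G \<sigma> Ext
      by (rule equivariant_ext.intro[OF assms(1-3)])
    interpret L: lifted_comparison G \<sigma> "base P" "idx T" "cov T" ?h "base ?E" "idx T_univ" "cov T_univ" ?h' f ?k Ext gh gh'
    proof (intro lifted_comparison.intro lifted_cocycle.intro comp C.P.H_cocycle_axioms C.E.H_cocycle_axioms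
        ext.equivariant_ext_axioms lifted_cocycle_axioms.intro)
      show "smooth_on (base P) (cov T i \<inter> cov T j) (ext_grp Ext) (gh i j)" if "i \<in> idx T" "j \<in> idx T" for i j
        using gh that unfolding smooth_lifts_def by blast
      show "ext_q Ext (gh i j x) = fst (?h i j x)" if "i \<in> idx T" "j \<in> idx T" "x \<in> cov T i" "x \<in> cov T j" for i j x
        using gh that unfolding smooth_lifts_def by blast
      show "smooth_on (base ?E) (cov T_univ i \<inter> cov T_univ j) (ext_grp Ext) (gh' i j)"
        if "i \<in> idx T_univ" "j \<in> idx T_univ" for i j
        using gh' that unfolding smooth_lifts_def by blast
      show "ext_q Ext (gh' i j x) = fst (?h' i j x)"
        if "i \<in> idx T_univ" "j \<in> idx T_univ" "x \<in> cov T_univ i" "x \<in> cov T_univ j" for i j x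
        using gh' that unfolding smooth_lifts_def by blast
    qed
    have DDP: "DD_class G \<sigma> Ext P T gh = L.PL.DD"
      unfolding DD_class_def L.PL.DD_def beta_class_def C.P.cech_class_eq twisted_coeff_def epsP
        L.PL.beta_cochain_def L.PL.coc_def ..
    have DDE: "DD_class G \<sigma> Ext ?E T_univ gh' = L.EL.DD"
      unfolding DD_class_def L.EL.DD_def beta_class_def C.E.cech_class_eq twisted_coeff_def epsE
        L.EL.beta_cochain_def L.EL.coc_def ..
    have ident: "ident_Z G \<sigma> Ext P T f T_univ \<Psi> = L.CZ.ident_map"
      by (simp add: fun_eq_iff ident_Z_def L.CZ.ident_map_def Let_def C.\<delta>_def C.E.frame_def)
    have pull: "pull_DD G \<sigma> Ext (base P) f ?E T_univ = pull_class C.P.T L.CZ.QA.F 3 f L.CZ.pull_map"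
      unfolding pull_DD_def pull_Z_coeff_def epsE L.CZ.pull_map_def[abs_def] ..
    have "DD_class G \<sigma> Ext P T gh = map_class C.P.T (twisted_coeff G \<sigma> P T Z_group (R_act Ext)) 3
        (ident_Z G \<sigma> Ext P T f T_univ \<Psi>) (pull_DD G \<sigma> Ext (base P) f ?E T_univ (DD_class G \<sigma> Ext ?E T_univ gh'))"
      unfolding DDP DDE ident pull twisted_coeff_def epsP by (rule L.DD_natural[symmetric])
    then show ?thesis
      unfolding tau_def pull_tau_def using alpha by simp
  qed
  with alpha show ?thesis
    using assms(6) by blast
qed

end
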